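(* Fix $p\ge1$ and $k\ge1$. For each $n\ge k$ let $\mathbf{S_{n,n}}=(S_{1,n},\dots,S_{n,n})^T$ be uniformly distributed on $\mathcal{M}_n(\mathbb{R})$ (i.e. with density $\mathcal{V}(\mathcal{M}_n(\mathbb{R}))^{-1}\mathbf{1}_{\mathcal{M}_n(\mathbb{R})}$ with respect to $dS_1\cdots dS_n$), and let $\mathbf{S_{k,n}}=(S_{1,n},\dots,S_{k,n})^T$, viewed as a $kp\times p$ block column. Then $$\sqrt{4n(p+1)}\,(A^{-1}\otimes I_p)(\mathbf{S_{k,n}}-\mathbf{S^0_k})\xrightarrow[n\to\infty]{\mathcal{D}}\mathbf{G}=(G_1,\dots,G_k)^T,$$ where $G_1,\dots,G_k$ are i.i.d. GOE random matrices, $\mathbf{S^0_k}=(s^0_1I_p,\dots,s^0_kI_p)^T$ with $s^0_j=\int_0^1\frac{x^j\,dx}{\pi\sqrt{x(1-x)}}=2^{-2j}\binom{2j}{j}$, and $A$ is the $k\times k$ lower triangular matrix with entries $a_{i,j}=2^{-2i+2}\binom{2i}{i-j}$ for $j\le i$ (and $a_{i,j}=0$ for $j>i$).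
   Context: $\mathcal{S}_p(\mathbb{R})$ is the space of real symmetric $p\times p$ matrices with Lebesgue measure $dX=\prod_{i\le j}dx_{i,j}$. A real matrix measure on $[0,1]$ is a $p\times p$ matrix of signed Borel measures $\mu$ with $\mu(B)$ symmetric nonnegative definite for all Borel $B$ and $\mu([0,1])=I_p$; its moments are $S_j=\int_0^1x^jd\mu(x)$, and $\mathcal{M}_n(\mathbb{R})=\{(S_1,\dots,S_n)^T\}\subset(\mathcal{S}_p(\mathbb{R}))^n$ is the set of all moment vectors of such measures (a compact convex set with nonempty interior). $\mathcal{V}(\mathcal{M}_n(\mathbb{R}))$ is its Lebesgue volume. $\otimes$ is the Kronecker product. A random matrix in $\mathcal{S}_p(\mathbb{R})$ is GOE (Gaussian orthogonal ensemble) if it has density $(2\pi)^{-p/2}\pi^{-p(p-1)/4}e^{-\frac12\operatorname{tr}X^2}$ with respect to $dX$. *)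

theory Defs
  imports "HOL-Probability.Probability"
begin

text \<open>A vector of m symmetric p x p matrices (S_1,...,S_m) is encoded by its coordinates
  x(l,i,j) = (S_l)_{i,j} for 1 <= l <= m and 0 <= i <= j < p (0-based matrix indices).
  Lebesgue measure dS_1...dS_m = prod_{l} prod_{i<=j} d(S_l)_{ij} is the product Lebesgue
  measure on these coordinates.\<close>

definition coords :: "nat \<Rightarrow> nat \<Rightarrow> (nat \<times> nat \<times> nat) set" where
  "coords p m = {(l, i, j). 1 \<le> l \<and> l \<le> m \<and> i \<le> j \<and> j < p}"

definition leb_sym :: "nat \<Rightarrow> nat \<Rightarrow> ((nat \<times> nat \<times> nat) \<Rightarrow> real) measure" where
  "leb_sym p m = PiM (coords p m) (\<lambda>_. lborel)"

definition symmat :: "((nat \<times> nat \<times> nat) \<Rightarrow> real) \<Rightarrow> nat \<Rightarrow> nat \<Rightarrow> nat \<Rightarrow> real" where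
  "symmat x l i j = x (l, min i j, max i j)"

definition psd :: "nat \<Rightarrow> (nat \<Rightarrow> nat \<Rightarrow> real) \<Rightarrow> bool" where
  "psd p M \<longleftrightarrow> (\<forall>i<p. \<forall>j<p. M i j = M j i) \<and>
     (\<forall>v :: nat \<Rightarrow> real. (\<Sum>i<p. \<Sum>j<p. v i * M i j * v j) \<ge> 0)"

text \<open>A p x p matrix of finite signed Borel measures on [0,1] is represented through the
  Jordan-type decomposition mu_{ij} = P_{ij} - N_{ij} with P_{ij}, N_{ij} finite (nonnegative)
  Borel measures concentrated on [0,1].  Every finite signed measure has such a
  decomposition, and integrals against mu_{ij} do not depend on the decomposition chosen.\<close>

definition mm_value :: "(nat \<Rightarrow> nat \<Rightarrow> real measure) \<Rightarrow> (nat \<Rightarrow> nat \<Rightarrow> real measure)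
    \<Rightarrow> real set \<Rightarrow> nat \<Rightarrow> nat \<Rightarrow> real" where
  "mm_value P N B i j = measure (P i j) B - measure (N i j) B"

definition matrix_measure :: "nat \<Rightarrow> (nat \<Rightarrow> nat \<Rightarrow> real measure)
    \<Rightarrow> (nat \<Rightarrow> nat \<Rightarrow> real measure) \<Rightarrow> bool" where
  "matrix_measure p P N \<longleftrightarrow>
     (\<forall>i<p. \<forall>j<p.
        sets (P i j) = sets borel \<and> sets (N i j) = sets borel \<and>
        finite_measure (P i j) \<and> finite_measure (N i j) \<and>
        emeasure (P i j) (- {0..1}) = 0 \<and> emeasure (N i j) (- {0..1}) = 0) \<and>
     (\<forall>B \<in> sets borel. psd p (mm_value P N B)) \<and>
     (\<forall>i<p. \<forall>j<p. mm_value P N {0..1} i j = (if i = j then 1 else 0))"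

definition mm_moment :: "(nat \<Rightarrow> nat \<Rightarrow> real measure) \<Rightarrow> (nat \<Rightarrow> nat \<Rightarrow> real measure)
    \<Rightarrow> nat \<Rightarrow> nat \<Rightarrow> nat \<Rightarrow> real" where
  "mm_moment P N l i j = (\<integral>x. x ^ l \<partial>(P i j)) - (\<integral>x. x ^ l \<partial>(N i j))"

definition moment_space :: "nat \<Rightarrow> nat \<Rightarrow> ((nat \<times> nat \<times> nat) \<Rightarrow> real) set" where
  "moment_space p n = {restrict (\<lambda>(l, i, j). mm_moment P N l i j) (coords p n) | P N.
      matrix_measure p P N}"

definition uniform_moments :: "nat \<Rightarrow> nat \<Rightarrow> ((nat \<times> nat \<times> nat) \<Rightarrow> real) measure" where
  "uniform_moments p n = uniform_measure (leb_sym p n) (moment_space p n)"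

definition s0 :: "nat \<Rightarrow> real" where
  "s0 j = (2::real) powr (- 2 * real j) * real ((2 * j) choose j)"

definition A_entry :: "nat \<Rightarrow> nat \<Rightarrow> real" where
  "A_entry i j = (if j \<le> i then (2::real) powr (- 2 * real i + 2) * real ((2 * i) choose (i - j))
                  else 0)"

definition A_inv :: "nat \<Rightarrow> nat \<Rightarrow> nat \<Rightarrow> real" where
  "A_inv k = (THE B. (\<forall>i j. (i \<notin> {1..k} \<or> j \<notin> {1..k}) \<longrightarrow> B i j = 0) \<and>
        (\<forall>i\<in>{1..k}. \<forall>j\<in>{1..k}. (\<Sum>l = 1..k. A_entry i l * B l j) = (if i = j then 1 else 0)))"

definition goe_density :: "nat \<Rightarrow> (nat \<Rightarrow> nat \<Rightarrow> real) \<Rightarrow> real" where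
  "goe_density p X = (2 * pi) powr (- real p / 2) * pi powr (- real p * (real p - 1) / 4) *
      exp (- (1/2) * (\<Sum>i<p. \<Sum>j<p. X i j * X j i))"

definition iid_goe :: "nat \<Rightarrow> nat \<Rightarrow> ((nat \<times> nat \<times> nat) \<Rightarrow> real) measure" where
  "iid_goe p k = density (leb_sym p k)
      (\<lambda>x. ennreal (\<Prod>l\<in>{1..k}. goe_density p (symmat x l)))"

definition weak_conv_coords :: "nat \<Rightarrow> nat \<Rightarrow> (nat \<Rightarrow> ((nat \<times> nat \<times> nat) \<Rightarrow> real) measure)
    \<Rightarrow> ((nat \<times> nat \<times> nat) \<Rightarrow> real) measure \<Rightarrow> bool" where
  "weak_conv_coords p k M L \<longleftrightarrow>
     (\<forall>f :: ((nat \<times> nat \<times> nat) \<Rightarrow> real) \<Rightarrow> real.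
        continuous_on (space (leb_sym p k)) f \<longrightarrow> bounded (f ` space (leb_sym p k)) \<longrightarrow>
        ((\<lambda>n. \<integral>x. f x \<partial>(M n)) \<longlongrightarrow> (\<integral>x. f x \<partial>L)) sequentially)"

text \<open>The rescaled statistic sqrt(4n(p+1)) (A^{-1} \<otimes> I_p)(S_{k,n} - S^0_k), as a function of the
  full moment vector S_{n,n} (in coordinates).\<close>
definition rescaled :: "nat \<Rightarrow> nat \<Rightarrow> nat \<Rightarrow> ((nat \<times> nat \<times> nat) \<Rightarrow> real)
    \<Rightarrow> ((nat \<times> nat \<times> nat) \<Rightarrow> real)" where
  "rescaled p k n x = restrict (\<lambda>(m, i, j). sqrt (4 * real n * (real p + 1)) *
       (\<Sum>l = 1..k. A_inv k m l * (x (l, i, j) - s0 l * (if i = j then 1 else 0))))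
     (coords p k)"

end

theory Submission
  imports Defs "HOL-Computational_Algebra.Polynomial"
begin

text \<open>
  Pass to the symmetric matrix measure on [-1,1] whose even moments are the given ones. Its block
  Jacobi matrix has zero diagonal, and the Cholesky factors of its off-diagonal blocks yield free
  parameters \<open>Y\<^sub>1, \<dots>, Y\<^sub>n\<close> (symmetric, \<open>0 < Y\<^sub>l < 1\<close>), the matrix canonical moments.
  Here \<open>S\<^sub>l = c\<^sub>l + L\<^sub>l Y\<^sub>l L\<^sub>l\<^sup>T\<close>, where \<open>c\<^sub>l\<close> and the lower triangular \<open>L\<^sub>l\<close> depend on
  \<open>Y\<^sub>1, \<dots>, Y\<^bsub>l-1\<^esub>\<close> only. So the change of variables is triangular with explicit Jacobian, and under
  the uniform law the \<open>Y\<^sub>l\<close> become independent with density proportional to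
  \<open>det (Y\<^sub>l - Y\<^sub>l\<^sup>2)\<close> raised to the power \<open>(p + 1) (n - l) / 2\<close>.
  Every tuple of parameters comes from a measure by the spectral theorem; conversely, every
  strictly positive moment sequence has parameters, by the three-term recurrence of its orthonormal
  polynomials, and moving a little towards Lebesgue measure makes any moment sequence strictly
  positive. Writing \<open>Y\<^sub>l = 1/2 + t G\<^sub>l\<close> with \<open>t = 1 / sqrt (4 n (p + 1))\<close>, the density of
  \<open>(G\<^sub>1, \<dots>, G\<^sub>k)\<close> converges to the GOE density under a Gaussian bound, while \<open>(S\<^sub>i - s\<^sup>0\<^sub>i) / t\<close> tends
  to \<open>\<Sum>\<^sub>j a\<^sub>i\<^sub>j G\<^sub>j\<close> pointwise; dominated convergence concludes.
\<close>

section \<open>Cholesky factorization\<close>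

text \<open>Symmetrization removes the diagonal Jacobi blocks, so each new moment brings exactly one
  matrix parameter. Lower triangular factors are taken instead of symmetric square roots because
  then every scalar entry of a moment is affine in its own parameter, with coefficients from earlier
  ones, and the change of variables reduces to one-dimensional substitutions. The constant in
  \<open>step_size\<close> balances the exponent: \<open>det (1 - 4 t^2 G^2)\<close> raised to
  \<open>(p + 1) n / 2\<close> behaves like \<open>exp (-2 (p + 1) n t^2 tr G^2)\<close>, which is
  the GOE weight \<open>exp (- tr G^2 / 2)\<close> for \<open>t^2 = 1 / (4 n (p + 1))\<close>. The
  obstacle is that the parameters reach only part of the moment space. Two devices settle the rest:
  the corner moments of symmetric contractions form a compact set that turns out to be the whole
  moment space, and shrinking this space toward the Lebesgue moments by a factor
  \<open>1 - e\<close> keeps the share \<open>(1 - e)^d\<close> of its volume, \<open>d\<close> the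
  number of coordinates, so what the parameters miss is a null set.\<close>

text \<open>A nonpositive pivot is replaced by 1, so the factor is invertible even if the argument is not positive
  definite.\<close>

function chol :: "(nat \<Rightarrow> nat \<Rightarrow> real) \<Rightarrow> nat \<Rightarrow> nat \<Rightarrow> real" where
  "chol A i j = (if i < j then 0
     else if i = j then (let s = A j j - (\<Sum>k<j. (chol A j k)\<^sup>2) in if s > 0 then sqrt s else 1)
     else (A i j - (\<Sum>k<j. chol A i k * chol A j k)) / chol A j j)"
  by pat_completeness auto
termination
  by (relation "measures [\<lambda>(A,i,j). j, \<lambda>(A,i,j). i]") auto

declare chol.simps [simp del]

definition pivot :: "(nat \<Rightarrow> nat \<Rightarrow> real) \<Rightarrow> nat \<Rightarrow> real" where
  "pivot A j = A j j - (\<Sum>k<j. (chol A j k)\<^sup>2)"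

lemma chol_upper: "i < j \<Longrightarrow> chol A i j = 0"
  by (subst chol.simps) simp

lemma chol_diag: "chol A j j = (if pivot A j > 0 then sqrt (pivot A j) else 1)"
  by (subst chol.simps) (simp add: pivot_def Let_def)

lemma chol_diag_pos: "chol A j j > 0"
  by (simp add: chol_diag)

lemma chol_lower: "j < i \<Longrightarrow> chol A i j = (A i j - (\<Sum>k<j. chol A i k * chol A j k)) / chol A j j"
  by (subst chol.simps) simp

text \<open>This follows the recursion of \<open>chol\<close>: earlier columns come first, and the
  diagonal entry of a column before the entries below it.\<close>

lemma chol_induct [case_names less]:
  fixes P :: "nat \<Rightarrow> nat \<Rightarrow> bool"
  assumes "\<And>i j. (\<And>a b. b < j \<Longrightarrow> P a b) \<Longrightarrow> (j < i \<Longrightarrow> P j j) \<Longrightarrow> P i j"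
  shows "P i j"
proof (induction j arbitrary: i rule: less_induct)
  case (less j)
  have jj: "P j j" by (rule assms) (use less in auto)
  show ?case by (rule assms) (use less jj in auto)
qed

lemma chol_cong:
  assumes "\<And>a b. a < p \<Longrightarrow> b < p \<Longrightarrow> A a b = A' a b" "i < p" "j < p"
  shows "chol A i j = chol A' i j"
proof -
  have "i < p \<Longrightarrow> j < p \<Longrightarrow> chol A i j = chol A' i j"
  proof (induction i j rule: chol_induct)
    case (less i j)
    have s1: "(\<Sum>k<j. (chol A j k)\<^sup>2) = (\<Sum>k<j. (chol A' j k)\<^sup>2)"
      using less by (intro sum.cong) auto
    have s2: "(\<Sum>k<j. chol A i k * chol A j k) = (\<Sum>k<j. chol A' i k * chol A' j k)"
      using less by (intro sum.cong) auto
    consider "i < j" | "i = j" | "j < i" by linarith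
    then show ?case
    proof cases
      case 1 then show ?thesis by (simp add: chol_upper)
    next
      case 2 then show ?thesis using less.prems assms(1) s1 by (simp add: chol_diag pivot_def)
    next
      case 3 then show ?thesis using less.IH(2)[OF 3] less.prems assms(1) s2 by (simp add: chol_lower[OF 3])
    qed
  qed
  then show ?thesis using assms by blast
qed

lemma pivot_cong:
  assumes "\<And>a b. a < p \<Longrightarrow> b < p \<Longrightarrow> A a b = A' a b" "j < p"
  shows "pivot A j = pivot A' j"
  unfolding pivot_def using assms chol_cong[of p A A' j]
  by (intro arg_cong2[where f="(-)"] sum.cong) auto

lemma sum_chol:
  assumes "j \<le> i" "pivot A j > 0"
  shows "(\<Sum>k\<le>j. chol A i k * chol A j k) = A i j"
proof (cases "i = j")
  case True
  have "chol A j j * chol A j j = pivot A j" using assms(2) by (simp add: chol_diag)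
  then show ?thesis using True
    by (simp add: lessThan_Suc_atMost[symmetric] pivot_def power2_eq_square)
next
  case False
  with assms(1) have "j < i" by simp
  then have "chol A i j * chol A j j = A i j - (\<Sum>k<j. chol A i k * chol A j k)"
    using chol_diag_pos[of A j] by (simp add: chol_lower[OF \<open>j < i\<close>])
  then show ?thesis by (simp add: lessThan_Suc_atMost[symmetric])
qed

section \<open>Lower triangular systems\<close>

definition lowtri :: "nat \<Rightarrow> (nat \<Rightarrow> nat \<Rightarrow> real) \<Rightarrow> bool" where
  "lowtri p L \<longleftrightarrow> (\<forall>i<p. L i i > 0 \<and> (\<forall>j<p. i < j \<longrightarrow> L i j = 0))"

lemma lowtri_chol: "lowtri p (chol A)"
  by (simp add: lowtri_def chol_diag_pos chol_upper)

lemma lowtriD: "lowtri p L \<Longrightarrow> i < p \<Longrightarrow> L i i > 0" "lowtri p L \<Longrightarrow> i < p \<Longrightarrow> j < p \<Longrightarrow> i < j \<Longrightarrow> L i j = 0"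
  by (auto simp: lowtri_def)

lemma lowtri_mono: "lowtri p L \<Longrightarrow> m \<le> p \<Longrightarrow> lowtri m L"
  by (auto simp: lowtri_def)

text \<open>The last equation contains only the last unknown, so the system is solved from the
  bottom up.\<close>

lemma lowtri_solve_left:
  assumes "lowtri m L"
  shows "\<exists>v. \<forall>k<m. (\<Sum>i<m. v i * L i k) = (b k :: real)"
  using assms
proof (induction m arbitrary: b)
  case (Suc m)
  define c where "c = b m / L m m"
  have "lowtri m L" using Suc.prems by (rule lowtri_mono) simp
  from Suc.IH[OF this, of "\<lambda>k. b k - c * L m k"] obtain v
    where v: "\<forall>k<m. (\<Sum>i<m. v i * L i k) = b k - c * L m k" by blast
  show ?case
  proof (intro exI[of _ "v(m := c)"] allI impI)
    fix k assume k: "k < Suc m"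
    show "(\<Sum>i<Suc m. (v(m := c)) i * L i k) = b k"
    proof (cases "k = m")
      case True
      have "(\<Sum>i<m. (v(m := c)) i * L i m) = 0"
        using lowtriD(2)[OF Suc.prems] by (intro sum.neutral) auto
      moreover have "L m m > 0" using lowtriD(1)[OF Suc.prems] by simp
      ultimately show ?thesis using True by (simp add: c_def)
    next
      case False
      have "(\<Sum>i<m. (v(m := c)) i * L i k) = (\<Sum>i<m. v i * L i k)" by (intro sum.cong) auto
      then show ?thesis using False k v by simp
    qed
  qed
qed simp

lemma lowtri_solve_right:
  assumes "lowtri m L"
  shows "\<exists>v. \<forall>i<m. (\<Sum>k<m. L i k * v k) = (b i :: real)"
  using assms
proof (induction m)
  case (Suc m)
  have "lowtri m L" using Suc.prems by (rule lowtri_mono) simp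
  from Suc.IH[OF this] obtain v
    where v: "\<forall>i<m. (\<Sum>k<m. L i k * v k) = b i" by blast
  define c where "c = (b m - (\<Sum>k<m. L m k * v k)) / L m m"
  show ?case
  proof (intro exI[of _ "v(m := c)"] allI impI)
    fix i assume i: "i < Suc m"
    have e: "(\<Sum>k<m. L i k * (v(m := c)) k) = (\<Sum>k<m. L i k * v k)" by (intro sum.cong) auto
    show "(\<Sum>k<Suc m. L i k * (v(m := c)) k) = b i"
    proof (cases "i = m")
      case True
      have "L m m > 0" using lowtriD(1)[OF Suc.prems] by simp
      then show ?thesis using True e by (simp add: c_def)
    next
      case False
      then have "i < m" using i by simp
      then have "L i m = 0" using lowtriD(2)[OF Suc.prems] by simp
      then show ?thesis using e v \<open>i < m\<close> by simp
    qed
  qed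
qed simp

lemma lowtri_left_inj:
  assumes "lowtri m L" "\<forall>k<m. (\<Sum>i<m. v i * L i k) = (0 :: real)" "i < m"
  shows "v i = 0"
  using assms
proof (induction m)
  case (Suc m)
  have L: "lowtri m L" using Suc.prems(1) by (rule lowtri_mono) simp
  have "(\<Sum>i<m. v i * L i m) = 0" using lowtriD(2)[OF Suc.prems(1)] by (intro sum.neutral) auto
  then have "v m * L m m = 0" using Suc.prems(2) by auto
  then have m: "v m = 0" using lowtriD(1)[OF Suc.prems(1), of m] by auto
  then have "\<forall>k<m. (\<Sum>i<m. v i * L i k) = 0" using Suc.prems(2) by auto
  with Suc.IH[OF L] m Suc.prems(3) show ?case by (cases "i = m") auto
qed simp

section \<open>Positive definite matrices and their pivots\<close>

definition pd :: "nat \<Rightarrow> (nat \<Rightarrow> nat \<Rightarrow> real) \<Rightarrow> bool" where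
  "pd p A \<longleftrightarrow> (\<forall>i<p. \<forall>j<p. A i j = A j i) \<and>
     (\<forall>v. (\<exists>i<p. v i \<noteq> 0) \<longrightarrow> (\<Sum>i<p. \<Sum>j<p. v i * A i j * v j) > 0)"

lemma pd_cong:
  assumes "\<And>i j. i < p \<Longrightarrow> j < p \<Longrightarrow> A i j = B i j"
  shows "pd p A \<longleftrightarrow> pd p B"
proof -
  have "(\<Sum>i<p. \<Sum>j<p. v i * A i j * v j) = (\<Sum>i<p. \<Sum>j<p. v i * B i j * v j)" for v
    using assms by (intro sum.cong) auto
  then show ?thesis using assms by (auto simp: pd_def)
qed

text \<open>Used wherever a factorization of a matrix turns its bilinear form into a sum of products
  of linear forms, or into a sum of squares when the factors and the vectors agree.\<close>

lemma quad_factor: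
  fixes A M N :: "_ \<Rightarrow> _ \<Rightarrow> real"
  assumes "\<And>i j. i \<in> I \<Longrightarrow> j \<in> J \<Longrightarrow> A i j = (\<Sum>k\<in>K. M i k * N j k)"
  shows "(\<Sum>i\<in>I. \<Sum>j\<in>J. v i * A i j * w j) = (\<Sum>k\<in>K. (\<Sum>i\<in>I. v i * M i k) * (\<Sum>j\<in>J. w j * N j k))"
proof -
  have "(\<Sum>i\<in>I. \<Sum>j\<in>J. v i * A i j * w j)
      = (\<Sum>i\<in>I. \<Sum>j\<in>J. \<Sum>k\<in>K. (v i * M i k) * (w j * N j k))"
    using assms by (intro sum.cong refl) (simp add: sum_distrib_left sum_distrib_right mult_ac)
  also have "\<dots> = (\<Sum>i\<in>I. \<Sum>k\<in>K. \<Sum>j\<in>J. (v i * M i k) * (w j * N j k))"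
    by (intro sum.cong refl sum.swap)
  also have "\<dots> = (\<Sum>k\<in>K. \<Sum>i\<in>I. \<Sum>j\<in>J. (v i * M i k) * (w j * N j k))"
    by (rule sum.swap)
  also have "\<dots> = (\<Sum>k\<in>K. (\<Sum>i\<in>I. v i * M i k) * (\<Sum>j\<in>J. w j * N j k))"
    by (intro sum.cong refl) (simp add: sum_product)
  finally show ?thesis .
qed

text \<open>The pivot is a value of the quadratic form. On the leading block up to \<open>j\<close>,
  \<open>A\<close> minus the pivot at \<open>(j, j)\<close> is the Gram matrix of the first
  \<open>j\<close> columns of the factor; a vector with last entry 1 that is orthogonal to these
  columns therefore gives the form the value \<open>pivot A j\<close>.\<close>

lemma pd_pivot:
  assumes "pd p A" "j < p"
  shows "pivot A j > 0"
  using assms(2)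
proof (induction j rule: less_induct)
  case (less j)
  let ?L = "chol A"
  have piv: "pivot A k > 0" if "k < j" for k using less that by simp
  obtain v0 where v0: "\<forall>k<j. (\<Sum>i<j. v0 i * ?L i k) = - ?L j k"
    using lowtri_solve_left[OF lowtri_chol[of j A], of "\<lambda>k. - ?L j k"] by blast
  define v where "v i = (if i < j then v0 i else if i = j then 1 else 0)" for i
  define A' where "A' a b = A a b - (if a = j \<and> b = j then pivot A j else 0)" for a b
  have sym: "A a b = A b a" if "a < p" "b < p" for a b using assms(1) that by (simp add: pd_def)
  have low_block: "A' a b = (\<Sum>k<j. ?L a k * ?L b k)" if "b \<le> a" "a \<le> j" for a b
  proof (cases "b = j")
    case True
    then have "a = j" using that by simp
    then show ?thesis using True by (simp add: A'_def pivot_def power2_eq_square)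
  next
    case False
    then have b: "b < j" using that by simp
    have "(\<Sum>k<j. ?L a k * ?L b k) = (\<Sum>k\<le>b. ?L a k * ?L b k)"
      using b by (intro sum.mono_neutral_right) (auto simp: chol_upper not_le)
    also have "\<dots> = A a b" using sum_chol[OF that(1) piv[OF b]] .
    finally show ?thesis using False by (simp add: A'_def)
  qed
  have fac: "A' a b = (\<Sum>k<j. ?L a k * ?L b k)" if "a \<in> {..j}" "b \<in> {..j}" for a b
  proof (cases "b \<le> a")
    case True then show ?thesis using low_block that by simp
  next
    case False
    then have "A' b a = (\<Sum>k<j. ?L b k * ?L a k)" using low_block that by simp
    moreover have "A' a b = A' b a" using sym that less.prems by (simp add: A'_def)
    ultimately show ?thesis by (simp add: mult.commute)
  qed
  have "(\<Sum>a\<le>j. \<Sum>b\<le>j. v a * A' a b * v b) = (\<Sum>k<j. (\<Sum>a\<le>j. v a * ?L a k) * (\<Sum>b\<le>j. v b * ?L b k))"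
    by (rule quad_factor) (use fac in auto)
  also have "\<dots> = 0"
  proof (intro sum.neutral ballI)
    fix k assume k: "k \<in> {..<j}"
    have "(\<Sum>a\<le>j. v a * ?L a k) = (\<Sum>a<j. v0 a * ?L a k) + ?L j k"
      unfolding lessThan_Suc_atMost[symmetric] by (simp add: v_def)
    then show "(\<Sum>a\<le>j. v a * ?L a k) * (\<Sum>b\<le>j. v b * ?L b k) = 0" using v0 k by simp
  qed
  finally have z: "(\<Sum>a\<le>j. \<Sum>b\<le>j. v a * A' a b * v b) = 0" .
  have "(\<Sum>a\<le>j. \<Sum>b\<le>j. v a * A a b * v b)
     = (\<Sum>a\<le>j. \<Sum>b\<le>j. v a * A' a b * v b + (if a = j \<and> b = j then pivot A j else 0))"
    by (intro sum.cong refl) (auto simp: A'_def v_def algebra_simps)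
  also have "\<dots> = (\<Sum>a\<le>j. \<Sum>b\<le>j. if a = j \<and> b = j then pivot A j else 0)"
    using z by (simp add: sum.distrib)
  also have "\<dots> = (\<Sum>a\<le>j. if a = j then (\<Sum>b\<le>j. if b = j then pivot A j else 0) else 0)"
    by (intro sum.cong refl) auto
  also have "\<dots> = pivot A j" by (simp add: sum.delta)
  finally have e: "(\<Sum>a\<le>j. \<Sum>b\<le>j. v a * A a b * v b) = pivot A j" .
  have "(\<Sum>a<p. \<Sum>b<p. v a * A a b * v b) = (\<Sum>a\<le>j. \<Sum>b<p. v a * A a b * v b)"
    using less.prems by (intro sum.mono_neutral_right) (auto simp: v_def not_le intro!: sum.neutral)
  also have "\<dots> = (\<Sum>a\<le>j. \<Sum>b\<le>j. v a * A a b * v b)"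
    using less.prems by (intro sum.cong refl sum.mono_neutral_right) (auto simp: v_def)
  finally have "(\<Sum>a<p. \<Sum>b<p. v a * A a b * v b) = pivot A j" using e by simp
  moreover have "\<exists>i<p. v i \<noteq> 0" using less.prems by (auto intro!: exI[of _ j] simp: v_def)
  then have "(\<Sum>a<p. \<Sum>b<p. v a * A a b * v b) > 0"
    using assms(1) unfolding pd_def by blast
  ultimately show ?case by simp
qed

lemma chol_mult_pivot:
  assumes "\<And>i j. i < p \<Longrightarrow> j < p \<Longrightarrow> A i j = A j i" "\<And>j. j < p \<Longrightarrow> pivot A j > 0" "i < p" "j < p"
  shows "(\<Sum>k<p. chol A i k * chol A j k) = A i j"
proof -
  have *: "(\<Sum>k<p. chol A i k * chol A j k) = A i j" if "j \<le> i" "i < p" for i j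
  proof -
    have "(\<Sum>k<p. chol A i k * chol A j k) = (\<Sum>k\<le>j. chol A i k * chol A j k)"
      using that by (intro sum.mono_neutral_right) (auto simp: chol_upper not_le)
    then show ?thesis using sum_chol[OF that(1)] assms(2) that by simp
  qed
  show ?thesis
  proof (cases "j \<le> i")
    case False
    then show ?thesis using *[of i j] assms by (simp add: mult.commute)
  qed (use * assms in auto)
qed

lemma chol_mult:
  assumes "pd p A" "i < p" "j < p"
  shows "(\<Sum>k<p. chol A i k * chol A j k) = A i j"
  using assms pd_pivot[OF assms(1)] by (intro chol_mult_pivot) (auto simp: pd_def)

lemma pd_gram:
  assumes "lowtri p L" "\<And>i j. i < p \<Longrightarrow> j < p \<Longrightarrow> A i j = (\<Sum>k<p. L i k * L j k)"
  shows "pd p A"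
  unfolding pd_def
proof (intro conjI allI impI)
  show "A i j = A j i" if "i < p" "j < p" for i j using assms(2) that by (simp add: mult.commute)
  fix v :: "nat \<Rightarrow> real" assume v: "\<exists>i<p. v i \<noteq> 0"
  have e: "(\<Sum>i<p. \<Sum>j<p. v i * A i j * v j) = (\<Sum>k<p. (\<Sum>i<p. v i * L i k) * (\<Sum>j<p. v j * L j k))"
    by (rule quad_factor) (use assms(2) in auto)
  have "\<exists>k<p. (\<Sum>i<p. v i * L i k) \<noteq> 0" using lowtri_left_inj[OF assms(1)] v by blast
  then show "0 < (\<Sum>i<p. \<Sum>j<p. v i * A i j * v j)"
    unfolding e by (auto intro!: sum_pos2 simp: zero_less_mult_iff linorder_neq_iff)
qed

text \<open>Finitely many inequalities replace the quantifier over vectors. In this form positive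
  definiteness is seen to be measurable and to persist under small perturbations.\<close>

lemma pd_iff_pivot:
  "pd p A \<longleftrightarrow> (\<forall>i<p. \<forall>j<p. A i j = A j i) \<and> (\<forall>j<p. pivot A j > 0)"
proof
  assume "pd p A" then show "(\<forall>i<p. \<forall>j<p. A i j = A j i) \<and> (\<forall>j<p. pivot A j > 0)"
    using pd_pivot by (auto simp: pd_def)
next
  assume a: "(\<forall>i<p. \<forall>j<p. A i j = A j i) \<and> (\<forall>j<p. pivot A j > 0)"
  show "pd p A"
    by (rule pd_gram[OF lowtri_chol[of p A]]) (use chol_mult_pivot a in metis)
qed

text \<open>The positive diagonal fixes the sign of the square roots, so the Gram matrix determines
  one column after another.\<close>

lemma chol_unique:
  assumes "lowtri p L" "\<And>i j. i < p \<Longrightarrow> j < p \<Longrightarrow> A i j = (\<Sum>k<p. L i k * L j k)" "i < p" "j < p"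
  shows "chol A i j = L i j"
proof -
  have pd: "pd p A" using pd_gram assms(1,2) .
  have "i < p \<Longrightarrow> j < p \<Longrightarrow> chol A i j = L i j"
  proof (induction i j rule: chol_induct)
    case (less i j)
    have A: "A i j = (\<Sum>k<j. L i k * L j k) + L i j * L j j" if "i < p" for i
    proof -
      have "A i j = (\<Sum>k<p. L i k * L j k)" using assms(2) that less.prems by simp
      also have "\<dots> = (\<Sum>k\<le>j. L i k * L j k)"
        using less.prems lowtriD(2)[OF assms(1)] by (intro sum.mono_neutral_right) (auto simp: not_le)
      finally show ?thesis unfolding lessThan_Suc_atMost[symmetric] by simp
    qed
    have s: "(\<Sum>k<j. chol A i k * chol A j k) = (\<Sum>k<j. L i k * L j k)" if "i < p" for i
      using less.IH(1) less.prems that assms(1)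
      by (intro sum.cong refl) (metis chol_upper lessThan_iff less.IH(1) less.prems(2) order.strict_trans)
    consider "i < j" | "i = j" | "j < i" by linarith
    then show ?case
    proof cases
      case 1 then show ?thesis using lowtriD(2)[OF assms(1)] less.prems by (simp add: chol_upper)
    next
      case 2
      have "pivot A j = L j j * L j j" using A[OF less.prems(2)] s[OF less.prems(2)]
        by (simp add: pivot_def power2_eq_square)
      then show ?thesis using 2 lowtriD(1)[OF assms(1) less.prems(2)] by (simp add: chol_diag)
    next
      case 3
      then show ?thesis using A[OF less.prems(1)] s[OF less.prems(1)] less.IH(2)[OF 3] less.prems
         lowtriD(1)[OF assms(1) less.prems(2)] by (simp add: chol_lower[OF 3])
    qed
  qed
  then show ?thesis using assms by blast
qed

section \<open>Measurability and first-order expansion of the Cholesky factor\<close>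

lemma chol_measurable:
  assumes "\<And>i j. (\<lambda>x. A x i j) \<in> borel_measurable M"
  shows "(\<lambda>x. chol (A x) i j) \<in> borel_measurable M"
proof (induction i j rule: chol_induct)
  case (less i j)
  note [measurable] = assms
  have [measurable]: "(\<lambda>x. \<Sum>k<j. (chol (A x) j k)\<^sup>2) \<in> borel_measurable M"
    "(\<lambda>x. \<Sum>k<j. chol (A x) i k * chol (A x) j k) \<in> borel_measurable M"
    using less(1) by (auto intro!: borel_measurable_sum borel_measurable_power borel_measurable_times)
  consider "i < j" | "i = j" | "j < i" by linarith
  then show ?case
  proof cases
    case 1 then show ?thesis by (simp add: chol_upper)
  next
    case 2
    show ?thesis unfolding 2 chol_diag pivot_def by measurable
  next
    case 3
    have [measurable]: "(\<lambda>x. chol (A x) j j) \<in> borel_measurable M" using less 3 by simp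
    show ?thesis unfolding chol_lower[OF 3] by measurable
  qed
qed

lemma pivot_measurable:
  assumes "\<And>i j. (\<lambda>x. A x i j) \<in> borel_measurable M"
  shows "(\<lambda>x. pivot (A x) j) \<in> borel_measurable M"
  unfolding pivot_def using assms chol_measurable[OF assms]
  by (intro borel_measurable_diff borel_measurable_sum borel_measurable_power) auto

text \<open>At \<open>c\<close> times the identity the factor is \<open>sqrt c\<close> times the
  identity. For symmetric \<open>A'\<close> the derivative \<open>L'\<close> of the factor thus
  solves \<open>sqrt c (L' + L'^T) = A'\<close>: it is the lower half of \<open>A'\<close> with
  halved diagonal, divided by \<open>sqrt c\<close>.\<close>

lemma chol_has_derivative:
  fixes A :: "real \<Rightarrow> nat \<Rightarrow> nat \<Rightarrow> real"
  assumes c: "c > 0" and A0: "\<And>i j. A 0 i j = (if i = j then c else 0)"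
    and A: "\<And>i j. ((\<lambda>t. A t i j) has_real_derivative A' i j) (at 0)"
  shows "((\<lambda>t. chol (A t) i j) has_real_derivative
      (if i < j then 0 else if i = j then A' i i / (2 * sqrt c) else A' i j / sqrt c)) (at 0)
    \<and> chol (A 0) i j = (if i = j then sqrt c else 0)"
proof (induction i j rule: chol_induct)
  case (less i j)
  let ?D = "\<lambda>i j. if i < j then 0 else if i = j then A' i i / (2 * sqrt c) else A' i j / sqrt c"
  have z: "chol (A 0) a k = (if a = k then sqrt c else 0)" if "k < j" for a k
    using less(1)[OF that] by blast
  have d: "((\<lambda>t. chol (A t) a k) has_real_derivative ?D a k) (at 0)" if "k < j" for a k
    using less(1)[OF that] by blast
  have p0: "pivot (A 0) j = c"
    using z by (simp add: pivot_def A0)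
  have "((\<lambda>t. \<Sum>k<j. (chol (A t) j k)\<^sup>2) has_real_derivative (\<Sum>k<j. 2 * (chol (A 0) j k * ?D j k))) (at 0)"
  proof (intro DERIV_sum)
    fix k assume "k \<in> {..<j}"
    then show "((\<lambda>t. (chol (A t) j k)\<^sup>2) has_real_derivative 2 * (chol (A 0) j k * ?D j k)) (at 0)"
      using DERIV_power[OF d[of k j], where n=2] by (auto simp: mult_ac split: if_splits)
  qed
  \<comment> \<open>Off-diagonal entries vanish at 0, so their squares have no first-order
    part.\<close>
  also have "(\<Sum>k<j. 2 * (chol (A 0) j k * ?D j k)) = 0" using z by (intro sum.neutral) auto
  finally have "((\<lambda>t. pivot (A t) j) has_real_derivative A' j j - 0) (at 0)"
    unfolding pivot_def by (intro DERIV_diff A)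
  then have pd: "((\<lambda>t. pivot (A t) j) has_real_derivative A' j j) (at 0)" by simp
  \<comment> \<open>The pivot stays positive near 0, so there \<open>chol\<close> is the smooth
    square root and not the default 1.\<close>
  have "((\<lambda>t. pivot (A t) j) \<longlongrightarrow> pivot (A 0) j) (nhds 0)"
    using DERIV_isCont[OF pd, unfolded isCont_def]
    by (rule tendsto_at_iff_tendsto_nhds[of "\<lambda>t. pivot (A t) j" 0, THEN iffD1])
  from order_tendstoD(1)[OF this, of 0] p0 c have "eventually (\<lambda>t. pivot (A t) j > 0) (nhds 0)"
    by simp
  then have ev: "eventually (\<lambda>t. chol (A t) j j = sqrt (pivot (A t) j)) (nhds 0)"
    by (rule eventually_mono) (simp add: chol_diag)
  consider "i < j" | "i = j" | "j < i" by linarith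
  then show ?case
  proof cases
    case 1 then show ?thesis by (simp add: chol_upper)
  next
    case 2
    have "(sqrt has_real_derivative inverse (sqrt (pivot (A 0) j)) / 2) (at (pivot (A 0) j))"
      using DERIV_real_sqrt[of "pivot (A 0) j"] p0 c by simp
    then have "((\<lambda>t. sqrt (pivot (A t) j)) has_real_derivative inverse (sqrt (pivot (A 0) j)) / 2 * A' j j) (at 0)"
      by (rule DERIV_chain2[OF _ pd])
    then have "((\<lambda>t. chol (A t) j j) has_real_derivative A' j j / (2 * sqrt c)) (at 0)"
      using DERIV_cong_ev[OF refl ev refl] p0 by (simp add: field_simps)
    moreover have "chol (A 0) j j = sqrt c" using p0 c by (simp add: chol_diag)
    ultimately show ?thesis using 2 by simp
  next
    case 3
    have jj: "((\<lambda>t. chol (A t) j j) has_real_derivative ?D j j) (at 0)" "chol (A 0) j j = sqrt c"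
      using less(2)[OF 3] by auto
    have "((\<lambda>t. \<Sum>k<j. chol (A t) i k * chol (A t) j k) has_real_derivative
       (\<Sum>k<j. ?D i k * chol (A 0) j k + ?D j k * chol (A 0) i k)) (at 0)"
    proof (intro DERIV_sum)
      fix k assume "k \<in> {..<j}"
      then have k: "k < j" by simp
      show "((\<lambda>t. chol (A t) i k * chol (A t) j k) has_real_derivative
         ?D i k * chol (A 0) j k + ?D j k * chol (A 0) i k) (at 0)"
        by (rule DERIV_mult[OF d[OF k] d[OF k]])
    qed
    also have "(\<Sum>k<j. ?D i k * chol (A 0) j k + ?D j k * chol (A 0) i k) = 0"
      using z 3 by (intro sum.neutral) auto
    finally have n: "((\<lambda>t. A t i j - (\<Sum>k<j. chol (A t) i k * chol (A t) j k)) has_real_derivative A' i j - 0) (at 0)"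
      by (intro DERIV_diff A)
    have n0: "A 0 i j - (\<Sum>k<j. chol (A 0) i k * chol (A 0) j k) = 0"
      using z 3 by (auto simp: A0 intro!: sum.neutral)
    have "((\<lambda>t. chol (A t) i j) has_real_derivative
       ((A' i j - 0) * sqrt c - 0 * ?D j j) / (sqrt c * sqrt c)) (at 0)"
      unfolding chol_lower[OF 3] using DERIV_divide[OF n jj(1)] n0 jj(2) c by simp
    moreover have "((A' i j - 0) * sqrt c - 0 * ?D j j) / (sqrt c * sqrt c) = A' i j / sqrt c"
      using nonzero_mult_divide_mult_cancel_right[of "sqrt c" "A' i j" "sqrt c"] c by (simp del: real_sqrt_mult_self)
    ultimately have "((\<lambda>t. chol (A t) i j) has_real_derivative A' i j / sqrt c) (at 0)" by simp
    moreover have "chol (A 0) i j = 0" unfolding chol_lower[OF 3] using n0 by simp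
    ultimately show ?thesis using 3 c by (simp add: field_simps)
  qed
qed

section \<open>Triangular change of variables\<close>

text \<open>Lets measurability be proved once on the whole function space with its Borel sets and
  then be transferred to every product; coordinates outside \<open>I\<close> are constant
  there.\<close>

lemma measurable_PiM_fun_borel:
  fixes I :: "'i::countable set"
  shows "(\<lambda>x. x) \<in> borel_measurable (PiM I (\<lambda>_. lborel :: real measure))"
proof (rule measurable_coordinatewise_then_product)
  fix i
  show "(\<lambda>x. x i) \<in> borel_measurable (PiM I (\<lambda>_. lborel :: real measure))"
  proof (cases "i \<in> I")
    case True
    then show ?thesis using measurable_component_singleton[of i I "\<lambda>_. lborel :: real measure"] by simp
  next
    case False
    have "(\<lambda>x. x i) \<in> borel_measurable (PiM I (\<lambda>_. lborel :: real measure)) \<longleftrightarrow>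
       (\<lambda>x. undefined :: real) \<in> borel_measurable (PiM I (\<lambda>_. lborel :: real measure))"
      by (rule measurable_cong) (use False in \<open>auto simp: space_PiM PiE_def extensional_def\<close>)
    then show ?thesis by simp
  qed
qed

text \<open>Tonelli with a variable of highest rank innermost: with the others fixed it undergoes an
  affine substitution, and no offset or slope depends on it. Dependence is on strictly smaller rank,
  so several variables may share a rank.\<close>

lemma triangular_nn_integral:
  fixes rk :: "'i \<Rightarrow> nat" and g d :: "'i \<Rightarrow> ('i \<Rightarrow> real) \<Rightarrow> real"
  assumes "finite I"
    and "\<And>i. i \<in> I \<Longrightarrow> g i \<in> borel_measurable (PiM I (\<lambda>_. lborel))"
    and "\<And>i. i \<in> I \<Longrightarrow> d i \<in> borel_measurable (PiM I (\<lambda>_. lborel))"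
    and "\<And>i y y'. i \<in> I \<Longrightarrow> (\<And>j. j \<in> I \<Longrightarrow> rk j < rk i \<Longrightarrow> y j = y' j) \<Longrightarrow> g i y = g i y'"
    and "\<And>i y y'. i \<in> I \<Longrightarrow> (\<And>j. j \<in> I \<Longrightarrow> rk j < rk i \<Longrightarrow> y j = y' j) \<Longrightarrow> d i y = d i y'"
    and "\<And>i y. i \<in> I \<Longrightarrow> d i y > 0"
    and "f \<in> borel_measurable (PiM I (\<lambda>_. lborel))"
  shows "(\<integral>\<^sup>+x. f x \<partial>PiM I (\<lambda>_. lborel)) =
    (\<integral>\<^sup>+y. ennreal (\<Prod>i\<in>I. d i y) * f (\<lambda>i\<in>I. g i y + d i y * y i) \<partial>PiM I (\<lambda>_. lborel))"
  using assms
proof (induction I arbitrary: f rule: finite_ranking_induct[where f = rk])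
  case empty
  show ?case by (rule nn_integral_cong) (simp add: space_PiM restrict_def)
next
  case (insert a S)
  \<comment> \<open>The ranking induction does not tell that the new element is fresh.\<close>
  show ?case
  proof (cases "a \<in> S")
    case True
    show ?thesis unfolding insert_absorb[OF True]
      by (rule insert.IH[OF insert.prems[unfolded insert_absorb[OF True]]])
  next
  case aS: False
  interpret product_sigma_finite "\<lambda>_::'i. lborel :: real measure" by standard
  let ?M = "\<lambda>I. PiM I (\<lambda>_::'i. lborel :: real measure)"
  note gm = insert.prems(1) and dm = insert.prems(2) and gdep = insert.prems(3) and ddep = insert.prems(4)
    and pos = insert.prems(5)
  note [measurable] = insert.prems(6)
  \<comment> \<open>No \<open>g i\<close> or \<open>d i\<close> depends on the coordinate
    \<open>a\<close> of top rank; setting it to 0 makes them measurable on the smaller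
    product.\<close>
  have upd: "(\<lambda>y. y(a := 0)) \<in> ?M S \<rightarrow>\<^sub>M ?M (insert a S)"
    by (rule measurable_fun_upd[where J=S]) auto
  have gdep': "g i y = g i y'" if "i \<in> insert a S" "\<And>j. j \<in> S \<Longrightarrow> rk j < rk i \<Longrightarrow> y j = y' j" for i y y'
    by (rule gdep) (use that insert.hyps in \<open>force\<close>)+
  have ddep': "d i y = d i y'" if "i \<in> insert a S" "\<And>j. j \<in> S \<Longrightarrow> rk j < rk i \<Longrightarrow> y j = y' j" for i y y'
    by (rule ddep) (use that insert.hyps in \<open>force\<close>)+
  have gmS: "g i \<in> borel_measurable (?M S)" if "i \<in> insert a S" for i
  proof -
    have "(\<lambda>y. g i (y(a := 0))) \<in> borel_measurable (?M S)"
      using measurable_compose[OF upd gm[OF that]] .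
    also have "(\<lambda>y. g i (y(a := 0))) = g i"
      by (intro ext gdep'[OF that]) (use aS insert.hyps in auto)
    finally show ?thesis .
  qed
  have dmS: "d i \<in> borel_measurable (?M S)" if "i \<in> insert a S" for i
  proof -
    have "(\<lambda>y. d i (y(a := 0))) \<in> borel_measurable (?M S)"
      using measurable_compose[OF upd dm[OF that]] .
    also have "(\<lambda>y. d i (y(a := 0))) = d i"
      by (intro ext ddep'[OF that]) (use aS insert.hyps in auto)
    finally show ?thesis .
  qed
  define F where "F x = (\<integral>\<^sup>+s. f (x(a := s)) \<partial>lborel)" for x
  have Fm: "F \<in> borel_measurable (?M S)" unfolding F_def by measurable
  let ?T = "\<lambda>I y. \<lambda>i\<in>I. g i y + d i y * y i"
  have Tm: "?T S \<in> ?M S \<rightarrow>\<^sub>M ?M S"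
  proof (rule measurable_restrict)
    fix i assume i: "i \<in> S"
    note [measurable] = gmS[of i] dmS[of i]
    show "(\<lambda>y. g i y + d i y * y i) \<in> ?M S \<rightarrow>\<^sub>M lborel" using i by simp
  qed
  have "(\<integral>\<^sup>+x. f x \<partial>?M (insert a S)) = (\<integral>\<^sup>+x. F x \<partial>?M S)"
    unfolding F_def by (rule product_nn_integral_insert) (use aS insert.hyps in auto)
  also have "\<dots> = (\<integral>\<^sup>+y. ennreal (\<Prod>i\<in>S. d i y) * F (?T S y) \<partial>?M S)"
  proof (rule insert.IH)
    show "g i y = g i y'" if "i \<in> S" "\<And>j. j \<in> S \<Longrightarrow> rk j < rk i \<Longrightarrow> y j = y' j" for i y y'
      using gdep'[of i y y'] that by auto
    show "d i y = d i y'" if "i \<in> S" "\<And>j. j \<in> S \<Longrightarrow> rk j < rk i \<Longrightarrow> y j = y' j" for i y y'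
      using ddep'[of i y y'] that by auto
  qed (use gmS dmS pos Fm in auto)
  also have "\<dots> = (\<integral>\<^sup>+y. (\<integral>\<^sup>+s. ennreal (\<Prod>i\<in>insert a S. d i (y(a:=s))) * f (?T (insert a S) (y(a := s))) \<partial>lborel) \<partial>?M S)"
  proof (rule nn_integral_cong)
    fix y assume y: "y \<in> space (?M S)"
    have Ty: "?T S y \<in> space (?M S)" using measurable_space[OF Tm y] .
    have e: "g i (y(a:=s)) = g i y" "d i (y(a:=s)) = d i y" if "i \<in> insert a S" for i s
    proof -
      have "(y(a:=s)) j = y j" if "j \<in> S" for j using that aS by auto
      then show "g i (y(a:=s)) = g i y" "d i (y(a:=s)) = d i y"
        by (intro gdep'[OF that] ddep'[OF that]; simp)+
    qed
    have fm: "(\<lambda>s. f ((?T S y)(a := s))) \<in> borel_measurable borel"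
      using measurable_comp[OF measurable_component_update[OF Ty aS] insert.prems(6)]
      by (simp add: comp_def)
    have "F (?T S y) = ennreal (d a y) * (\<integral>\<^sup>+s. f ((?T S y)(a := g a y + d a y * s)) \<partial>lborel)"
      unfolding F_def using nn_integral_real_affine[OF fm, of "d a y" "g a y"] pos[of a y] by simp
    moreover have "(?T S y)(a := g a y + d a y * s) = ?T (insert a S) (y(a := s))" for s
      using e aS by (auto simp: fun_eq_iff restrict_def)
    moreover have "(\<Prod>i\<in>insert a S. d i (y(a:=s))) = d a y * (\<Prod>i\<in>S. d i y)" for s
      using e aS insert.hyps by simp
    moreover have "(\<integral>\<^sup>+s. ennreal (d a y * (\<Prod>i\<in>S. d i y)) * f ((?T S y)(a := g a y + d a y * s)) \<partial>lborel)
      = ennreal (d a y * (\<Prod>i\<in>S. d i y)) * (\<integral>\<^sup>+s. f ((?T S y)(a := g a y + d a y * s)) \<partial>lborel)"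
      by (rule nn_integral_cmult) (use fm in measurable)
    moreover have "ennreal (d a y * (\<Prod>i\<in>S. d i y)) = ennreal (\<Prod>i\<in>S. d i y) * ennreal (d a y)"
      using pos by (subst mult.commute, intro ennreal_mult) (auto intro!: prod_pos less_imp_le)
    ultimately show "ennreal (\<Prod>i\<in>S. d i y) * F (?T S y) =
      (\<integral>\<^sup>+s. ennreal (\<Prod>i\<in>insert a S. d i (y(a:=s))) * f (?T (insert a S) (y(a := s))) \<partial>lborel)"
      by (simp add: mult.assoc)
  qed
  also have "\<dots> = (\<integral>\<^sup>+y. ennreal (\<Prod>i\<in>insert a S. d i y) * f (?T (insert a S) y) \<partial>?M (insert a S))"
  proof (rule product_nn_integral_insert[symmetric])
    note [measurable] = gm dm
    have "?T (insert a S) \<in> ?M (insert a S) \<rightarrow>\<^sub>M ?M (insert a S)"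
    proof (rule measurable_restrict)
      fix i assume i: "i \<in> insert a S"
      note [measurable] = gm[OF i] dm[OF i]
      show "(\<lambda>y. g i y + d i y * y i) \<in> ?M (insert a S) \<rightarrow>\<^sub>M lborel" using i by simp
    qed
    then have "(\<lambda>y. f (?T (insert a S) y)) \<in> borel_measurable (?M (insert a S))"
      by (rule measurable_compose) (rule insert.prems(6))
    moreover have "(\<lambda>y. \<Prod>i\<in>insert a S. d i y) \<in> borel_measurable (?M (insert a S))"
      using dm by (rule borel_measurable_prod)
    ultimately show "(\<lambda>y. ennreal (\<Prod>i\<in>insert a S. d i y) * f (?T (insert a S) y)) \<in> borel_measurable (?M (insert a S))"
      by simp
  qed (use aS insert.hyps in auto)
  finally show ?thesis .
  qed
qed

section \<open>Weighted lattice paths and the parametrization of moments\<close>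

text \<open>\<open>path_weight p B m h\<close> is the block at position \<open>(0, h)\<close> of \<open>J\<^sup>m\<close>, where \<open>J\<close> is the symmetric
  block tridiagonal matrix with zero diagonal and \<open>B (h + 1)\<close> at position \<open>(h, h + 1)\<close>.\<close>

fun path_weight :: "nat \<Rightarrow> (nat \<Rightarrow> nat \<Rightarrow> nat \<Rightarrow> real) \<Rightarrow> nat \<Rightarrow> nat \<Rightarrow> nat \<Rightarrow> nat \<Rightarrow> real" where
  "path_weight p B 0 h i j = (if h = 0 \<and> i = j then 1 else 0)"
| "path_weight p B (Suc m) h i j =
     (if h = 0 then 0 else \<Sum>k<p. path_weight p B m (h - 1) i k * B h k j)
     + (\<Sum>k<p. path_weight p B m (Suc h) i k * B (Suc h) j k)"

lemma path_weight_above: "m < h \<Longrightarrow> path_weight p B m h i j = 0"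
  by (induction m arbitrary: h i j) auto

text \<open>A path of \<open>m\<close> steps from level 0 to level \<open>h\<close> rises at most to
  level \<open>(m + h) / 2\<close>, so no higher block occurs.\<close>

lemma path_weight_cong:
  assumes "\<And>l a b. 1 \<le> l \<Longrightarrow> 2 * l \<le> m + h \<Longrightarrow> a < p \<Longrightarrow> b < p \<Longrightarrow> B l a b = B' l a b" "j < p"
  shows "path_weight p B m h i j = path_weight p B' m h i j"
  using assms
proof (induction m arbitrary: h j)
  case (Suc m)
  have a: "(\<Sum>k<p. path_weight p B m (h - 1) i k * B h k j)
      = (\<Sum>k<p. path_weight p B' m (h - 1) i k * B' h k j)" if "h \<noteq> 0"
  proof (rule sum.cong)
    fix k assume k: "k \<in> {..<p}"
    have "path_weight p B m (h - 1) i k = path_weight p B' m (h - 1) i k"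
      by (rule Suc.IH) (use Suc.prems k that in auto)
    moreover have "B h k j = B' h k j" if "h - 1 \<le> m"
      by (rule Suc.prems) (use k that \<open>h \<noteq> 0\<close> \<open>j < p\<close> in auto)
    ultimately show "path_weight p B m (h - 1) i k * B h k j = path_weight p B' m (h - 1) i k * B' h k j"
      using path_weight_above[of m "h - 1"] by (cases "h - 1 \<le> m") auto
  qed auto
  have b: "(\<Sum>k<p. path_weight p B m (Suc h) i k * B (Suc h) j k)
      = (\<Sum>k<p. path_weight p B' m (Suc h) i k * B' (Suc h) j k)"
  proof (rule sum.cong)
    fix k assume k: "k \<in> {..<p}"
    have "path_weight p B m (Suc h) i k = path_weight p B' m (Suc h) i k"
      by (rule Suc.IH) (use Suc.prems k in auto)
    moreover have "B (Suc h) j k = B' (Suc h) j k" if "Suc h \<le> m"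
      by (rule Suc.prems) (use k that \<open>j < p\<close> in auto)
    ultimately show "path_weight p B m (Suc h) i k * B (Suc h) j k = path_weight p B' m (Suc h) i k * B' (Suc h) j k"
      using path_weight_above[of m "Suc h"] by (cases "Suc h \<le> m") auto
  qed auto
  show ?case using a b by simp
qed simp

lemma path_weight_top:
  "path_weight p B (Suc m) (Suc m) i j = (\<Sum>k<p. path_weight p B m m i k * B (Suc m) k j)"
  by (simp add: path_weight_above)

text \<open>Symmetry of \<open>J\<close> moves one factor from the left power to the right one.
  Stopping the sum at level \<open>N\<close> loses nothing, since a path cannot rise above its
  length.\<close>

lemma path_weight_shift:
  assumes N: "a < N" "b < N"
  shows "(\<Sum>h\<le>N. \<Sum>k<p. path_weight p B (Suc a) h i k * path_weight p B b h i' k)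
       = (\<Sum>h\<le>N. \<Sum>k<p. path_weight p B a h i k * path_weight p B (Suc b) h i' k)"
proof -
  \<comment> \<open>The contribution of the edge between \<open>h\<close> and \<open>h + 1\<close>,
    with \<open>a\<close> steps on the lower side and \<open>b\<close> on the upper.\<close>
  define E where "E a b i i' h = (\<Sum>k<p. \<Sum>c<p. path_weight p B a h i c * B (Suc h) c k * path_weight p B b (Suc h) i' k)"
    for a b i i' h
  have st: "(\<Sum>k<p. path_weight p B (Suc a) h i k * path_weight p B b h i' k)
      = (if h = 0 then 0 else E a b i i' (h - 1)) + E b a i' i h" for a b h i i'
  proof -
    have "(\<Sum>k<p. path_weight p B (Suc a) h i k * path_weight p B b h i' k)
       = (\<Sum>k<p. (if h = 0 then 0 else \<Sum>c<p. path_weight p B a (h-1) i c * B h c k * path_weight p B b h i' k)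
          + (\<Sum>c<p. path_weight p B b h i' k * B (Suc h) k c * path_weight p B a (Suc h) i c))"
      by (intro sum.cong refl) (simp add: distrib_right distrib_left sum_distrib_right sum_distrib_left mult_ac)
    also have "\<dots> = (\<Sum>k<p. if h = 0 then 0 else \<Sum>c<p. path_weight p B a (h-1) i c * B h c k * path_weight p B b h i' k)
        + E b a i' i h"
      unfolding sum.distrib E_def by (intro arg_cong2[where f="(+)"] refl sum.swap)
    finally show ?thesis by (simp add: E_def)
  qed
  have sw: "(\<Sum>k<p. path_weight p B a h i k * path_weight p B (Suc b) h i' k)
      = (if h = 0 then 0 else E b a i' i (h - 1)) + E a b i i' h" for a b h i i'
    using st[where a=b and b=a and i=i' and i'=i] by (simp add: mult.commute)
  have z: "E a b i i' N = 0" "E b a i' i N = 0"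
    using path_weight_above[of b "Suc N"] path_weight_above[of a "Suc N"] N by (simp_all add: E_def)
  have sh: "(\<Sum>h\<le>N. if h = 0 then 0 else e (h - 1)) = (\<Sum>h<N. e h)" for e :: "nat \<Rightarrow> real"
    by (subst lessThan_Suc_atMost[symmetric], subst sum.lessThan_Suc_shift) simp
  have sn: "(\<Sum>h\<le>N. e h) = (\<Sum>h<N. e h)" if "e N = 0" for e :: "nat \<Rightarrow> real"
    using that by (simp add: lessThan_Suc_atMost[symmetric])
  show ?thesis unfolding st sw sum.distrib sh
    using sn[of "E a b i i'"] sn[of "E b a i' i"] z by simp
qed

lemma path_weight_inner:
  assumes "a + b \<le> N" "i' < p"
  shows "(\<Sum>h\<le>N. \<Sum>k<p. path_weight p B a h i k * path_weight p B b h i' k) = path_weight p B (a + b) 0 i i'"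
  using assms
proof (induction b arbitrary: a)
  case 0
  have "(\<Sum>h\<le>N. \<Sum>k<p. path_weight p B a h i k * path_weight p B 0 h i' k)
     = (\<Sum>h\<le>N. if h = 0 then path_weight p B a 0 i i' else 0)"
    using 0(2) by (intro sum.cong refl) (auto simp: if_distrib[of "\<lambda>x. _ * x"] sum.delta' cong: if_cong)
  then show ?case by simp
next
  case (Suc b)
  show ?case using path_weight_shift[of a N b p B i i'] Suc.IH[of "Suc a"] Suc.prems by simp
qed

text \<open>A path of length \<open>2 * l\<close> is cut in the middle. Only the summand
  \<open>h = l\<close> involves the block \<open>B l\<close>; this makes the moments triangular in
  the parameters.\<close>

lemma path_weight_moment:
  assumes "i' < p"
  shows "path_weight p B (2 * l) 0 i i' = (\<Sum>h\<le>l. \<Sum>k<p. path_weight p B l h i k * path_weight p B l h i' k)"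
proof -
  have "path_weight p B (2 * l) 0 i i' = (\<Sum>h\<le>2*l. \<Sum>k<p. path_weight p B l h i k * path_weight p B l h i' k)"
    using path_weight_inner[of l l "2*l"] assms by (simp add: mult_2)
  also have "\<dots> = (\<Sum>h\<le>l. \<Sum>k<p. path_weight p B l h i k * path_weight p B l h i' k)"
    by (intro sum.mono_neutral_right) (auto simp: path_weight_above not_le)
  finally show ?thesis .
qed

lemma lowtri_mult:
  assumes "lowtri p L" "lowtri p M"
  shows "lowtri p (\<lambda>i j. \<Sum>k<p. L i k * M k j)"
    and "i < p \<Longrightarrow> (\<Sum>k<p. L i k * M k i) = L i i * M i i"
proof -
  have d: "(\<Sum>k<p. L i k * M k i) = L i i * M i i" if "i < p" for i
  proof -
    have "(\<Sum>k<p. L i k * M k i) = (\<Sum>k\<in>{i}. L i k * M k i)"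
      using that lowtriD(2)[OF assms(1)] lowtriD(2)[OF assms(2)]
      by (intro sum.mono_neutral_right) (auto simp: neq_iff)
    then show ?thesis by simp
  qed
  show "i < p \<Longrightarrow> (\<Sum>k<p. L i k * M k i) = L i i * M i i" by (rule d)
  have z: "(\<Sum>k<p. L i k * M k j) = 0" if "i < j" "j < p" for i j
  proof (rule sum.neutral, rule)
    fix k assume "k \<in> {..<p}"
    then show "L i k * M k j = 0"
      using that lowtriD(2)[OF assms(1), of i k] lowtriD(2)[OF assms(2), of k j] by (cases "i < k") auto
  qed
  show "lowtri p (\<lambda>i j. \<Sum>k<p. L i k * M k j)"
    unfolding lowtri_def using d z lowtriD(1)[OF assms(1)] lowtriD(1)[OF assms(2)] by simp
qed

text \<open>With \<open>Y\<close> the value of \<open>shifted\<close>, the factors satisfy \<open>Y = W W\<^sup>T\<close> and \<open>1 - W\<^sup>T W = C C\<^sup>T\<close> whenever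
  these matrices are positive definite; the off-diagonal Jacobi blocks are \<open>B\<^sub>l = C\<^bsub>l-1\<^esub> W\<^sub>l\<close>.\<close>

definition shifted :: "real \<Rightarrow> (nat \<times> nat \<times> nat \<Rightarrow> real) \<Rightarrow> nat \<Rightarrow> nat \<Rightarrow> nat \<Rightarrow> real" where
  "shifted t y l i j = (if i = j then 1/2 else 0) + t * symmat y l i j"

definition Wfac :: "real \<Rightarrow> (nat \<times> nat \<times> nat \<Rightarrow> real) \<Rightarrow> nat \<Rightarrow> nat \<Rightarrow> nat \<Rightarrow> real" where
  "Wfac t y l = chol (shifted t y l)"

definition complement_gram :: "nat \<Rightarrow> (nat \<Rightarrow> nat \<Rightarrow> real) \<Rightarrow> nat \<Rightarrow> nat \<Rightarrow> real" where
  "complement_gram p W i j = (if i = j then 1 else 0) - (\<Sum>k<p. W k i * W k j)"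

text \<open>The value at \<open>l = 0\<close> makes the first off-diagonal Jacobi block equal to
  \<open>Wfac\<close> at 1.\<close>

definition Cfac :: "nat \<Rightarrow> real \<Rightarrow> (nat \<times> nat \<times> nat \<Rightarrow> real) \<Rightarrow> nat \<Rightarrow> nat \<Rightarrow> nat \<Rightarrow> real" where
  "Cfac p t y l = (if l = 0 then (\<lambda>i j. if i = j then 1 else 0) else chol (complement_gram p (Wfac t y l)))"

definition Bfac :: "nat \<Rightarrow> real \<Rightarrow> (nat \<times> nat \<times> nat \<Rightarrow> real) \<Rightarrow> nat \<Rightarrow> nat \<Rightarrow> nat \<Rightarrow> real" where
  "Bfac p t y l i j = (\<Sum>k<p. Cfac p t y (l - 1) i k * Wfac t y l k j)"

text \<open>The product \<open>B_1 ... B_l\<close> ends with \<open>Wfac\<close> at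
  \<open>l\<close>; this is what stands before it. Level \<open>l\<close> of a path cut in the
  middle then contributes \<open>Lfac Y Lfac^T\<close> to the moment.\<close>

definition Lfac :: "nat \<Rightarrow> real \<Rightarrow> (nat \<times> nat \<times> nat \<Rightarrow> real) \<Rightarrow> nat \<Rightarrow> nat \<Rightarrow> nat \<Rightarrow> real" where
  "Lfac p t y l i j = (\<Sum>k<p. path_weight p (Bfac p t y) (l - 1) (l - 1) i k * Cfac p t y (l - 1) k j)"

text \<open>The last term uses \<open>Y\<close> itself and not \<open>W W\<^sup>T\<close>: then the map is triangular on the whole space and not
  only on the parameters for which the Cholesky factorizations exist.\<close>

fun moment_map :: "nat \<Rightarrow> real \<Rightarrow> (nat \<times> nat \<times> nat \<Rightarrow> real) \<Rightarrow> nat \<times> nat \<times> nat \<Rightarrow> real" where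
  "moment_map p t y (l, i, j) =
     (\<Sum>h<l. \<Sum>k<p. path_weight p (Bfac p t y) l h i k * path_weight p (Bfac p t y) l h j k)
     + (\<Sum>a<p. \<Sum>b<p. Lfac p t y l i a * shifted t y l a b * Lfac p t y l j b)"

text \<open>Since \<open>W^T W\<close> and \<open>W W^T = Y\<close> have the same eigenvalues, this
  says \<open>0 < Y < 1\<close>; the second condition is put on the matrix that \<open>Cfac\<close>
  factors.\<close>

definition admissible :: "nat \<Rightarrow> real \<Rightarrow> (nat \<times> nat \<times> nat \<Rightarrow> real) \<Rightarrow> nat \<Rightarrow> bool" where
  "admissible p t y l \<longleftrightarrow> pd p (shifted t y l) \<and> pd p (complement_gram p (Wfac t y l))"

lemma lowtri_Cfac: "lowtri p (Cfac p t y l)"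
  by (cases "l = 0") (auto simp: Cfac_def lowtri_chol, auto simp: lowtri_def)

lemma lowtri_Wfac: "lowtri p (Wfac t y l)"
  by (simp add: Wfac_def lowtri_chol)

lemma lowtri_Bfac: "lowtri p (Bfac p t y l)"
  unfolding Bfac_def[abs_def] by (rule lowtri_mult[OF lowtri_Cfac lowtri_Wfac])

lemma lowtri_path_weight: "lowtri p (path_weight p (Bfac p t y) m m)"
proof (induction m)
  case (Suc m)
  then show ?case unfolding path_weight_top[abs_def] by (rule lowtri_mult[OF _ lowtri_Bfac])
qed (auto simp: lowtri_def)

lemma lowtri_Lfac: "lowtri p (Lfac p t y l)"
  unfolding Lfac_def[abs_def] by (rule lowtri_mult[OF lowtri_path_weight lowtri_Cfac])

lemma path_weight_top_diag:
  "i < p \<Longrightarrow> path_weight p (Bfac p t y) m m i i = (\<Prod>l=1..m. Cfac p t y (l - 1) i i * Wfac t y l i i)"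
proof (induction m)
  case (Suc m)
  have "path_weight p (Bfac p t y) (Suc m) (Suc m) i i = path_weight p (Bfac p t y) m m i i * Bfac p t y (Suc m) i i"
    unfolding path_weight_top by (rule lowtri_mult(2)[OF lowtri_path_weight lowtri_Bfac Suc.prems])
  also have "Bfac p t y (Suc m) i i = Cfac p t y m i i * Wfac t y (Suc m) i i"
    unfolding Bfac_def using lowtri_mult(2)[OF lowtri_Cfac lowtri_Wfac Suc.prems] by simp
  finally show ?case using Suc by simp
qed simp

lemma Lfac_diag:
  assumes "i < p" "l \<ge> 1"
  shows "Lfac p t y l i i = (\<Prod>m=1..<l. Cfac p t y m i i * Wfac t y m i i)"
proof -
  obtain m where l: "l = Suc m" using assms(2) by (cases l) auto
  have *: "(\<Prod>l=1..m. Cfac p t y (l - 1) i i * Wfac t y l i i) * Cfac p t y m i i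
     = (\<Prod>l=1..m. Cfac p t y l i i * Wfac t y l i i)" for m
  proof (induction m)
    case (Suc m)
    then show ?case by (simp add: mult_ac)
  qed (simp add: Cfac_def)
  have "Lfac p t y l i i = path_weight p (Bfac p t y) m m i i * Cfac p t y m i i"
    unfolding Lfac_def l using lowtri_mult(2)[OF lowtri_path_weight lowtri_Cfac assms(1)] by simp
  then show ?thesis using * path_weight_top_diag[OF assms(1)] by (simp add: l atLeastLessThanSuc_atLeastAtMost)
qed

lemma path_weight_top_factor:
  assumes "l \<ge> 1"
  shows "path_weight p (Bfac p t y) l l i j = (\<Sum>k<p. Lfac p t y l i k * Wfac t y l k j)"
proof -
  obtain m where l: "l = Suc m" using assms by (cases l) auto
  have "path_weight p (Bfac p t y) l l i j
      = (\<Sum>k<p. \<Sum>c<p. path_weight p (Bfac p t y) m m i k * Cfac p t y m k c * Wfac t y l c j)"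
    unfolding l path_weight_top by (simp add: Bfac_def sum_distrib_left mult.assoc)
  also have "\<dots> = (\<Sum>c<p. \<Sum>k<p. path_weight p (Bfac p t y) m m i k * Cfac p t y m k c * Wfac t y l c j)"
    by (rule sum.swap)
  finally show ?thesis by (simp add: l Lfac_def sum_distrib_right)
qed

text \<open>Admissibility enters through \<open>W W^T = Y\<close>, which turns the last term of
  \<open>moment_map\<close> into level \<open>l\<close> of the path cut in the middle.\<close>

lemma moment_map_good:
  assumes "admissible p t y l" "l \<ge> 1" "i < p" "j < p"
  shows "moment_map p t y (l, i, j) = path_weight p (Bfac p t y) (2 * l) 0 i j"
proof -
  have "(\<Sum>a<p. \<Sum>b<p. Lfac p t y l i a * shifted t y l a b * Lfac p t y l j b)
     = (\<Sum>k<p. (\<Sum>a<p. Lfac p t y l i a * Wfac t y l a k) * (\<Sum>b<p. Lfac p t y l j b * Wfac t y l b k))"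
    by (rule quad_factor) (use chol_mult assms(1) in \<open>auto simp: admissible_def Wfac_def\<close>)
  then show ?thesis using assms(2,4)
    by (simp add: path_weight_moment lessThan_Suc_atMost[symmetric] path_weight_top_factor)
qed

text \<open>The block index dominates because \<open>i + j < 2 * p\<close>. Inside a block the
  moment entry \<open>(i, j)\<close> involves parameters \<open>(a, b)\<close> with
  \<open>a \<le> i\<close> and \<open>b \<le> j\<close>, whose sum is smaller unless they coincide
  with it.\<close>

definition block_rank :: "nat \<Rightarrow> nat \<times> nat \<times> nat \<Rightarrow> nat" where
  "block_rank p = (\<lambda>(l, i, j). l * (2 * p) + i + j)"

section \<open>Triangular dependence of the moments on the parameters\<close>

context
  fixes p :: nat and t :: real and y y' :: "nat \<times> nat \<times> nat \<Rightarrow> real" and l :: nat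
  assumes agree: "\<And>l' i j. 1 \<le> l' \<Longrightarrow> l' < l \<Longrightarrow> i \<le> j \<Longrightarrow> j < p \<Longrightarrow> y (l', i, j) = y' (l', i, j)"
begin

lemma shifted_agree:
  assumes "1 \<le> l'" "l' < l" "i < p" "j < p"
  shows "shifted t y l' i j = shifted t y' l' i j"
  using assms agree[of l' "min i j" "max i j"] by (simp add: shifted_def symmat_def)

lemma Wfac_agree:
  assumes "1 \<le> l'" "l' < l" "i < p" "j < p"
  shows "Wfac t y l' i j = Wfac t y' l' i j"
  unfolding Wfac_def by (rule chol_cong[of p]) (use assms shifted_agree in auto)

lemma Cfac_agree:
  assumes "l' < l" "i < p" "j < p"
  shows "Cfac p t y l' i j = Cfac p t y' l' i j"
proof (cases "l' = 0")
  case False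
  have "chol (complement_gram p (Wfac t y l')) i j = chol (complement_gram p (Wfac t y' l')) i j"
    by (rule chol_cong[of p]) (use assms Wfac_agree[of l'] False in \<open>auto simp: complement_gram_def intro!: sum.cong\<close>)
  then show ?thesis using False by (simp add: Cfac_def)
qed (simp add: Cfac_def)

lemma Bfac_agree:
  assumes "1 \<le> l'" "l' < l" "i < p" "j < p"
  shows "Bfac p t y l' i j = Bfac p t y' l' i j"
  unfolding Bfac_def using assms Wfac_agree[of l'] Cfac_agree[of "l' - 1"] by (intro sum.cong) auto

lemma path_weight_agree:
  assumes "m + h < 2 * l" "j < p"
  shows "path_weight p (Bfac p t y) m h i j = path_weight p (Bfac p t y') m h i j"
  by (rule path_weight_cong) (use assms Bfac_agree in auto)

lemma Lfac_agree:
  assumes "1 \<le> l" "j < p"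
  shows "Lfac p t y l i j = Lfac p t y' l i j"
  unfolding Lfac_def using assms path_weight_agree[of "l - 1" "l - 1"] Cfac_agree[of "l - 1"]
  by (intro sum.cong) auto

end

text \<open>The first part serves the slope and the second the offset of the affine dependence on
  \<open>y (l, i, j)\<close>. Within the block the triangular shape of \<open>Lfac\<close> leaves
  only parameters up to row \<open>i\<close> and column \<open>j\<close>.\<close>

lemma moment_map_dep:
  assumes x: "(l, i, j) \<in> coords p n"
    and eq: "\<And>x'. x' \<in> coords p n \<Longrightarrow> block_rank p x' < block_rank p (l, i, j) \<Longrightarrow> y x' = y' x'"
  shows "Lfac p t y l a b = Lfac p t y' l a b \<or> \<not> b < p"
    and "moment_map p t (y((l,i,j) := 0)) (l,i,j) = moment_map p t (y'((l,i,j) := 0)) (l,i,j)"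
proof -
  have x': "1 \<le> l" "l \<le> n" "i \<le> j" "j < p" using x by (auto simp: coords_def)
  have lo: "y (l', a, b) = y' (l', a, b)" if "1 \<le> l'" "l' < l" "a \<le> b" "b < p" for l' a b
  proof (rule eq)
    show "(l', a, b) \<in> coords p n" using that x' by (auto simp: coords_def)
    have "l' * (2 * p) + (2 * p) \<le> l * (2 * p)" using that(2) mult_le_mono1[of "Suc l'" l "2 * p"] by simp
    then show "block_rank p (l', a, b) < block_rank p (l, i, j)" using that by (simp add: block_rank_def)
  qed
  show "Lfac p t y l a b = Lfac p t y' l a b \<or> \<not> b < p"
    using Lfac_agree[of l p y y' b t a, OF lo] x' by blast
  let ?y = "y((l,i,j) := 0)" and ?y' = "y'((l,i,j) := 0)"
  have lo': "?y (l', a, b) = ?y' (l', a, b)" if "1 \<le> l'" "l' < l" "a \<le> b" "b < p" for l' a b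
    using lo that by simp
  have s: "Lfac p t ?y l i a * shifted t ?y l a b * Lfac p t ?y l j b
       = Lfac p t ?y' l i a * shifted t ?y' l a b * Lfac p t ?y' l j b" if ab: "a < p" "b < p" for a b
  proof (cases "a \<le> i \<and> b \<le> j")
    case True
    have "shifted t ?y l a b = shifted t ?y' l a b"
    proof (cases "(min a b, max a b) = (i, j)")
      case False
      have "min a b + max a b < i + j"
        using True False x'(3) by (auto simp: min_def max_def split: if_splits)
      then have "y (l, min a b, max a b) = y' (l, min a b, max a b)"
        using ab x' by (intro eq) (auto simp: coords_def block_rank_def)
      then show ?thesis by (simp add: shifted_def symmat_def)
    qed (simp add: shifted_def symmat_def)
    then show ?thesis using Lfac_agree[of l p ?y ?y' _ t, OF lo'] ab x' by simp
  next
    case False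
    then have "Lfac p t ?y l i a = 0 \<or> Lfac p t ?y l j b = 0" "Lfac p t ?y' l i a = 0 \<or> Lfac p t ?y' l j b = 0"
      using lowtriD(2)[OF lowtri_Lfac] ab x' by (meson not_le order.strict_trans1)+
    then show ?thesis by auto
  qed
  show "moment_map p t ?y (l,i,j) = moment_map p t ?y' (l,i,j)"
    unfolding moment_map.simps
    using path_weight_agree[of l p ?y ?y' l _ _ t, OF lo'] s
    by (intro arg_cong2[where f="(+)"] sum.cong refl) auto
qed

text \<open>A parameter with \<open>i < j\<close> sits at two places of its symmetric matrix, but
  the copy at \<open>(j, i)\<close> is multiplied by the entry \<open>(i, j)\<close> of
  \<open>Lfac\<close>, which is 0. Hence no factor 2 arises.\<close>

lemma moment_map_affine:
  assumes x: "(l, i, j) \<in> coords p n"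
  shows "moment_map p t y (l,i,j) = moment_map p t (y((l,i,j) := 0)) (l,i,j)
     + t * Lfac p t y l i i * Lfac p t y l j j * y (l,i,j)"
proof -
  have x': "1 \<le> l" "l \<le> n" "i \<le> j" "j < p" using x by (auto simp: coords_def)
  let ?y = "y((l,i,j) := 0)"
  have lo: "?y (l', a, b) = y (l', a, b)" if "1 \<le> l'" "l' < l" "a \<le> b" "b < p" for l' a b
    using that by simp
  have s: "Lfac p t y l i a * shifted t y l a b * Lfac p t y l j b
       = Lfac p t ?y l i a * shifted t ?y l a b * Lfac p t ?y l j b
        + (if a = i then (if b = j then t * Lfac p t y l i i * Lfac p t y l j j * y (l,i,j) else 0) else 0)"
    if ab: "a < p" "b < p" for a b
  proof -
    have L: "Lfac p t ?y l i a = Lfac p t y l i a" "Lfac p t ?y l j b = Lfac p t y l j b"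
      using Lfac_agree[of l p ?y y _ t, OF lo] ab x' by blast+
    show ?thesis
    proof (cases "a \<le> i \<and> b \<le> j")
      case True
      show ?thesis
      proof (cases "(min a b, max a b) = (i, j)")
        case False
        then have "\<not> (a = i \<and> b = j)" using x' by auto
        moreover have "shifted t y l a b = shifted t ?y l a b" using False by (auto simp: shifted_def symmat_def)
        ultimately show ?thesis using L by auto
      next
        case T: True
        then have "a = i" "b = j" using True x' by (auto simp: min_def max_def split: if_splits)
        then show ?thesis using L x' by (simp add: shifted_def symmat_def algebra_simps)
      qed
    next
      case False
      then have "Lfac p t y l i a = 0 \<or> Lfac p t y l j b = 0"
        using lowtriD(2)[OF lowtri_Lfac] ab x' by (meson not_le order.strict_trans1)+
      then show ?thesis using L False by auto
    qed
  qed
  have "(\<Sum>a<p. \<Sum>b<p. Lfac p t y l i a * shifted t y l a b * Lfac p t y l j b)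
     = (\<Sum>a<p. \<Sum>b<p. Lfac p t ?y l i a * shifted t ?y l a b * Lfac p t ?y l j b
        + (if a = i then (if b = j then t * Lfac p t y l i i * Lfac p t y l j j * y (l,i,j) else 0) else 0))"
    using s by (intro sum.cong refl) auto
  also have "\<dots> = (\<Sum>a<p. \<Sum>b<p. Lfac p t ?y l i a * shifted t ?y l a b * Lfac p t ?y l j b)
     + (\<Sum>a<p. \<Sum>b<p. if a = i then (if b = j then t * Lfac p t y l i i * Lfac p t y l j j * y (l,i,j) else 0) else 0)"
    by (simp add: sum.distrib)
  also have "(\<Sum>a<p. \<Sum>b<p. if a = i then (if b = j then t * Lfac p t y l i i * Lfac p t y l j j * y (l,i,j) else 0) else 0)
     = (\<Sum>a<p. if a = i then (\<Sum>b<p. if b = j then t * Lfac p t y l i i * Lfac p t y l j j * y (l,i,j) else 0) else 0)"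
    by (intro sum.cong refl) auto
  also have "\<dots> = t * Lfac p t y l i i * Lfac p t y l j j * y (l,i,j)"
    using x' by (simp add: sum.delta')
  finally have S: "(\<Sum>a<p. \<Sum>b<p. Lfac p t y l i a * shifted t y l a b * Lfac p t y l j b)
     = (\<Sum>a<p. \<Sum>b<p. Lfac p t ?y l i a * shifted t ?y l a b * Lfac p t ?y l j b)
       + t * Lfac p t y l i i * Lfac p t y l j j * y (l,i,j)" .
  have P: "(\<Sum>h<l. \<Sum>k<p. path_weight p (Bfac p t y) l h i k * path_weight p (Bfac p t y) l h j k)
     = (\<Sum>h<l. \<Sum>k<p. path_weight p (Bfac p t ?y) l h i k * path_weight p (Bfac p t ?y) l h j k)"
    using path_weight_agree[of l p ?y y l _ _ t, OF lo] by (intro sum.cong refl) simp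
  show ?thesis unfolding moment_map.simps P S by (rule add.assoc[symmetric])
qed

section \<open>Measurability of the parametrization\<close>

lemma shifted_measurable: "(\<lambda>y. shifted t y l i j) \<in> borel_measurable borel"
  unfolding shifted_def symmat_def
  by (intro borel_measurable_add borel_measurable_times borel_measurable_const
      borel_measurable_continuous_onI continuous_on_product_coordinates)

lemma Wfac_measurable: "(\<lambda>y. Wfac t y l i j) \<in> borel_measurable borel"
  unfolding Wfac_def by (rule chol_measurable[OF shifted_measurable])

lemma compl_Wfac_measurable: "(\<lambda>y. complement_gram p (Wfac t y l) i j) \<in> borel_measurable borel"
  unfolding complement_gram_def
  by (intro borel_measurable_diff borel_measurable_sum borel_measurable_times Wfac_measurable borel_measurable_const)

lemma Cfac_measurable: "(\<lambda>y. Cfac p t y l i j) \<in> borel_measurable borel"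
  unfolding Cfac_def using chol_measurable[OF compl_Wfac_measurable] by (cases "l = 0") simp_all

lemma Bfac_measurable: "(\<lambda>y. Bfac p t y l i j) \<in> borel_measurable borel"
  unfolding Bfac_def by (intro borel_measurable_sum borel_measurable_times Wfac_measurable Cfac_measurable)

lemma path_weight_measurable: "(\<lambda>y. path_weight p (Bfac p t y) m h i j) \<in> borel_measurable borel"
proof (induction m arbitrary: h i j)
  case (Suc m)
  then have "(\<lambda>y. \<Sum>k<p. path_weight p (Bfac p t y) m (h - 1) i k * Bfac p t y h k j) \<in> borel_measurable borel"
    "(\<lambda>y. \<Sum>k<p. path_weight p (Bfac p t y) m (Suc h) i k * Bfac p t y (Suc h) j k) \<in> borel_measurable borel"
    by (auto intro!: borel_measurable_sum borel_measurable_times Bfac_measurable)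
  then show ?case by (cases "h = 0") auto
qed auto

lemma Lfac_measurable: "(\<lambda>y. Lfac p t y l i j) \<in> borel_measurable borel"
  unfolding Lfac_def by (intro borel_measurable_sum borel_measurable_times path_weight_measurable Cfac_measurable)

lemma moment_map_measurable: "(\<lambda>y. moment_map p t y x) \<in> borel_measurable borel"
  by (cases x) (auto intro!: borel_measurable_add borel_measurable_sum borel_measurable_times
    path_weight_measurable Lfac_measurable shifted_measurable)

lemma good_measurable: "Measurable.pred borel (\<lambda>y. admissible p t y l)"
proof -
  have [measurable]: "(\<lambda>y. pivot (shifted t y l) j) \<in> borel_measurable borel"
     "(\<lambda>y. pivot (complement_gram p (Wfac t y l)) j) \<in> borel_measurable borel" for j
    by (rule pivot_measurable, rule shifted_measurable compl_Wfac_measurable)+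
  have "(\<lambda>y. admissible p t y l) = (\<lambda>y. (\<forall>j\<in>{..<p}. pivot (shifted t y l) j > 0) \<and> (\<forall>j\<in>{..<p}. pivot (complement_gram p (Wfac t y l)) j > 0))"
    by (auto simp: admissible_def pd_iff_pivot fun_eq_iff shifted_def complement_gram_def symmat_def min.commute max.commute mult.commute)
  then show ?thesis by simp
qed

section \<open>Spectral decomposition of symmetric matrices\<close>

lemma compact_PiE_UNIV:
  fixes S :: "'a \<Rightarrow> real set"
  assumes "\<And>i. compact (S i)"
  shows "compact (PiE UNIV S)"
proof -
  have "compactin (product_topology (\<lambda>i. euclidean) UNIV) (PiE UNIV S)"
    using assms by (simp add: compactin_PiE)
  then show ?thesis by (simp add: euclidean_product_topology)
qed

lemma continuous_on_coordinate: "continuous_on S (\<lambda>x :: 'a \<Rightarrow> real. x i)"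
  by (rule continuous_on_subset[OF continuous_on_product_coordinates]) simp

lemma max_quadratic_form:
  fixes J :: "'i \<Rightarrow> 'i \<Rightarrow> real"
  assumes "finite S" "a \<in> S"
  shows "\<exists>u l. (\<Sum>i\<in>S. (u i)\<^sup>2) = 1 \<and> (\<Sum>i\<in>S. \<Sum>j\<in>S. u i * J i j * u j) = l \<and>
    (\<forall>w. (\<Sum>i\<in>S. \<Sum>j\<in>S. w i * J i j * w j) \<le> l * (\<Sum>i\<in>S. (w i)\<^sup>2))"
proof -
  \<comment> \<open>The unit sphere of the coordinates in \<open>S\<close>. Bounding these and
    pinning all others to 0 makes it compact in the product topology.\<close>
  define K where "K = PiE UNIV (\<lambda>i. if i \<in> S then {-1..1::real} else {0}) \<inter> {v. (\<Sum>i\<in>S. (v i)\<^sup>2) = 1}"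
  have "closed {v :: 'i \<Rightarrow> real. (\<Sum>i\<in>S. (v i)\<^sup>2) = 1}"
    by (intro closed_Collect_eq continuous_on_sum continuous_on_power continuous_on_coordinate continuous_on_const)
  then have "compact K" unfolding K_def by (intro compact_Int_closed compact_PiE_UNIV) auto
  moreover have "(\<lambda>i. if i = a then 1 else 0) \<in> K"
    using assms by (auto simp: K_def if_distrib[of "\<lambda>x. x\<^sup>2"] cong: if_cong)
  moreover have "continuous_on K (\<lambda>v. \<Sum>i\<in>S. \<Sum>j\<in>S. v i * J i j * v j)"
    by (intro continuous_intros continuous_on_coordinate)
  ultimately obtain u where u: "u \<in> K"
    "\<And>v. v \<in> K \<Longrightarrow> (\<Sum>i\<in>S. \<Sum>j\<in>S. v i * J i j * v j) \<le> (\<Sum>i\<in>S. \<Sum>j\<in>S. u i * J i j * u j)"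
    using continuous_attains_sup[of K "\<lambda>v. \<Sum>i\<in>S. \<Sum>j\<in>S. v i * J i j * v j"] by blast
  let ?l = "\<Sum>i\<in>S. \<Sum>j\<in>S. u i * J i j * u j"
  have "(\<Sum>i\<in>S. \<Sum>j\<in>S. w i * J i j * w j) \<le> ?l * (\<Sum>i\<in>S. (w i)\<^sup>2)" for w
  proof (cases "(\<Sum>i\<in>S. (w i)\<^sup>2) = 0")
    case True
    then have "w i = 0" if "i \<in> S" for i using assms(1) that by (simp add: sum_nonneg_eq_0_iff)
    then show ?thesis by (simp add: True)
  next
    case False
    define N where "N = sqrt (\<Sum>i\<in>S. (w i)\<^sup>2)"
    have N2: "N\<^sup>2 = (\<Sum>i\<in>S. (w i)\<^sup>2)" by (simp add: N_def sum_nonneg)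
    have N0: "N \<noteq> 0" using False N2 by auto
    define v where "v i = (if i \<in> S then w i / N else 0)" for i
    have v1: "(\<Sum>i\<in>S. (v i)\<^sup>2) = 1"
    proof -
      have "(\<Sum>i\<in>S. (v i)\<^sup>2) = (\<Sum>i\<in>S. (w i)\<^sup>2 / N\<^sup>2)" by (intro sum.cong) (auto simp: v_def power_divide)
      also have "\<dots> = 1" using N0 by (simp add: sum_divide_distrib[symmetric] N2[symmetric])
      finally show ?thesis .
    qed
    have "(v i)\<^sup>2 \<le> 1" if "i \<in> S" for i
      using v1 member_le_sum[of i S "\<lambda>i. (v i)\<^sup>2"] assms(1) that by simp
    then have "\<bar>v i\<bar> \<le> 1" if "i \<in> S" for i using that by (simp add: abs_square_le_1)
    then have "-1 \<le> v i" "v i \<le> 1" if "i \<in> S" for i using that by (simp_all add: abs_le_iff minus_le_iff)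
    moreover have "v i = 0" if "i \<notin> S" for i using that by (simp add: v_def)
    ultimately have "v \<in> K" using v1 by (auto simp: K_def)
    then have "(\<Sum>i\<in>S. \<Sum>j\<in>S. v i * J i j * v j) \<le> ?l" by (rule u(2))
    moreover have "(\<Sum>i\<in>S. \<Sum>j\<in>S. v i * J i j * v j) = (\<Sum>i\<in>S. \<Sum>j\<in>S. w i * J i j * w j) / N\<^sup>2"
      unfolding sum_divide_distrib by (intro sum.cong refl) (auto simp: v_def power2_eq_square)
    ultimately show ?thesis using N0 by (simp add: N2[symmetric] divide_le_eq)
  qed
  then show ?thesis using u(1) by (intro exI[of _ u] exI[of _ ?l]) (auto simp: K_def)
qed

lemma linear_term_zero:
  fixes b c :: real
  assumes "\<And>s. 0 \<le> s * b + s\<^sup>2 * c"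
  shows "b = 0"
proof (rule ccontr)
  assume b: "b \<noteq> 0"
  define d where "d = \<bar>c\<bar> + 1"
  have d: "d > 0" "c < d" by (auto simp: d_def)
  \<comment> \<open>As \<open>c < d\<close>, the linear term, now negative, outweighs the quadratic
    one.\<close>
  define s where "s = - b / d"
  have "s * b + s\<^sup>2 * c = (b\<^sup>2 / d) * (c / d - 1)"
    using d by (simp add: s_def power2_eq_square field_simps)
  also have "\<dots> < 0"
    using b d by (intro mult_pos_neg) (auto simp: divide_less_eq)
  finally show False using assms[of s] by simp
qed

text \<open>A maximizer of the form on the sphere will do: a perturbation along a coordinate vector
  cannot lift the form above \<open>l\<close> times the squared norm, so the first-order term
  vanishes.\<close>

lemma exists_eigenvector:
  fixes J :: "'i \<Rightarrow> 'i \<Rightarrow> real"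
  assumes "finite S" "a \<in> S" and sym: "\<And>x y. x \<in> S \<Longrightarrow> y \<in> S \<Longrightarrow> J x y = J y x"
  shows "\<exists>u l. (\<Sum>i\<in>S. (u i)\<^sup>2) = 1 \<and> (\<forall>x\<in>S. (\<Sum>y\<in>S. u y * J y x) = l * u x)"
proof -
  obtain u l where u: "(\<Sum>i\<in>S. (u i)\<^sup>2) = 1" "(\<Sum>i\<in>S. \<Sum>j\<in>S. u i * J i j * u j) = l"
    and le: "\<And>w. (\<Sum>i\<in>S. \<Sum>j\<in>S. w i * J i j * w j) \<le> l * (\<Sum>i\<in>S. (w i)\<^sup>2)"
    using max_quadratic_form[OF assms(1,2), of J] by blast
  have "(\<Sum>y\<in>S. u y * J y x) = l * u x" if x: "x \<in> S" for x
  proof -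
    let ?e = "\<lambda>i. if i = x then 1 else 0 :: real"
    have "0 \<le> s * (2 * (l * u x - (\<Sum>y\<in>S. u y * J y x))) + s\<^sup>2 * (l - J x x)" for s
    proof -
      have a: "(\<Sum>i\<in>S. (u i + s * ?e i)\<^sup>2) = 1 + 2 * s * u x + s\<^sup>2"
      proof -
        have "(\<Sum>i\<in>S. (u i + s * ?e i)\<^sup>2) = (\<Sum>i\<in>S. (u i)\<^sup>2 + (if i = x then 2 * s * u x + s\<^sup>2 else 0))"
          by (intro sum.cong refl) (auto simp: power2_sum)
        then show ?thesis using u(1) x assms(1) by (simp add: sum.distrib)
      qed
      have r: "(\<Sum>j\<in>S. J x j * u j) = (\<Sum>y\<in>S. u y * J y x)"
        using sym x by (intro sum.cong refl) (simp add: mult.commute)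
      have b: "(\<Sum>i\<in>S. \<Sum>j\<in>S. (u i + s * ?e i) * J i j * (u j + s * ?e j))
         = l + 2 * s * (\<Sum>y\<in>S. u y * J y x) + s\<^sup>2 * J x x"
      proof -
        have "(\<Sum>i\<in>S. \<Sum>j\<in>S. (u i + s * ?e i) * J i j * (u j + s * ?e j))
          = (\<Sum>i\<in>S. \<Sum>j\<in>S. u i * J i j * u j) + (\<Sum>i\<in>S. \<Sum>j\<in>S. if j = x then s * (u i * J i x) else 0)
            + (\<Sum>i\<in>S. \<Sum>j\<in>S. if i = x then s * (J x j * u j) else 0)
            + (\<Sum>i\<in>S. \<Sum>j\<in>S. if i = x then if j = x then s\<^sup>2 * J x x else 0 else 0)"
          unfolding sum.distrib[symmetric]
          by (intro sum.cong refl) (auto simp: algebra_simps power2_eq_square)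
        also have "(\<Sum>i\<in>S. \<Sum>j\<in>S. if j = x then s * (u i * J i x) else 0) = s * (\<Sum>y\<in>S. u y * J y x)"
          using x assms(1) by (simp add: sum_distrib_left)
        also have "(\<Sum>i\<in>S. \<Sum>j\<in>S. if i = x then s * (J x j * u j) else 0) = s * (\<Sum>j\<in>S. J x j * u j)"
          using x assms(1) by (subst sum.swap) (simp add: sum_distrib_left)
        also have "(\<Sum>i\<in>S. \<Sum>j\<in>S. if i = x then if j = x then s\<^sup>2 * J x x else 0 else 0) = s\<^sup>2 * J x x"
          using x assms(1) by (subst sum.swap) simp
        finally show ?thesis using u(2) r by simp
      qed
      show ?thesis using le[of "\<lambda>i. u i + s * ?e i"] unfolding a b by (simp add: algebra_simps)
    qed
    then have "2 * (l * u x - (\<Sum>y\<in>S. u y * J y x)) = 0" by (rule linear_term_zero)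
    then show ?thesis by simp
  qed
  then show ?thesis using u(1) by blast
qed

text \<open>The induction step deflates an eigenvector \<open>u\<close> with the Householder reflection that maps
  it to the coordinate vector of the new index.\<close>

lemma spectral_decomposition:
  fixes J :: "'i \<Rightarrow> 'i \<Rightarrow> real"
  assumes "finite S" "\<And>x y. x \<in> S \<Longrightarrow> y \<in> S \<Longrightarrow> J x y = J y x"
  shows "\<exists>u l. (\<forall>x\<in>S. \<forall>y\<in>S. (\<Sum>r\<in>S. u r x * u r y) = (if x = y then 1 else 0)) \<and>
    (\<forall>r\<in>S. (\<Sum>x\<in>S. (u r x)\<^sup>2) = (1::real)) \<and>
    (\<forall>r\<in>S. \<forall>x\<in>S. (\<Sum>y\<in>S. u r y * J y x) = l r * u r x)"
  using assms
proof (induction S arbitrary: J)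
  case (insert a I)
  let ?S = "insert a I"
  have fS: "finite ?S" using insert.hyps by simp
  obtain u l where u1: "(\<Sum>i\<in>?S. (u i)\<^sup>2) = 1" and uJ: "\<And>x. x \<in> ?S \<Longrightarrow> (\<Sum>y\<in>?S. u y * J y x) = l * u x"
    using exists_eigenvector[of ?S a J] insert.hyps insert.prems by blast
  \<comment> \<open>\<open>H\<close> is the reflection along \<open>u - e_a\<close>, which exchanges
    \<open>u\<close> and the coordinate vector \<open>e_a\<close>. If these already agree then
    \<open>c = 0\<close> and \<open>H\<close> is the identity.\<close>
  define v where "v x = u x - (if x = a then 1 else 0)" for x
  define nv where "nv = (\<Sum>x\<in>?S. (v x)\<^sup>2)"
  define c where "c = (if nv = 0 then 0 else 2 / nv)"
  define H where "H x y = (if x = y then 1 else 0) - c * v x * v y" for x y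
  have Hs: "H x y = H y x" for x y by (simp add: H_def mult_ac)
  have d1: "(\<Sum>s\<in>?S. (if x = s then 1 else 0) * f s) = f x" if "x \<in> ?S" for x and f :: "'i \<Rightarrow> real"
    using fS that by (simp add: if_distrib[of "\<lambda>x. x * _"] sum.delta' cong: if_cong del: sum.insert)
  have HH: "(\<Sum>s\<in>?S. H x s * H s y) = (if x = y then 1 else 0)" if "x \<in> ?S" "y \<in> ?S" for x y
  proof -
    have "(\<Sum>s\<in>?S. H x s * H s y) = (\<Sum>s\<in>?S. (if x = s then 1 else 0) * H s y)
       - c * v x * (\<Sum>s\<in>?S. (if y = s then 1 else 0) * v s) + c * v x * c * v y * (\<Sum>s\<in>?S. (v s)\<^sup>2)"
      unfolding sum_distrib_left sum_subtractf[symmetric] sum.distrib[symmetric]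
      by (intro sum.cong refl) (auto simp: H_def algebra_simps power2_eq_square)
    also have "\<dots> = H x y - c * v x * v y + c * v x * c * v y * nv"
      unfolding d1[OF that(1)] d1[OF that(2)] nv_def ..
    also have "\<dots> = (if x = y then 1 else 0)" by (auto simp: H_def c_def)
    finally show ?thesis .
  qed
  have nv: "nv = 2 - 2 * u a"
  proof -
    have "nv = (\<Sum>x\<in>?S. (u x)\<^sup>2 + (if a = x then 1 else 0) * (1 - 2 * u x))"
      unfolding nv_def by (intro sum.cong refl) (auto simp: v_def power2_diff)
    also have "\<dots> = 1 + (1 - 2 * u a)" unfolding sum.distrib u1 by (subst d1) auto
    finally show ?thesis by simp
  qed
  have Ha: "H x a = u x" if x: "x \<in> ?S" for x
  proof (cases "nv = 0")
    case True
    then have "v x = 0" using x fS by (auto simp: nv_def sum_nonneg_eq_0_iff simp del: sum.insert)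
    then show ?thesis using True by (simp add: H_def c_def v_def)
  next
    case False
    have "c * v a = -1" using False nv by (simp add: c_def v_def field_simps)
    then have "c * v x * v a = - v x" by (metis mult.assoc mult.commute mult_minus1)
    then show ?thesis by (simp add: H_def v_def)
  qed
  \<comment> \<open>After conjugation \<open>e_a\<close> is an eigenvector, so row and column
    \<open>a\<close> vanish off the diagonal and the induction hypothesis applies to the block on
    \<open>I\<close>.\<close>
  define J' where "J' x y = (\<Sum>s\<in>?S. \<Sum>t\<in>?S. H x s * J s t * H t y)" for x y
  have J's: "J' x y = J' y x" if "x \<in> I" "y \<in> I" for x y
  proof -
    have "J' x y = (\<Sum>t\<in>?S. \<Sum>s\<in>?S. H x s * J s t * H t y)" unfolding J'_def by (rule sum.swap)
    also have "\<dots> = J' y x" unfolding J'_def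
      by (intro sum.cong refl) (simp add: Hs insert.prems mult_ac del: sum.insert)
    finally show ?thesis .
  qed
  have "\<exists>u' l'. (\<forall>x\<in>I. \<forall>y\<in>I. (\<Sum>r\<in>I. u' r x * u' r y) = (if x = y then 1 else 0)) \<and>
    (\<forall>r\<in>I. (\<Sum>x\<in>I. (u' r x)\<^sup>2) = (1::real)) \<and>
    (\<forall>r\<in>I. \<forall>x\<in>I. (\<Sum>y\<in>I. u' r y * J' y x) = l' r * u' r x)"
    by (rule insert.IH) (rule J's)
  then obtain u' l' where IH: "\<forall>x\<in>I. \<forall>y\<in>I. (\<Sum>r\<in>I. u' r x * u' r y) = (if x = y then 1 else 0)"
    "\<forall>r\<in>I. (\<Sum>x\<in>I. (u' r x)\<^sup>2) = (1::real)"
    "\<forall>r\<in>I. \<forall>x\<in>I. (\<Sum>y\<in>I. u' r y * J' y x) = l' r * u' r x"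
    by (elim exE conjE)
  note c' = IH(1)[rule_format] and n' = IH(2)[rule_format] and e' = IH(3)[rule_format]
  \<comment> \<open>The reflection carries the eigenvectors of the smaller block back.\<close>
  define U where "U r x = (if r = a then u x else \<Sum>y\<in>I. H x y * u' r y)" for r x
  have Ur: "U r x = (\<Sum>y\<in>I. H x y * u' r y)" if "r \<in> I" for r x
    using that insert.hyps by (auto simp: U_def)
  define L where "L r = (if r = a then l else l' r)" for r
  have "(\<Sum>r\<in>?S. U r x * U r z) = (if x = z then 1 else 0)" if xz: "x \<in> ?S" "z \<in> ?S" for x z
  proof -
    have "(\<Sum>r\<in>I. U r x * U r z) = (\<Sum>r\<in>I. \<Sum>y\<in>I. \<Sum>y'\<in>I. H x y * H z y' * (u' r y * u' r y'))"
      by (intro sum.cong refl) (simp add: Ur sum_product mult_ac)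
    also have "\<dots> = (\<Sum>y\<in>I. \<Sum>r\<in>I. \<Sum>y'\<in>I. H x y * H z y' * (u' r y * u' r y'))"
      by (rule sum.swap)
    also have "\<dots> = (\<Sum>y\<in>I. \<Sum>y'\<in>I. H x y * H z y' * (\<Sum>r\<in>I. u' r y * u' r y'))"
      by (rule sum.cong[OF refl], subst sum.swap) (simp add: sum_distrib_left)
    also have "\<dots> = (\<Sum>y\<in>I. \<Sum>y'\<in>I. H x y * H z y' * (if y = y' then 1 else 0))"
      by (intro sum.cong refl) (simp add: c')
    also have "\<dots> = (\<Sum>y\<in>I. H x y * H y z)"
      using insert.hyps by (intro sum.cong refl)
        (simp add: if_distrib[of "\<lambda>x. _ * x"] sum.delta' Hs cong: if_cong)
    finally have "(\<Sum>r\<in>?S. U r x * U r z) = u x * u z + (\<Sum>y\<in>I. H x y * H y z)"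
      using insert.hyps by (simp add: U_def)
    also have "\<dots> = (\<Sum>y\<in>?S. H x y * H y z)"
      using insert.hyps Ha[OF xz(1)] Ha[OF xz(2)] Hs[of a z] by simp
    finally show ?thesis using HH xz by simp
  qed
  moreover have "(\<Sum>x\<in>?S. (U r x)\<^sup>2) = 1" if r: "r \<in> ?S" for r
  proof (cases "r = a")
    case True then show ?thesis using u1 by (simp add: U_def del: sum.insert)
  next
    case False
    then have rI: "r \<in> I" using r by simp
    have "(\<Sum>x\<in>?S. (U r x)\<^sup>2) = (\<Sum>x\<in>?S. \<Sum>y\<in>I. \<Sum>y'\<in>I. H y x * H x y' * (u' r y * u' r y'))"
      by (intro sum.cong refl) (simp add: Ur[OF rI] power2_eq_square sum_product Hs mult_ac)
    also have "\<dots> = (\<Sum>y\<in>I. \<Sum>x\<in>?S. \<Sum>y'\<in>I. H y x * H x y' * (u' r y * u' r y'))"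
      by (rule sum.swap)
    also have "\<dots> = (\<Sum>y\<in>I. \<Sum>y'\<in>I. (\<Sum>x\<in>?S. H y x * H x y') * (u' r y * u' r y'))"
      by (rule sum.cong[OF refl], subst sum.swap) (simp add: sum_distrib_right del: sum.insert)
    also have "\<dots> = (\<Sum>y\<in>I. \<Sum>y'\<in>I. (if y = y' then 1 else 0) * (u' r y * u' r y'))"
      by (intro sum.cong refl) (simp add: HH del: sum.insert)
    also have "\<dots> = (\<Sum>y\<in>I. (u' r y)\<^sup>2)"
      using insert.hyps by (intro sum.cong refl)
        (simp add: if_distrib[of "\<lambda>x. x * _"] sum.delta' power2_eq_square cong: if_cong)
    finally show ?thesis using n'[OF rI] by simp
  qed
  moreover have "(\<Sum>y\<in>?S. U r y * J y x) = L r * U r x" if r: "r \<in> ?S" and x: "x \<in> ?S" for r x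
  proof (cases "r = a")
    case True then show ?thesis using uJ[OF x] by (simp add: U_def L_def del: sum.insert)
  next
    case False
    then have rI: "r \<in> I" using r by simp
    have J'a: "J' y a = 0" if y: "y \<in> I" for y
    proof -
      have "J' y a = (\<Sum>s\<in>?S. H y s * (\<Sum>t\<in>?S. u t * J t s))"
        unfolding J'_def sum_distrib_left
        by (intro sum.cong refl) (simp add: Ha insert.prems mult_ac del: sum.insert)
      also have "\<dots> = (\<Sum>s\<in>?S. l * (H y s * H s a))"
        by (rule sum.cong[OF refl]) (simp only: uJ Ha mult_ac)
      also have "\<dots> = l * (\<Sum>s\<in>?S. H y s * H s a)"
        by (simp add: sum_distrib_left del: sum.insert)
      also have "\<dots> = 0" using HH[of y a] y insert.hyps by auto
      finally show ?thesis .
    qed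
    have HJ: "(\<Sum>s\<in>?S. H y s * J s x) = (\<Sum>z\<in>?S. J' y z * H z x)" if "y \<in> ?S" for y
    proof -
      have "(\<Sum>z\<in>?S. J' y z * H z x) = (\<Sum>z\<in>?S. \<Sum>s\<in>?S. \<Sum>t\<in>?S. H y s * J s t * (H t z * H z x))"
        by (simp only: J'_def sum_distrib_right mult.assoc)
      also have "\<dots> = (\<Sum>s\<in>?S. \<Sum>z\<in>?S. \<Sum>t\<in>?S. H y s * J s t * (H t z * H z x))" by (rule sum.swap)
      also have "\<dots> = (\<Sum>s\<in>?S. \<Sum>t\<in>?S. H y s * J s t * (\<Sum>z\<in>?S. H t z * H z x))"
        by (rule sum.cong[OF refl], subst sum.swap) (simp add: sum_distrib_left del: sum.insert)
      also have "\<dots> = (\<Sum>s\<in>?S. \<Sum>t\<in>?S. (if x = t then 1 else 0) * (H y s * J s t))"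
        by (rule sum.cong[OF refl], rule sum.cong[OF refl]) (auto simp: HH[OF _ x] simp del: sum.insert)
      also have "\<dots> = (\<Sum>s\<in>?S. H y s * J s x)" by (rule sum.cong[OF refl]) (rule d1[OF x])
      finally show ?thesis ..
    qed
    have "(\<Sum>y\<in>?S. U r y * J y x) = (\<Sum>s\<in>?S. \<Sum>y\<in>I. u' r y * (H y s * J s x))"
      by (intro sum.cong refl) (simp add: Ur[OF rI] sum_distrib_left sum_distrib_right Hs mult_ac del: sum.insert)
    also have "\<dots> = (\<Sum>y\<in>I. u' r y * (\<Sum>s\<in>?S. H y s * J s x))"
      by (subst sum.swap) (simp add: sum_distrib_left del: sum.insert)
    also have "\<dots> = (\<Sum>y\<in>I. u' r y * (\<Sum>z\<in>I. J' y z * H z x))"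
      using insert.hyps J'a by (intro sum.cong refl) (simp add: HJ[OF insertI2] del: sum.insert, simp)
    also have "\<dots> = (\<Sum>z\<in>I. (\<Sum>y\<in>I. u' r y * J' y z) * H z x)"
      unfolding sum_distrib_left sum_distrib_right by (subst sum.swap) (simp add: mult.assoc)
    also have "\<dots> = l' r * U r x"
      unfolding Ur[OF rI] sum_distrib_left
      by (rule sum.cong[OF refl]) (use e'[OF rI] in \<open>simp add: Hs[of _ x]\<close>)
    finally show ?thesis using False by (simp add: L_def)
  qed
  ultimately show ?case by (intro exI[of _ U] exI[of _ L]) (simp del: sum.insert)
qed simp

section \<open>Corner moments of contractions\<close>

definition discrete_measure :: "'i set \<Rightarrow> ('i \<Rightarrow> real) \<Rightarrow> ('i \<Rightarrow> real) \<Rightarrow> real measure" where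
  "discrete_measure I x f = distr (density (count_space I) (\<lambda>r. ennreal (f r))) borel x"

lemma emeasure_discrete_measure:
  assumes "finite I" "\<And>r. r \<in> I \<Longrightarrow> f r \<ge> 0" "B \<in> sets borel"
  shows "emeasure (discrete_measure I x f) B = ennreal (\<Sum>r\<in>{r\<in>I. x r \<in> B}. f r)"
proof -
  have "emeasure (discrete_measure I x f) B = emeasure (density (count_space I) (\<lambda>r. ennreal (f r))) {r\<in>I. x r \<in> B}"
    unfolding discrete_measure_def using assms(3)
    by (subst emeasure_distr) (auto simp: vimage_def Int_def conj_commute)
  also have "\<dots> = (\<Sum>r\<in>I. ennreal (f r) * indicator {r\<in>I. x r \<in> B} r)"
    using assms(1) by (subst emeasure_density) (auto simp: nn_integral_count_space_finite)
  also have "\<dots> = (\<Sum>r\<in>{r\<in>I. x r \<in> B}. ennreal (f r))"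
    using assms(1) by (intro sum.mono_neutral_cong_right) (auto simp: indicator_def)
  also have "\<dots> = ennreal (\<Sum>r\<in>{r\<in>I. x r \<in> B}. f r)"
    using assms(2) by (intro sum_ennreal) auto
  finally show ?thesis .
qed

lemma measure_discrete_measure:
  assumes "finite I" "\<And>r. r \<in> I \<Longrightarrow> f r \<ge> 0" "B \<in> sets borel"
  shows "measure (discrete_measure I x f) B = (\<Sum>r\<in>{r\<in>I. x r \<in> B}. f r)"
  unfolding measure_def using assms
  by (subst emeasure_discrete_measure) (auto intro!: enn2real_ennreal sum_nonneg)

lemma finite_measure_discrete_measure:
  assumes "finite I" "\<And>r. r \<in> I \<Longrightarrow> f r \<ge> 0"
  shows "finite_measure (discrete_measure I x f)"
proof (rule finite_measureI)
  have "space (discrete_measure I x f) = UNIV" by (simp add: discrete_measure_def)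
  then show "emeasure (discrete_measure I x f) (space (discrete_measure I x f)) \<noteq> \<infinity>"
    using assms by (simp add: emeasure_discrete_measure)
qed

lemma integral_discrete_measure:
  assumes "finite I" "\<And>r. r \<in> I \<Longrightarrow> f r \<ge> 0" "g \<in> borel_measurable borel"
  shows "(\<integral>y. g y \<partial>discrete_measure I x f) = (\<Sum>r\<in>I. f r * (g (x r) :: real))"
proof -
  have "(\<integral>y. g y \<partial>discrete_measure I x f) = (\<integral>r. g (x r) \<partial>density (count_space I) (\<lambda>r. ennreal (f r)))"
    unfolding discrete_measure_def by (rule integral_distr) (use assms(3) in auto)
  also have "\<dots> = (\<integral>r. f r *\<^sub>R g (x r) \<partial>count_space I)"
    using assms(2) by (subst integral_density) (auto simp: AE_count_space)
  also have "\<dots> = (\<Sum>r\<in>I. f r * g (x r))"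
    using assms(1) by (subst lebesgue_integral_count_space_finite) auto
  finally show ?thesis .
qed

text \<open>The measure has atoms \<open>x r\<close> with the rank-one weights
  \<open>w_r w_r^T\<close>. Entries of the weights have both signs; their positive and negative
  parts give the two measures of the representation.\<close>

lemma discrete_moments_in_moment_space:
  fixes x :: "'i \<Rightarrow> real" and w :: "'i \<Rightarrow> nat \<Rightarrow> real"
  assumes I: "finite I" and x: "\<And>r. r \<in> I \<Longrightarrow> x r \<in> {0..1}"
    and w: "\<And>i j. i < p \<Longrightarrow> j < p \<Longrightarrow> (\<Sum>r\<in>I. w r i * w r j) = (if i = j then 1 else 0)"
  shows "restrict (\<lambda>(l, i, j). \<Sum>r\<in>I. x r ^ l * (w r i * w r j)) (coords p n) \<in> moment_space p n"
proof -
  define P where "P i j = discrete_measure I x (\<lambda>r. max 0 (w r i * w r j))" for i j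
  define N where "N i j = discrete_measure I x (\<lambda>r. max 0 (- (w r i * w r j)))" for i j
  have mx: "max 0 a - max 0 (- a) = a" for a :: real by (simp add: max_def)
  have val: "mm_value P N B i j = (\<Sum>r\<in>{r\<in>I. x r \<in> B}. w r i * w r j)" if "B \<in> sets borel" for B i j
    unfolding mm_value_def P_def N_def
    by (simp add: measure_discrete_measure I that sum_subtractf[symmetric] mx)
  have mom: "mm_moment P N l i j = (\<Sum>r\<in>I. x r ^ l * (w r i * w r j))" for l i j
  proof -
    have "mm_moment P N l i j = (\<Sum>r\<in>I. (max 0 (w r i * w r j) - max 0 (- (w r i * w r j))) * x r ^ l)"
      unfolding mm_moment_def P_def N_def
      by (simp add: integral_discrete_measure I sum_subtractf[symmetric] left_diff_distrib)
    then show ?thesis unfolding mx by (simp add: mult_ac)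
  qed
  have "psd p (mm_value P N B)" if B: "B \<in> sets borel" for B
    unfolding psd_def
  proof (intro conjI allI impI)
    show "mm_value P N B i j = mm_value P N B j i" for i j by (simp add: val B mult.commute)
    fix v :: "nat \<Rightarrow> real"
    have "(\<Sum>i<p. \<Sum>j<p. v i * mm_value P N B i j * v j)
       = (\<Sum>r\<in>{r\<in>I. x r \<in> B}. (\<Sum>i<p. v i * w r i) * (\<Sum>j<p. v j * w r j))"
      by (rule quad_factor) (simp add: val B)
    then show "0 \<le> (\<Sum>i<p. \<Sum>j<p. v i * mm_value P N B i j * v j)"
      by (simp add: sum_nonneg)
  qed
  moreover have "mm_value P N {0..1} i j = (if i = j then 1 else 0)" if "i < p" "j < p" for i j
  proof -
    have "{r \<in> I. x r \<in> {0..1}} = I" using x by auto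
    then show ?thesis by (simp add: val w that)
  qed
  moreover have "emeasure (P i j) (- {0..1}) = 0" "emeasure (N i j) (- {0..1}) = 0" for i j
  proof -
    have e: "{r \<in> I. x r \<in> - {0..1}} = {}" using x by auto
    have "emeasure (discrete_measure I x f) (- {0..1}) = 0" if "\<And>r. r \<in> I \<Longrightarrow> f r \<ge> 0" for f
      using emeasure_discrete_measure[of I f "- {0..1}" x] I that unfolding e by simp
    then show "emeasure (P i j) (- {0..1}) = 0" "emeasure (N i j) (- {0..1}) = 0"
      unfolding P_def N_def by simp_all
  qed
  ultimately have "matrix_measure p P N"
    unfolding matrix_measure_def
    by (auto simp: P_def N_def finite_measure_discrete_measure I) (auto simp: discrete_measure_def)
  then show ?thesis unfolding moment_space_def mom[symmetric] by auto
qed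

text \<open>Row \<open>e\<close> of the power \<open>J^m\<close>.\<close>

fun krylov :: "'i set \<Rightarrow> ('i \<times> 'i \<Rightarrow> real) \<Rightarrow> 'i \<Rightarrow> nat \<Rightarrow> 'i \<Rightarrow> real" where
  "krylov I J e 0 x = (if x = e then 1 else 0)"
| "krylov I J e (Suc m) x = (\<Sum>y\<in>I. krylov I J e m y * J (y, x))"

text \<open>Symmetric matrices of operator norm at most 1. Entries off \<open>I \<times> I\<close>
  are fixed to 0 so that the set is compact among functions on all pairs.\<close>

definition contractions :: "'i set \<Rightarrow> ('i \<times> 'i \<Rightarrow> real) set" where
  "contractions I = {J. (\<forall>z. z \<notin> I \<times> I \<longrightarrow> J z = 0) \<and> (\<forall>x y. J (x, y) = J (y, x)) \<and>
     (\<forall>v. \<bar>\<Sum>x\<in>I. \<Sum>y\<in>I. v x * J (x, y) * v y\<bar> \<le> (\<Sum>x\<in>I. (v x)\<^sup>2))}"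

abbreviation block_index :: "nat \<Rightarrow> nat \<Rightarrow> (nat \<times> nat) set" where
  "block_index p n \<equiv> {..n} \<times> {..<p}"

lemma sum_block_index: "(\<Sum>x\<in>block_index p n. f x) = (\<Sum>h\<le>n. \<Sum>j<p. f (h, j))"
  by (simp add: sum.cartesian_product)

text \<open>Even powers are taken because the squares of the eigenvalues lie in
  \<open>[0, 1]\<close>: these are the moments of the spectral measure of the squared matrix at
  level 0.\<close>

definition corner_moments :: "nat \<Rightarrow> nat \<Rightarrow> ((nat \<times> nat) \<times> (nat \<times> nat) \<Rightarrow> real) \<Rightarrow> nat \<times> nat \<times> nat \<Rightarrow> real" where
  "corner_moments p n J = restrict (\<lambda>(l, i, j). krylov (block_index p n) J (0, i) (2 * l) (0, j)) (coords p n)"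

text \<open>The spectral theorem writes each corner as a sum over eigenvectors: atoms at the squared
  eigenvalues, weighted by the level-0 components of the eigenvectors.\<close>

lemma corner_moments_in_moment_space:
  assumes J: "J \<in> contractions (block_index p n)"
  shows "corner_moments p n J \<in> moment_space p n"
proof -
  define I where "I = block_index p n"
  have fin: "finite I" by (simp add: I_def)
  have I0: "(0, i) \<in> I" if "i < p" for i using that by (simp add: I_def)
  have sym: "J (x, y) = J (y, x)" for x y using J unfolding contractions_def by blast
  have "\<exists>u l. (\<forall>x\<in>I. \<forall>y\<in>I. (\<Sum>r\<in>I. u r x * u r y) = (if x = y then 1 else 0)) \<and>
    (\<forall>r\<in>I. (\<Sum>x\<in>I. (u r x)\<^sup>2) = (1::real)) \<and>
    (\<forall>r\<in>I. \<forall>x\<in>I. (\<Sum>y\<in>I. u r y * J (y, x)) = l r * u r x)"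
    by (rule spectral_decomposition[OF fin]) (rule sym)
  then obtain u l where U: "\<forall>x\<in>I. \<forall>y\<in>I. (\<Sum>r\<in>I. u r x * u r y) = (if x = y then 1 else 0)"
    "\<forall>r\<in>I. (\<Sum>x\<in>I. (u r x)\<^sup>2) = (1::real)"
    "\<forall>r\<in>I. \<forall>x\<in>I. (\<Sum>y\<in>I. u r y * J (y, x)) = l r * u r x"
    by (elim exE conjE)
  have kr: "krylov I J e m x = (\<Sum>r\<in>I. l r ^ m * (u r e * u r x))" if "e \<in> I" "x \<in> I" for e m x
    using that
  proof (induction m arbitrary: x)
    case 0
    then have "(\<Sum>r\<in>I. u r e * u r x) = (if e = x then 1 else 0)" using U(1) by blast
    then show ?case by (cases "x = e") simp_all
  next
    case (Suc m)
    have "krylov I J e (Suc m) x = (\<Sum>y\<in>I. \<Sum>r\<in>I. l r ^ m * u r e * (u r y * J (y, x)))"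
      using Suc by (simp add: sum_distrib_left sum_distrib_right mult_ac)
    also have "\<dots> = (\<Sum>r\<in>I. l r ^ m * u r e * (\<Sum>y\<in>I. u r y * J (y, x)))"
      by (subst sum.swap) (simp add: sum_distrib_left)
    also have "\<dots> = (\<Sum>r\<in>I. l r ^ Suc m * (u r e * u r x))"
      using U(3) Suc.prems by (intro sum.cong refl) simp
    finally show ?case .
  qed
  have l1: "(l r)\<^sup>2 \<in> {0..1}" if r: "r \<in> I" for r
  proof -
    have "(\<Sum>x\<in>I. \<Sum>y\<in>I. u r x * J (x, y) * u r y) = (\<Sum>y\<in>I. (\<Sum>x\<in>I. u r x * J (x, y)) * u r y)"
      by (subst sum.swap) (simp add: sum_distrib_right)
    also have "\<dots> = (\<Sum>y\<in>I. l r * (u r y)\<^sup>2)"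
      using U(3) r by (intro sum.cong refl) (simp add: power2_eq_square)
    also have "\<dots> = l r" using U(2) r by (simp add: sum_distrib_left[symmetric])
    finally have e: "(\<Sum>x\<in>I. \<Sum>y\<in>I. u r x * J (x, y) * u r y) = l r" .
    have "\<bar>\<Sum>x\<in>I. \<Sum>y\<in>I. u r x * J (x, y) * u r y\<bar> \<le> (\<Sum>x\<in>I. (u r x)\<^sup>2)"
      using J unfolding contractions_def I_def[symmetric] by blast
    then have "\<bar>l r\<bar> \<le> (\<Sum>x\<in>I. (u r x)\<^sup>2)" unfolding e .
    then show ?thesis using U(2) r by (simp add: abs_square_le_1)
  qed
  have "corner_moments p n J = restrict (\<lambda>(l', i, j). \<Sum>r\<in>I. ((l r)\<^sup>2) ^ l' * (u r (0, i) * u r (0, j))) (coords p n)"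
    unfolding corner_moments_def I_def[symmetric]
    by (intro restrict_ext) (auto simp: coords_def kr power_mult I0)
  also have "\<dots> \<in> moment_space p n"
    by (rule discrete_moments_in_moment_space[OF fin l1]) (use U(1) I0 in auto)
  finally show ?thesis .
qed

text \<open>Polarization with the test vectors \<open>e_x + e_y\<close> and
  \<open>e_x - e_y\<close>; a crude bound is enough for compactness.\<close>

lemma contractions_bounded:
  assumes J: "J \<in> contractions I" and "finite I"
  shows "J z \<in> {-2..2}"
proof (cases "z \<in> I \<times> I")
  case False
  then have "J z = 0" using J unfolding contractions_def by blast
  then show ?thesis by simp
next
  case True
  then obtain x y where z: "z = (x, y)" "x \<in> I" "y \<in> I" by auto
  have q: "\<bar>\<Sum>x\<in>I. \<Sum>y\<in>I. v x * J (x, y) * v y\<bar> \<le> (\<Sum>x\<in>I. (v x)\<^sup>2)" for v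
    using J by (simp add: contractions_def)
  have sym: "J (y, x) = J (x, y)" using J by (simp add: contractions_def)
  have ex: "(\<Sum>a\<in>I. \<Sum>b\<in>I. ((if a = x then 1 else 0) + s * (if a = y then 1 else 0)) * J (a, b) *
      ((if b = x then 1 else 0) + s * (if b = y then 1 else 0))) = J (x, x) + 2 * s * J (x, y) + s\<^sup>2 * J (y, y)" for s :: real
  proof -
    have "(\<Sum>a\<in>I. \<Sum>b\<in>I. ((if a = x then 1 else 0) + s * (if a = y then 1 else 0)) * J (a, b) *
      ((if b = x then 1 else 0) + s * (if b = y then 1 else 0)))
      = (\<Sum>a\<in>I. if a = x then \<Sum>b\<in>I. if b = x then J (x, x) else 0 else 0)
      + (\<Sum>a\<in>I. if a = x then \<Sum>b\<in>I. if b = y then s * J (x, y) else 0 else 0)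
      + (\<Sum>a\<in>I. if a = y then \<Sum>b\<in>I. if b = x then s * J (x, y) else 0 else 0)
      + (\<Sum>a\<in>I. if a = y then \<Sum>b\<in>I. if b = y then s\<^sup>2 * J (y, y) else 0 else 0)"
      unfolding sum.distrib[symmetric]
    proof (intro sum.cong refl)
      fix a assume "a \<in> I"
      show "(\<Sum>b\<in>I. ((if a = x then 1 else 0) + s * (if a = y then 1 else 0)) * J (a, b) *
      ((if b = x then 1 else 0) + s * (if b = y then 1 else 0)))
       = (if a = x then \<Sum>b\<in>I. if b = x then J (x, x) else 0 else 0)
      + (if a = x then \<Sum>b\<in>I. if b = y then s * J (x, y) else 0 else 0)
      + (if a = y then \<Sum>b\<in>I. if b = x then s * J (x, y) else 0 else 0)
      + (if a = y then \<Sum>b\<in>I. if b = y then s\<^sup>2 * J (y, y) else 0 else 0)"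
        using z assms(2) sym
        by (cases "a = x"; cases "a = y")
          (simp_all add: distrib_left if_distrib[of "\<lambda>x. _ * x"] sum.distrib algebra_simps power2_eq_square cong: if_cong)
    qed
    then show ?thesis using z assms(2) by simp
  qed
  \<comment> \<open>Twice the squared norm expected of orthogonal vectors, so that
    \<open>x = y\<close> is covered.\<close>
  have nn: "(\<Sum>a\<in>I. ((if a = x then 1 else 0) + s * (if a = y then 1 else 0))\<^sup>2) \<le> 2 + 2 * s\<^sup>2" for s :: real
  proof -
    have "(\<Sum>a\<in>I. ((if a = x then 1 else 0) + s * (if a = y then 1 else 0))\<^sup>2)
      \<le> (\<Sum>a\<in>I. 2 * (if a = x then 1 else 0) + 2 * s\<^sup>2 * (if a = y then 1 else 0))"
      using sum_squares_bound[of 1 s] by (intro sum_mono) (auto simp: power2_sum)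
    also have "\<dots> = 2 + 2 * s\<^sup>2" using z assms(2) by (simp add: sum.distrib sum_distrib_left[symmetric])
    finally show ?thesis .
  qed
  have "\<bar>J (x, x) + 2 * J (x, y) + J (y, y)\<bar> \<le> 4" "\<bar>J (x, x) - 2 * J (x, y) + J (y, y)\<bar> \<le> 4"
    using q[of "\<lambda>a. (if a = x then 1 else 0) + 1 * (if a = y then 1 else 0)"] nn[of 1]
      q[of "\<lambda>a. (if a = x then 1 else 0) + (-1) * (if a = y then 1 else 0)"] nn[of "-1"]
    unfolding ex by auto
  then have "\<bar>J (x, y)\<bar> \<le> 2" by linarith
  then show ?thesis using z by (auto simp: abs_le_iff)
qed

lemma compact_contractions:
  assumes "finite I"
  shows "compact (contractions I)"
proof -
  have "contractions I = PiE UNIV (\<lambda>_. {-2..2}) \<inter> ((\<Inter>z\<in>-(I \<times> I). {J. J z = 0}) \<inter> (\<Inter>x. \<Inter>y. {J. J (x, y) = J (y, x)})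
     \<inter> (\<Inter>v. {J. \<bar>\<Sum>x\<in>I. \<Sum>y\<in>I. v x * J (x, y) * v y\<bar> \<le> (\<Sum>x\<in>I. (v x)\<^sup>2)}))" (is "?K = _ \<inter> ?C")
    using contractions_bounded[OF _ assms] by (auto simp: contractions_def)
  moreover have "closed ?C"
    by (intro closed_Int closed_INT ballI closed_Collect_eq closed_Collect_le continuous_on_rabs continuous_on_sum
        continuous_on_mult continuous_on_coordinate continuous_on_const)
  ultimately show ?thesis by (simp only: compact_Int_closed compact_PiE_UNIV compact_Icc)
qed

lemma continuous_krylov: "continuous_on S (\<lambda>J. krylov I J e m x)"
  by (induction m arbitrary: x) (auto intro!: continuous_on_sum continuous_on_mult continuous_on_coordinate)

text \<open>This is where compactness of the moment space will come from.\<close>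

lemma compact_corner_moments: "compact (corner_moments p n ` contractions (block_index p n))"
proof (rule compact_continuous_image[OF _ compact_contractions])
  show "continuous_on (contractions (block_index p n)) (corner_moments p n)"
  proof (rule continuous_on_coordinatewise_then_product)
    fix i
    show "continuous_on (contractions (block_index p n)) (\<lambda>J. corner_moments p n J i)"
      unfolding corner_moments_def
      by (cases "i \<in> coords p n"; cases i) (auto intro!: continuous_krylov)
  qed
qed simp

section \<open>Block Jacobi matrices as contractions\<close>

definition jacobi_matrix :: "nat \<Rightarrow> nat \<Rightarrow> (nat \<Rightarrow> nat \<Rightarrow> nat \<Rightarrow> real) \<Rightarrow> (nat \<times> nat) \<times> (nat \<times> nat) \<Rightarrow> real" where
  "jacobi_matrix p n B = (\<lambda>((h, j), (h', k)).
     if h \<le> n \<and> h' \<le> n \<and> j < p \<and> k < p then (if h' = Suc h then B h' j k else if h = Suc h' then B h k j else 0) else 0)"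

text \<open>A path of \<open>m\<close> steps that ends at level \<open>h\<close> never passes level
  \<open>n\<close>, so cutting the matrix off there changes nothing.\<close>

lemma krylov_jacobi_matrix:
  assumes "m + h \<le> 2 * n" "h \<le> n" "j < p" "i < p"
  shows "krylov (block_index p n) (jacobi_matrix p n B) (0, i) m (h, j) = path_weight p B m h i j"
  using assms
proof (induction m arbitrary: h j)
  case (Suc m)
  let ?J = "jacobi_matrix p n B"
  let ?z = "\<lambda>h k. krylov (block_index p n) ?J (0, i) m (h, k)"
  have "krylov (block_index p n) ?J (0, i) (Suc m) (h, j) = (\<Sum>h'\<le>n. \<Sum>k<p. ?z h' k * ?J ((h', k), (h, j)))"
    by (simp add: sum.cartesian_product)
  also have "\<dots> = (\<Sum>h'\<le>n. (if Suc h' = h then \<Sum>k<p. ?z h' k * B h k j else 0)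
      + (if h' = Suc h then \<Sum>k<p. ?z h' k * B (Suc h) j k else 0))"
    using Suc.prems by (intro sum.cong refl) (auto simp: jacobi_matrix_def)
  also have "\<dots> = (\<Sum>h'\<le>n. if Suc h' = h then \<Sum>k<p. ?z h' k * B h k j else 0)
      + (if Suc h \<le> n then \<Sum>k<p. ?z (Suc h) k * B (Suc h) j k else 0)"
    by (simp add: sum.distrib)
  also have "(\<Sum>h'\<le>n. if Suc h' = h then \<Sum>k<p. ?z h' k * B h k j else 0)
      = (if h = 0 then 0 else \<Sum>k<p. path_weight p B m (h - 1) i k * B h k j)"
  proof (cases h)
    case (Suc h0)
    have "(\<Sum>h'\<le>n. if Suc h' = h then \<Sum>k<p. ?z h' k * B h k j else 0)
      = (\<Sum>h'\<le>n. if h' = h0 then \<Sum>k<p. ?z h0 k * B h k j else 0)"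
      unfolding Suc by (intro sum.cong refl) auto
    also have "\<dots> = (\<Sum>k<p. ?z h0 k * B h k j)" using Suc Suc.prems by simp
    also have "\<dots> = (\<Sum>k<p. path_weight p B m h0 i k * B h k j)"
      using Suc Suc.prems by (intro sum.cong refl) (simp add: Suc.IH)
    finally show ?thesis using Suc by simp
  qed simp
  also have "(if Suc h \<le> n then \<Sum>k<p. ?z (Suc h) k * B (Suc h) j k else 0)
      = (\<Sum>k<p. path_weight p B m (Suc h) i k * B (Suc h) j k)"
  proof (cases "Suc h \<le> n")
    case True
    then show ?thesis using Suc.prems by (simp add: Suc.IH)
  next
    case False
    then have "m < Suc h" using Suc.prems by simp
    then show ?thesis using False by (simp add: path_weight_above)
  qed
  finally show ?case by simp
qed auto

text \<open>The quadratic form of the identity minus the Jacobi matrix, on the levels up to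
  \<open>m\<close>.\<close>

definition energy :: "nat \<Rightarrow> (nat \<Rightarrow> nat \<Rightarrow> nat \<Rightarrow> real) \<Rightarrow> nat \<Rightarrow> (nat \<Rightarrow> nat \<Rightarrow> real) \<Rightarrow> real" where
  "energy p B m v = (\<Sum>h\<le>m. \<Sum>j<p. (v h j)\<^sup>2) - 2 * (\<Sum>h<m. \<Sum>j<p. \<Sum>k<p. v h j * B (Suc h) j k * v (Suc h) k)"

lemma compl_quad:
  "(\<Sum>j<p. \<Sum>k<p. v j * complement_gram p W j k * v k) = (\<Sum>j<p. (v j)\<^sup>2) - (\<Sum>c<p. (\<Sum>k<p. W c k * v k)\<^sup>2)"
proof -
  have "(\<Sum>j<p. \<Sum>k<p. v j * complement_gram p W j k * v k)
     = (\<Sum>j<p. \<Sum>k<p. v j * (if j = k then 1 else 0) * v k) - (\<Sum>j<p. \<Sum>k<p. v j * (\<Sum>c<p. W c j * W c k) * v k)"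
    by (simp add: complement_gram_def right_diff_distrib left_diff_distrib sum_subtractf)
  also have "(\<Sum>j<p. \<Sum>k<p. v j * (\<Sum>c<p. W c j * W c k) * v k)
     = (\<Sum>c<p. (\<Sum>j<p. v j * W c j) * (\<Sum>k<p. v k * W c k))"
    by (rule quad_factor) simp
  also have "(\<Sum>j<p. \<Sum>k<p. v j * (if j = k then 1 else 0) * v k) = (\<Sum>j<p. (v j)\<^sup>2)"
    by (intro sum.cong refl) (simp add: if_distrib[of "\<lambda>x. _ * x"] if_distrib[of "\<lambda>x. x * _"] power2_eq_square cong: if_cong)
  finally show ?thesis by (simp add: power2_eq_square mult.commute)
qed

text \<open>Completion of the square in the coupling of levels \<open>m\<close> and
  \<open>m + 1\<close>, with the block written as \<open>C W\<close>: a square is taken from level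
  \<open>m\<close>, and \<open>1 - W^T W\<close> is left on level \<open>m + 1\<close>.\<close>

lemma energy_Suc:
  assumes B: "\<And>j k. j < p \<Longrightarrow> k < p \<Longrightarrow> B (Suc m) j k = (\<Sum>c<p. C j c * W c k)"
  shows "energy p B (Suc m) v = energy p B m v - (\<Sum>c<p. (\<Sum>j<p. v m j * C j c)\<^sup>2)
     + (\<Sum>c<p. ((\<Sum>j<p. v m j * C j c) - (\<Sum>k<p. W c k * v (Suc m) k))\<^sup>2)
     + (\<Sum>j<p. \<Sum>k<p. v (Suc m) j * complement_gram p W j k * v (Suc m) k)"
proof -
  define a where "a c = (\<Sum>j<p. v m j * C j c)" for c
  define b where "b c = (\<Sum>k<p. W c k * v (Suc m) k)" for c
  have x: "(\<Sum>j<p. \<Sum>k<p. v m j * B (Suc m) j k * v (Suc m) k) = (\<Sum>c<p. a c * b c)"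
  proof -
    have "(\<Sum>j<p. \<Sum>k<p. v m j * B (Suc m) j k * v (Suc m) k)
      = (\<Sum>c<p. (\<Sum>j<p. v m j * C j c) * (\<Sum>k<p. v (Suc m) k * W c k))"
      by (rule quad_factor) (use B in auto)
    then show ?thesis by (simp add: a_def b_def mult.commute)
  qed
  have s: "(\<Sum>c<p. (a c - b c)\<^sup>2) = (\<Sum>c<p. (a c)\<^sup>2) - 2 * (\<Sum>c<p. a c * b c) + (\<Sum>c<p. (b c)\<^sup>2)"
    by (simp add: power2_diff sum.distrib sum_subtractf sum_distrib_left mult_ac)
  show ?thesis
    unfolding compl_quad a_def[symmetric] b_def[symmetric] s
    by (simp add: energy_def x)
qed

text \<open>By \<open>1 - W^T W = C C^T\<close>, what is left on one level is exactly the square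
  that the coupling to the next level takes away.\<close>

lemma energy_lower_bound:
  assumes "\<And>h. 1 \<le> h \<Longrightarrow> h \<le> m \<Longrightarrow> admissible p t y h"
  shows "energy p (Bfac p t y) m v \<ge> (\<Sum>c<p. (\<Sum>j<p. v m j * Cfac p t y m j c)\<^sup>2)"
  using assms
proof (induction m)
  case 0
  show ?case by (simp add: energy_def Cfac_def if_distrib[of "\<lambda>x. _ * x"] cong: if_cong)
next
  case (Suc m)
  have IH: "(\<Sum>c<p. (\<Sum>j<p. v m j * Cfac p t y m j c)\<^sup>2) \<le> energy p (Bfac p t y) m v"
    by (rule Suc.IH) (use Suc.prems in auto)
  have g: "pd p (complement_gram p (Wfac t y (Suc m)))" using Suc.prems[of "Suc m"] by (simp add: admissible_def)
  let ?q = "\<Sum>j<p. \<Sum>k<p. v (Suc m) j * complement_gram p (Wfac t y (Suc m)) j k * v (Suc m) k"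
  let ?s = "\<Sum>c<p. ((\<Sum>j<p. v m j * Cfac p t y m j c) - (\<Sum>k<p. Wfac t y (Suc m) c k * v (Suc m) k))\<^sup>2"
  have "?q = (\<Sum>c<p. (\<Sum>j<p. v (Suc m) j * Cfac p t y (Suc m) j c) * (\<Sum>j<p. v (Suc m) j * Cfac p t y (Suc m) j c))"
    by (rule quad_factor) (simp add: Cfac_def chol_mult[OF g])
  then have "?q = (\<Sum>c<p. (\<Sum>j<p. v (Suc m) j * Cfac p t y (Suc m) j c)\<^sup>2)"
    by (simp only: power2_eq_square)
  moreover have "energy p (Bfac p t y) (Suc m) v
     = energy p (Bfac p t y) m v - (\<Sum>c<p. (\<Sum>j<p. v m j * Cfac p t y m j c)\<^sup>2) + ?s + ?q"
    by (rule energy_Suc) (simp add: Bfac_def)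
  moreover have "?s \<ge> 0" by (intro sum_nonneg) simp
  ultimately show ?case using IH by linarith
qed

lemma jacobi_matrix_quad:
  "(\<Sum>x\<in>block_index p n. \<Sum>z\<in>block_index p n. v x * jacobi_matrix p n B (x, z) * v z)
     = 2 * (\<Sum>h<n. \<Sum>j<p. \<Sum>k<p. v (h, j) * B (Suc h) j k * v (Suc h, k))"
proof -
  define E where "E h = (\<Sum>j<p. \<Sum>k<p. v (h, j) * B (Suc h) j k * v (Suc h, k))" for h
  have "(\<Sum>x\<in>block_index p n. \<Sum>z\<in>block_index p n. v x * jacobi_matrix p n B (x, z) * v z)
     = (\<Sum>h\<le>n. \<Sum>j<p. \<Sum>h'\<le>n. \<Sum>k<p. v (h, j) * jacobi_matrix p n B ((h, j), (h', k)) * v (h', k))"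
    by (simp only: sum_block_index)
  also have "\<dots> = (\<Sum>h\<le>n. \<Sum>h'\<le>n. \<Sum>j<p. \<Sum>k<p. v (h, j) * jacobi_matrix p n B ((h, j), (h', k)) * v (h', k))"
    by (intro sum.cong refl sum.swap)
  also have "\<dots> = (\<Sum>h\<le>n. \<Sum>h'\<le>n. (if h' = Suc h then E h else 0) + (if h = Suc h' then E h' else 0))"
  proof (intro sum.cong refl)
    fix h h' assume h: "h \<in> {..n}" "h' \<in> {..n}"
    consider "h' = Suc h" | "h = Suc h'" | "h' \<noteq> Suc h" "h \<noteq> Suc h'" by blast
    then show "(\<Sum>j<p. \<Sum>k<p. v (h, j) * jacobi_matrix p n B ((h, j), (h', k)) * v (h', k))
      = (if h' = Suc h then E h else 0) + (if h = Suc h' then E h' else 0)"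
    proof cases
      case 1
      then show ?thesis using h by (auto simp: E_def jacobi_matrix_def intro!: sum.cong)
    next
      case 2
      then have "(\<Sum>j<p. \<Sum>k<p. v (h, j) * jacobi_matrix p n B ((h, j), (h', k)) * v (h', k))
        = (\<Sum>j<p. \<Sum>k<p. v (h', k) * B (Suc h') k j * v (Suc h', j))"
        using h by (auto simp: jacobi_matrix_def intro!: sum.cong)
      also have "\<dots> = E h'" unfolding E_def by (rule sum.swap)
      finally show ?thesis using 2 by simp
    next
      case 3
      then show ?thesis by (auto simp: jacobi_matrix_def intro!: sum.neutral)
    qed
  qed
  also have "\<dots> = (\<Sum>h\<le>n. if Suc h \<le> n then E h else 0) + (\<Sum>h'\<le>n. if Suc h' \<le> n then E h' else 0)"
    unfolding sum.distrib by (subst (2) sum.swap) (simp add: sum.delta')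
  also have "(\<Sum>h\<le>n. if Suc h \<le> n then E h else 0) = (\<Sum>h<n. E h)"
    by (intro sum.mono_neutral_cong_right) auto
  finally show ?thesis by (simp add: E_def)
qed

lemma jacobi_matrix_contraction:
  assumes "\<And>h. 1 \<le> h \<Longrightarrow> h \<le> n \<Longrightarrow> admissible p t y h"
  shows "jacobi_matrix p n (Bfac p t y) \<in> contractions (block_index p n)"
proof -
  let ?B = "Bfac p t y"
  have e0: "energy p ?B n v \<ge> 0" for v
    using energy_lower_bound[of n p t y v] assms by (meson order_trans sum_nonneg zero_le_power2)
  have "\<bar>\<Sum>x\<in>block_index p n. \<Sum>z\<in>block_index p n. v x * jacobi_matrix p n ?B (x, z) * v z\<bar> \<le> (\<Sum>x\<in>block_index p n. (v x)\<^sup>2)" for v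
  proof -
    have sq1: "((-1 :: real) ^ h)\<^sup>2 = 1" for h
      by (simp add: power2_eq_square flip: power_mult_distrib)
    let ?Q = "\<Sum>h<n. \<Sum>j<p. \<Sum>k<p. v (h, j) * ?B (Suc h) j k * v (Suc h, k)"
    have n: "(\<Sum>x\<in>block_index p n. (v x)\<^sup>2) = (\<Sum>h\<le>n. \<Sum>j<p. (v (h, j))\<^sup>2)"
      by (simp add: sum.cartesian_product)
    have "2 * ?Q \<le> (\<Sum>h\<le>n. \<Sum>j<p. (v (h, j))\<^sup>2)"
      using e0[of "\<lambda>h j. v (h, j)"] by (simp add: energy_def)
    \<comment> \<open>Alternating the signs of the levels reverses the coupling, so the bound also
      holds for minus the matrix.\<close>
    moreover have "- (2 * ?Q) \<le> (\<Sum>h\<le>n. \<Sum>j<p. (v (h, j))\<^sup>2)"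
      using e0[of "\<lambda>h j. (-1) ^ h * v (h, j)"] sq1
      by (simp add: energy_def power_mult_distrib sum_negf mult_ac flip: power_add)
    ultimately show ?thesis unfolding jacobi_matrix_quad n by linarith
  qed
  then show ?thesis unfolding contractions_def by (auto simp: jacobi_matrix_def)
qed

lemma corner_moments_jacobi:
  "corner_moments p n (jacobi_matrix p n B) = restrict (\<lambda>(l, i, j). path_weight p B (2 * l) 0 i j) (coords p n)"
  unfolding corner_moments_def
  by (intro restrict_ext) (auto simp: coords_def krylov_jacobi_matrix)

section \<open>Orthonormal vector polynomials\<close>

lemma lowtri_div:
  assumes C: "lowtri p C" and K: "lowtri p K"
  shows "\<exists>W. lowtri p W \<and> (\<forall>j<p. \<forall>k<p. (\<Sum>c<p. C j c * W c k) = K j k)"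
proof -
  have "\<forall>k. \<exists>v. \<forall>i<p. (\<Sum>c<p. C i c * v c) = K i k"
    by (intro allI, rule lowtri_solve_right[OF C])
  then obtain V where V: "\<And>k i. i < p \<Longrightarrow> (\<Sum>c<p. C i c * V k c) = K i k" by metis
  have exp: "(\<Sum>c<p. C i c * V k c) = (\<Sum>c<i. C i c * V k c) + C i i * V k i" if "i < p" for i k
  proof -
    have "(\<Sum>c<p. C i c * V k c) = (\<Sum>c\<le>i. C i c * V k c)"
      using that lowtriD(2)[OF C] by (intro sum.mono_neutral_right) (auto simp: not_le)
    then show ?thesis by (simp add: lessThan_Suc_atMost[symmetric])
  qed
  have z: "V k j = 0" if "j < k" "k < p" for j k
    using that
  proof (induction j rule: less_induct)
    case (less j)
    then have "(\<Sum>c<j. C j c * V k c) = 0" by (intro sum.neutral) auto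
    then have "C j j * V k j = 0"
      using V[of j k] exp[of j k] less.prems lowtriD(2)[OF K, of j k] by simp
    then show ?case using lowtriD(1)[OF C, of j] less.prems by simp
  qed
  have d: "V k k > 0" if "k < p" for k
  proof -
    have "(\<Sum>c<k. C k c * V k c) = 0" using z that by (intro sum.neutral) auto
    then have "C k k * V k k = K k k" using V[of k k] exp[of k k] that by simp
    then show ?thesis using lowtriD(1)[OF C that] lowtriD(1)[OF K that] by (metis zero_less_mult_pos)
  qed
  show ?thesis
    by (intro exI[of _ "\<lambda>c k. V k c"]) (use z d V in \<open>auto simp: lowtri_def\<close>)
qed

lemma sum_delta_left: "(i::nat) < p \<Longrightarrow> (\<Sum>k<p. (if i = k then 1 else 0) * f k) = (f i :: real)"
  by (simp add: if_distrib[of "\<lambda>x. x * _"] cong: if_cong)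

lemma sum_delta_right: "(i::nat) < p \<Longrightarrow> (\<Sum>k<p. f k * (if k = i then 1 else 0)) = (f i :: real)"
  by (simp add: if_distrib[of "\<lambda>x. _ * x"] cong: if_cong)

lemma sum_assoc3:
  fixes f g h :: "nat \<Rightarrow> nat \<Rightarrow> real"
  shows "(\<Sum>k<p. (\<Sum>c<p. f i c * g c k) * h k j) = (\<Sum>c<p. f i c * (\<Sum>k<p. g c k * h k j))"
  unfolding sum_distrib_left sum_distrib_right by (subst sum.swap) (simp add: mult.assoc)

text \<open>A right inverse of the right inverse has to be \<open>K\<close>, which makes the inverse
  two-sided.\<close>

lemma lowtri_inverse:
  assumes K: "lowtri p K"
  shows "\<exists>E. lowtri p E \<and> (\<forall>j<p. \<forall>k<p. (\<Sum>c<p. K j c * E c k) = (if j = k then 1 else 0))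
     \<and> (\<forall>j<p. \<forall>k<p. (\<Sum>c<p. E j c * K c k) = (if j = k then 1 else 0))"
proof -
  have one: "lowtri p (\<lambda>j k. if j = k then 1 else 0)" by (auto simp: lowtri_def)
  obtain E where E: "lowtri p E" "\<And>j k. j < p \<Longrightarrow> k < p \<Longrightarrow> (\<Sum>c<p. K j c * E c k) = (if j = k then 1 else 0)"
    using lowtri_div[OF K one] by blast
  obtain F where F: "\<And>j k. j < p \<Longrightarrow> k < p \<Longrightarrow> (\<Sum>c<p. E j c * F c k) = (if j = k then 1 else 0)"
    using lowtri_div[OF E(1) one] by blast
  have KF: "K j k = F j k" if "j < p" "k < p" for j k
  proof -
    have "F j k = (\<Sum>c<p. (\<Sum>d<p. K j d * E d c) * F c k)"
      using that E(2) by (simp add: sum_delta_left)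
    also have "\<dots> = (\<Sum>d<p. K j d * (\<Sum>c<p. E d c * F c k))" by (rule sum_assoc3)
    also have "\<dots> = K j k" using that F by (simp add: sum_delta_right)
    finally show ?thesis ..
  qed
  have "(\<Sum>c<p. E j c * K c k) = (if j = k then 1 else 0)" if "j < p" "k < p" for j k
    using F[OF that] that by (simp add: KF)
  then show ?thesis using E by blast
qed

text \<open>All squares in \<open>energy_Suc\<close> can be made to vanish, level by level downward,
  because \<open>Cfac\<close> is invertible. So the form of \<open>1 - W^T W\<close> is itself a
  value of the energy, and positive energies make it positive definite.\<close>

lemma energy_optimal:
  assumes admissible: "\<And>h. 1 \<le> h \<Longrightarrow> h \<le> m \<Longrightarrow> admissible p t y h"
  shows "\<exists>u. (\<forall>j. u (Suc m) j = v j) \<and> energy p (Bfac p t y) (Suc m) u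
    = (\<Sum>j<p. \<Sum>k<p. v j * complement_gram p (Wfac t y (Suc m)) j k * v k)"
proof -
  have base: "\<exists>u. (\<forall>j. u m j = w j) \<and> energy p (Bfac p t y) m u = (\<Sum>c<p. (\<Sum>j<p. w j * Cfac p t y m j c)\<^sup>2)
     \<Longrightarrow> (\<forall>c<p. (\<Sum>j<p. w j * Cfac p t y m j c) = (\<Sum>k<p. Wfac t y (Suc m) c k * v k))
     \<Longrightarrow> \<exists>u. (\<forall>j. u (Suc m) j = v j) \<and> energy p (Bfac p t y) (Suc m) u
    = (\<Sum>j<p. \<Sum>k<p. v j * complement_gram p (Wfac t y (Suc m)) j k * v k)" for m v w
  proof -
    assume "\<exists>u. (\<forall>j. u m j = w j) \<and> energy p (Bfac p t y) m u = (\<Sum>c<p. (\<Sum>j<p. w j * Cfac p t y m j c)\<^sup>2)"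
      and w: "\<forall>c<p. (\<Sum>j<p. w j * Cfac p t y m j c) = (\<Sum>k<p. Wfac t y (Suc m) c k * v k)"
    then obtain u where u: "\<And>j. u m j = w j"
      "energy p (Bfac p t y) m u = (\<Sum>c<p. (\<Sum>j<p. w j * Cfac p t y m j c)\<^sup>2)" by blast
    let ?u = "u(Suc m := v)"
    have "energy p (Bfac p t y) m ?u = energy p (Bfac p t y) m u" by (simp add: energy_def)
    then have "energy p (Bfac p t y) (Suc m) ?u = (\<Sum>j<p. \<Sum>k<p. v j * complement_gram p (Wfac t y (Suc m)) j k * v k)"
      using w by (subst energy_Suc[where C = "Cfac p t y m" and W = "Wfac t y (Suc m)"])
        (auto simp: Bfac_def u)
    then show "\<exists>u. (\<forall>j. u (Suc m) j = v j) \<and> energy p (Bfac p t y) (Suc m) u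
        = (\<Sum>j<p. \<Sum>k<p. v j * complement_gram p (Wfac t y (Suc m)) j k * v k)"
      by (intro exI[of _ ?u]) simp
  qed
  have ex: "\<exists>w. \<forall>c<p. (\<Sum>j<p. w j * Cfac p t y m j c) = (\<Sum>k<p. Wfac t y (Suc m) c k * v k)" for m v
    by (rule lowtri_solve_left[OF lowtri_Cfac])
  have "\<exists>u. (\<forall>j. u m j = w j) \<and> energy p (Bfac p t y) m u = (\<Sum>c<p. (\<Sum>j<p. w j * Cfac p t y m j c)\<^sup>2)" for w
    using admissible
  proof (induction m arbitrary: w)
    case 0
    show ?case
      by (intro exI[of _ "\<lambda>_. w"]) (simp add: energy_def Cfac_def sum_delta_right)
  next
    case (Suc m)
    obtain w' where w': "\<forall>c<p. (\<Sum>j<p. w' j * Cfac p t y m j c) = (\<Sum>k<p. Wfac t y (Suc m) c k * w k)"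
      using ex by blast
    obtain u where u: "\<forall>j. u (Suc m) j = w j" "energy p (Bfac p t y) (Suc m) u
      = (\<Sum>j<p. \<Sum>k<p. w j * complement_gram p (Wfac t y (Suc m)) j k * w k)"
      using base[OF Suc.IH w'] Suc.prems by auto
    have g: "pd p (complement_gram p (Wfac t y (Suc m)))" using Suc.prems[of "Suc m"] by (simp add: admissible_def)
    have "(\<Sum>j<p. \<Sum>k<p. w j * complement_gram p (Wfac t y (Suc m)) j k * w k)
      = (\<Sum>c<p. (\<Sum>j<p. w j * Cfac p t y (Suc m) j c) * (\<Sum>j<p. w j * Cfac p t y (Suc m) j c))"
      by (rule quad_factor) (simp add: Cfac_def chol_mult[OF g])
    then show ?case using u by (intro exI[of _ u]) (simp only: power2_eq_square simp_thms)
  qed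
  moreover obtain w where "\<forall>c<p. (\<Sum>j<p. w j * Cfac p t y m j c) = (\<Sum>k<p. Wfac t y (Suc m) c k * v k)"
    using ex by blast
  ultimately show ?thesis using base by blast
qed

text \<open>Moments of the symmetrized measure: the image of the symmetric measure under squaring has moments \<open>s\<close>.\<close>

definition sym_moment :: "(nat \<Rightarrow> nat \<Rightarrow> nat \<Rightarrow> real) \<Rightarrow> nat \<Rightarrow> nat \<Rightarrow> nat \<Rightarrow> real" where
  "sym_moment s a i j = (if even a then s (a div 2) i j else 0)"

text \<open>The integral of \<open>f\<close> against entry \<open>(i, j)\<close> of the symmetrized
  measure, expressed by moments alone.\<close>

definition moment_fun :: "(nat \<Rightarrow> nat \<Rightarrow> nat \<Rightarrow> real) \<Rightarrow> nat \<Rightarrow> nat \<Rightarrow> real poly \<Rightarrow> real" where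
  "moment_fun s i j f = (\<Sum>a\<le>degree f. coeff f a * sym_moment s a i j)"

definition vform :: "nat \<Rightarrow> (nat \<Rightarrow> nat \<Rightarrow> nat \<Rightarrow> real) \<Rightarrow> (nat \<Rightarrow> real poly) \<Rightarrow> (nat \<Rightarrow> real poly) \<Rightarrow> real" where
  "vform p s q r = (\<Sum>i<p. \<Sum>j<p. moment_fun s i j (q i * r j))"

lemma moment_fun_alt: "degree f \<le> N \<Longrightarrow> moment_fun s i j f = (\<Sum>a\<le>N. coeff f a * sym_moment s a i j)"
  unfolding moment_fun_def by (rule sum.mono_neutral_left) (auto simp: coeff_eq_0 not_le)

lemma moment_fun_add: "moment_fun s i j (f + g) = moment_fun s i j f + moment_fun s i j g"
proof -
  let ?N = "max (degree f) (degree g)"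
  show ?thesis
    using moment_fun_alt[of f ?N s i j] moment_fun_alt[of g ?N s i j] moment_fun_alt[of "f + g" ?N s i j]
    by (simp add: degree_add_le distrib_right sum.distrib)
qed

lemma moment_fun_smult: "moment_fun s i j (smult c f) = c * moment_fun s i j f"
  using moment_fun_alt[of "smult c f" "degree f" s i j]
  by (simp add: moment_fun_def sum_distrib_left mult.assoc)

lemma smult_sum_right: "smult c (sum f A) = (\<Sum>x\<in>A. smult c (f x))"
  by (induction A rule: infinite_finite_induct) (auto simp: smult_add_right)

lemma moment_fun_0: "moment_fun s i j 0 = 0"
  by (simp add: moment_fun_def)

lemma moment_fun_sum: "moment_fun s i j (sum f A) = (\<Sum>x\<in>A. moment_fun s i j (f x))"
  by (induction A rule: infinite_finite_induct) (auto simp: moment_fun_0 moment_fun_add)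

lemma moment_fun_monom: "moment_fun s i j (monom 1 a) = sym_moment s a i j"
  using moment_fun_alt[of "monom 1 a :: real poly" a s i j] by (simp add: degree_monom_eq sum_delta_right
    if_distrib[of "\<lambda>x. x * _"] cong: if_cong)

lemma moment_fun_odd:
  assumes "pcompose f [:0, -1:] = - f"
  shows "moment_fun s i j f = 0"
proof -
  have "coeff f a = 0" if "even a" for a
  proof -
    have "coeff (pcompose f [:0, -1:]) a = (-1) ^ a * coeff f a"
      using coeff_pcompose_linear[of f "-1" a] by simp
    then show ?thesis using assms that by simp
  qed
  then show ?thesis unfolding moment_fun_def sym_moment_def by (intro sum.neutral) auto
qed

lemma vform_cong:
  "(\<And>i. i < p \<Longrightarrow> q i = q' i) \<Longrightarrow> (\<And>i. i < p \<Longrightarrow> r i = r' i) \<Longrightarrow> vform p s q r = vform p s q' r'"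
  unfolding vform_def by (intro sum.cong) auto

lemma vform_sum_left: "vform p s (\<lambda>i. \<Sum>x\<in>A. smult (f x) (q x i)) r = (\<Sum>x\<in>A. f x * vform p s (q x) r)"
proof -
  have "vform p s (\<lambda>i. \<Sum>x\<in>A. smult (f x) (q x i)) r
     = (\<Sum>i<p. \<Sum>j<p. \<Sum>x\<in>A. f x * moment_fun s i j (q x i * r j))"
    by (simp add: vform_def sum_distrib_right moment_fun_sum moment_fun_smult)
  also have "\<dots> = (\<Sum>i<p. \<Sum>x\<in>A. \<Sum>j<p. f x * moment_fun s i j (q x i * r j))"
    by (rule sum.cong[OF refl]) (rule sum.swap)
  also have "\<dots> = (\<Sum>x\<in>A. \<Sum>i<p. \<Sum>j<p. f x * moment_fun s i j (q x i * r j))"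
    by (rule sum.swap)
  finally show ?thesis by (simp add: vform_def sum_distrib_left)
qed

lemma vform_add_left: "vform p s (\<lambda>i. q i + q' i) r = vform p s q r + vform p s q' r"
  by (simp add: vform_def distrib_right moment_fun_add sum.distrib)

lemma vform_mult_shift: "vform p s (\<lambda>i. f * q i) r = vform p s q (\<lambda>i. f * r i)"
  by (simp add: vform_def mult_ac)

lemma vform_zero_left: "(\<And>i. i < p \<Longrightarrow> q i = 0) \<Longrightarrow> vform p s q r = 0"
  by (simp add: vform_def moment_fun_0)

lemma vform_sym:
  assumes "\<And>l i j. i < p \<Longrightarrow> j < p \<Longrightarrow> s l i j = s l j i"
  shows "vform p s q r = vform p s r q"
proof -
  have "moment_fun s i j f = moment_fun s j i f" if "i < p" "j < p" for i j f
    unfolding moment_fun_def sym_moment_def assms[OF that] ..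
  then have "vform p s q r = (\<Sum>i<p. \<Sum>j<p. moment_fun s j i (q i * r j))"
    unfolding vform_def by (intro sum.cong refl) simp
  also have "\<dots> = vform p s r q" unfolding vform_def by (subst sum.swap) (simp add: mult.commute)
  finally show ?thesis .
qed

lemma vform_parity:
  assumes "\<And>i. i < p \<Longrightarrow> pcompose (q i) [:0, -1:] = smult a (q i)"
    and "\<And>i. i < p \<Longrightarrow> pcompose (r i) [:0, -1:] = smult b (r i)" and "a * b = -1"
  shows "vform p s q r = 0"
  unfolding vform_def
proof (intro sum.neutral ballI)
  fix i j assume "i \<in> {..<p}" "j \<in> {..<p}"
  then have "pcompose (q i * r j) [:0, -1:] = - (q i * r j)"
    using assms by (simp add: pcompose_mult mult.commute)
  then show "moment_fun s i j (q i * r j) = 0" by (rule moment_fun_odd)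
qed

text \<open>The last inequality is positivity with weight \<open>1 - x\<close>; the functional is
  even, so the weight \<open>1 + x\<close> follows, and one condition encodes support in
  \<open>[-1, 1]\<close>. Strictness makes the Cholesky factors of the recurrence exist.\<close>

definition positive_moments :: "nat \<Rightarrow> (nat \<Rightarrow> nat \<Rightarrow> nat \<Rightarrow> real) \<Rightarrow> bool" where
  "positive_moments p s \<longleftrightarrow>
     (\<forall>l. \<forall>i<p. \<forall>j<p. s l i j = s l j i) \<and>
     (\<forall>i<p. \<forall>j<p. s 0 i j = (if i = j then 1 else 0)) \<and>
     (\<forall>q. (\<exists>i<p. q i \<noteq> 0) \<longrightarrow> vform p s q q > 0 \<and> vform p s q (\<lambda>i. [:0, 1:] * q i) < vform p s q q)"

text \<open>\<open>P h c\<close> is row \<open>c\<close> of the matrix polynomial of degree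
  \<open>h\<close>, a vector of \<open>p\<close> scalar polynomials. The recurrence stops below
  \<open>n\<close>, as the block \<open>B (n + 1)\<close> is still to be found; the last clause says
  that the leading coefficient is invertible.\<close>

definition orthonormal_system :: "nat \<Rightarrow> (nat \<Rightarrow> nat \<Rightarrow> nat \<Rightarrow> real) \<Rightarrow> nat \<Rightarrow>
    (nat \<Rightarrow> nat \<Rightarrow> nat \<Rightarrow> real) \<Rightarrow> (nat \<Rightarrow> nat \<Rightarrow> nat \<Rightarrow> real poly) \<Rightarrow> bool" where
  "orthonormal_system p s n B P \<longleftrightarrow>
     (\<forall>h\<le>n. \<forall>h'\<le>n. \<forall>c<p. \<forall>c'<p. vform p s (P h c) (P h' c') = (if h = h' \<and> c = c' then 1 else 0)) \<and>
     (\<forall>c<p. \<forall>i<p. P 0 c i = (if c = i then 1 else 0)) \<and>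
     (\<forall>h<n. \<forall>c<p. \<forall>i<p. [:0, 1:] * P h c i = (\<Sum>k<p. smult (if h = 0 then 0 else B h k c) (P (h - 1) k i))
        + (\<Sum>k<p. smult (B (Suc h) c k) (P (Suc h) k i))) \<and>
     (\<forall>h\<le>n. \<forall>c<p. \<forall>i<p. pcompose (P h c i) [:0, -1:] = smult ((-1) ^ h) (P h c i)) \<and>
     (\<forall>h\<le>n. \<forall>c<p. \<forall>i<p. degree (P h c i) \<le> h) \<and>
     (\<forall>v. (\<forall>i<p. (\<Sum>c<p. v c * coeff (P n c i) n) = 0) \<longrightarrow> (\<forall>c<p. v c = 0))"

context
  fixes p s n B P
  assumes pos: "positive_moments p s" and sys: "orthonormal_system p s n B P"
begin

lemmas ons = sys[unfolded orthonormal_system_def, THEN conjunct1, rule_format]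
lemmas ons_0 = sys[unfolded orthonormal_system_def, THEN conjunct2, THEN conjunct1, rule_format]
lemmas ons_rec = sys[unfolded orthonormal_system_def, THEN conjunct2, THEN conjunct2, THEN conjunct1, rule_format]
lemmas ons_parity = sys[unfolded orthonormal_system_def, THEN conjunct2, THEN conjunct2, THEN conjunct2, THEN conjunct1, rule_format]
lemmas ons_degree = sys[unfolded orthonormal_system_def, THEN conjunct2, THEN conjunct2, THEN conjunct2, THEN conjunct2, THEN conjunct1, rule_format]
lemmas ons_lead = sys[unfolded orthonormal_system_def, THEN conjunct2, THEN conjunct2, THEN conjunct2, THEN conjunct2, THEN conjunct2, rule_format]

lemma vsym: "vform p s q r = vform p s r q"
  using pos by (intro vform_sym) (auto simp: positive_moments_def)

lemma vform_sum_right: "vform p s r (\<lambda>i. \<Sum>x\<in>A. smult (f x) (q x i)) = (\<Sum>x\<in>A. f x * vform p s r (q x))"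
  using vform_sum_left[where A=A and f=f and q=q and r=r] by (simp add: vsym[of r])

lemma rec_form:
  assumes "h < n" "c < p"
  shows "vform p s (\<lambda>i. [:0, 1:] * P h c i) r
     = (if h = 0 then 0 else \<Sum>k<p. B h k c * vform p s (P (h - 1) k) r) + (\<Sum>k<p. B (Suc h) c k * vform p s (P (Suc h) k) r)"
proof -
  have "vform p s (\<lambda>i. [:0, 1:] * P h c i) r =
    vform p s (\<lambda>i. (\<Sum>k<p. smult (if h = 0 then 0 else B h k c) (P (h - 1) k i)) + (\<Sum>k<p. smult (B (Suc h) c k) (P (Suc h) k i))) r"
    using ons_rec[OF assms] by (intro vform_cong) auto
  then show ?thesis by (simp add: vform_add_left vform_sum_left)
qed

lemma rec_form_P:
  assumes "h < n" "c < p" "h' \<le> n" "c' < p"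
  shows "vform p s (\<lambda>i. [:0, 1:] * P h c i) (P h' c')
     = (if h = Suc h' then B h c' c else 0) + (if h' = Suc h then B h' c c' else 0)"
proof -
  have a: "(if h = 0 then 0 else \<Sum>k<p. B h k c * vform p s (P (h - 1) k) (P h' c')) = (if h = Suc h' then B h c' c else 0)"
    using assms by (cases h) (simp_all add: ons sum_delta_right)
  have b: "(\<Sum>k<p. B (Suc h) c k * vform p s (P (Suc h) k) (P h' c')) = (if h' = Suc h then B h' c c' else 0)"
    using assms by (simp add: ons sum_delta_right)
  show ?thesis unfolding rec_form[OF assms(1,2)] a b ..
qed

text \<open>The reason why the diagonal Jacobi blocks vanish: multiplication by \<open>x\<close>
  reverses parity.\<close>

lemma X_parity:
  assumes "c < p" "c' < p" "h \<le> n"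
  shows "vform p s (\<lambda>i. [:0, 1:] * P h c i) (P h c') = 0"
proof (rule vform_parity)
  show "pcompose ([:0, 1:] * P h c i) [:0, -1:] = smult ((-1) ^ Suc h) ([:0, 1:] * P h c i)" if "i < p" for i
    using ons_parity[OF assms(3,1) that] by (simp add: pcompose_mult pcompose_pCons)
  show "pcompose (P h c' i) [:0, -1:] = smult ((-1) ^ h) (P h c' i)" if "i < p" for i
    using ons_parity[OF assms(3,2) that] .
qed (simp flip: power_mult_distrib)

text \<open>In the orthonormal basis, multiplication by \<open>x\<close> is the Jacobi matrix. The
  recurrence is applied to an index below \<open>n\<close>; if there is none, parity
  decides.\<close>

lemma X_gram:
  assumes "h \<le> n" "c < p" "h' \<le> n" "c' < p"
  shows "vform p s (P h c) (\<lambda>i. [:0, 1:] * P h' c' i) = jacobi_matrix p n B ((h, c), (h', c'))"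
proof -
  consider "h' < n" | "h < n" "h' = n" | "h = n" "h' = n" using assms by linarith
  then show ?thesis
  proof cases
    case 1
    then show ?thesis using rec_form_P[OF 1 assms(4,1,2)] assms
      by (subst vsym) (auto simp: jacobi_matrix_def)
  next
    case 2
    then show ?thesis using rec_form_P[OF 2(1) assms(2) assms(3,4)] assms
      by (subst vform_mult_shift[symmetric]) (auto simp: jacobi_matrix_def)
  next
    case 3
    then show ?thesis using X_parity[OF assms(2,4), of n] assms
      by (subst vform_mult_shift[symmetric]) (auto simp: jacobi_matrix_def)
  qed
qed

lemma X_gram_left:
  assumes "h \<le> n" "c < p" "h' \<le> n" "c' < p"
  shows "vform p s (\<lambda>i. [:0, 1:] * P h c i) (P h' c') = jacobi_matrix p n B ((h, c), (h', c'))"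
  using X_gram[OF assms] by (simp only: vform_mult_shift)

text \<open>The energy is the form with weight \<open>1 - x\<close> at the polynomial with
  coefficients \<open>u\<close>. This polynomial is nonzero because its squared norm is the sum of
  the squared coefficients.\<close>

lemma energy_pos:
  assumes "\<exists>c<p. u n c \<noteq> 0"
  shows "energy p B n u > 0"
proof -
  define q where "q i = (\<Sum>x\<in>block_index p n. smult (u (fst x) (snd x)) (P (fst x) (snd x) i))" for i
  have qP: "vform p s q r = (\<Sum>x\<in>block_index p n. u (fst x) (snd x) * vform p s (P (fst x) (snd x)) r)" for r
    unfolding q_def[abs_def] by (rule vform_sum_left)
  have Pq: "vform p s r q = (\<Sum>x\<in>block_index p n. u (fst x) (snd x) * vform p s r (P (fst x) (snd x)))" for r
    unfolding q_def[abs_def] by (rule vform_sum_right)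
  have qq: "vform p s q q = (\<Sum>h\<le>n. \<Sum>c<p. (u h c)\<^sup>2)"
  proof -
    have "vform p s q q = (\<Sum>x\<in>block_index p n. \<Sum>z\<in>block_index p n. if z = x then (u (fst x) (snd x))\<^sup>2 else 0)"
      unfolding qP Pq sum_distrib_left by (intro sum.cong refl) (auto simp: ons power2_eq_square split: if_splits)
    also have "\<dots> = (\<Sum>x\<in>block_index p n. (u (fst x) (snd x))\<^sup>2)" by simp
    finally show ?thesis by (simp add: sum_block_index)
  qed
  have "vform p s q (\<lambda>i. [:0, 1:] * q i)
     = (\<Sum>x\<in>block_index p n. u (fst x) (snd x) * vform p s (\<lambda>i. [:0, 1:] * P (fst x) (snd x) i) q)"
    unfolding qP by (simp only: vform_mult_shift)
  also have "\<dots> = (\<Sum>x\<in>block_index p n. \<Sum>z\<in>block_index p n. u (fst x) (snd x) * jacobi_matrix p n B (x, z) * u (fst z) (snd z))"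
    unfolding Pq sum_distrib_left
    by (intro sum.cong refl) (auto simp: X_gram_left simp del: mult_pCons_left)
  also have "\<dots> = 2 * (\<Sum>h<n. \<Sum>j<p. \<Sum>k<p. u h j * B (Suc h) j k * u (Suc h) k)"
    using jacobi_matrix_quad[of "\<lambda>x. u (fst x) (snd x)" p n B] by simp
  finally have qX: "energy p B n u = vform p s q q - vform p s q (\<lambda>i. [:0, 1:] * q i)"
    by (simp add: energy_def qq)
  obtain c where c: "c < p" "u n c \<noteq> 0" using assms by blast
  have "0 < (\<Sum>c<p. (u n c)\<^sup>2)" using c by (intro sum_pos2[of _ c]) auto
  also have "\<dots> \<le> (\<Sum>h\<le>n. \<Sum>c<p. (u h c)\<^sup>2)"
    using member_le_sum[of n "{..n}" "\<lambda>h. \<Sum>c<p. (u h c)\<^sup>2"] by (simp add: sum_nonneg)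
  finally have "vform p s q q \<noteq> 0" using qq by simp
  then have "\<exists>i<p. q i \<noteq> 0" using vform_zero_left by blast
  then have "vform p s q (\<lambda>i. [:0, 1:] * q i) < vform p s q q"
    using pos unfolding positive_moments_def by blast
  then show ?thesis using qX by simp
qed

text \<open>Multiplication by \<open>x\<close> acts on the coefficients through the recurrence, and
  this is the recursion that defines \<open>path_weight\<close>.\<close>

lemma monom_expansion:
  assumes "m \<le> n" "i < p" "a < p"
  shows "(if a = i then monom 1 m else 0) = (\<Sum>h\<le>m. \<Sum>k<p. smult (path_weight p B m h i k) (P h k a))"
  using assms
proof (induction m)
  case 0
  then show ?case by (auto simp: ons_0 if_distrib[of "\<lambda>x. smult x _"] if_distrib[of "\<lambda>x. smult _ x"] monom_0 one_pCons cong: if_cong)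
next
  case (Suc m)
  let ?w = "path_weight p B"
  have "(if a = i then monom 1 (Suc m) else 0) = [:0, 1:] * (if a = i then monom 1 m else 0 :: real poly)"
    by (simp add: monom_Suc)
  also have "\<dots> = (\<Sum>h\<le>m. \<Sum>c<p. smult (?w m h i c) ([:0, 1:] * P h c a))"
    using Suc by (simp only: sum_distrib_left mult_smult_right Suc_leD)
  also have "\<dots> = (\<Sum>h\<le>m. \<Sum>c<p. \<Sum>k<p. smult (?w m h i c * (if h = 0 then 0 else B h k c)) (P (h - 1) k a)
       + smult (?w m h i c * B (Suc h) c k) (P (Suc h) k a))"
    using Suc.prems by (intro sum.cong refl) (simp add: ons_rec smult_add_right smult_sum_right sum.distrib del: mult_pCons_left)
  also have "\<dots> = (\<Sum>h\<le>m. \<Sum>k<p. smult (\<Sum>c<p. ?w m h i c * (if h = 0 then 0 else B h k c)) (P (h - 1) k a))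
       + (\<Sum>h\<le>m. \<Sum>k<p. smult (\<Sum>c<p. ?w m h i c * B (Suc h) c k) (P (Suc h) k a))"
    unfolding sum.distrib smult_sum by (intro arg_cong2[where f="(+)"]; rule sum.cong[OF refl]; rule sum.swap)
  also have "(\<Sum>h\<le>m. \<Sum>k<p. smult (\<Sum>c<p. ?w m h i c * (if h = 0 then 0 else B h k c)) (P (h - 1) k a))
     = (\<Sum>h<m. \<Sum>k<p. smult (\<Sum>c<p. ?w m (Suc h) i c * B (Suc h) k c) (P h k a))"
    by (subst lessThan_Suc_atMost[symmetric], subst sum.lessThan_Suc_shift) simp
  also have "\<dots> = (\<Sum>h\<le>Suc m. \<Sum>k<p. smult (\<Sum>c<p. ?w m (Suc h) i c * B (Suc h) k c) (P h k a))"
    by (rule sum.mono_neutral_left) (auto simp: path_weight_above intro!: sum.neutral)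
  also have "(\<Sum>h\<le>m. \<Sum>k<p. smult (\<Sum>c<p. ?w m h i c * B (Suc h) c k) (P (Suc h) k a))
     = (\<Sum>h\<le>Suc m. \<Sum>k<p. smult (if h = 0 then 0 else \<Sum>c<p. ?w m (h - 1) i c * B h c k) (P h k a))"
    by (subst (2) lessThan_Suc_atMost[symmetric], subst sum.lessThan_Suc_shift) (simp add: lessThan_Suc_atMost)
  finally show ?case
    by (simp only: sum.distrib[symmetric] smult_add_left[symmetric] path_weight.simps add.commute)
qed

text \<open>Expand \<open>x^l e_i\<close> and \<open>x^l e_j\<close> in the orthonormal basis; their
  inner product is a path of length \<open>2 * l\<close> cut in the middle.\<close>

lemma moment_eq_path_weight:
  assumes "l \<le> n" "i < p" "j < p"
  shows "s l i j = path_weight p B (2 * l) 0 i j"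
proof -
  let ?e = "\<lambda>i a. if a = i then monom 1 l else 0 :: real poly"
  let ?w = "path_weight p B l"
  have ee: "vform p s (?e i') r = vform p s (\<lambda>a. \<Sum>x\<in>block_index p l. smult (?w (fst x) i' (snd x)) (P (fst x) (snd x) a)) r"
    if "i' < p" for i' r
    by (rule vform_cong) (use monom_expansion[OF assms(1) that] in \<open>simp_all add: sum_block_index\<close>)
  have "s l i j = moment_fun s i j (monom 1 l * monom 1 l)"
    by (simp add: mult_monom moment_fun_monom sym_moment_def mult_2[symmetric])
  also have "\<dots> = vform p s (?e i) (?e j)"
  proof -
    let ?M = "moment_fun s i j (monom 1 l * monom 1 l)"
    have "moment_fun s a b (?e i a * ?e j b) = (if b = j then (if a = i then ?M else 0) else 0)" for a b
      by (auto simp: moment_fun_0)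
    then have "vform p s (?e i) (?e j) = (\<Sum>a<p. \<Sum>b<p. if b = j then (if a = i then ?M else 0) else 0)"
      unfolding vform_def by presburger
    then show ?thesis using assms by simp
  qed
  also have "\<dots> = (\<Sum>x\<in>block_index p l. ?w (fst x) i (snd x) * vform p s (P (fst x) (snd x)) (?e j))"
    unfolding ee[OF assms(2)] by (rule vform_sum_left)
  also have "\<dots> = (\<Sum>x\<in>block_index p l. ?w (fst x) i (snd x) * ?w (fst x) j (snd x))"
  proof (rule sum.cong[OF refl])
    fix x assume x: "x \<in> block_index p l"
    have "vform p s (P (fst x) (snd x)) (?e j) = (\<Sum>z\<in>block_index p l. ?w (fst z) j (snd z) * vform p s (P (fst z) (snd z)) (P (fst x) (snd x)))"
      unfolding vsym[of _ "?e j"] ee[OF assms(3)] by (rule vform_sum_left)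
    also have "\<dots> = (\<Sum>z\<in>block_index p l. if z = x then ?w (fst x) j (snd x) else 0)"
      using x assms by (intro sum.cong refl) (auto simp: ons split: if_splits)
    also have "\<dots> = ?w (fst x) j (snd x)" using x by simp
    finally show "?w (fst x) i (snd x) * vform p s (P (fst x) (snd x)) (?e j) = ?w (fst x) i (snd x) * ?w (fst x) j (snd x)"
      by simp
  qed
  finally show ?thesis using assms by (simp add: sum_block_index path_weight_moment)
qed

end

lemma vform_const:
  assumes "c < p" "c' < p"
  shows "vform p s (\<lambda>i. if c = i then 1 else 0) (\<lambda>i. if c' = i then 1 else 0) = s 0 c c'"
proof -
  have m: "moment_fun s i j 1 = s 0 i j" for i j
    by (simp add: moment_fun_def sym_moment_def)
  have "moment_fun s a b ((if c = a then 1 else 0) * (if c' = b then 1 else 0))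
      = (if b = c' then (if a = c then s 0 c c' else 0) else 0)" for a b
    by (auto simp: moment_fun_0 m)
  then have "vform p s (\<lambda>i. if c = i then 1 else 0) (\<lambda>i. if c' = i then 1 else 0)
     = (\<Sum>a<p. \<Sum>b<p. if b = c' then (if a = c then s 0 c c' else 0) else 0)"
    unfolding vform_def by presburger
  then show ?thesis using assms by simp
qed

lemma orthonormal_system_0:
  assumes "positive_moments p s"
  shows "orthonormal_system p s 0 B (\<lambda>h c i. if c = i then 1 else 0)"
  unfolding orthonormal_system_def
proof (intro conjI allI impI)
  fix h h' c c' :: nat assume "h \<le> 0" "h' \<le> 0" "c < p" "c' < p"
  then show "vform p s (\<lambda>i. if c = i then 1 else 0) (\<lambda>i. if c' = i then 1 else 0) = (if h = h' \<and> c = c' then 1 else 0)"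
    using assms by (simp add: vform_const positive_moments_def)
next
  fix v :: "nat \<Rightarrow> real" and c assume "\<forall>i<p. (\<Sum>c<p. v c * coeff (if c = i then 1 else 0) 0) = 0" "c < p"
  then show "v c = 0" by (auto simp: if_distrib[of "\<lambda>x. coeff x _"] if_distrib[of "\<lambda>x. _ * x"] cong: if_cong)
qed (auto simp: pcompose_1 if_distrib[of degree])

section \<open>Induction step for the orthonormal polynomials\<close>

context
  fixes p s n y P
  assumes pos: "positive_moments p s"
    and sys: "orthonormal_system p s n (Bfac p 1 y) P"
    and gd: "\<And>l. 1 \<le> l \<Longrightarrow> l \<le> n \<Longrightarrow> admissible p 1 y l"
begin

private abbreviation (input) "B \<equiv> Bfac p 1 y"

text \<open>\<open>x P_n\<close> minus its component along \<open>P_(n-1)\<close>: the next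
  orthogonal polynomial before normalization. For \<open>n = 0\<close> nothing is
  subtracted.\<close>

private definition Q :: "nat \<Rightarrow> nat \<Rightarrow> real poly" where
  "Q c i = [:0, 1:] * P n c i + (\<Sum>k<p. smult (if n = 0 then 0 else - B n k c) (P (n - 1) k i))"

private lemma Q_form:
  assumes "c < p"
  shows "vform p s (Q c) r = vform p s (\<lambda>i. [:0, 1:] * P n c i) r + (\<Sum>k<p. (if n = 0 then 0 else - B n k c) * vform p s (P (n - 1) k) r)"
  unfolding Q_def[abs_def] vform_add_left vform_sum_left ..

private lemma Q_orth:
  assumes "c < p" "h \<le> n" "k < p"
  shows "vform p s (Q c) (P h k) = 0"
proof -
  have a: "vform p s (\<lambda>i. [:0, 1:] * P n c i) (P h k) = (if n = Suc h then B n k c else 0)"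
    using X_gram_left[OF pos sys, of n c h k] assms by (auto simp: jacobi_matrix_def)
  have b: "(\<Sum>k'<p. (if n = 0 then 0 else - B n k' c) * vform p s (P (n - 1) k') (P h k)) = (if n = Suc h then - B n k c else 0)"
    using assms ons[OF pos sys] by (cases n) (auto simp: sum_delta_right sum_negf)
  show ?thesis unfolding Q_form[OF assms(1)] a b by simp
qed

private lemma Q_degree: "c < p \<Longrightarrow> i < p \<Longrightarrow> degree (Q c i) \<le> Suc n"
proof -
  assume c: "c < p" "i < p"
  have "degree (P (n - 1) k i) \<le> Suc n" if "k < p" for k
    using ons_degree[OF pos sys, of "n - 1" k i] that c by simp
  then show ?thesis
    unfolding Q_def using ons_degree[OF pos sys order_refl c]
    by (intro degree_add_le degree_sum_le order_trans[OF degree_mult_le] order_trans[OF degree_smult_le]) auto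
qed

private lemma Q_parity:
  assumes "c < p" "i < p"
  shows "pcompose (Q c i) [:0, -1:] = smult ((-1) ^ Suc n) (Q c i)"
proof -
  have "pcompose (\<Sum>k<p. smult (if n = 0 then 0 else - B n k c) (P (n - 1) k i)) [:0, -1:]
     = (\<Sum>k<p. smult ((-1) ^ Suc n) (smult (if n = 0 then 0 else - B n k c) (P (n - 1) k i)))"
    unfolding pcompose_sum
  proof (rule sum.cong[OF refl])
    fix k assume "k \<in> {..<p}"
    then have e: "pcompose (P (n - 1) k i) [:0, -1:] = smult ((-1) ^ (n - 1)) (P (n - 1) k i)"
      using ons_parity[OF pos sys, of "n - 1" k i] assms by simp
    show "pcompose (smult (if n = 0 then 0 else - B n k c) (P (n - 1) k i)) [:0, -1:]
      = smult ((-1) ^ Suc n) (smult (if n = 0 then 0 else - B n k c) (P (n - 1) k i))"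
      unfolding pcompose_smult e by (cases n) (auto simp: mult_ac)
  qed
  then show ?thesis unfolding Q_def
    using ons_parity[OF pos sys order_refl assms]
    by (simp add: pcompose_add pcompose_mult pcompose_pCons smult_add_right smult_sum_right)
qed

private lemma Q_lead:
  assumes "c < p" "i < p"
  shows "coeff (Q c i) (Suc n) = coeff (P n c i) n"
proof -
  have "coeff (smult (if n = 0 then 0 else - B n k c) (P (n - 1) k i)) (Suc n) = 0" if "k < p" for k
    using ons_degree[OF pos sys, of "n - 1" k i] that assms by (simp add: coeff_eq_0)
  then show ?thesis by (auto simp: Q_def coeff_sum intro!: sum.neutral)
qed

private definition G :: "nat \<Rightarrow> nat \<Rightarrow> real" where "G c c' = vform p s (Q c) (Q c')"

text \<open>A nontrivial combination of the rows of \<open>Q\<close> is a nonzero polynomial vector,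
  since \<open>Q\<close> inherits the invertible leading coefficient of \<open>P n\<close>.\<close>

private lemma G_pd: "pd p G"
  unfolding pd_def
proof (intro conjI allI impI)
  show "G i j = G j i" for i j unfolding G_def by (rule vsym[OF pos sys])
  fix v :: "nat \<Rightarrow> real" assume v: "\<exists>i<p. v i \<noteq> 0"
  define q where "q i = (\<Sum>c<p. smult (v c) (Q c i))" for i
  have "vform p s q q = (\<Sum>c<p. \<Sum>c'<p. v c * G c c' * v c')"
    unfolding q_def[abs_def] vform_sum_left vform_sum_right[OF pos sys] G_def
    by (simp add: sum_distrib_left mult_ac)
  moreover have "\<exists>i<p. q i \<noteq> 0"
  proof (rule ccontr)
    assume "\<not> (\<exists>i<p. q i \<noteq> 0)"
    moreover have "coeff (q i) (Suc n) = (\<Sum>c<p. v c * coeff (P n c i) n)" if "i < p" for i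
      using that by (simp add: q_def coeff_sum Q_lead)
    ultimately have "(\<Sum>c<p. v c * coeff (P n c i) n) = 0" if "i < p" for i
      using that by (metis coeff_0)
    then have "v c = 0" if "c < p" for c using ons_lead[OF pos sys] that by blast
    then show False using v by blast
  qed
  ultimately show "0 < (\<Sum>c<p. \<Sum>c'<p. v c * G c c' * v c')"
    using pos unfolding positive_moments_def by metis
qed

text \<open>The Cholesky factor \<open>K\<close> of the Gram matrix of \<open>Q\<close> is the next
  Jacobi block, and \<open>K^(-1) Q\<close> the next polynomial. Dividing \<open>K\<close> by the
  known factor \<open>Cfac\<close> at \<open>n\<close> gives \<open>W\<close>, and
  \<open>Y = W W^T\<close> is the new parameter.\<close>

lemma orthonormal_step:
  "\<exists>y' P'. (\<forall>l. 1 \<le> l \<longrightarrow> l \<le> Suc n \<longrightarrow> admissible p 1 y' l) \<and> orthonormal_system p s (Suc n) (Bfac p 1 y') P'"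
proof -
  let ?C = "Cfac p 1 y n"
  define K where "K = chol G"
  have K: "lowtri p K" "\<And>i j. i < p \<Longrightarrow> j < p \<Longrightarrow> G i j = (\<Sum>k<p. K i k * K j k)"
    using lowtri_chol chol_mult[OF G_pd] by (auto simp: K_def)
  obtain W where W: "lowtri p W" "\<And>j k. j < p \<Longrightarrow> k < p \<Longrightarrow> (\<Sum>c<p. ?C j c * W c k) = K j k"
    using lowtri_div[OF lowtri_Cfac K(1)] by blast
  obtain E where E: "lowtri p E" "\<And>j k. j < p \<Longrightarrow> k < p \<Longrightarrow> (\<Sum>c<p. K j c * E c k) = (if j = k then 1 else 0)"
    "\<And>j k. j < p \<Longrightarrow> k < p \<Longrightarrow> (\<Sum>c<p. E j c * K c k) = (if j = k then 1 else 0)"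
    using lowtri_inverse[OF K(1)] by blast
  define Y where "Y i j = (\<Sum>k<p. W i k * W j k)" for i j
  \<comment> \<open>\<open>shifted\<close> will add one half on the diagonal, so it is subtracted
    here.\<close>
  define y' where "y' = (\<lambda>(l, i, j). if l = Suc n then Y i j - (if i = j then 1/2 else 0) else y (l, i, j))"
  have Ysym: "Y i j = Y j i" for i j by (simp add: Y_def mult.commute)
  have sh: "shifted 1 y' (Suc n) i j = Y i j" for i j
    using Ysym[of i j] by (cases i j rule: linorder_cases) (auto simp: shifted_def symmat_def y'_def)
  have agree: "y' (l', i, j) = y (l', i, j)" if "l' < Suc n" for l' i j
    using that by (simp add: y'_def)
  have sh0: "shifted 1 y' l = shifted 1 y l" if "l \<le> n" for l
    using that by (auto simp: shifted_def[abs_def] symmat_def y'_def fun_eq_iff)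
  have W0: "Wfac 1 y' l = Wfac 1 y l" if "l \<le> n" for l using sh0[OF that] by (simp add: Wfac_def)
  have C0: "Cfac p 1 y' l = Cfac p 1 y l" if "l \<le> n" for l using W0[OF that] by (simp add: Cfac_def)
  have B0: "Bfac p 1 y' l = Bfac p 1 y l" if "l \<le> n" for l
    using W0[OF that] C0[of "l - 1"] that by (simp add: Bfac_def[abs_def])
  have good0: "admissible p 1 y' l" if "1 \<le> l" "l \<le> n" for l
    using gd[OF that] sh0[OF that(2)] W0[OF that(2)] by (simp add: admissible_def)
  have W1: "Wfac 1 y' (Suc n) i j = W i j" if "i < p" "j < p" for i j
    unfolding Wfac_def by (rule chol_unique[OF W(1) _ that]) (simp add: sh Y_def)
  have B1: "Bfac p 1 y' (Suc n) i j = K i j" if "i < p" "j < p" for i j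
    unfolding Bfac_def using W(2)[OF that] W1 that by (simp add: C0)
  define P' where "P' h k i = (if h = Suc n then \<Sum>c<p. smult (E k c) (Q c i) else P h k i)" for h k i
  have P'0: "P' h = P h" if "h \<le> n" for h using that by (auto simp: P'_def fun_eq_iff)
  have P'1: "P' (Suc n) k = (\<lambda>i. \<Sum>c<p. smult (E k c) (Q c i))" for k by (simp add: P'_def fun_eq_iff)
  have orth: "vform p s (P' (Suc n) k) (P' h c) = 0" if "h \<le> n" "k < p" "c < p" for h k c
    unfolding P'1 vform_sum_left P'0[OF that(1)] using that by (simp add: Q_orth)
  have norm: "vform p s (P' (Suc n) k) (P' (Suc n) k') = (if k = k' then 1 else 0)" if "k < p" "k' < p" for k k'
  proof -
    have "vform p s (P' (Suc n) k) (P' (Suc n) k') = (\<Sum>c<p. \<Sum>c'<p. E k c * G c c' * E k' c')"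
      unfolding P'1 vform_sum_left vform_sum_right[OF pos sys] G_def by (simp add: sum_distrib_left mult_ac)
    also have "\<dots> = (\<Sum>a<p. (\<Sum>c<p. E k c * K c a) * (\<Sum>c'<p. E k' c' * K c' a))"
      by (rule quad_factor) (use K(2) in auto)
    also have "\<dots> = (\<Sum>a<p. (if k = a then 1 else 0) * (if k' = a then 1 else 0))"
      using that E(3) by (intro sum.cong refl) auto
    also have "\<dots> = (if k = k' then 1 else 0)" using that by (simp add: sum_delta_left)
    finally show ?thesis .
  qed
  have sys': "orthonormal_system p s (Suc n) (Bfac p 1 y') P'"
    unfolding orthonormal_system_def
  proof (intro conjI allI impI)
    fix h h' c c' assume h: "h \<le> Suc n" "h' \<le> Suc n" and c: "c < p" "c' < p"
    consider "h \<le> n" "h' \<le> n" | "h = Suc n" "h' \<le> n" | "h \<le> n" "h' = Suc n" | "h = Suc n" "h' = Suc n"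
      using h by linarith
    then show "vform p s (P' h c) (P' h' c') = (if h = h' \<and> c = c' then 1 else 0)"
    proof cases
      case 1 then show ?thesis using ons[OF pos sys] c by (simp add: P'0)
    next
      case 2 then show ?thesis using orth[of h' c c'] c by simp
    next
      case 3 then show ?thesis using orth[of h c' c] c vsym[OF pos sys, of "P' h c"] by simp
    next
      case 4 then show ?thesis using norm c by simp
    qed
  next
    fix c i assume "c < p" "i < p"
    then show "P' 0 c i = (if c = i then 1 else 0)" using ons_0[OF pos sys] by (simp add: P'0)
  next
    fix h c i assume h: "h < Suc n" and c: "c < p" "i < p"
    show "[:0, 1:] * P' h c i = (\<Sum>k<p. smult (if h = 0 then 0 else Bfac p 1 y' h k c) (P' (h - 1) k i))
        + (\<Sum>k<p. smult (Bfac p 1 y' (Suc h) c k) (P' (Suc h) k i))"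
    proof (cases "h < n")
      case True
      then have b: "Bfac p 1 y' h = Bfac p 1 y h" "Bfac p 1 y' (Suc h) = Bfac p 1 y (Suc h)"
        and pp: "P' h = P h" "P' (h - 1) = P (h - 1)" "P' (Suc h) = P (Suc h)"
        by (simp_all add: B0 P'0)
      show ?thesis unfolding b pp by (rule ons_rec[OF pos sys True c])
    next
      case False
      then have hn: "h = n" using h by simp
      have "(\<Sum>k<p. smult (Bfac p 1 y' (Suc n) c k) (P' (Suc n) k i))
        = (\<Sum>k<p. \<Sum>c'<p. smult (K c k * E k c') (Q c' i))"
        using c by (simp add: B1 P'1 smult_sum_right)
      also have "\<dots> = (\<Sum>c'<p. smult (\<Sum>k<p. K c k * E k c') (Q c' i))"
        unfolding smult_sum by (rule sum.swap)
      also have "\<dots> = (\<Sum>c'<p. if c' = c then Q c i else 0)"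
        using c E(2) by (intro sum.cong refl) auto
      also have "\<dots> = Q c i" using c by simp
      finally have s: "(\<Sum>k<p. smult (Bfac p 1 y' (Suc n) c k) (P' (Suc n) k i)) = Q c i" .
      have z: "(\<Sum>k<p. smult (if n = 0 then 0 else Bfac p 1 y' n k c) (P' (n - 1) k i))
         + (\<Sum>k<p. smult (if n = 0 then 0 else - Bfac p 1 y n k c) (P (n - 1) k i)) = 0"
        unfolding sum.distrib[symmetric] by (intro sum.neutral) (simp add: P'0 B0)
      show ?thesis unfolding hn s Q_def P'0[OF order_refl] using z by (simp add: algebra_simps)
    qed
  next
    fix h c i assume h: "h \<le> Suc n" and c: "c < p" "i < p"
    show "pcompose (P' h c i) [:0, -1:] = smult ((-1) ^ h) (P' h c i)"
    proof (cases "h \<le> n")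
      case True then show ?thesis using ons_parity[OF pos sys True c] by (simp add: P'0)
    next
      case False
      then have "h = Suc n" using h by simp
      then show ?thesis using c
        by (simp add: P'1 pcompose_sum pcompose_smult Q_parity smult_sum_right mult_ac del: power_Suc)
    qed
  next
    fix h c i assume h: "h \<le> Suc n" and c: "c < p" "i < p"
    show "degree (P' h c i) \<le> h"
    proof (cases "h \<le> n")
      case True then show ?thesis using ons_degree[OF pos sys True c] by (simp add: P'0)
    next
      case False
      then have "h = Suc n" using h by simp
      then show ?thesis using c
        by (auto simp: P'1 intro!: degree_sum_le order_trans[OF degree_smult_le] Q_degree)
    qed
  next
    fix v c assume v: "\<forall>i<p. (\<Sum>k<p. v k * coeff (P' (Suc n) k i) (Suc n)) = 0" and c: "c < p"
    have z: "(\<Sum>c<p. (\<Sum>k<p. v k * E k c) * coeff (P n c i) n) = 0" if i: "i < p" for i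
    proof -
      have "(\<Sum>c<p. (\<Sum>k<p. v k * E k c) * coeff (P n c i) n) = (\<Sum>k<p. v k * (\<Sum>c<p. E k c * coeff (P n c i) n))"
        unfolding sum_distrib_left sum_distrib_right by (subst sum.swap) (simp add: mult.assoc)
      also have "\<dots> = (\<Sum>k<p. v k * coeff (P' (Suc n) k i) (Suc n))"
        using i by (simp add: P'1 coeff_sum Q_lead)
      finally show ?thesis using v i by simp
    qed
    have "(\<Sum>k<p. v k * E k c) = 0" if "c < p" for c
      by (rule ons_lead[OF pos sys, where v = "\<lambda>c. \<Sum>k<p. v k * E k c", OF z that])
    then show "v c = 0" using lowtri_left_inj[OF E(1)] c by blast
  qed
  have "admissible p 1 y' (Suc n)"
    unfolding admissible_def
  proof
    show "pd p (shifted 1 y' (Suc n))" by (rule pd_gram[OF W(1)]) (simp add: sh Y_def)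
    show "pd p (complement_gram p (Wfac 1 y' (Suc n)))"
      unfolding pd_def
    proof (intro conjI allI impI)
      show "complement_gram p (Wfac 1 y' (Suc n)) i j = complement_gram p (Wfac 1 y' (Suc n)) j i" for i j
        by (simp add: complement_gram_def mult.commute)
      fix v :: "nat \<Rightarrow> real" assume v: "\<exists>i<p. v i \<noteq> 0"
      \<comment> \<open>The form of \<open>1 - W^T W\<close> at \<open>v\<close> is the energy of a
        vector with top level \<open>v\<close>, hence positive.\<close>
      obtain u where u: "\<forall>j. u (Suc n) j = v j" "energy p (Bfac p 1 y') (Suc n) u
        = (\<Sum>j<p. \<Sum>k<p. v j * complement_gram p (Wfac 1 y' (Suc n)) j k * v k)"
        using energy_optimal[of n p 1 y' v] good0 by blast
      have "energy p (Bfac p 1 y') (Suc n) u > 0"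
        using energy_pos[OF pos sys'] u(1) v by simp
      then show "0 < (\<Sum>j<p. \<Sum>k<p. v j * complement_gram p (Wfac 1 y' (Suc n)) j k * v k)" using u(2) by simp
    qed
  qed
  then have "\<forall>l. 1 \<le> l \<longrightarrow> l \<le> Suc n \<longrightarrow> admissible p 1 y' l" using good0 le_Suc_eq by blast
  then show ?thesis using sys' by blast
qed

end

theorem positive_moments_parametrization:
  assumes pos: "positive_moments p s"
  shows "\<exists>y. (\<forall>l. 1 \<le> l \<longrightarrow> l \<le> n \<longrightarrow> admissible p 1 y l) \<and>
    (\<forall>l\<le>n. \<forall>i<p. \<forall>j<p. s l i j = path_weight p (Bfac p 1 y) (2 * l) 0 i j)"
proof -
  have "\<exists>y P. (\<forall>l. 1 \<le> l \<longrightarrow> l \<le> n \<longrightarrow> admissible p 1 y l) \<and> orthonormal_system p s n (Bfac p 1 y) P"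
  proof (induction n)
    case 0
    then show ?case using orthonormal_system_0[OF pos] by (metis le_zero_eq not_one_le_zero)
  next
    case (Suc n)
    then show ?case using orthonormal_step[OF pos] by blast
  qed
  then show ?thesis using moment_eq_path_weight[OF pos] by blast
qed

section \<open>Positivity of matrix measures\<close>

definition on_unit_interval :: "real measure \<Rightarrow> bool" where
  "on_unit_interval \<mu> \<longleftrightarrow> sets \<mu> = sets borel \<and> finite_measure \<mu> \<and> emeasure \<mu> (- {0..1}) = 0"

lemma on_unit_intervalD:
  assumes "on_unit_interval \<mu>"
  shows "sets \<mu> = sets borel" "finite_measure \<mu>" "space \<mu> = UNIV" "AE x in \<mu>. x \<in> {0..1}"
proof -
  show s: "sets \<mu> = sets borel" and "finite_measure \<mu>" using assms by (auto simp: on_unit_interval_def)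
  show sp: "space \<mu> = UNIV" using sets_eq_imp_space_eq[OF s] by simp
  have "- {0..1} \<in> null_sets \<mu>" using assms s by (auto simp: on_unit_interval_def null_sets_def)
  then show "AE x in \<mu>. x \<in> {0..1}" by (rule AE_I') auto
qed

lemma continuous_bounded_unit:
  fixes g :: "real \<Rightarrow> real"
  assumes "continuous_on UNIV g"
  shows "\<exists>C. \<forall>x\<in>{0..1}. \<bar>g x\<bar> \<le> C"
proof -
  have "compact (g ` {0..1})"
    by (intro compact_continuous_image continuous_on_subset[OF assms]) auto
  then have "bounded (g ` {0..1})" by (rule compact_imp_bounded)
  then show ?thesis by (auto simp: bounded_iff)
qed

lemma integrable_on_unit:
  fixes g :: "real \<Rightarrow> real"
  assumes \<mu>: "on_unit_interval \<mu>" and g: "continuous_on UNIV g"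
  shows "integrable \<mu> g"
proof -
  obtain C where C: "\<forall>x\<in>{0..1}. \<bar>g x\<bar> \<le> C" using continuous_bounded_unit[OF g] by blast
  interpret finite_measure \<mu> by (rule on_unit_intervalD[OF \<mu>])
  show ?thesis
  proof (rule integrable_const_bound)
    show "AE x in \<mu>. norm (g x) \<le> C" using on_unit_intervalD(4)[OF \<mu>] by eventually_elim (use C in auto)
    show "g \<in> borel_measurable \<mu>"
      using borel_measurable_continuous_onI[OF g] on_unit_intervalD(1)[OF \<mu>] measurable_cong_sets by blast
  qed
qed

text \<open>Only the point 1 gets the index \<open>Suc m\<close>; this is why sums over the cells
  run up to \<open>Suc m\<close>.\<close>

definition cell :: "nat \<Rightarrow> nat \<Rightarrow> real set" where
  "cell m r = {x \<in> {0..1}. \<lfloor>real (Suc m) * x\<rfloor> = int r}"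

lemma cell_borel [measurable]: "cell m r \<in> sets borel"
  unfolding cell_def by measurable

text \<open>Sums over cells carry positivity of the matrix values on Borel sets over to integrals of
  quadratic forms with varying vectors.\<close>

lemma riemann_stieltjes_limit:
  fixes g :: "real \<Rightarrow> real"
  assumes \<mu>: "on_unit_interval \<mu>" and g: "continuous_on UNIV g"
  shows "(\<lambda>m. \<Sum>r\<le>Suc m. g (real r / real (Suc m)) * measure \<mu> (cell m r)) \<longlonglongrightarrow> (\<integral>x. g x \<partial>\<mu>)"
proof -
  obtain C where C: "\<forall>x\<in>{0..1}. \<bar>g x\<bar> \<le> C" using continuous_bounded_unit[OF g] by blast
  interpret finite_measure \<mu> by (rule on_unit_intervalD[OF \<mu>])
  note sets_\<mu> [measurable_cong] = on_unit_intervalD(1)[OF \<mu>]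
  define h where "h m x = (\<Sum>r\<le>Suc m. g (real r / real (Suc m)) * indicator (cell m r) x)" for m and x :: real
  have h: "h m x = g (of_int \<lfloor>real (Suc m) * x\<rfloor> / real (Suc m))" if x: "x \<in> {0..1}" for m x
  proof -
    define k where "k = nat \<lfloor>real (Suc m) * x\<rfloor>"
    have "0 \<le> real (Suc m) * x" "real (Suc m) * x \<le> real (Suc m)" using x by (auto intro: mult_left_le)
    then have "0 \<le> \<lfloor>real (Suc m) * x\<rfloor>" "\<lfloor>real (Suc m) * x\<rfloor> \<le> int (Suc m)"
      using floor_mono[of "real (Suc m) * x" "real (Suc m)"] by (simp_all del: of_nat_Suc)
    then have k: "int k = \<lfloor>real (Suc m) * x\<rfloor>" "k \<le> Suc m"
      unfolding k_def by linarith+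
    have "h m x = (\<Sum>r\<le>Suc m. if r = k then g (real k / real (Suc m)) else 0)"
      unfolding h_def by (intro sum.cong refl) (use x k(1) in \<open>auto simp: cell_def indicator_def\<close>)
    also have "\<dots> = g (real k / real (Suc m))" using k(2) by (subst sum.delta) (simp_all del: of_nat_Suc)
    finally show ?thesis unfolding k(1)[symmetric] by simp
  qed
  have fl: "of_int \<lfloor>real (Suc m) * x\<rfloor> / real (Suc m) \<in> {0..1}" if x: "x \<in> {0..1}" for m x
  proof -
    have "of_int \<lfloor>real (Suc m) * x\<rfloor> \<le> real (Suc m) * x" by (rule of_int_floor_le)
    also have "\<dots> \<le> real (Suc m)" using x by (auto intro: mult_left_le)
    finally have "of_int \<lfloor>real (Suc m) * x\<rfloor> \<le> real (Suc m)" .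
    moreover have "0 \<le> \<lfloor>real (Suc m) * x\<rfloor>" using x by simp
    ultimately show ?thesis by (simp add: divide_le_eq)
  qed
  have "(\<lambda>m. \<integral>x. h m x \<partial>\<mu>) \<longlonglongrightarrow> (\<integral>x. g x \<partial>\<mu>)"
  proof (rule integral_dominated_convergence[where w = "\<lambda>_. C"])
    show "g \<in> borel_measurable \<mu>" using integrable_on_unit[OF \<mu> g] by auto
    show "h m \<in> borel_measurable \<mu>" for m unfolding h_def by measurable
    show "AE x in \<mu>. (\<lambda>m. h m x) \<longlonglongrightarrow> g x" using on_unit_intervalD(4)[OF \<mu>]
    proof eventually_elim
      case (elim x)
      have "(\<lambda>m. real_of_int \<lfloor>real (Suc m) * x\<rfloor> / real (Suc m)) \<longlonglongrightarrow> x"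
      proof (rule tendsto_sandwich[of "\<lambda>m. x - 1 / real (Suc m)" _ _ "\<lambda>m. x"])
        show "(\<lambda>m. x - 1 / real (Suc m)) \<longlonglongrightarrow> x"
          using tendsto_diff[OF tendsto_const LIMSEQ_inverse_real_of_nat, of x] by (simp add: inverse_eq_divide)
        show "\<forall>\<^sub>F m in sequentially. x - 1 / real (Suc m) \<le> real_of_int \<lfloor>real (Suc m) * x\<rfloor> / real (Suc m)"
        proof (intro always_eventually allI)
          fix m
          have "real (Suc m) * x - 1 \<le> of_int \<lfloor>real (Suc m) * x\<rfloor>" by linarith
          then have "(real (Suc m) * x - 1) / real (Suc m) \<le> of_int \<lfloor>real (Suc m) * x\<rfloor> / real (Suc m)"
            by (rule divide_right_mono) simp
          then show "x - 1 / real (Suc m) \<le> real_of_int \<lfloor>real (Suc m) * x\<rfloor> / real (Suc m)"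
            by (simp add: diff_divide_distrib del: of_nat_Suc)
        qed
        show "\<forall>\<^sub>F m in sequentially. real_of_int \<lfloor>real (Suc m) * x\<rfloor> / real (Suc m) \<le> x"
        proof (intro always_eventually allI)
          fix m
          have "real_of_int \<lfloor>real (Suc m) * x\<rfloor> \<le> real (Suc m) * x" by (rule of_int_floor_le)
          then show "real_of_int \<lfloor>real (Suc m) * x\<rfloor> / real (Suc m) \<le> x"
            by (simp add: divide_le_eq mult.commute del: of_nat_Suc)
        qed
      qed simp
      then have "(\<lambda>m. g (real_of_int \<lfloor>real (Suc m) * x\<rfloor> / real (Suc m))) \<longlonglongrightarrow> g x"
        using g by (auto simp: continuous_on_eq_continuous_at isCont_def intro: isCont_tendsto_compose)
      then show ?case unfolding h[OF elim] .
    qed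
    show "AE x in \<mu>. norm (h m x) \<le> C" for m using on_unit_intervalD(4)[OF \<mu>]
      by eventually_elim (use C fl h in auto)
  qed simp
  moreover have "(\<integral>x. h m x \<partial>\<mu>) = (\<Sum>r\<le>Suc m. g (real r / real (Suc m)) * measure \<mu> (cell m r))" for m
    unfolding h_def by (subst Bochner_Integration.integral_sum)
      (auto intro!: integrable_real_mult_indicator simp: emeasure_eq_measure)
  ultimately show ?thesis by simp
qed

lemma sqrt_unit_interval:
  fixes x :: real
  assumes "x \<in> {0..1}"
  shows "sqrt x \<in> {-1..1}" "- sqrt x \<in> {-1..1}"
proof -
  have "0 \<le> sqrt x" "sqrt x \<le> 1" using assms by auto
  then show "sqrt x \<in> {-1..1}" "- sqrt x \<in> {-1..1}" unfolding atLeastAtMost_iff by linarith+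
qed

text \<open>The integral of \<open>f\<close> against the symmetrization of \<open>\<mu>\<close>.\<close>

definition half_sum :: "real poly \<Rightarrow> real measure \<Rightarrow> real" where
  "half_sum f \<mu> = ((\<integral>x. poly f (sqrt x) \<partial>\<mu>) + (\<integral>x. poly f (- sqrt x) \<partial>\<mu>)) / 2"

lemma continuous_poly_sqrt:
  "continuous_on UNIV (\<lambda>x. poly f (sqrt x) :: real)" "continuous_on UNIV (\<lambda>x. poly f (- sqrt x) :: real)"
  by (intro continuous_intros)+

lemma half_sum_moments:
  assumes \<mu>: "on_unit_interval \<mu>"
  shows "(\<Sum>a\<le>degree f. coeff f a * (if even a then \<integral>x. x ^ (a div 2) \<partial>\<mu> else 0)) = half_sum f \<mu>"
proof -
  have i: "integrable \<mu> (\<lambda>x. (sqrt x) ^ a)" "integrable \<mu> (\<lambda>x. (- sqrt x) ^ a)" for a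
    by (intro integrable_on_unit[OF \<mu>] continuous_intros)+
  have m: "(if even a then \<integral>x. x ^ (a div 2) \<partial>\<mu> else 0) = ((\<integral>x. (sqrt x) ^ a \<partial>\<mu>) + (\<integral>x. (- sqrt x) ^ a \<partial>\<mu>)) / 2" for a
  proof (cases "even a")
    case True
    then obtain b where b: "a = 2 * b" by blast
    have "(\<integral>x. (sqrt x) ^ a \<partial>\<mu>) = (\<integral>x. x ^ b \<partial>\<mu>)"
    proof (rule integral_cong_AE)
      show "AE x in \<mu>. (sqrt x) ^ a = x ^ b" using on_unit_intervalD(4)[OF \<mu>]
        by eventually_elim (simp add: b power_mult)
      show "(\<lambda>x. sqrt x ^ a) \<in> borel_measurable \<mu>" by (rule borel_measurable_integrable[OF i(1)])
      show "(\<lambda>x. x ^ b) \<in> borel_measurable \<mu>"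
        by (rule borel_measurable_integrable, rule integrable_on_unit[OF \<mu>]) (intro continuous_intros)
    qed
    moreover have "(- sqrt x) ^ a = (sqrt x) ^ a" for x using True by simp
    ultimately show ?thesis using True b by simp
  next
    case False
    then have "(- sqrt x) ^ a = - ((sqrt x) ^ a)" for x by simp
    then show ?thesis using False by simp
  qed
  have "half_sum f \<mu> = (\<Sum>a\<le>degree f. coeff f a * (((\<integral>x. (sqrt x) ^ a \<partial>\<mu>) + (\<integral>x. (- sqrt x) ^ a \<partial>\<mu>)) / 2))"
    unfolding half_sum_def poly_altdef using i
    by (simp add: sum.distrib[symmetric] sum_divide_distrib distrib_left)
  then show ?thesis unfolding m by simp
qed

context
  fixes p P N
  assumes mm: "matrix_measure p P N"
begin

lemma mm_unit: "i < p \<Longrightarrow> j < p \<Longrightarrow> on_unit_interval (P i j)" "i < p \<Longrightarrow> j < p \<Longrightarrow> on_unit_interval (N i j)"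
  using mm unfolding matrix_measure_def on_unit_interval_def by auto

lemma mm_limit:
  fixes g :: "real \<Rightarrow> real"
  assumes "i < p" "j < p" "continuous_on UNIV g"
  shows "(\<lambda>m. \<Sum>r\<le>Suc m. g (real r / real (Suc m)) * mm_value P N (cell m r) i j) \<longlonglongrightarrow> (\<integral>x. g x \<partial>P i j) - (\<integral>x. g x \<partial>N i j)"
  using tendsto_diff[OF riemann_stieltjes_limit[OF mm_unit(1)[OF assms(1,2)] assms(3)]
      riemann_stieltjes_limit[OF mm_unit(2)[OF assms(1,2)] assms(3)]]
  unfolding mm_value_def by (simp add: sum_subtractf right_diff_distrib)

lemma mm_psd: "B \<in> sets borel \<Longrightarrow> psd p (mm_value P N B)"
  using mm by (auto simp: matrix_measure_def)

lemma mm_symmetric: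
  fixes g :: "real \<Rightarrow> real"
  assumes "i < p" "j < p" "continuous_on UNIV g"
  shows "(\<integral>x. g x \<partial>P i j) - (\<integral>x. g x \<partial>N i j) = (\<integral>x. g x \<partial>P j i) - (\<integral>x. g x \<partial>N j i)"
proof -
  have "mm_value P N (cell m r) i j = mm_value P N (cell m r) j i" for m r
    using mm_psd[OF cell_borel, of m r] assms unfolding psd_def by blast
  then show ?thesis
    using mm_limit[OF assms] mm_limit[OF assms(2,1,3)] by (auto intro: LIMSEQ_unique)
qed

lemma mm_quad_nonneg:
  fixes w :: "real \<Rightarrow> real" and e :: "nat \<Rightarrow> real \<Rightarrow> real"
  assumes w: "continuous_on UNIV w" "\<And>x. x \<in> {0..1} \<Longrightarrow> w x \<ge> 0" and e: "\<And>i. continuous_on UNIV (e i)"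
  shows "(\<Sum>i<p. \<Sum>j<p. (\<integral>x. w x * (e i x * e j x) \<partial>P i j) - (\<integral>x. w x * (e i x * e j x) \<partial>N i j)) \<ge> 0"
proof -
  let ?x = "\<lambda>m r. real r / real (Suc m)"
  have "(\<lambda>m. \<Sum>i<p. \<Sum>j<p. \<Sum>r\<le>Suc m. w (?x m r) * (e i (?x m r) * e j (?x m r)) * mm_value P N (cell m r) i j)
     \<longlonglongrightarrow> (\<Sum>i<p. \<Sum>j<p. (\<integral>x. w x * (e i x * e j x) \<partial>P i j) - (\<integral>x. w x * (e i x * e j x) \<partial>N i j))"
    using e w(1) by (intro tendsto_sum mm_limit continuous_on_mult) auto
  moreover have "(\<Sum>i<p. \<Sum>j<p. \<Sum>r\<le>Suc m. w (?x m r) * (e i (?x m r) * e j (?x m r)) * mm_value P N (cell m r) i j) \<ge> 0" for m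
  proof -
    have "(\<Sum>i<p. \<Sum>j<p. \<Sum>r\<le>Suc m. w (?x m r) * (e i (?x m r) * e j (?x m r)) * mm_value P N (cell m r) i j)
      = (\<Sum>i<p. \<Sum>r\<le>Suc m. \<Sum>j<p. w (?x m r) * (e i (?x m r) * e j (?x m r)) * mm_value P N (cell m r) i j)"
      by (rule sum.cong[OF refl], rule sum.swap)
    also have "\<dots> = (\<Sum>r\<le>Suc m. \<Sum>i<p. \<Sum>j<p. w (?x m r) * (e i (?x m r) * e j (?x m r)) * mm_value P N (cell m r) i j)"
      by (rule sum.swap)
    also have "\<dots> = (\<Sum>r\<le>Suc m. w (?x m r) * (\<Sum>i<p. \<Sum>j<p. e i (?x m r) * mm_value P N (cell m r) i j * e j (?x m r)))"
      by (simp add: sum_distrib_left mult_ac)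
    also have "\<dots> \<ge> 0"
    proof (rule sum_nonneg)
      fix r assume "r \<in> {..Suc m}"
      then have "?x m r \<in> {0..1}" by (simp add: divide_le_eq)
      moreover have "0 \<le> (\<Sum>i<p. \<Sum>j<p. e i (?x m r) * mm_value P N (cell m r) i j * e j (?x m r))"
        by (rule mm_psd[OF cell_borel, unfolded psd_def, THEN conjunct2, rule_format])
      ultimately show "0 \<le> w (?x m r) * (\<Sum>i<p. \<Sum>j<p. e i (?x m r) * mm_value P N (cell m r) i j * e j (?x m r))"
        using w(2) by (intro mult_nonneg_nonneg) auto
    qed
    finally show ?thesis .
  qed
  ultimately show ?thesis by (intro LIMSEQ_le_const[of _ _ 0]) auto
qed

lemma mm_moment_fun:
  assumes "i < p" "j < p"
  shows "moment_fun (mm_moment P N) i j f = half_sum f (P i j) - half_sum f (N i j)"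
proof -
  have "moment_fun (mm_moment P N) i j f =
     (\<Sum>a\<le>degree f. coeff f a * (if even a then \<integral>x. x ^ (a div 2) \<partial>P i j else 0))
     - (\<Sum>a\<le>degree f. coeff f a * (if even a then \<integral>x. x ^ (a div 2) \<partial>N i j else 0))"
    unfolding moment_fun_def sym_moment_def mm_moment_def sum_subtractf[symmetric]
    by (intro sum.cong refl) (auto simp: right_diff_distrib)
  then show ?thesis by (simp only: half_sum_moments[OF mm_unit(1)[OF assms]] half_sum_moments[OF mm_unit(2)[OF assms]])
qed

lemma mm_weighted_nonneg:
  assumes w: "\<And>x. x \<in> {-1..1} \<Longrightarrow> poly w x \<ge> 0"
  shows "(\<Sum>i<p. \<Sum>j<p. moment_fun (mm_moment P N) i j (w * (q i * q j))) \<ge> 0"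
proof -
  have 1: "(\<Sum>i<p. \<Sum>j<p. (\<integral>x. poly w (sqrt x) * (poly (q i) (sqrt x) * poly (q j) (sqrt x)) \<partial>P i j)
     - (\<integral>x. poly w (sqrt x) * (poly (q i) (sqrt x) * poly (q j) (sqrt x)) \<partial>N i j)) \<ge> 0" (is "?a \<ge> 0")
    by (rule mm_quad_nonneg) (use sqrt_unit_interval w in \<open>auto intro!: continuous_intros\<close>)
  have 2: "(\<Sum>i<p. \<Sum>j<p. (\<integral>x. poly w (- sqrt x) * (poly (q i) (- sqrt x) * poly (q j) (- sqrt x)) \<partial>P i j)
     - (\<integral>x. poly w (- sqrt x) * (poly (q i) (- sqrt x) * poly (q j) (- sqrt x)) \<partial>N i j)) \<ge> 0" (is "?b \<ge> 0")
    by (rule mm_quad_nonneg) (use sqrt_unit_interval w in \<open>auto intro!: continuous_intros\<close>)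
  have "(\<Sum>i<p. \<Sum>j<p. moment_fun (mm_moment P N) i j (w * (q i * q j))) = (?a + ?b) / 2"
    unfolding sum.distrib[symmetric] sum_divide_distrib
    by (intro sum.cong refl) (simp add: mm_moment_fun half_sum_def field_simps)
  then show ?thesis using 1 2 by simp
qed

lemma mm_moment_sym: "i < p \<Longrightarrow> j < p \<Longrightarrow> mm_moment P N l i j = mm_moment P N l j i"
  unfolding mm_moment_def by (rule mm_symmetric) (auto intro!: continuous_intros)

lemma mm_moment_0:
  assumes "i < p" "j < p"
  shows "mm_moment P N 0 i j = (if i = j then 1 else 0)"
proof -
  have m: "measure \<mu> (space \<mu>) = measure \<mu> {0..1}" if \<mu>: "on_unit_interval \<mu>" for \<mu>
  proof -
    interpret finite_measure \<mu> by (rule on_unit_intervalD[OF \<mu>])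
    have "measure \<mu> (space \<mu> - {0..1}) = 0"
      using \<mu> on_unit_intervalD(3)[OF \<mu>] by (simp add: on_unit_interval_def measure_def Compl_eq_Diff_UNIV)
    then show ?thesis
      using finite_measure_compl[of "{0..1}"] on_unit_intervalD(1)[OF \<mu>] by simp
  qed
  have "mm_moment P N 0 i j = mm_value P N {0..1} i j"
    by (simp add: mm_moment_def mm_value_def m[OF mm_unit(1)[OF assms], symmetric] m[OF mm_unit(2)[OF assms], symmetric])
  then show ?thesis using mm assms by (simp add: matrix_measure_def)
qed

end

section \<open>Strict positivity of mixtures with Lebesgue measure\<close>

definition unit_lebesgue :: "real measure" where
  "unit_lebesgue = density lborel (\<lambda>x. ennreal (indicator {0..1} x))"

definition lebesgue_moment :: "nat \<Rightarrow> nat \<Rightarrow> nat \<Rightarrow> real" where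
  "lebesgue_moment l i j = (if i = j then \<integral>x. x ^ l \<partial>unit_lebesgue else 0)"

lemma on_unit_interval_lebesgue: "on_unit_interval unit_lebesgue"
proof -
  have e: "emeasure unit_lebesgue A = emeasure lborel (A \<inter> {0..1})" if "A \<in> sets borel" for A
    using that unfolding unit_lebesgue_def by (subst emeasure_density) (auto simp: ennreal_indicator indicator_inter_arith[symmetric] Int_commute)
  have "finite_measure unit_lebesgue" 
    by (rule finite_measureI) (use e[of UNIV] in \<open>simp add: unit_lebesgue_def\<close>)
  then show ?thesis using e[of "- {0..1}"] by (simp add: on_unit_interval_def unit_lebesgue_def)
qed

lemma integral_unit_lebesgue_pos:
  assumes g: "continuous_on UNIV g" "\<And>x. x \<in> {0..1} \<Longrightarrow> g x \<ge> (0::real)" and x: "x \<in> {0..1}" "g x \<noteq> 0"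
  shows "(\<integral>x. g x \<partial>unit_lebesgue) > 0"
proof -
  have "(\<integral>x. g x \<partial>unit_lebesgue) = (\<integral>x. indicator {0..1} x *\<^sub>R g x \<partial>lborel)"
    unfolding unit_lebesgue_def using borel_measurable_continuous_onI[OF g(1)]
    by (subst integral_density) auto
  also have "\<dots> = integral {0..1} g"
    using borel_integrable_atLeastAtMost'[of 0 1 g] continuous_on_subset[OF g(1)]
    by (intro set_borel_integral_eq_integral(2)[unfolded set_lebesgue_integral_def]) auto
  finally have e: "(\<integral>x. g x \<partial>unit_lebesgue) = integral {0..1} g" .
  have c: "continuous_on {0..1} g" using continuous_on_subset[OF g(1)] by auto
  have "integral {0..1} g \<noteq> 0"
    using integral_eq_0_iff[of 0 1 g] c g(2) x by auto
  moreover have "integral {0..1} g \<ge> 0"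
    by (rule integral_nonneg) (use c g(2) in \<open>auto intro: integrable_continuous_interval\<close>)
  ultimately show ?thesis using e by simp
qed

lemma poly_nonzero_point:
  assumes "f \<noteq> (0 :: real poly)"
  shows "\<exists>x\<in>{0<..<1}. poly f (- sqrt x) \<noteq> 0"
proof (rule ccontr)
  assume "\<not> ?thesis"
  then have "poly f (- sqrt x) = 0" if "x \<in> {0<..<1}" for x using that by blast
  moreover have "\<exists>x\<in>{0<..<1}. y = - sqrt x" if "y \<in> {-1<..<0}" for y
    using that by (intro bexI[of _ "y\<^sup>2"]) (auto simp: abs_square_less_1)
  ultimately have "{-1<..<0} \<subseteq> {x. poly f x = 0}" by (metis (mono_tags, lifting) mem_Collect_eq subsetI)
  then have "finite {-1<..<0::real}" using poly_roots_finite[OF assms] by (rule finite_subset)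
  then show False using infinite_Ioo[of "-1" "0::real"] by simp
qed

lemma lebesgue_moment_fun:
  "moment_fun lebesgue_moment i j f = (if i = j then half_sum f unit_lebesgue else 0)"
  unfolding half_sum_moments[OF on_unit_interval_lebesgue, symmetric] moment_fun_def sym_moment_def lebesgue_moment_def
  by (cases "i = j") (simp_all cong: if_cong)

text \<open>A nonzero polynomial is nonzero somewhere in \<open>(-1, 0)\<close>, where the weight is
  positive, and continuity then makes the integral positive. The weights to come are
  \<open>1\<close> and \<open>1 - x\<close>.\<close>

lemma lebesgue_weighted_pos:
  assumes w: "\<And>x. x \<in> {-1..1} \<Longrightarrow> poly w x \<ge> 0" "\<And>x. x \<in> {-1<..<0} \<Longrightarrow> poly w x > 0"
    and q: "i0 < p" "q i0 \<noteq> 0"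
  shows "(\<Sum>i<p. \<Sum>j<p. moment_fun lebesgue_moment i j (w * (q i * q j))) > 0"
proof -
  have "(\<Sum>i<p. \<Sum>j<p. moment_fun lebesgue_moment i j (w * (q i * q j))) = (\<Sum>i<p. half_sum (w * (q i * q i)) unit_lebesgue)"
    unfolding lebesgue_moment_fun by (intro sum.cong refl) simp
  moreover have nn: "(\<integral>x. poly (w * (q i * q i)) (sqrt x) \<partial>unit_lebesgue) \<ge> 0"
     "(\<integral>x. poly (w * (q i * q i)) (- sqrt x) \<partial>unit_lebesgue) \<ge> 0" for i
    by (rule integral_nonneg_AE, rule eventually_mono[OF on_unit_intervalD(4)[OF on_unit_interval_lebesgue]],
        use sqrt_unit_interval w(1) in simp)+
  have "(\<integral>x. poly (w * (q i0 * q i0)) (- sqrt x) \<partial>unit_lebesgue) > 0"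
  proof -
    obtain x where x: "x \<in> {0<..<1}" "poly (q i0) (- sqrt x) \<noteq> 0" using poly_nonzero_point[OF q(2)] by blast
    have "poly w (- sqrt x) > 0" using x by (intro w(2)) auto
    then show ?thesis using x
      by (intro integral_unit_lebesgue_pos[where x = x] continuous_poly_sqrt)
         (use sqrt_unit_interval w(1) in auto)
  qed
  then have "half_sum (w * (q i0 * q i0)) unit_lebesgue > 0" using nn(1)[of i0] by (simp add: half_sum_def)
  moreover have "half_sum (w * (q i * q i)) unit_lebesgue \<ge> 0" for i using nn[of i] by (simp add: half_sum_def)
  ultimately show ?thesis using q(1) by (simp add: sum_pos2[of _ i0])
qed

lemma lebesgue_moment_0: "lebesgue_moment 0 i j = (if i = j then 1 else 0)"
proof -
  have "emeasure unit_lebesgue UNIV = 1"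
    unfolding unit_lebesgue_def by (subst emeasure_density) (auto simp: ennreal_indicator)
  then show ?thesis by (simp add: lebesgue_moment_def measure_def on_unit_intervalD(3)[OF on_unit_interval_lebesgue])
qed

lemma moment_fun_linear:
  "moment_fun (\<lambda>l i j. a * s l i j + b * s' l i j) i j f = a * moment_fun s i j f + b * moment_fun s' i j f"
  unfolding moment_fun_def sym_moment_def sum_distrib_left sum.distrib[symmetric]
  by (intro sum.cong refl) (auto simp: algebra_simps)

lemma mixture_positive:
  assumes mm: "matrix_measure p P N" and e: "0 < e" "e \<le> 1"
  shows "positive_moments p (\<lambda>l i j. (1 - e) * mm_moment P N l i j + e * lebesgue_moment l i j)"
    (is "positive_moments p ?s")
  unfolding positive_moments_def
proof (intro conjI allI impI)
  show "?s l i j = ?s l j i" if "i < p" "j < p" for l i j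
    using mm_moment_sym[OF mm that] by (simp add: lebesgue_moment_def)
  show "?s 0 i j = (if i = j then 1 else 0)" if "i < p" "j < p" for i j
    using mm_moment_0[OF mm that] by (simp add: lebesgue_moment_0)
  fix q :: "nat \<Rightarrow> real poly" assume "\<exists>i<p. q i \<noteq> 0"
  then obtain i0 where q: "i0 < p" "q i0 \<noteq> 0" by blast
  have pos: "(\<Sum>i<p. \<Sum>j<p. moment_fun ?s i j (w * (q i * q j))) > 0"
    if w: "\<And>x. x \<in> {-1..1} \<Longrightarrow> poly w x \<ge> 0" "\<And>x. x \<in> {-1<..<0} \<Longrightarrow> poly w x > 0" for w
  proof -
    have "(\<Sum>i<p. \<Sum>j<p. moment_fun ?s i j (w * (q i * q j)))
       = (1 - e) * (\<Sum>i<p. \<Sum>j<p. moment_fun (mm_moment P N) i j (w * (q i * q j)))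
        + e * (\<Sum>i<p. \<Sum>j<p. moment_fun lebesgue_moment i j (w * (q i * q j)))"
      by (simp add: moment_fun_linear sum.distrib sum_distrib_left)
    then show ?thesis
      using mm_weighted_nonneg[OF mm, of w q] lebesgue_weighted_pos[of w i0 p q] w q e
      by (auto intro!: add_nonneg_pos mult_nonneg_nonneg mult_pos_pos)
  qed
  show "0 < vform p ?s q q" using pos[of 1] by (simp add: vform_def)
  have "0 < (\<Sum>i<p. \<Sum>j<p. moment_fun ?s i j ([:1, -1:] * (q i * q j)))"
    by (rule pos) auto
  also have "\<dots> = vform p ?s q q - vform p ?s q (\<lambda>i. [:0, 1:] * q i)"
    unfolding vform_def sum_subtractf[symmetric]
  proof (intro sum.cong refl)
    fix i j
    have "[:1, -1:] * (q i * q j) = q i * q j + smult (-1) (q i * ([:0, 1:] * q j))"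
      by (simp add: mult_ac)
    then show "moment_fun ?s i j ([:1, -1:] * (q i * q j)) = moment_fun ?s i j (q i * q j) - moment_fun ?s i j (q i * ([:0, 1:] * q j))"
      by (simp only: moment_fun_add moment_fun_smult)
  qed
  finally show "vform p ?s q (\<lambda>i. [:0, 1:] * q i) < vform p ?s q q" by simp
qed

section \<open>The moment space\<close>

lemma finite_coords: "finite (coords p n)"
  by (rule finite_subset[of _ "{1..n} \<times> {..<p} \<times> {..<p}"]) (auto simp: coords_def)

lemma coordsD: "(l, i, j) \<in> coords p n \<longleftrightarrow> 1 \<le> l \<and> l \<le> n \<and> i \<le> j \<and> j < p"
  by (auto simp: coords_def)

lemma space_leb_sym: "space (leb_sym p n) = extensional (coords p n)"
  by (auto simp: leb_sym_def space_PiM PiE_def)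

lemma closed_in_leb_sym:
  assumes "closed M" "M \<subseteq> extensional (coords p n)"
  shows "M \<in> sets (leb_sym p n)"
proof -
  have "(\<lambda>x. x) -` M \<inter> space (leb_sym p n) \<in> sets (leb_sym p n)"
    using measurable_PiM_fun_borel[of "coords p n"] borel_closed[OF assms(1)]
    unfolding leb_sym_def by (rule measurable_sets)
  then show ?thesis using assms(2) by (simp add: space_leb_sym Int_absorb2)
qed

definition moment_map_n :: "nat \<Rightarrow> nat \<Rightarrow> real \<Rightarrow> (nat \<times> nat \<times> nat \<Rightarrow> real) \<Rightarrow> nat \<times> nat \<times> nat \<Rightarrow> real" where
  "moment_map_n p n t y = restrict (moment_map p t y) (coords p n)"

definition all_admissible :: "nat \<Rightarrow> nat \<Rightarrow> real \<Rightarrow> (nat \<times> nat \<times> nat \<Rightarrow> real) \<Rightarrow> bool" where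
  "all_admissible p n t y \<longleftrightarrow> (\<forall>l\<in>{1..n}. admissible p t y l)"

definition lebesgue_mix :: "nat \<Rightarrow> nat \<Rightarrow> real \<Rightarrow> (nat \<times> nat \<times> nat \<Rightarrow> real) \<Rightarrow> nat \<times> nat \<times> nat \<Rightarrow> real" where
  "lebesgue_mix p n e x = restrict (\<lambda>(l, i, j). (1 - e) * x (l, i, j) + e * lebesgue_moment l i j) (coords p n)"

abbreviation corner_space :: "nat \<Rightarrow> nat \<Rightarrow> (nat \<times> nat \<times> nat \<Rightarrow> real) set" where
  "corner_space p n \<equiv> corner_moments p n ` contractions (block_index p n)"

lemma moment_map_in_corner_space:
  assumes "all_admissible p n t y"
  shows "moment_map_n p n t y \<in> corner_space p n"
proof -
  have g: "admissible p t y l" if "1 \<le> l" "l \<le> n" for l using assms that by (simp add: all_admissible_def)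
  have "moment_map_n p n t y = restrict (\<lambda>(l, i, j). path_weight p (Bfac p t y) (2 * l) 0 i j) (coords p n)"
    unfolding moment_map_n_def
    by (intro restrict_ext) (auto simp: coordsD g moment_map_good simp del: moment_map.simps)
  also have "\<dots> = corner_moments p n (jacobi_matrix p n (Bfac p t y))"
    by (rule corner_moments_jacobi[symmetric])
  finally show ?thesis using jacobi_matrix_contraction[of n p t y] g by blast
qed

lemma shifted_scale:
  assumes "t \<noteq> 0"
  shows "shifted t (\<lambda>x. y x / t) = shifted 1 y"
  using assms by (simp add: shifted_def symmat_def fun_eq_iff)

lemma mix_parametrization:
  assumes S: "S \<in> moment_space p n" and e: "0 < e" "e \<le> 1" and t: "t \<noteq> 0"
  shows "\<exists>y. all_admissible p n t y \<and> moment_map_n p n t y = lebesgue_mix p n e S"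
proof -
  obtain P N where PN: "matrix_measure p P N" "S = restrict (\<lambda>(l, i, j). mm_moment P N l i j) (coords p n)"
    using S by (auto simp: moment_space_def)
  obtain y where y: "\<forall>l. 1 \<le> l \<longrightarrow> l \<le> n \<longrightarrow> admissible p 1 y l"
    "\<forall>l\<le>n. \<forall>i<p. \<forall>j<p. (1 - e) * mm_moment P N l i j + e * lebesgue_moment l i j = path_weight p (Bfac p 1 y) (2 * l) 0 i j"
    using positive_moments_parametrization[OF mixture_positive[OF PN(1) e], of n] by blast
  \<comment> \<open>The parameters were built for \<open>t = 1\<close>; dividing them by
    \<open>t\<close> leaves \<open>shifted\<close>, and with it all factors, unchanged.\<close>
  let ?y = "\<lambda>x. y x / t"
  have W: "Wfac t ?y = Wfac 1 y" by (simp add: Wfac_def[abs_def] shifted_scale[OF t] fun_eq_iff)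
  have C: "Cfac p t ?y = Cfac p 1 y" unfolding Cfac_def[abs_def] W ..
  have B: "Bfac p t ?y = Bfac p 1 y" by (simp add: Bfac_def[abs_def] W C)
  have g: "admissible p t ?y l" if "1 \<le> l" "l \<le> n" for l
    using y(1) that by (simp add: admissible_def W shifted_scale[OF t])
  have "moment_map_n p n t ?y = lebesgue_mix p n e S"
    unfolding moment_map_n_def lebesgue_mix_def
    by (intro restrict_ext) (auto simp: coordsD g moment_map_good B y(2) PN(2) simp del: moment_map.simps)
  moreover have "all_admissible p n t ?y" using g by (simp add: all_admissible_def)
  ultimately show ?thesis by blast
qed

lemma moment_space_extensional: "moment_space p n \<subseteq> extensional (coords p n)"
  by (auto simp: moment_space_def)

lemma mix_0: "x \<in> extensional (coords p n) \<Longrightarrow> lebesgue_mix p n 0 x = x"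
  by (auto simp: lebesgue_mix_def restrict_def extensional_def fun_eq_iff)

text \<open>The corner moments form a closed set that contains every mixture with
  \<open>0 < e < 1\<close>, by the parametrization; letting \<open>e\<close> tend to 0 puts every
  moment vector into it.\<close>

lemma moment_space_eq: "moment_space p n = corner_space p n"
proof
  show "corner_space p n \<subseteq> moment_space p n" using corner_moments_in_moment_space by blast
  show "moment_space p n \<subseteq> corner_space p n"
  proof
    fix S assume S: "S \<in> moment_space p n"
    have "continuous_on UNIV (\<lambda>e. lebesgue_mix p n e S)"
    proof (rule continuous_on_coordinatewise_then_product)
      fix x show "continuous_on UNIV (\<lambda>e. lebesgue_mix p n e S x)"
        by (cases x; cases "x \<in> coords p n") (auto simp: lebesgue_mix_def intro!: continuous_intros)
    qed
    then have "closed ((\<lambda>e. lebesgue_mix p n e S) -` corner_space p n)"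
      using compact_imp_closed[OF compact_corner_moments] by (rule closed_vimage[rotated])
    moreover have "{0<..<1} \<subseteq> (\<lambda>e. lebesgue_mix p n e S) -` corner_space p n"
    proof
      fix e :: real assume "e \<in> {0<..<1}"
      then obtain y where "all_admissible p n 1 y" "moment_map_n p n 1 y = lebesgue_mix p n e S"
        using mix_parametrization[OF S, of e 1] by auto
      then show "e \<in> (\<lambda>e. lebesgue_mix p n e S) -` corner_space p n"
        using moment_map_in_corner_space[of p n 1 y] by simp
    qed
    ultimately have "closure {0<..<1} \<subseteq> (\<lambda>e. lebesgue_mix p n e S) -` corner_space p n"
      by (rule closure_minimal[rotated])
    then have "(0::real) \<in> (\<lambda>e. lebesgue_mix p n e S) -` corner_space p n" by (rule subsetD) (simp add: closure_greaterThanLessThan)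
    then show "S \<in> corner_space p n" using mix_0 S moment_space_extensional by (metis subsetD vimage_eq)
  qed
qed

lemma compact_moment_space: "compact (moment_space p n)"
  unfolding moment_space_eq by (rule compact_corner_moments)

lemma moment_space_sets: "moment_space p n \<in> sets (leb_sym p n)"
  by (rule closed_in_leb_sym[OF compact_imp_closed[OF compact_moment_space] moment_space_extensional])

interpretation lborel_product: product_sigma_finite "\<lambda>_ :: 'i. lborel :: real measure"
  by standard

lemma emeasure_moment_space_finite: "emeasure (leb_sym p n) (moment_space p n) < \<infinity>"
proof -
  have "\<exists>c. \<forall>y\<in>moment_space p n. \<bar>y x\<bar> \<le> c" for x
  proof -
    have "compact ((\<lambda>y. y x) ` moment_space p n)"
      by (intro compact_continuous_image continuous_on_coordinate compact_moment_space)
    then have "bounded ((\<lambda>y. y x) ` moment_space p n)" by (rule compact_imp_bounded)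
    then show ?thesis by (auto simp: bounded_iff)
  qed
  then obtain c where c: "\<And>x y. y \<in> moment_space p n \<Longrightarrow> \<bar>y x\<bar> \<le> c x" by metis
  have "moment_space p n \<subseteq> PiE (coords p n) (\<lambda>x. {- c x..c x})"
  proof
    fix y assume y: "y \<in> moment_space p n"
    have "- c x \<le> y x \<and> y x \<le> c x" for x using c[OF y, of x] by linarith
    then show "y \<in> PiE (coords p n) (\<lambda>x. {- c x..c x})"
      using y moment_space_extensional[of p n] by (auto simp: PiE_def Pi_def)
  qed
  then have "emeasure (leb_sym p n) (moment_space p n) \<le> emeasure (leb_sym p n) (PiE (coords p n) (\<lambda>x. {- c x..c x}))"
    by (rule emeasure_mono) (auto simp: leb_sym_def finite_coords intro!: sets_PiM_I_finite)
  also have "\<dots> = (\<Prod>x\<in>coords p n. emeasure lborel {- c x..c x})"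
    unfolding leb_sym_def by (rule lborel_product.emeasure_PiM) (auto simp: finite_coords)
  also have "\<dots> < \<infinity>" 
    by (auto simp: ennreal_prod_eq_top emeasure_lborel_Icc_eq less_top[symmetric])
  finally show ?thesis .
qed

section \<open>Injectivity of the parametrization\<close>

lemma block_rank_induct:
  assumes "\<And>x. x \<in> coords p n \<Longrightarrow> (\<And>x'. x' \<in> coords p n \<Longrightarrow> block_rank p x' < block_rank p x \<Longrightarrow> Q x') \<Longrightarrow> Q x"
    and "x \<in> coords p n"
  shows "Q x"
  using assms(2)
proof (induction "block_rank p x" arbitrary: x rule: less_induct)
  case less then show ?case using assms(1) by blast
qed

text \<open>In the order of the rank, each moment entry is affine in its own parameter with nonzero
  slope. This holds for all parameters, admissible or not.\<close>

lemma moment_map_inj: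
  assumes eq: "moment_map_n p n t y = moment_map_n p n t y'" and t: "t > 0" and x: "x \<in> coords p n"
  shows "y x = y' x"
  using x
proof (induction x rule: block_rank_induct[where p = p and n = n])
  case (1 x)
  obtain l i j where x: "x = (l, i, j)" by (cases x) auto
  have lij: "(l, i, j) \<in> coords p n" "i < p" "j < p" using 1(1) by (auto simp: x coordsD)
  have m: "moment_map p t y (l, i, j) = moment_map p t y' (l, i, j)"
    using fun_cong[OF eq, of "(l, i, j)"] lij by (simp add: moment_map_n_def del: moment_map.simps)
  have L: "Lfac p t y l i i = Lfac p t y' l i i" "Lfac p t y l j j = Lfac p t y' l j j"
    using moment_map_dep(1)[OF lij(1), of y y' t] 1(2) lij unfolding x by blast+
  have g: "moment_map p t (y((l,i,j) := 0)) (l,i,j) = moment_map p t (y'((l,i,j) := 0)) (l,i,j)"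
    by (rule moment_map_dep(2)[OF lij(1)]) (use 1(2) x in auto)
  have "t * Lfac p t y' l i i * Lfac p t y' l j j * y (l,i,j) = t * Lfac p t y' l i i * Lfac p t y' l j j * y' (l,i,j)"
    using moment_map_affine[OF lij(1), of t y] moment_map_affine[OF lij(1), of t y'] m g L by simp
  moreover have "t * Lfac p t y' l i i * Lfac p t y' l j j \<noteq> 0"
    using lowtriD(1)[OF lowtri_Lfac] lij t by (simp add: less_imp_neq[THEN not_sym])
  ultimately show ?case unfolding x by simp
qed (fact x)

lemma good_agree:
  assumes "\<And>x. x \<in> coords p n \<Longrightarrow> y x = y' x" "1 \<le> l" "l \<le> n"
  shows "admissible p t y l \<longleftrightarrow> admissible p t y' l"
proof -
  have a: "y (l', i, j) = y' (l', i, j)" if "1 \<le> l'" "l' < Suc n" "i \<le> j" "j < p" for l' i j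
    using assms(1) that by (simp add: coordsD)
  have s: "shifted t y l i j = shifted t y' l i j" if "i < p" "j < p" for i j
    using shifted_agree[of "Suc n" p y y' l i j t, OF a] that assms(2,3) by simp
  have "Wfac t y l i j = Wfac t y' l i j" if "i < p" "j < p" for i j
    using Wfac_agree[of "Suc n" p y y' l i j t, OF a] that assms(2,3) by simp
  then have "complement_gram p (Wfac t y l) i j = complement_gram p (Wfac t y' l) i j" if "i < p" "j < p" for i j
    using that unfolding complement_gram_def by (intro arg_cong2[where f="(-)"] sum.cong refl) auto
  then show ?thesis unfolding admissible_def using s pd_cong by metis
qed

text \<open>The mixture has an admissible preimage, and injectivity leaves no other.\<close>

lemma mix_in_good:
  assumes S: "S \<in> moment_space p n" and e: "0 < e" "e \<le> 1" and t: "t > 0"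
    and eq: "moment_map_n p n t y = lebesgue_mix p n e S"
  shows "all_admissible p n t y"
proof -
  obtain y' where y': "all_admissible p n t y'" "moment_map_n p n t y' = lebesgue_mix p n e S"
    using mix_parametrization[OF S e, of t] t by auto
  then have "y x = y' x" if "x \<in> coords p n" for x
    using moment_map_inj[of p n t y y' x] eq t that by simp
  then show ?thesis using y'(1) good_agree[of p n y y'] by (auto simp: all_admissible_def)
qed

section \<open>The moment space shrunk toward the Lebesgue moments\<close>

definition unmix :: "nat \<Rightarrow> nat \<Rightarrow> real \<Rightarrow> (nat \<times> nat \<times> nat \<Rightarrow> real) \<Rightarrow> nat \<times> nat \<times> nat \<Rightarrow> real" where
  "unmix p n e x = restrict (\<lambda>(l, i, j). (x (l, i, j) - e * lebesgue_moment l i j) / (1 - e)) (coords p n)"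

text \<open>For \<open>e\<close> other than 1, the image of the moment space under
  \<open>lebesgue_mix\<close>, written as a preimage under the inverse map so that measurability is
  immediate.\<close>

definition shrunk :: "nat \<Rightarrow> nat \<Rightarrow> real \<Rightarrow> (nat \<times> nat \<times> nat \<Rightarrow> real) set" where
  "shrunk p n e = {x \<in> space (leb_sym p n). unmix p n e x \<in> moment_space p n}"

lemma measurable_coord: "x \<in> coords p n \<Longrightarrow> (\<lambda>y. y x) \<in> borel_measurable (leb_sym p n)"
  using measurable_component_singleton[of x "coords p n" "\<lambda>_. lborel :: real measure"] by (simp add: leb_sym_def)

lemma measurable_leb_symI:
  assumes "\<And>x. x \<in> coords p n \<Longrightarrow> (\<lambda>y. f y x) \<in> borel_measurable M"
  shows "(\<lambda>y. restrict (f y) (coords p n)) \<in> measurable M (leb_sym p n)"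
  unfolding leb_sym_def by (rule measurable_restrict) (use assms in auto)

lemma unmix_measurable: "unmix p n e \<in> measurable (leb_sym p n) (leb_sym p n)"
proof -
  have "(\<lambda>y. restrict (\<lambda>x. (y x - e * (case x of (l, i, j) \<Rightarrow> lebesgue_moment l i j)) / (1 - e)) (coords p n))
     \<in> measurable (leb_sym p n) (leb_sym p n)"
    by (rule measurable_leb_symI) (intro borel_measurable_divide borel_measurable_diff measurable_coord; simp)
  also have "(\<lambda>y. restrict (\<lambda>x. (y x - e * (case x of (l, i, j) \<Rightarrow> lebesgue_moment l i j)) / (1 - e)) (coords p n)) = unmix p n e"
    by (auto simp: unmix_def fun_eq_iff restrict_def)
  finally show ?thesis .
qed

lemma shrunk_sets: "shrunk p n e \<in> sets (leb_sym p n)"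
  using measurable_sets[OF unmix_measurable moment_space_sets, of p n e]
  by (simp add: shrunk_def vimage_def Int_def conj_commute)

lemma mix_unmix: "e \<noteq> 1 \<Longrightarrow> x \<in> extensional (coords p n) \<Longrightarrow> lebesgue_mix p n e (unmix p n e x) = x"
  by (auto simp: lebesgue_mix_def unmix_def fun_eq_iff restrict_def extensional_def)

lemma unmix_mix: "e \<noteq> 1 \<Longrightarrow> x \<in> extensional (coords p n) \<Longrightarrow> unmix p n e (lebesgue_mix p n e x) = x"
  by (auto simp: lebesgue_mix_def unmix_def fun_eq_iff restrict_def extensional_def)

lemma emeasure_shrunk:
  assumes "0 < e" "e < 1"
  shows "emeasure (leb_sym p n) (shrunk p n e) = ennreal ((1 - e) ^ card (coords p n)) * emeasure (leb_sym p n) (moment_space p n)"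
proof -
  let ?I = "coords p n"
  have "emeasure (leb_sym p n) (shrunk p n e) = (\<integral>\<^sup>+x. indicator (shrunk p n e) x \<partial>leb_sym p n)"
    using shrunk_sets by simp
  also have "\<dots> = (\<integral>\<^sup>+y. ennreal (\<Prod>i\<in>?I. 1 - e) * indicator (shrunk p n e)
     (\<lambda>x\<in>?I. e * (case x of (l, i, j) \<Rightarrow> lebesgue_moment l i j) + (1 - e) * y x) \<partial>leb_sym p n)"
    unfolding leb_sym_def
    by (rule triangular_nn_integral[where rk = "block_rank p"])
      (use assms shrunk_sets finite_coords in \<open>auto simp: leb_sym_def[symmetric]\<close>)
  also have "\<dots> = (\<integral>\<^sup>+y. ennreal ((1 - e) ^ card ?I) * indicator (moment_space p n) y \<partial>leb_sym p n)"
  proof (rule nn_integral_cong)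
    fix y assume y: "y \<in> space (leb_sym p n)"
    have m: "(\<lambda>x\<in>?I. e * (case x of (l, i, j) \<Rightarrow> lebesgue_moment l i j) + (1 - e) * y x) = lebesgue_mix p n e y"
      by (auto simp: lebesgue_mix_def fun_eq_iff restrict_def)
    have "lebesgue_mix p n e y \<in> space (leb_sym p n)" by (simp add: lebesgue_mix_def space_leb_sym)
    then have "lebesgue_mix p n e y \<in> shrunk p n e \<longleftrightarrow> y \<in> moment_space p n"
      using unmix_mix[of e y p n] y assms by (simp add: shrunk_def space_leb_sym)
    then show "ennreal (\<Prod>i\<in>?I. 1 - e) * indicator (shrunk p n e)
     (\<lambda>x\<in>?I. e * (case x of (l, i, j) \<Rightarrow> lebesgue_moment l i j) + (1 - e) * y x)
      = ennreal ((1 - e) ^ card ?I) * indicator (moment_space p n) y"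
      unfolding m by (simp add: indicator_def)
  qed
  also have "\<dots> = ennreal ((1 - e) ^ card ?I) * emeasure (leb_sym p n) (moment_space p n)"
    using moment_space_sets by (simp add: nn_integral_cmult)
  finally show ?thesis .
qed

lemma shrunk_subset:
  assumes "0 < e" "e < 1"
  shows "shrunk p n e \<subseteq> moment_space p n"
proof
  fix x assume x: "x \<in> shrunk p n e"
  then have "lebesgue_mix p n e (unmix p n e x) = x" using mix_unmix[of e x p n] assms by (simp add: shrunk_def space_leb_sym)
  moreover obtain y where "all_admissible p n 1 y" "moment_map_n p n 1 y = lebesgue_mix p n e (unmix p n e x)"
    using mix_parametrization[of "unmix p n e x" p n e 1] x assms by (auto simp: shrunk_def)
  ultimately show "x \<in> moment_space p n" using moment_map_in_corner_space[of p n 1 y] by (simp add: moment_space_eq)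
qed

lemma shrunk_good:
  assumes "0 < e" "e < 1" "t > 0" "moment_map_n p n t y \<in> shrunk p n e"
  shows "all_admissible p n t y"
proof -
  let ?x = "moment_map_n p n t y"
  have "lebesgue_mix p n e (unmix p n e ?x) = ?x" using mix_unmix[of e ?x p n] assms by (simp add: shrunk_def space_leb_sym)
  then show ?thesis using mix_in_good[of "unmix p n e ?x" p n e t y] assms by (auto simp: shrunk_def)
qed

text \<open>The shrunk copies have \<open>(1 - e) ^ d\<close> times the volume of the moment space,
  which is finite; this tends to all of it as \<open>e\<close> tends to 0.\<close>

lemma moment_space_boundary_null:
  "emeasure (leb_sym p n) (moment_space p n - (\<Union>m. shrunk p n (1 / real (m + 2)))) = 0"
proof -
  \<comment> \<open>The offset 2 keeps \<open>e\<close> strictly below 1, where mixing can be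
    undone.\<close>
  let ?M = "leb_sym p n" and ?e = "\<lambda>m. 1 / real (m + 2)"
  have e: "0 < ?e m" "?e m < 1" for m by auto
  let ?v = "measure ?M (moment_space p n)"
  have fin: "emeasure ?M (moment_space p n) = ennreal ?v"
    using emeasure_moment_space_finite[of p n] by (intro emeasure_eq_ennreal_measure) auto
  have le: "emeasure ?M (moment_space p n - (\<Union>m. shrunk p n (?e m))) \<le> ennreal (?v - (1 - ?e m) ^ card (coords p n) * ?v)" for m
  proof -
    have "emeasure ?M (moment_space p n - (\<Union>m. shrunk p n (?e m))) \<le> emeasure ?M (moment_space p n - shrunk p n (?e m))"
      by (rule emeasure_mono) (use moment_space_sets shrunk_sets in auto)
    also have "\<dots> = emeasure ?M (moment_space p n) - emeasure ?M (shrunk p n (?e m))"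
      using emeasure_moment_space_finite emeasure_shrunk[OF e] fin
      by (intro emeasure_Diff moment_space_sets shrunk_sets shrunk_subset e) (auto simp: ennreal_mult_eq_top_iff)
    also have "\<dots> = ennreal (?v - (1 - ?e m) ^ card (coords p n) * ?v)"
      unfolding emeasure_shrunk[OF e] fin using e[of m]
      by (simp add: ennreal_mult[symmetric] ennreal_minus)
    finally show ?thesis .
  qed
  have "(\<lambda>m. ?e m) \<longlonglongrightarrow> 0"
    using LIMSEQ_ignore_initial_segment[OF lim_1_over_n, of 2] by simp
  then have "(\<lambda>m. ?v - (1 - ?e m) ^ card (coords p n) * ?v) \<longlonglongrightarrow> ?v - (1 - 0) ^ card (coords p n) * ?v"
    by (intro tendsto_intros)
  then have "(\<lambda>m. ennreal (?v - (1 - ?e m) ^ card (coords p n) * ?v)) \<longlonglongrightarrow> ennreal 0"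
    by (intro tendsto_ennrealI) simp
  then have "emeasure ?M (moment_space p n - (\<Union>m. shrunk p n (?e m))) \<le> ennreal 0"
    using le by (intro LIMSEQ_le_const) auto
  then show ?thesis by simp
qed

section \<open>Change of variables on the moment space\<close>

definition jacobian_entry :: "nat \<Rightarrow> real \<Rightarrow> nat \<times> nat \<times> nat \<Rightarrow> (nat \<times> nat \<times> nat \<Rightarrow> real) \<Rightarrow> real" where
  "jacobian_entry p t = (\<lambda>(l, i, j) y. if j < p \<and> i < p then t * Lfac p t y l i i * Lfac p t y l j j else 1)"

lemma measurable_leb_sym_borel: "f \<in> borel_measurable borel \<Longrightarrow> f \<in> borel_measurable (leb_sym p n)"
  unfolding leb_sym_def by (rule measurable_compose[OF measurable_PiM_fun_borel])

lemma jac_measurable: "(\<lambda>y. jacobian_entry p t x y) \<in> borel_measurable borel"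
proof -
  obtain l i j where "x = (l, i, j)" by (cases x) auto
  then show ?thesis
    by (cases "j < p \<and> i < p") (auto simp: jacobian_entry_def intro!: borel_measurable_times Lfac_measurable)
qed

lemma nn_integral_moment_map:
  assumes t: "t > 0" and f: "f \<in> borel_measurable (leb_sym p n)"
  shows "(\<integral>\<^sup>+x. f x \<partial>leb_sym p n) = (\<integral>\<^sup>+y. ennreal (\<Prod>x\<in>coords p n. jacobian_entry p t x y) * f (moment_map_n p n t y) \<partial>leb_sym p n)"
proof -
  let ?I = "coords p n"
  have e: "(\<lambda>x\<in>?I. moment_map p t (y(x := 0)) x + jacobian_entry p t x y * y x) = moment_map_n p n t y" for y
    unfolding moment_map_n_def
  proof (rule restrict_ext)
    fix x assume "x \<in> ?I"
    then obtain l i j where "x = (l, i, j)" "(l, i, j) \<in> ?I" by (cases x) auto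
    then show "moment_map p t (y(x := 0)) x + jacobian_entry p t x y * y x = moment_map p t y x"
      using moment_map_affine[of l i j p n t y] by (simp add: jacobian_entry_def coordsD del: moment_map.simps)
  qed
  have "(\<integral>\<^sup>+x. f x \<partial>leb_sym p n) = (\<integral>\<^sup>+y. ennreal (\<Prod>x\<in>?I. jacobian_entry p t x y) *
     f (\<lambda>x\<in>?I. moment_map p t (y(x := 0)) x + jacobian_entry p t x y * y x) \<partial>leb_sym p n)"
    unfolding leb_sym_def
  proof (rule triangular_nn_integral[where rk = "block_rank p"])
    fix x assume x: "x \<in> ?I"
    have "(\<lambda>y. y(x := 0)) \<in> borel_measurable (borel :: (nat \<times> nat \<times> nat \<Rightarrow> real) measure)"
      by (rule measurable_coordinatewise_then_product)
        (auto intro!: borel_measurable_continuous_onI continuous_on_coordinate)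
    then show "(\<lambda>y. moment_map p t (y(x := 0)) x) \<in> borel_measurable (PiM ?I (\<lambda>_. lborel))"
      unfolding leb_sym_def[symmetric]
      by (intro measurable_leb_sym_borel measurable_compose[OF _ moment_map_measurable])
    show "jacobian_entry p t x \<in> borel_measurable (PiM ?I (\<lambda>_. lborel))"
      unfolding leb_sym_def[symmetric] by (intro measurable_leb_sym_borel jac_measurable)
    show "jacobian_entry p t x y > 0" for y
      using lowtriD(1)[OF lowtri_Lfac] t by (cases x) (simp add: jacobian_entry_def)
    fix y y' :: "nat \<times> nat \<times> nat \<Rightarrow> real"
    assume eq: "\<And>j. j \<in> ?I \<Longrightarrow> block_rank p j < block_rank p x \<Longrightarrow> y j = y' j"
    obtain l i j where lij: "x = (l, i, j)" by (cases x) auto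
    show "moment_map p t (y(x := 0)) x = moment_map p t (y'(x := 0)) x"
      unfolding lij by (rule moment_map_dep(2)) (use x eq lij in auto)
    have "Lfac p t y l a b = Lfac p t y' l a b" if "b < p" for a b
      using moment_map_dep(1)[of l i j p n y y' t a b] x eq lij that by auto
    then show "jacobian_entry p t x y = jacobian_entry p t x y'" unfolding lij jacobian_entry_def by auto
  qed (use finite_coords f in \<open>auto simp: leb_sym_def\<close>)
  then show ?thesis unfolding e .
qed

lemma prod_jac_pos: "t > 0 \<Longrightarrow> (\<Prod>x\<in>coords p n. jacobian_entry p t x y) > 0"
  using lowtriD(1)[OF lowtri_Lfac] by (intro prod_pos) (auto simp: jacobian_entry_def)

lemma measurable_moment_map_n: "moment_map_n p n t \<in> measurable (leb_sym p n) (leb_sym p n)"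
  unfolding moment_map_n_def[abs_def]
  by (intro measurable_leb_symI measurable_leb_sym_borel moment_map_measurable)

lemma prod_jac_measurable: "(\<lambda>y. \<Prod>x\<in>coords p n. jacobian_entry p t x y) \<in> borel_measurable (leb_sym p n)"
  by (intro borel_measurable_prod measurable_leb_sym_borel jac_measurable)

lemma all_good_sets: "{y \<in> space (leb_sym p n). all_admissible p n t y} \<in> sets (leb_sym p n)"
proof -
  have "Measurable.pred (leb_sym p n) (\<lambda>y. admissible p t y l)" for l
    using good_measurable[of p t l] measurable_compose[OF measurable_PiM_fun_borel[of "coords p n"]]
    unfolding leb_sym_def by blast
  then show ?thesis unfolding all_admissible_def by measurable
qed

text \<open>Up to a null set, the parameters that map into the moment space are the admissible ones.
  The exceptions lie in the preimage of what the shrunk copies miss, and this preimage is null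
  because the Jacobian is positive.\<close>

lemma nn_integral_moment_space:
  assumes t: "t > 0" and f: "f \<in> borel_measurable (leb_sym p n)"
  shows "(\<integral>\<^sup>+x. f x * indicator (moment_space p n) x \<partial>leb_sym p n)
    = (\<integral>\<^sup>+y. ennreal (\<Prod>x\<in>coords p n. jacobian_entry p t x y) * (f (moment_map_n p n t y) * indicator {y. all_admissible p n t y} y) \<partial>leb_sym p n)"
proof -
  let ?N = "moment_space p n - (\<Union>m. shrunk p n (1 / real (m + 2)))"
  have N: "?N \<in> sets (leb_sym p n)" using moment_space_sets shrunk_sets by auto
  note [measurable] = moment_space_sets f N prod_jac_measurable measurable_moment_map_n
  have "0 = (\<integral>\<^sup>+x. indicator ?N x \<partial>leb_sym p n)"
    using moment_space_boundary_null N by simp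
  also have "\<dots> = (\<integral>\<^sup>+y. ennreal (\<Prod>x\<in>coords p n. jacobian_entry p t x y) * indicator ?N (moment_map_n p n t y) \<partial>leb_sym p n)"
    by (rule nn_integral_moment_map[OF t]) (use N in measurable)
  finally have "(\<integral>\<^sup>+y. ennreal (\<Prod>x\<in>coords p n. jacobian_entry p t x y) * indicator ?N (moment_map_n p n t y) \<partial>leb_sym p n) = 0" ..
  moreover have "(\<lambda>y. ennreal (\<Prod>x\<in>coords p n. jacobian_entry p t x y) * indicator ?N (moment_map_n p n t y)) \<in> borel_measurable (leb_sym p n)"
    by measurable
  ultimately have "AE y in leb_sym p n. ennreal (\<Prod>x\<in>coords p n. jacobian_entry p t x y) * indicator ?N (moment_map_n p n t y) = 0"
    by (simp add: nn_integral_0_iff_AE)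
  then have ae: "AE y in leb_sym p n. moment_map_n p n t y \<notin> ?N"
  proof eventually_elim
    case (elim y)
    then show ?case using prod_jac_pos[OF t, where p = p and n = n and y = y] by (auto simp: indicator_def ennreal_eq_0_iff split: if_splits)
  qed
  have "(\<integral>\<^sup>+x. f x * indicator (moment_space p n) x \<partial>leb_sym p n)
    = (\<integral>\<^sup>+y. ennreal (\<Prod>x\<in>coords p n. jacobian_entry p t x y) * (f (moment_map_n p n t y) * indicator (moment_space p n) (moment_map_n p n t y)) \<partial>leb_sym p n)"
    by (rule nn_integral_moment_map[OF t]) measurable
  also have "\<dots> = (\<integral>\<^sup>+y. ennreal (\<Prod>x\<in>coords p n. jacobian_entry p t x y) * (f (moment_map_n p n t y) * indicator {y. all_admissible p n t y} y) \<partial>leb_sym p n)"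
  proof (rule nn_integral_cong_AE, use ae in eventually_elim)
    case (elim y)
    have "moment_map_n p n t y \<in> moment_space p n \<longleftrightarrow> all_admissible p n t y"
    proof
      assume "moment_map_n p n t y \<in> moment_space p n"
      then obtain m where "moment_map_n p n t y \<in> shrunk p n (1 / real (m + 2))" using elim by blast
      then show "all_admissible p n t y" using shrunk_good[of "1 / real (m + 2)" t p n y] t by simp
    next
      assume "all_admissible p n t y"
      then show "moment_map_n p n t y \<in> moment_space p n"
        using moment_map_in_corner_space by (simp add: moment_space_eq)
    qed
    then show ?case by (simp add: indicator_def)
  qed
  finally show ?thesis .
qed

section \<open>Weights of the blocks\<close>

text \<open>For an admissible block with \<open>m \<ge> 1\<close> this is the square root of
  \<open>det (Y - Y^2)\<close>: it is the determinant of the triangular matrix \<open>W C\<close>,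
  whose Gram matrix is \<open>Y - Y^2\<close>.\<close>

definition diag_prod :: "nat \<Rightarrow> real \<Rightarrow> (nat \<times> nat \<times> nat \<Rightarrow> real) \<Rightarrow> nat \<Rightarrow> real" where
  "diag_prod p t y m = (\<Prod>i<p. Cfac p t y m i i * Wfac t y m i i)"

text \<open>Each index occurs twice in its diagonal pair and once with each of the other
  \<open>p - 1\<close> indices. This is the origin of the exponent \<open>p + 1\<close>.\<close>

lemma prod_pairs:
  fixes a :: "nat \<Rightarrow> real"
  shows "(\<Prod>j<p. \<Prod>i\<le>j. a i * a j) = (\<Prod>i<p. a i) ^ (p + 1)"
proof (induction p)
  case (Suc p)
  have "(\<Prod>i\<le>p. a i * a p) = (\<Prod>i<Suc p. a i) * a p ^ Suc p"
    by (simp add: prod.distrib lessThan_Suc_atMost)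
  then show ?case using Suc by (simp add: power_mult_distrib mult_ac)
qed simp

lemma prod_coords:
  fixes f :: "nat \<times> nat \<times> nat \<Rightarrow> real"
  shows "(\<Prod>x\<in>coords p n. f x) = (\<Prod>l=1..n. \<Prod>j<p. \<Prod>i\<le>j. f (l, i, j))"
proof -
  let ?S = "SIGMA l:{1..n}. SIGMA j:{..<p}. {..j}"
  have "coords p n = (\<lambda>(l, j, i). (l, i, j)) ` ?S"
    by (auto simp: coords_def image_iff)
  moreover have "inj_on (\<lambda>(l, j, i). (l, i, j)) ?S" by (auto simp: inj_on_def)
  ultimately have "(\<Prod>x\<in>coords p n. f x) = (\<Prod>(l, j, i)\<in>?S. f (l, i, j))"
    by (simp add: prod.reindex case_prod_unfold)
  also have "\<dots> = (\<Prod>l=1..n. \<Prod>z\<in>(SIGMA j:{..<p}. {..j}). f (l, snd z, fst z))"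
    by (subst prod.Sigma) (auto simp: case_prod_unfold)
  also have "\<dots> = (\<Prod>l=1..n. \<Prod>j<p. \<Prod>i\<le>j. f (l, i, j))"
    by (rule prod.cong[OF refl], subst prod.Sigma) (auto simp: case_prod_unfold)
  finally show ?thesis .
qed

text \<open>Block \<open>m\<close> enters the slopes of the later blocks \<open>l > m\<close>, and
  there are \<open>n - m\<close> of them.\<close>

lemma prod_telescope_power:
  fixes k :: "nat \<Rightarrow> real"
  shows "(\<Prod>l=1..n. (\<Prod>m=1..<l. k m) ^ a) = (\<Prod>m=1..n. k m ^ (a * (n - m)))"
proof (induction n)
  case (Suc n)
  have "(\<Prod>m=1..n. k m ^ (a * (Suc n - m))) = (\<Prod>m=1..n. k m ^ (a * (n - m)) * k m ^ a)"
    by (intro prod.cong refl) (auto simp: Suc_diff_le power_add)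
  then show ?case using Suc
    by (simp add: prod.distrib prod_power_distrib atLeastLessThanSuc_atLeastAtMost)
qed simp

lemma prod_jac_eq:
  "(\<Prod>x\<in>coords p n. jacobian_entry p t x y) = t ^ card (coords p n) * (\<Prod>m=1..n. diag_prod p t y m ^ ((p + 1) * (n - m)))"
proof -
  have "(\<Prod>x\<in>coords p n. jacobian_entry p t x y) = (\<Prod>x\<in>coords p n. t * (case x of (l, i, j) \<Rightarrow> Lfac p t y l i i * Lfac p t y l j j))"
    by (intro prod.cong refl) (auto simp: jacobian_entry_def coords_def)
  also have "\<dots> = t ^ card (coords p n) * (\<Prod>l=1..n. \<Prod>j<p. \<Prod>i\<le>j. Lfac p t y l i i * Lfac p t y l j j)"
    by (simp add: prod.distrib prod_coords[of "\<lambda>x. case x of (l, i, j) \<Rightarrow> Lfac p t y l i i * Lfac p t y l j j"])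
  also have "(\<Prod>l=1..n. \<Prod>j<p. \<Prod>i\<le>j. Lfac p t y l i i * Lfac p t y l j j) = (\<Prod>l=1..n. (\<Prod>i<p. Lfac p t y l i i) ^ (p + 1))"
    by (simp only: prod_pairs)
  also have "\<dots> = (\<Prod>l=1..n. (\<Prod>m=1..<l. diag_prod p t y m) ^ (p + 1))"
  proof (rule prod.cong[OF refl])
    fix l assume "l \<in> {1..n}"
    then have "(\<Prod>i<p. Lfac p t y l i i) = (\<Prod>i<p. \<Prod>m=1..<l. Cfac p t y m i i * Wfac t y m i i)"
      by (intro prod.cong refl) (simp add: Lfac_diag)
    also have "\<dots> = (\<Prod>m=1..<l. diag_prod p t y m)" unfolding diag_prod_def by (rule prod.swap)
    finally show "(\<Prod>i<p. Lfac p t y l i i) ^ (p + 1) = (\<Prod>m=1..<l. diag_prod p t y m) ^ (p + 1)" by simp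
  qed
  also have "\<dots> = (\<Prod>m=1..n. diag_prod p t y m ^ ((p + 1) * (n - m)))" by (rule prod_telescope_power)
  finally show ?thesis .
qed

definition quarter_minus_square :: "nat \<Rightarrow> real \<Rightarrow> (nat \<times> nat \<times> nat \<Rightarrow> real) \<Rightarrow> nat \<Rightarrow> nat \<Rightarrow> nat \<Rightarrow> real" where
  "quarter_minus_square p e y m i j = (if i = j then 1/4 else 0) - e * (\<Sum>k<p. symmat y m i k * symmat y m k j)"

lemma symmat_sym: "symmat y l i j = symmat y l j i"
  by (simp add: symmat_def min.commute max.commute)

text \<open>With \<open>Y = 1/2 + t S\<close> one has \<open>Y - Y\<^sup>2 = 1/4 - t\<^sup>2 S\<^sup>2\<close>.\<close>

lemma WC_gram:
  assumes g: "admissible p t y m" and m: "m \<ge> 1" and ij: "i < p" "j < p"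
  shows "quarter_minus_square p (t\<^sup>2) y m i j = (\<Sum>k<p. (\<Sum>a<p. Wfac t y m i a * Cfac p t y m a k) * (\<Sum>a<p. Wfac t y m j a * Cfac p t y m a k))"
proof -
  let ?W = "Wfac t y m" and ?C = "Cfac p t y m" and ?Y = "shifted t y m"
  have C: "complement_gram p ?W a b = (\<Sum>k<p. ?C a k * ?C b k)" if "a < p" "b < p" for a b
    using chol_mult[of p "complement_gram p ?W" a b] g m that by (simp add: admissible_def Cfac_def)
  have W: "(\<Sum>k<p. ?W a k * ?W b k) = ?Y a b" if "a < p" "b < p" for a b
    using chol_mult[of p ?Y a b] g that by (simp add: admissible_def Wfac_def)
  \<comment> \<open>The computation is
    \<open>W C C^T W^T = W (1 - W^T W) W^T = Y - Y^2\<close>.\<close>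
  have "(\<Sum>k<p. (\<Sum>a<p. ?W i a * ?C a k) * (\<Sum>a<p. ?W j a * ?C a k)) = (\<Sum>a<p. \<Sum>b<p. ?W i a * complement_gram p ?W a b * ?W j b)"
    by (rule quad_factor[symmetric]) (use C in auto)
  also have "\<dots> = (\<Sum>a<p. \<Sum>b<p. ?W i a * (if a = b then 1 else 0) * ?W j b)
      - (\<Sum>a<p. \<Sum>b<p. ?W i a * (\<Sum>c<p. ?W c a * ?W c b) * ?W j b)"
    by (simp add: complement_gram_def right_diff_distrib left_diff_distrib sum_subtractf)
  also have "(\<Sum>a<p. \<Sum>b<p. ?W i a * (if a = b then 1 else 0) * ?W j b) = ?Y i j"
    using W[OF ij] by (simp add: if_distrib[of "\<lambda>x. _ * x"] if_distrib[of "\<lambda>x. x * _"] cong: if_cong)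
  also have "(\<Sum>a<p. \<Sum>b<p. ?W i a * (\<Sum>c<p. ?W c a * ?W c b) * ?W j b)
     = (\<Sum>c<p. (\<Sum>a<p. ?W i a * ?W c a) * (\<Sum>b<p. ?W j b * ?W c b))"
    by (rule quad_factor) simp
  also have "\<dots> = (\<Sum>c<p. ?Y i c * ?Y j c)" using W ij by (intro sum.cong refl) simp
  also have "\<dots> = (\<Sum>c<p. (if i = c then 1 else 0) * (if j = c then 1/4 else 0) + (if i = c then 1 else 0) * (t * symmat y m j c / 2)
      + (if j = c then 1 else 0) * (t * symmat y m i c / 2) + t\<^sup>2 * (symmat y m i c * symmat y m c j))"
    unfolding shifted_def symmat_sym[of y m _ j]
    by (intro sum.cong refl) (auto simp: algebra_simps power2_eq_square)
  also have "\<dots> = (if j = i then 1/4 else 0) + t * symmat y m j i / 2 + t * symmat y m i j / 2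
      + t\<^sup>2 * (\<Sum>c<p. symmat y m i c * symmat y m c j)"
    unfolding sum.distrib using ij by (simp only: sum_delta_left sum_distrib_left)
  finally show ?thesis by (simp add: quarter_minus_square_def shifted_def symmat_sym[of y m j i])
qed

text \<open>\<open>W C\<close> is lower triangular with positive diagonal, so it is the Cholesky
  factor of \<open>1/4 - t^2 S^2\<close>. The weight of a block thus depends on \<open>t\<close>
  only through \<open>t^2\<close>, around a multiple of the identity.\<close>

lemma WC_chol:
  assumes g: "admissible p t y m" and m: "m \<ge> 1" and i: "i < p"
  shows "chol (quarter_minus_square p (t\<^sup>2) y m) i i = Cfac p t y m i i * Wfac t y m i i"
proof -
  have "chol (quarter_minus_square p (t\<^sup>2) y m) i i = (\<Sum>k<p. Wfac t y m i k * Cfac p t y m k i)"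
    by (rule chol_unique[OF lowtri_mult(1)[OF lowtri_Wfac lowtri_Cfac] WC_gram[OF g m] i i])
  then show ?thesis using lowtri_mult(2)[OF lowtri_Wfac[of p t y m] lowtri_Cfac[of p t y m] i] by simp
qed

definition trace_sq :: "nat \<Rightarrow> (nat \<times> nat \<times> nat \<Rightarrow> real) \<Rightarrow> nat \<Rightarrow> real" where
  "trace_sq p y m = (\<Sum>i<p. \<Sum>k<p. (symmat y m i k)\<^sup>2)"

lemma kap_pos: "diag_prod p t y m > 0"
  unfolding diag_prod_def using lowtriD(1)[OF lowtri_Cfac] lowtriD(1)[OF lowtri_Wfac]
  by (intro prod_pos) auto

text \<open>A squared diagonal entry of a triangular factor is at most the squared norm of its row,
  a diagonal entry of the Gram matrix; then \<open>1 + x \<le> exp x\<close> applies. The factor 2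
  per index offsets the 1/4.\<close>

lemma kap_bound:
  assumes g: "admissible p t y m" and m: "m \<ge> 1"
  shows "(2 ^ p * diag_prod p t y m)\<^sup>2 \<le> exp (- 4 * t\<^sup>2 * trace_sq p y m)"
proof -
  let ?K = "\<lambda>i. Cfac p t y m i i * Wfac t y m i i"
  have b: "(2 * ?K i)\<^sup>2 \<le> exp (- 4 * t\<^sup>2 * (\<Sum>k<p. (symmat y m i k)\<^sup>2))" if i: "i < p" for i
  proof -
    have "(?K i)\<^sup>2 = (\<Sum>a<p. Wfac t y m i a * Cfac p t y m a i)\<^sup>2"
      using lowtri_mult(2)[OF lowtri_Wfac[of p t y m] lowtri_Cfac[of p t y m] i] by (simp add: mult.commute)
    also have "\<dots> \<le> (\<Sum>k<p. (\<Sum>a<p. Wfac t y m i a * Cfac p t y m a k)\<^sup>2)"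
      using i member_le_sum[of i "{..<p}" "\<lambda>k. (\<Sum>a<p. Wfac t y m i a * Cfac p t y m a k)\<^sup>2"] by simp
    also have "\<dots> = quarter_minus_square p (t\<^sup>2) y m i i"
      unfolding WC_gram[OF g m i i] by (simp add: power2_eq_square)
    also have "\<dots> = 1/4 - t\<^sup>2 * (\<Sum>k<p. (symmat y m i k)\<^sup>2)"
      unfolding quarter_minus_square_def symmat_sym[of y m _ i] by (simp add: power2_eq_square)
    finally have "(2 * ?K i)\<^sup>2 \<le> 1 + (- 4 * t\<^sup>2 * (\<Sum>k<p. (symmat y m i k)\<^sup>2))"
      by (simp add: power_mult_distrib)
    also have "\<dots> \<le> exp (- 4 * t\<^sup>2 * (\<Sum>k<p. (symmat y m i k)\<^sup>2))" by (rule exp_ge_add_one_self)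
    finally show ?thesis .
  qed
  have "(2 ^ p * diag_prod p t y m)\<^sup>2 = (\<Prod>i<p. (2 * ?K i)\<^sup>2)"
  proof -
    have "2 ^ p * diag_prod p t y m = (\<Prod>i<p. 2 * ?K i)" by (simp add: diag_prod_def prod.distrib)
    then show ?thesis by (simp add: prod_power_distrib)
  qed
  also have "\<dots> \<le> (\<Prod>i<p. exp (- 4 * t\<^sup>2 * (\<Sum>k<p. (symmat y m i k)\<^sup>2)))"
    using b by (intro prod_mono) auto
  also have "\<dots> = exp (- 4 * t\<^sup>2 * trace_sq p y m)"
    by (simp add: exp_sum[symmetric] trace_sq_def sum_distrib_left sum_negf)
  finally show ?thesis .
qed

text \<open>The factor \<open>2 ^ p\<close> makes the base equal to 1 at the centre
  \<open>Y = 1/2\<close>, so that the growing power can have a finite limit.\<close>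

definition block_factor :: "nat \<Rightarrow> nat \<Rightarrow> real \<Rightarrow> (nat \<times> nat \<times> nat \<Rightarrow> real) \<Rightarrow> nat \<Rightarrow> real" where
  "block_factor p n t y m = (if admissible p t y m then (2 ^ p * diag_prod p t y m) ^ ((p + 1) * (n - m)) else 0)"

definition step_size :: "nat \<Rightarrow> nat \<Rightarrow> real" where
  "step_size p n = 1 / sqrt (4 * real n * (real p + 1))"

lemma trace_sq_nonneg: "trace_sq p y m \<ge> 0"
  by (simp add: trace_sq_def sum_nonneg)

lemma wt_nonneg: "block_factor p n t y m \<ge> 0"
  using kap_pos[of p t y m] by (simp add: block_factor_def)

lemma step_size_sq: "n \<ge> 1 \<Longrightarrow> (step_size p n)\<^sup>2 = 1 / (4 * real n * (real p + 1))"
  by (simp add: step_size_def power_divide)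

lemma step_size_power:
  assumes "n \<ge> 1" "m \<le> n"
  shows "real ((p + 1) * (n - m)) * (step_size p n)\<^sup>2 = (real n - real m) / (4 * real n)"
proof -
  define P where "P = real p + 1"
  have P: "P > 0" by (simp add: P_def)
  have a: "real ((p + 1) * (n - m)) = P * (real n - real m)"
    unfolding P_def of_nat_mult of_nat_diff[OF assms(2)] by simp
  have b: "(step_size p n)\<^sup>2 = 1 / (4 * real n * P)" using assms by (simp add: step_size_sq P_def)
  show ?thesis unfolding a b using P assms by (simp add: field_simps)
qed

text \<open>For \<open>n \<ge> 2 * m\<close> the exponent \<open>n - m\<close> is at least half of
  \<open>n\<close>, which gives half of the limiting rate 1/2, uniformly in
  \<open>n\<close>.\<close>

lemma wt_bound:
  assumes m: "m \<ge> 1" and n: "n \<ge> 2 * m"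
  shows "block_factor p n (step_size p n) y m \<le> exp (- trace_sq p y m / 4)"
proof (cases "admissible p (step_size p n) y m")
  case True
  let ?t = "step_size p n"
  let ?K = "2 ^ p * diag_prod p ?t y m"
  have K: "?K > 0" using kap_pos by simp
  have "2 * ln ?K = ln (?K\<^sup>2)" using K by (simp add: ln_realpow)
  also have "\<dots> \<le> ln (exp (- 4 * ?t\<^sup>2 * trace_sq p y m))"
    using kap_bound[OF True m] K by (subst ln_le_cancel_iff) auto
  finally have l: "ln ?K \<le> - 2 * ?t\<^sup>2 * trace_sq p y m" by (simp add: mult_ac)
  have "block_factor p n ?t y m = exp (real ((p + 1) * (n - m)) * ln ?K)"
    using True K by (simp add: block_factor_def exp_of_nat_mult del: of_nat_mult of_nat_add)
  also have "real ((p + 1) * (n - m)) * ln ?K \<le> real ((p + 1) * (n - m)) * (- 2 * ?t\<^sup>2 * trace_sq p y m)"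
    using l by (intro mult_left_mono) auto
  also have "\<dots> = - 2 * (real ((p + 1) * (n - m)) * ?t\<^sup>2) * trace_sq p y m" by simp
  also have "\<dots> = - 2 * ((real n - real m) / (4 * real n)) * trace_sq p y m"
    using m n by (subst step_size_power) auto
  also have "\<dots> \<le> - (1 / 4) * trace_sq p y m"
  proof (intro mult_right_mono trace_sq_nonneg)
    show "- 2 * ((real n - real m) / (4 * real n)) \<le> - (1 / 4)" using m n by (simp add: field_simps)
  qed
  finally show ?thesis by simp
qed (simp add: block_factor_def)

lemma power_limit_exp:
  fixes f :: "real \<Rightarrow> real" and e :: "nat \<Rightarrow> real" and N :: "nat \<Rightarrow> nat"
  assumes d: "(f has_real_derivative d) (at 0)" and f0: "f 0 = 1"
    and e: "e \<longlonglongrightarrow> 0" "\<And>n. n \<ge> 1 \<Longrightarrow> e n \<noteq> 0" and N: "(\<lambda>n. real (N n) * e n) \<longlonglongrightarrow> c"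
  shows "(\<lambda>n. f (e n) ^ N n) \<longlonglongrightarrow> exp (c * d)"
proof -
  have "((\<lambda>x. ln (f x)) has_real_derivative d) (at 0)"
    using DERIV_chain2[OF DERIV_ln[of "f 0"] d] f0 by simp
  then have "(\<lambda>h. ln (f h) / h) \<midarrow>0\<rightarrow> d" using f0 by (simp add: DERIV_def)
  moreover have ev: "filterlim e (at 0) sequentially"
    using e by (auto simp: filterlim_at eventually_sequentially)
  ultimately have l: "(\<lambda>n. ln (f (e n)) / e n) \<longlonglongrightarrow> d" by (rule filterlim_compose)
  have "(\<lambda>n. exp ((real (N n) * e n) * (ln (f (e n)) / e n))) \<longlonglongrightarrow> exp (c * d)"
    by (intro tendsto_exp tendsto_mult N l)
  moreover have "\<forall>\<^sub>F n in sequentially. exp ((real (N n) * e n) * (ln (f (e n)) / e n)) = f (e n) ^ N n"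
  proof -
    have "(\<lambda>n. f (e n)) \<longlonglongrightarrow> f 0"
      by (rule isCont_tendsto_compose[OF DERIV_isCont[OF d] e(1)])
    then have "\<forall>\<^sub>F n in sequentially. f (e n) > 0" using f0 by (intro order_tendstoD(1)[of _ 1]) auto
    then show ?thesis using eventually_ge_at_top[of 1]
      by eventually_elim (use e in \<open>simp add: exp_of_nat_mult\<close>)
  qed
  ultimately show ?thesis by (rule Lim_transform_eventually)
qed

section \<open>Expansion of the factors at \<open>t = 0\<close> and limit of the weights\<close>

lemma pivot_eventually_pos:
  fixes A :: "real \<Rightarrow> nat \<Rightarrow> nat \<Rightarrow> real"
  assumes c: "c > 0" and A0: "\<And>i j. A 0 i j = (if i = j then c else 0)"
    and A: "\<And>i j. ((\<lambda>t. A t i j) has_real_derivative A' i j) (at 0)"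
  shows "\<forall>\<^sub>F t in nhds 0. pivot (A t) j > 0"
proof -
  note D = chol_has_derivative[where A = A and A' = A', OF c A0 A]
  have "((\<lambda>t. pivot (A t) j) \<longlongrightarrow> pivot (A 0) j) (nhds 0)"
    unfolding pivot_def
  proof (intro tendsto_diff tendsto_sum tendsto_power)
    show "((\<lambda>t. A t j j) \<longlongrightarrow> A 0 j j) (nhds 0)"
      using DERIV_isCont[OF A, unfolded isCont_def] by (rule tendsto_at_iff_tendsto_nhds[of "\<lambda>t. A t j j" 0, THEN iffD1])
    show "((\<lambda>t. chol (A t) j k) \<longlongrightarrow> chol (A 0) j k) (nhds 0)" for k
      using DERIV_isCont[OF D[THEN conjunct1], of j k, unfolded isCont_def]
      by (rule tendsto_at_iff_tendsto_nhds[of "\<lambda>t. chol (A t) j k" 0, THEN iffD1])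
  qed
  moreover have "pivot (A 0) j = c" using D by (simp add: pivot_def A0)
  ultimately show ?thesis using c by (intro order_tendstoD(1)[of _ c]) auto
qed

lemma shifted_derivative: "((\<lambda>t. shifted t y l i j) has_real_derivative symmat y l i j) (at 0)"
  unfolding shifted_def by (auto intro!: derivative_eq_intros)

lemma shifted_0: "shifted 0 y l i j = (if i = j then 1/2 else 0)"
  by (simp add: shifted_def)

text \<open>The lower triangular half of a symmetric \<open>S\<close>, which gives \<open>S\<close>
  when added to its transpose: the shape of derivatives of Cholesky factors at multiples of the
  identity.\<close>

definition lowpart :: "(nat \<Rightarrow> nat \<Rightarrow> real) \<Rightarrow> nat \<Rightarrow> nat \<Rightarrow> real" where
  "lowpart S i j = (if i < j then 0 else if i = j then S i i / 2 else S i j)"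

lemma lowpart_add: "S i j = S j i \<Longrightarrow> lowpart S i j + lowpart S j i = S i j"
  by (auto simp: lowpart_def)

lemma Wfac_derivative:
  "((\<lambda>t. Wfac t y l i j) has_real_derivative sqrt 2 * lowpart (symmat y l) i j) (at 0)"
  "Wfac 0 y l i j = (if i = j then sqrt (1/2) else 0)"
proof -
  have D: "((\<lambda>t. chol (shifted t y l) i j) has_real_derivative
      (if i < j then 0 else if i = j then symmat y l i i / (2 * sqrt (1/2)) else symmat y l i j / sqrt (1/2))) (at 0)
    \<and> chol (shifted 0 y l) i j = (if i = j then sqrt (1/2) else 0)"
    by (rule chol_has_derivative[where A = "\<lambda>t. shifted t y l" and A' = "symmat y l"])
      (simp_all add: shifted_0 shifted_derivative)
  then show "Wfac 0 y l i j = (if i = j then sqrt (1/2) else 0)" by (simp add: Wfac_def)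
  have "(if i < j then 0 else if i = j then symmat y l i i / (2 * sqrt (1/2)) else symmat y l i j / sqrt (1/2))
      = sqrt 2 * lowpart (symmat y l) i j"
    by (auto simp: lowpart_def real_sqrt_divide)
  then show "((\<lambda>t. Wfac t y l i j) has_real_derivative sqrt 2 * lowpart (symmat y l) i j) (at 0)"
    using D by (simp add: Wfac_def)
qed

lemma compl_derivative:
  assumes "i < p" "j < p"
  shows "((\<lambda>t. complement_gram p (Wfac t y l) i j) has_real_derivative - symmat y l i j) (at 0)"
    and "complement_gram p (Wfac 0 y l) i j = (if i = j then 1/2 else 0)"
proof -
  let ?G = "lowpart (symmat y l)"
  have "((\<lambda>t. \<Sum>k<p. Wfac t y l k i * Wfac t y l k j) has_real_derivative
    (\<Sum>k<p. sqrt 2 * ?G k i * Wfac 0 y l k j + sqrt 2 * ?G k j * Wfac 0 y l k i)) (at 0)"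
    by (intro DERIV_sum DERIV_mult Wfac_derivative)
  also have "(\<Sum>k<p. sqrt 2 * ?G k i * Wfac 0 y l k j + sqrt 2 * ?G k j * Wfac 0 y l k i)
     = (\<Sum>k<p. ?G k i * (if k = j then 1 else 0) + ?G k j * (if k = i then 1 else 0))"
    by (intro sum.cong refl) (auto simp: Wfac_derivative(2) real_sqrt_divide)
  also have "\<dots> = symmat y l i j"
    using assms lowpart_add[of "symmat y l" j i] by (simp add: sum.distrib sum_delta_right symmat_sym[of y l j i])
  finally have "((\<lambda>t. (if i = j then 1 else 0) - (\<Sum>k<p. Wfac t y l k i * Wfac t y l k j)) has_real_derivative 0 - symmat y l i j) (at 0)"
    by (intro DERIV_diff DERIV_const)
  then show "((\<lambda>t. complement_gram p (Wfac t y l) i j) has_real_derivative - symmat y l i j) (at 0)"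
    by (simp add: complement_gram_def)
  have "(\<Sum>k<p. Wfac 0 y l k i * Wfac 0 y l k j) = (\<Sum>k<p. (if i = j then 1/2 else 0) * (if k = j then 1 else 0))"
    by (intro sum.cong refl) (auto simp: Wfac_derivative(2))
  then show "complement_gram p (Wfac 0 y l) i j = (if i = j then 1/2 else 0)"
    using assms by (simp add: complement_gram_def sum_delta_right)
qed

text \<open>\<open>chol_has_derivative\<close> asks for one multiple of the identity at all indices.
  Beyond the block the diagonal of \<open>complement_gram\<close> is 1 instead of 1/2 at
  \<open>t = 0\<close>, so it is overwritten there.\<close>

definition clip_block :: "nat \<Rightarrow> real \<Rightarrow> (nat \<Rightarrow> nat \<Rightarrow> real) \<Rightarrow> nat \<Rightarrow> nat \<Rightarrow> real" where
  "clip_block p c A i j = (if i < p \<and> j < p then A i j else if i = j then c else 0)"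

lemma clip_compl_derivative:
  "((\<lambda>t. clip_block p (1/2) (complement_gram p (Wfac t y l)) i j) has_real_derivative clip_block p 0 (\<lambda>i j. - symmat y l i j) i j) (at 0)"
  "clip_block p (1/2) (complement_gram p (Wfac 0 y l)) i j = (if i = j then 1/2 else 0)"
  by (cases "i < p \<and> j < p") (auto simp: clip_block_def compl_derivative)

lemma Cfac_derivative:
  assumes "i < p" "j < p"
  shows "((\<lambda>t. Cfac p t y l i j) has_real_derivative (if l = 0 then 0 else - sqrt 2 * lowpart (symmat y l) i j)) (at 0)"
    and "Cfac p 0 y l i j = (if i = j then if l = 0 then 1 else sqrt (1/2) else 0)"
proof -
  let ?A = "\<lambda>t. clip_block p (1/2) (complement_gram p (Wfac t y l))"
  have D: "((\<lambda>t. chol (?A t) i j) has_real_derivative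
      (if i < j then 0 else if i = j then clip_block p 0 (\<lambda>i j. - symmat y l i j) i i / (2 * sqrt (1/2))
       else clip_block p 0 (\<lambda>i j. - symmat y l i j) i j / sqrt (1/2))) (at 0)
    \<and> chol (?A 0) i j = (if i = j then sqrt (1/2) else 0)"
    by (rule chol_has_derivative[where A = ?A and A' = "clip_block p 0 (\<lambda>i j. - symmat y l i j)"])
      (simp_all add: clip_compl_derivative)
  have c: "chol (?A t) i j = chol (complement_gram p (Wfac t y l)) i j" for t
    by (rule chol_cong[of p]) (use assms in \<open>auto simp: clip_block_def\<close>)
  have e: "(if i < j then 0 else if i = j then clip_block p 0 (\<lambda>i j. - symmat y l i j) i i / (2 * sqrt (1/2))
       else clip_block p 0 (\<lambda>i j. - symmat y l i j) i j / sqrt (1/2)) = - sqrt 2 * lowpart (symmat y l) i j"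
    using assms by (auto simp: lowpart_def clip_block_def real_sqrt_divide)
  show "((\<lambda>t. Cfac p t y l i j) has_real_derivative (if l = 0 then 0 else - sqrt 2 * lowpart (symmat y l) i j)) (at 0)"
    using D unfolding c e by (auto simp: Cfac_def)
  show "Cfac p 0 y l i j = (if i = j then if l = 0 then 1 else sqrt (1/2) else 0)"
    using D unfolding c by (auto simp: Cfac_def)
qed

text \<open>How small \<open>t\<close> must be depends on \<open>y\<close>, which is enough for
  pointwise limits under the integral.\<close>

lemma good_eventually: "\<forall>\<^sub>F t in nhds 0. admissible p t y l"
proof -
  have "\<forall>\<^sub>F t in nhds 0. \<forall>j\<in>{..<p}. pivot (shifted t y l) j > 0"
    by (intro eventually_ball_finite ballI
        pivot_eventually_pos[where c = "1/2" and A = "\<lambda>t. shifted t y l" and A' = "symmat y l"])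
      (simp_all add: shifted_0 shifted_derivative)
  moreover have "\<forall>\<^sub>F t in nhds 0. \<forall>j\<in>{..<p}. pivot (clip_block p (1/2) (complement_gram p (Wfac t y l))) j > 0"
    by (intro eventually_ball_finite ballI pivot_eventually_pos[where c = "1/2"
        and A = "\<lambda>t. clip_block p (1/2) (complement_gram p (Wfac t y l))" and A' = "clip_block p 0 (\<lambda>i j. - symmat y l i j)"])
      (simp_all add: clip_compl_derivative)
  ultimately show ?thesis
  proof eventually_elim
    case (elim t)
    have "pivot (clip_block p (1/2) (complement_gram p (Wfac t y l))) j = pivot (complement_gram p (Wfac t y l)) j" if "j < p" for j
      by (rule pivot_cong[of p]) (use that in \<open>auto simp: clip_block_def\<close>)
    then show ?case using elim
      by (auto simp: admissible_def pd_iff_pivot shifted_def complement_gram_def symmat_sym[of y l] mult.commute)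
  qed
qed

lemma step_size_tendsto: "(\<lambda>n. step_size p n) \<longlonglongrightarrow> 0"
proof -
  have "filterlim (\<lambda>n. sqrt (4 * real n * (real p + 1))) at_top sequentially"
    by (intro filterlim_compose[OF sqrt_at_top] filterlim_tendsto_pos_mult_at_top[OF tendsto_const]
      filterlim_at_top_mult_tendsto_pos[OF tendsto_const] filterlim_real_sequentially) auto
  then show ?thesis unfolding step_size_def
    by (intro tendsto_divide_0[OF tendsto_const] filterlim_at_top_imp_at_infinity)
qed

text \<open>Once admissible, the weight is a power of a function of \<open>t^2\<close> with value 1
  and slope \<open>- 2 * trace_sq p y m\<close> at 0. The exponent times \<open>t^2\<close> tends to
  1/4, whence the rate 1/2.\<close>

lemma wt_tendsto:
  assumes m: "m \<ge> 1"
  shows "(\<lambda>n. block_factor p n (step_size p n) y m) \<longlonglongrightarrow> exp (- trace_sq p y m / 2)"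
proof -
  let ?M = "\<lambda>i j. \<Sum>k<p. symmat y m i k * symmat y m k j"
  have D: "((\<lambda>e. chol (quarter_minus_square p e y m) i i) has_real_derivative
      (if i < i then 0 else if i = i then - ?M i i / (2 * sqrt (1/4)) else - ?M i i / sqrt (1/4))) (at 0)
    \<and> chol (quarter_minus_square p 0 y m) i i = (if i = i then sqrt (1/4) else 0)" for i
    by (rule chol_has_derivative) (auto simp: quarter_minus_square_def intro!: derivative_eq_intros)
  have s4: "sqrt (1/4) = (1/2 :: real)" by (rule real_sqrt_unique) (auto simp: power2_eq_square)
  have d: "((\<lambda>e. 2 * chol (quarter_minus_square p e y m) i i) has_real_derivative - 2 * ?M i i) (at 0)"
    and v: "2 * chol (quarter_minus_square p 0 y m) i i = 1" for i
    using D[of i] unfolding s4 by (auto intro!: derivative_eq_intros)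
  have "((\<lambda>e. \<Prod>i<q. 2 * chol (quarter_minus_square p e y m) i i) has_real_derivative - 2 * (\<Sum>i<q. ?M i i)) (at 0)
     \<and> (\<Prod>i<q. 2 * chol (quarter_minus_square p 0 y m) i i) = 1" for q
  proof (induction q)
    case (Suc q)
    show ?case using DERIV_mult[OF Suc[THEN conjunct1] d[of q]] Suc v[of q] by (simp add: algebra_simps)
  qed simp
  from this[of p] have "((\<lambda>e. \<Prod>i<p. 2 * chol (quarter_minus_square p e y m) i i) has_real_derivative - 2 * (\<Sum>i<p. ?M i i)) (at 0)"
     "(\<Prod>i<p. 2 * chol (quarter_minus_square p 0 y m) i i) = 1" by auto
  moreover have "(\<Sum>i<p. ?M i i) = trace_sq p y m"
    unfolding trace_sq_def by (intro sum.cong refl) (simp add: power2_eq_square symmat_sym)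
  ultimately have F: "((\<lambda>e. \<Prod>i<p. 2 * chol (quarter_minus_square p e y m) i i) has_real_derivative - 2 * trace_sq p y m) (at 0)"
    "(\<Prod>i<p. 2 * chol (quarter_minus_square p 0 y m) i i) = 1" by simp_all
  have lim: "(\<lambda>n. (\<Prod>i<p. 2 * chol (quarter_minus_square p ((step_size p n)\<^sup>2) y m) i i) ^ ((p + 1) * (n - m))) \<longlonglongrightarrow> exp (1/4 * (- 2 * trace_sq p y m))"
  proof (rule power_limit_exp[where f = "\<lambda>e. \<Prod>i<p. 2 * chol (quarter_minus_square p e y m) i i"
        and e = "\<lambda>n. (step_size p n)\<^sup>2" and N = "\<lambda>n. (p + 1) * (n - m)", OF F])
    show "(\<lambda>n. (step_size p n)\<^sup>2) \<longlonglongrightarrow> 0" using tendsto_power[OF step_size_tendsto, of p 2] by simp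
    show "(step_size p n)\<^sup>2 \<noteq> 0" if "n \<ge> 1" for n using that by (simp add: step_size_sq del: power_eq_0_iff)
    have "(\<lambda>n. 1/4 * (1 - real m / real n)) \<longlonglongrightarrow> 1/4 * (1 - 0)"
      by (intro tendsto_intros tendsto_divide_0[OF tendsto_const] filterlim_at_top_imp_at_infinity filterlim_real_sequentially)
    moreover have "\<forall>\<^sub>F n in sequentially. 1/4 * (1 - real m / real n) = real ((p + 1) * (n - m)) * (step_size p n)\<^sup>2"
      using eventually_ge_at_top[of m]
    proof eventually_elim
      case (elim n)
      then have n: "n \<ge> 1" using m by simp
      show ?case unfolding step_size_power[OF n elim] using n by (simp add: field_simps)
    qed
    ultimately show "(\<lambda>n. real ((p + 1) * (n - m)) * (step_size p n)\<^sup>2) \<longlonglongrightarrow> 1/4"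
      by (auto intro: Lim_transform_eventually)
  qed
  have "\<forall>\<^sub>F n in sequentially. admissible p (step_size p n) y m"
    using eventually_compose_filterlim[OF good_eventually step_size_tendsto] .
  then have "\<forall>\<^sub>F n in sequentially. (\<Prod>i<p. 2 * chol (quarter_minus_square p ((step_size p n)\<^sup>2) y m) i i) ^ ((p + 1) * (n - m)) = block_factor p n (step_size p n) y m"
  proof eventually_elim
    case (elim n)
    then show ?case using m by (simp add: block_factor_def diag_prod_def prod.distrib WC_chol)
  qed
  then show ?thesis using Lim_transform_eventually[OF lim] by simp
qed

section \<open>Linearization at the arcsine law\<close>

text \<open>At \<open>t = 0\<close> the Jacobi matrix is the scalar one of the arcsine law, with off-diagonal entries
  \<open>sqrt (1/2), 1/2, 1/2, \<dots>\<close>; \<open>gauge h\<close> is the product of the first \<open>h\<close> of them.\<close>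

definition gauge :: "nat \<Rightarrow> real" where
  "gauge h = (if h = 0 then 1 else sqrt (1/2) * 2 * (1/2) ^ h)"

definition base_entry :: "nat \<Rightarrow> real" where
  "base_entry h = (if h = 1 then sqrt (1/2) else 1/2)"

text \<open>The coefficient of \<open>x^m\<close> at the monic Chebyshev polynomial of the first
  kind of degree \<open>h\<close>; dividing path weights by \<open>gauge\<close> passes from
  orthonormal to monic polynomials.\<close>

definition path_count :: "nat \<Rightarrow> nat \<Rightarrow> real" where
  "path_count m h = (if h \<le> m \<and> even (m - h) then (1/2) ^ (m - h) * real (m choose ((m - h) div 2)) else 0)"

text \<open>The first-order change of \<open>path_count\<close> when scalar parameters move from 1/2
  to \<open>1/2 + t * G r\<close>, as a solution of the linearized recursion below. At level 0 its
  coefficients are the entries of \<open>A\<close>.\<close>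

definition path_slope :: "(nat \<Rightarrow> real) \<Rightarrow> nat \<Rightarrow> nat \<Rightarrow> real" where
  "path_slope G m h = (if h \<le> m \<and> even (m - h) then
     2 * (1/2) ^ (m - h) * (\<Sum>r=1..(m - h) div 2. real (m choose ((m - h) div 2 - r)) * (G (h + r) + G r)) else 0)"

lemma path_count_shift: "path_count (h + 2 * q) h = (1/4) ^ q * real ((h + 2 * q) choose q)"
  by (simp add: path_count_def power_mult power2_eq_square)

lemma path_slope_shift: "path_slope G (h + 2 * q) h =
    2 * (1/4) ^ q * (\<Sum>r=1..q. real ((h + 2 * q) choose (q - r)) * (G (h + r) + G r))"
  by (simp add: path_slope_def power_mult power2_eq_square)

lemma parity_cases:
  fixes m h :: nat
  obtains (off) "\<not> (h \<le> m \<and> even (m - h))" | (on) q where "m = h + 2 * q"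
  by (metis dvdE le_add_diff_inverse)

lemma path_count_off: "\<not> (h \<le> m \<and> even (m - h)) \<Longrightarrow> path_count m h = 0"
  by (auto simp: path_count_def)

lemma path_slope_off: "\<not> (h \<le> m \<and> even (m - h)) \<Longrightarrow> path_slope G m h = 0"
  by (auto simp: path_slope_def)

lemma choose_Suc_sum:
  assumes "r < q"
  shows "real (Suc N choose (q - r)) = real (N choose (q - r)) + real (N choose (q - 1 - r))"
proof -
  obtain d where "q - r = Suc d" using assms by (metis Suc_diff_Suc)
  moreover have "q - 1 - r = d" using calculation by simp
  ultimately show ?thesis by simp
qed

text \<open>With the gauge divided out, an upward step weighs 1 and a downward step the square of
  its entry: 1/4, but 1/2 into level 0. The recursion is then Pascal's rule.\<close>

lemma path_count_Suc:
  assumes "h \<ge> 1"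
  shows "path_count (Suc m) h = path_count m (h - 1) + path_count m (Suc h) / 4"
proof (cases "Suc m" h rule: parity_cases)
  case off
  then have o: "\<not> (h - 1 \<le> m \<and> even (m - (h - 1)))" "\<not> (Suc h \<le> m \<and> even (m - Suc h))"
    using assms by (cases h; auto)+
  show ?thesis unfolding path_count_off[OF off] path_count_off[OF o(1)] path_count_off[OF o(2)] by simp
next
  case (on q)
  obtain g where h: "h = Suc g" using assms by (cases h) auto
  have m: "m = g + 2 * q" using on h by simp
  show ?thesis
  proof (cases q)
    case 0
    then show ?thesis using m h by (simp add: path_count_def)
  next
    case (Suc q')
    have e: "m = Suc h + 2 * q'" using m h Suc by simp
    have a: "path_count m (Suc h) = (1/4) ^ q' * real (m choose q')" unfolding e by (rule path_count_shift)
    have b: "path_count m (h - 1) = (1/4) ^ q * real (m choose q)" unfolding m h using path_count_shift[of g q] by simp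
    have c: "path_count (Suc m) h = (1/4) ^ q * real (Suc m choose q)" unfolding on by (rule path_count_shift)
    show ?thesis unfolding a b c Suc by (simp add: field_simps)
  qed
qed

lemma path_count_Suc_0: "path_count (Suc m) 0 = path_count m 1 / 2"
proof (cases "Suc m" "0::nat" rule: parity_cases)
  case off
  then have o: "\<not> (1 \<le> m \<and> even (m - 1))" by (cases m) auto
  show ?thesis unfolding path_count_off[OF off] path_count_off[OF o] by simp
next
  case (on q)
  then obtain q' where q: "q = Suc q'" by (cases q) auto
  have m: "m = 1 + 2 * q'" using on q by simp
  have a: "path_count (Suc m) 0 = (1/4) ^ q * real (Suc m choose q)"
    unfolding on using path_count_shift[of 0 q] by simp
  have b: "path_count m 1 = (1/4) ^ q' * real (m choose q')" unfolding m by (rule path_count_shift)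
  have c: "(m choose Suc q') = (m choose q')"
    using binomial_symmetric[of q' m] m by simp
  show ?thesis unfolding a b q by (simp add: c field_simps)
qed

text \<open>The last term is the first-order change of the downward weight
  \<open>(1 - Y_h) Y_(h+1)\<close> at 1/2. In the binomial sums it is the boundary term that the
  index shifts leave after Pascal's rule.\<close>

lemma path_slope_Suc:
  assumes "h \<ge> 1"
  shows "path_slope G (Suc m) h = path_slope G m (h - 1) + path_slope G m (Suc h) / 4
     + path_count m (Suc h) / 2 * (G (Suc h) - G h)"
proof (cases "Suc m" h rule: parity_cases)
  case off
  then have o: "\<not> (h - 1 \<le> m \<and> even (m - (h - 1)))" "\<not> (Suc h \<le> m \<and> even (m - Suc h))"
    using assms by (cases h; auto)+
  show ?thesis unfolding path_slope_off[OF off] path_slope_off[OF o(1)] path_slope_off[OF o(2)] path_count_off[OF o(2)]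
    by simp
next
  case (on q)
  obtain g where h: "h = Suc g" using assms by (cases h) auto
  have m: "m = g + 2 * q" using on h by simp
  show ?thesis
  proof (cases q)
    case 0
    then show ?thesis using m h by (simp add: path_slope_def path_count_def)
  next
    case (Suc q')
    have e: "m = Suc h + 2 * q'" using m h Suc by simp
    let ?C = "\<lambda>k. real (m choose k)"
    have L: "path_slope G (Suc m) h = 2 * (1/4) ^ q * (\<Sum>r=1..q. real (Suc m choose (q - r)) * (G (h + r) + G r))"
      unfolding on by (rule path_slope_shift)
    have A: "path_slope G m (h - 1) = 2 * (1/4) ^ q * (\<Sum>r=1..q. ?C (q - r) * (G (g + r) + G r))"
      unfolding m h using path_slope_shift[of G g q] by simp
    have B: "path_slope G m (Suc h) = 2 * (1/4) ^ q' * (\<Sum>r=1..q'. ?C (q' - r) * (G (Suc h + r) + G r))"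
      unfolding e by (rule path_slope_shift)
    have D: "path_count m (Suc h) = (1/4) ^ q' * ?C q'" unfolding e by (rule path_count_shift)
    have s1: "(\<Sum>r=1..q. real (Suc m choose (q - r)) * G r) = (\<Sum>r=1..q. ?C (q - r) * G r) + (\<Sum>r=1..q'. ?C (q' - r) * G r)"
      and s2: "(\<Sum>r=1..q. real (Suc m choose (q - r)) * G (h + r)) = (\<Sum>r=1..q. ?C (q - r) * G (h + r)) + (\<Sum>r=1..q'. ?C (q' - r) * G (h + r))"
    proof -
      have "(\<Sum>r=1..q. real (Suc m choose (q - r)) * F r) = (\<Sum>r=1..q. ?C (q - r) * F r) + (\<Sum>r=1..q'. ?C (q' - r) * F r)" for F :: "nat \<Rightarrow> real"
      proof -
        have "(\<Sum>r=1..q'. real (Suc m choose (q - r)) * F r) = (\<Sum>r=1..q'. ?C (q - r) * F r + ?C (q' - r) * F r)"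
          using Suc by (intro sum.cong refl) (subst choose_Suc_sum, auto simp: distrib_right)
        then show ?thesis unfolding Suc by (simp add: sum.distrib)
      qed
      from this[of G] this[of "\<lambda>r. G (h + r)"] show
        "(\<Sum>r=1..q. real (Suc m choose (q - r)) * G r) = (\<Sum>r=1..q. ?C (q - r) * G r) + (\<Sum>r=1..q'. ?C (q' - r) * G r)"
        "(\<Sum>r=1..q. real (Suc m choose (q - r)) * G (h + r)) = (\<Sum>r=1..q. ?C (q - r) * G (h + r)) + (\<Sum>r=1..q'. ?C (q' - r) * G (h + r))"
        by simp_all
    qed
    have a1: "(\<Sum>r=1..q. ?C (q - r) * G (g + r)) = ?C q' * G h + (\<Sum>r=1..q'. ?C (q' - r) * G (h + r))"
    proof -
      have "(\<Sum>r=1..q. ?C (q - r) * G (g + r)) = (\<Sum>r=0..q'. ?C (q' - r) * G (h + r))"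
        unfolding Suc h One_nat_def sum.shift_bounds_cl_Suc_ivl by simp
      then show ?thesis by (simp add: sum.atLeast_Suc_atMost)
    qed
    have b1: "(\<Sum>r=1..q'. ?C (q' - r) * G (Suc h + r)) + ?C q' * G (Suc h) = (\<Sum>r=1..q. ?C (q - r) * G (h + r))"
    proof -
      have "(\<Sum>r=1..q. ?C (q - r) * G (h + r)) = (\<Sum>r=0..q'. ?C (q' - r) * G (Suc h + r))"
        unfolding Suc One_nat_def sum.shift_bounds_cl_Suc_ivl by simp
      then show ?thesis by (simp add: sum.atLeast_Suc_atMost)
    qed
    have "path_slope G m (h - 1) + path_slope G m (Suc h) / 4 + path_count m (Suc h) / 2 * (G (Suc h) - G h)
      = 2 * (1/4) ^ q * ((\<Sum>r=1..q. ?C (q - r) * (G (g + r) + G r)) + (\<Sum>r=1..q'. ?C (q' - r) * (G (Suc h + r) + G r))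
         + ?C q' * (G (Suc h) - G h))"
      unfolding A B D by (simp add: Suc field_simps)
    also have "(\<Sum>r=1..q. ?C (q - r) * (G (g + r) + G r)) + (\<Sum>r=1..q'. ?C (q' - r) * (G (Suc h + r) + G r)) + ?C q' * (G (Suc h) - G h)
      = (\<Sum>r=1..q. real (Suc m choose (q - r)) * (G (h + r) + G r))"
      using s1 s2 a1 b1 by (simp only: distrib_left sum.distrib right_diff_distrib)
    finally show ?thesis unfolding L by simp
  qed
qed

lemma path_slope_Suc_0: "path_slope G (Suc m) 0 = path_slope G m 1 / 2 + path_count m 1 * G 1"
proof (cases "Suc m" "0::nat" rule: parity_cases)
  case off
  then have o: "\<not> (1 \<le> m \<and> even (m - 1))" by (cases m) auto
  show ?thesis unfolding path_slope_off[OF off] path_slope_off[OF o] path_count_off[OF o] by simp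
next
  case (on q)
  then obtain q' where q: "q = Suc q'" by (cases q) auto
  have m: "m = 1 + 2 * q'" using on q by simp
  let ?C = "\<lambda>k. real (m choose k)"
  have L: "path_slope G (Suc m) 0 = 2 * (1/4) ^ q * (\<Sum>r=1..q. real (Suc m choose (q - r)) * (G r + G r))"
    unfolding on using path_slope_shift[of G 0 q] by simp
  have B: "path_slope G m 1 = 2 * (1/4) ^ q' * (\<Sum>r=1..q'. ?C (q' - r) * (G (1 + r) + G r))"
    unfolding m by (rule path_slope_shift)
  have D: "path_count m 1 = (1/4) ^ q' * ?C q'" unfolding m by (rule path_count_shift)
  have s1: "(\<Sum>r=1..q. real (Suc m choose (q - r)) * G r) = (\<Sum>r=1..q. ?C (q - r) * G r) + (\<Sum>r=1..q'. ?C (q' - r) * G r)"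
  proof -
    have "(\<Sum>r=1..q'. real (Suc m choose (q - r)) * G r) = (\<Sum>r=1..q'. ?C (q - r) * G r + ?C (q' - r) * G r)"
      using q by (intro sum.cong refl) (subst choose_Suc_sum, auto simp: distrib_right)
    then show ?thesis unfolding q by (simp add: sum.distrib)
  qed
  have b1: "(\<Sum>r=1..q'. ?C (q' - r) * G (1 + r)) + ?C q' * G 1 = (\<Sum>r=1..q. ?C (q - r) * G r)"
  proof -
    have "(\<Sum>r=1..q. ?C (q - r) * G r) = (\<Sum>r=0..q'. ?C (q' - r) * G (1 + r))"
      unfolding q One_nat_def sum.shift_bounds_cl_Suc_ivl by simp
    then show ?thesis by (simp add: sum.atLeast_Suc_atMost)
  qed
  have "path_slope G m 1 / 2 + path_count m 1 * G 1
    = 4 * (1/4) ^ q * ((\<Sum>r=1..q'. ?C (q' - r) * (G (1 + r) + G r)) + ?C q' * G 1)"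
    unfolding B D by (simp add: q field_simps)
  also have "(\<Sum>r=1..q'. ?C (q' - r) * (G (1 + r) + G r)) + ?C q' * G 1 = (\<Sum>r=1..q. real (Suc m choose (q - r)) * G r)"
    using s1 b1 by (simp only: distrib_left sum.distrib)
  finally have R: "path_slope G m 1 / 2 + path_count m 1 * G 1 = 4 * (1/4) ^ q * (\<Sum>r=1..q. real (Suc m choose (q - r)) * G r)" .
  have "(\<Sum>r=1..q. real (Suc m choose (q - r)) * (G r + G r)) = 2 * (\<Sum>r=1..q. real (Suc m choose (q - r)) * G r)"
    unfolding sum_distrib_left by (intro sum.cong refl) simp
  then show ?thesis unfolding L R by simp
qed

definition low_block :: "(nat \<times> nat \<times> nat \<Rightarrow> real) \<Rightarrow> nat \<Rightarrow> nat \<Rightarrow> nat \<Rightarrow> real" where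
  "low_block y h i j = (if h = 0 then 0 else lowpart (symmat y h) i j)"

lemma low_add: "h \<ge> 1 \<Longrightarrow> low_block y h i j + low_block y h j i = symmat y h i j"
  using lowpart_add[of "symmat y h" i j] symmat_sym[of y h i j] by (simp add: low_block_def)

lemma sqrt_half_sq: "sqrt (1/2) * sqrt (1/2) = (1/2 :: real)"
  by (rule real_sqrt_mult_self[THEN trans]) simp

lemma sqrt_2_half: "sqrt 2 = 2 * sqrt (1/2 :: real)"
  by (rule real_sqrt_unique) (simp_all add: power_mult_distrib)

lemma base_entry_sq: "base_entry h * base_entry h = (if h = 1 then 1/2 else 1/4)"
  by (simp add: base_entry_def sqrt_half_sq del: real_sqrt_mult_self)

lemma gauge_step: "gauge (Suc h) = gauge h * base_entry (Suc h)"
  by (cases h) (simp_all add: gauge_def base_entry_def)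

text \<open>Product rule for \<open>C W\<close> at multiples of the identity: \<open>W\<close> moves
  along the lower half of its block, \<open>C\<close> against the lower half of the preceding
  one.\<close>

lemma Bfac_derivative:
  assumes h: "h \<ge> 1" and ij: "i < p" "j < p"
  shows "((\<lambda>t. Bfac p t y h i j) has_real_derivative 2 * base_entry h * (low_block y h i j - low_block y (h - 1) i j)) (at 0)"
    and "Bfac p 0 y h i j = base_entry h * (if i = j then 1 else 0)"
proof -
  define c where "c = (if h = 1 then 1 else sqrt (1/2 :: real))"
  have C0: "Cfac p 0 y (h - 1) i k = (if i = k then 1 else 0) * c" if "k < p" for k
    using Cfac_derivative(2)[of i p k y "h - 1"] ij that h by (auto simp: c_def)
  have W0: "Wfac 0 y h k j = sqrt (1/2) * (if k = j then 1 else 0)" for k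
    by (simp add: Wfac_derivative(2))
  have dC: "((\<lambda>t. Cfac p t y (h - 1) i k) has_real_derivative - sqrt 2 * low_block y (h - 1) i k) (at 0)" if "k < p" for k
    using Cfac_derivative(1)[of i p k y "h - 1"] ij that by (auto simp: low_block_def)
  have dW: "((\<lambda>t. Wfac t y h k j) has_real_derivative sqrt 2 * low_block y h k j) (at 0)" for k
    using Wfac_derivative(1)[of y h k j] h by (simp add: low_block_def)
  have b: "base_entry h = c * sqrt (1/2)"
    using h sqrt_half_sq by (auto simp: base_entry_def c_def)
  have "((\<lambda>t. \<Sum>k<p. Cfac p t y (h - 1) i k * Wfac t y h k j) has_real_derivative
     (\<Sum>k<p. (- sqrt 2 * low_block y (h - 1) i k) * Wfac 0 y h k j + sqrt 2 * low_block y h k j * Cfac p 0 y (h - 1) i k)) (at 0)"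
    by (intro DERIV_sum DERIV_mult dC dW) simp
  also have "(\<Sum>k<p. (- sqrt 2 * low_block y (h - 1) i k) * Wfac 0 y h k j + sqrt 2 * low_block y h k j * Cfac p 0 y (h - 1) i k)
     = (\<Sum>k<p. (- sqrt 2 * sqrt (1/2)) * low_block y (h - 1) i k * (if k = j then 1 else 0)
        + (if i = k then 1 else 0) * (sqrt 2 * c * low_block y h k j))"
    by (intro sum.cong refl) (simp only: C0 W0 lessThan_iff mult_ac mult_minus_left mult_minus_right)
  also have "\<dots> = - (sqrt 2 * sqrt (1/2)) * low_block y (h - 1) i j + sqrt 2 * c * low_block y h i j"
    unfolding sum.distrib sum_delta_left[OF ij(1)]
    using sum_delta_right[OF ij(2), of "\<lambda>k. (- sqrt 2 * sqrt (1/2)) * low_block y (h - 1) i k"] by simp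
  also have "sqrt 2 * sqrt (1/2) * low_block y (h - 1) i j = 2 * base_entry h * low_block y (h - 1) i j"
  proof (cases "h = 1")
    case False
    have "sqrt 2 * sqrt (1/2) = (1::real)" unfolding sqrt_2_half mult.assoc sqrt_half_sq by simp
    then show ?thesis using False by (simp add: base_entry_def)
  qed (simp add: low_block_def)
  then have "- (sqrt 2 * sqrt (1/2)) * low_block y (h - 1) i j + sqrt 2 * c * low_block y h i j
     = 2 * base_entry h * (low_block y h i j - low_block y (h - 1) i j)"
    unfolding b by (simp only: sqrt_2_half) (simp add: algebra_simps)
  finally show "((\<lambda>t. Bfac p t y h i j) has_real_derivative 2 * base_entry h * (low_block y h i j - low_block y (h - 1) i j)) (at 0)"
    unfolding Bfac_def .
  have "Bfac p 0 y h i j = (\<Sum>k<p. (if i = k then 1 else 0) * (c * (sqrt (1/2) * (if k = j then 1 else 0))))"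
    unfolding Bfac_def by (intro sum.cong refl) (simp only: C0 W0 lessThan_iff mult_ac)
  then show "Bfac p 0 y h i j = base_entry h * (if i = j then 1 else 0)"
    unfolding sum_delta_left[OF ij(1)] b by simp
qed

text \<open>The triangular normalization adds the lower half of block \<open>h\<close> to the
  symmetric part. This extra term vanishes at \<open>h = 0\<close>, where the moments are read off;
  at other levels the downward step, which uses the transposed block, completes the half of block
  \<open>h + 1\<close> to a symmetric matrix.\<close>

lemma path_weight_derivative:
  assumes "i < p" "j < p"
  shows "((\<lambda>t. path_weight p (Bfac p t y) m h i j) has_real_derivative
      gauge h * (path_slope (\<lambda>r. symmat y r i j) m h + 2 * path_count m h * low_block y h i j)) (at 0)
    \<and> path_weight p (Bfac p 0 y) m h i j = gauge h * path_count m h * (if i = j then 1 else 0)"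
  using assms
proof (induction m arbitrary: h j)
  case 0
  have "path_slope (\<lambda>r. symmat y r i j) 0 h + 2 * path_count 0 h * low_block y h i j = 0"
    by (cases h) (simp_all add: path_slope_def path_count_def low_block_def)
  then show ?case by (cases h) (simp_all add: path_count_def gauge_def)
next
  case (Suc m)
  let ?S = "\<lambda>j. path_slope (\<lambda>r. symmat y r i j)" and ?c = "path_count m"
  let ?D = "\<lambda>h j. gauge h * (?S j m h + 2 * ?c h * low_block y h i j)"
  have IHd: "((\<lambda>t. path_weight p (Bfac p t y) m h i k) has_real_derivative ?D h k) (at 0)" if "k < p" for h k
    using Suc.IH[of k h] Suc.prems that by blast
  have IHv: "path_weight p (Bfac p 0 y) m h i k = (if i = k then 1 else 0) * (gauge h * ?c h)" if "k < p" for h k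
    using Suc.IH[of k h] Suc.prems that by simp
  have j: "j < p" and i: "i < p" using Suc.prems by auto
  have up: "((\<lambda>t. \<Sum>k<p. path_weight p (Bfac p t y) m (h - 1) i k * Bfac p t y h k j) has_real_derivative
      ?D (h - 1) j * base_entry h + gauge (h - 1) * ?c (h - 1) * (2 * base_entry h * (low_block y h i j - low_block y (h - 1) i j))) (at 0)
    \<and> (\<Sum>k<p. path_weight p (Bfac p 0 y) m (h - 1) i k * Bfac p 0 y h k j) = gauge (h - 1) * ?c (h - 1) * base_entry h * (if i = j then 1 else 0)"
    if h: "h \<ge> 1"
  proof
    have "((\<lambda>t. \<Sum>k<p. path_weight p (Bfac p t y) m (h - 1) i k * Bfac p t y h k j) has_real_derivative
       (\<Sum>k<p. ?D (h - 1) k * Bfac p 0 y h k j + 2 * base_entry h * (low_block y h k j - low_block y (h - 1) k j) * path_weight p (Bfac p 0 y) m (h - 1) i k)) (at 0)"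
      by (intro DERIV_sum DERIV_mult IHd Bfac_derivative h j) simp_all
    also have "(\<Sum>k<p. ?D (h - 1) k * Bfac p 0 y h k j + 2 * base_entry h * (low_block y h k j - low_block y (h - 1) k j) * path_weight p (Bfac p 0 y) m (h - 1) i k)
      = (\<Sum>k<p. ?D (h - 1) k * base_entry h * (if k = j then 1 else 0)
          + (if i = k then 1 else 0) * (gauge (h - 1) * ?c (h - 1) * (2 * base_entry h * (low_block y h k j - low_block y (h - 1) k j))))"
      using j by (intro sum.cong refl) (simp add: Bfac_derivative(2)[OF h _ j] IHv)
    also have "\<dots> = ?D (h - 1) j * base_entry h + gauge (h - 1) * ?c (h - 1) * (2 * base_entry h * (low_block y h i j - low_block y (h - 1) i j))"
      unfolding sum.distrib using sum_delta_right[OF j, of "\<lambda>k. ?D (h - 1) k * base_entry h"] sum_delta_left[OF i] by simp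
    finally show "((\<lambda>t. \<Sum>k<p. path_weight p (Bfac p t y) m (h - 1) i k * Bfac p t y h k j) has_real_derivative
      ?D (h - 1) j * base_entry h + gauge (h - 1) * ?c (h - 1) * (2 * base_entry h * (low_block y h i j - low_block y (h - 1) i j))) (at 0)" .
    have "(\<Sum>k<p. path_weight p (Bfac p 0 y) m (h - 1) i k * Bfac p 0 y h k j)
      = (\<Sum>k<p. (if i = k then 1 else 0) * (gauge (h - 1) * ?c (h - 1) * (base_entry h * (if k = j then 1 else 0))))"
      using j by (intro sum.cong refl) (simp add: Bfac_derivative(2)[OF h _ j] IHv)
    then show "(\<Sum>k<p. path_weight p (Bfac p 0 y) m (h - 1) i k * Bfac p 0 y h k j) = gauge (h - 1) * ?c (h - 1) * base_entry h * (if i = j then 1 else 0)"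
      unfolding sum_delta_left[OF i] by simp
  qed
  have dn: "((\<lambda>t. \<Sum>k<p. path_weight p (Bfac p t y) m (Suc h) i k * Bfac p t y (Suc h) j k) has_real_derivative
      ?D (Suc h) j * base_entry (Suc h) + gauge (Suc h) * ?c (Suc h) * (2 * base_entry (Suc h) * (low_block y (Suc h) j i - low_block y h j i))) (at 0)"
  proof -
    have "((\<lambda>t. \<Sum>k<p. path_weight p (Bfac p t y) m (Suc h) i k * Bfac p t y (Suc h) j k) has_real_derivative
       (\<Sum>k<p. ?D (Suc h) k * Bfac p 0 y (Suc h) j k + 2 * base_entry (Suc h) * (low_block y (Suc h) j k - low_block y (Suc h - 1) j k) * path_weight p (Bfac p 0 y) m (Suc h) i k)) (at 0)"
      by (intro DERIV_sum DERIV_mult IHd Bfac_derivative j) simp_all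
    also have "(\<Sum>k<p. ?D (Suc h) k * Bfac p 0 y (Suc h) j k + 2 * base_entry (Suc h) * (low_block y (Suc h) j k - low_block y (Suc h - 1) j k) * path_weight p (Bfac p 0 y) m (Suc h) i k)
      = (\<Sum>k<p. (if j = k then 1 else 0) * (?D (Suc h) k * base_entry (Suc h))
          + (if i = k then 1 else 0) * (gauge (Suc h) * ?c (Suc h) * (2 * base_entry (Suc h) * (low_block y (Suc h) j k - low_block y h j k))))"
      using j by (intro sum.cong refl) (simp add: Bfac_derivative(2)[OF _ j] IHv)
    also have "\<dots> = ?D (Suc h) j * base_entry (Suc h) + gauge (Suc h) * ?c (Suc h) * (2 * base_entry (Suc h) * (low_block y (Suc h) j i - low_block y h j i))"
      unfolding sum.distrib sum_delta_left[OF i] sum_delta_left[OF j] ..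
    finally show ?thesis .
  qed
  have dnv: "(\<Sum>k<p. path_weight p (Bfac p 0 y) m (Suc h) i k * Bfac p 0 y (Suc h) j k) = gauge (Suc h) * ?c (Suc h) * base_entry (Suc h) * (if i = j then 1 else 0)"
  proof -
    have "(\<Sum>k<p. path_weight p (Bfac p 0 y) m (Suc h) i k * Bfac p 0 y (Suc h) j k)
      = (\<Sum>k<p. (if i = k then 1 else 0) * (gauge (Suc h) * ?c (Suc h) * (base_entry (Suc h) * (if j = k then 1 else 0))))"
      using j by (intro sum.cong refl) (simp add: Bfac_derivative(2)[OF _ j] IHv)
    then show ?thesis unfolding sum_delta_left[OF i] by simp
  qed
  show ?case
  proof (cases "h = 0")
    case True
    have "gauge (Suc 0) = base_entry (Suc 0)" using gauge_step[of 0] by (simp add: gauge_def[of 0])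
    then have g: "gauge (Suc 0) * base_entry (Suc 0) = 1/2" using base_entry_sq[of 1] by simp
    have "?D (Suc 0) j * base_entry (Suc 0) + gauge (Suc 0) * ?c (Suc 0) * (2 * base_entry (Suc 0) * (low_block y (Suc 0) j i - low_block y 0 j i))
      = (gauge (Suc 0) * base_entry (Suc 0)) * (?S j m (Suc 0) + 2 * ?c (Suc 0) * (low_block y 1 i j + low_block y 1 j i))"
      by (simp add: low_block_def algebra_simps)
    also have "\<dots> = ?S j (Suc m) 0"
      unfolding g low_add[OF order_refl] path_slope_Suc_0 by simp
    finally have e: "?D (Suc 0) j * base_entry (Suc 0) + gauge (Suc 0) * ?c (Suc 0) * (2 * base_entry (Suc 0) * (low_block y (Suc 0) j i - low_block y 0 j i)) = ?S j (Suc m) 0" .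
    have "gauge (Suc 0) * ?c (Suc 0) * base_entry (Suc 0) = path_count (Suc m) 0"
      using g by (simp add: path_count_Suc_0 algebra_simps)
    then show ?thesis using dn dnv e True by (simp add: gauge_def[of 0] low_block_def)
  next
    case False
    then obtain g where h: "h = Suc g" by (cases h) auto
    have h1: "h \<ge> 1" using False by simp
    have g1: "gauge (h - 1) * base_entry h = gauge h" using gauge_step[of g] h by simp
    have g2: "gauge (Suc h) * base_entry (Suc h) = gauge h / 4"
      using base_entry_sq[of "Suc h"] h by (simp add: gauge_step mult.assoc)
    have "(?D (h - 1) j * base_entry h + gauge (h - 1) * ?c (h - 1) * (2 * base_entry h * (low_block y h i j - low_block y (h - 1) i j)))
       + (?D (Suc h) j * base_entry (Suc h) + gauge (Suc h) * ?c (Suc h) * (2 * base_entry (Suc h) * (low_block y (Suc h) j i - low_block y h j i)))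
      = (gauge (h - 1) * base_entry h) * (?S j m (h - 1) + 2 * ?c (h - 1) * low_block y h i j)
        + (gauge (Suc h) * base_entry (Suc h)) * (?S j m (Suc h) + 2 * ?c (Suc h) * ((low_block y (Suc h) i j + low_block y (Suc h) j i) - low_block y h j i))"
      by (simp add: algebra_simps)
    \<comment> \<open>The two halves of block \<open>h + 1\<close> add up to the whole, and the
      transposed half of block \<open>h\<close> is the whole minus the half that is kept.\<close>
    also have "\<dots> = (gauge (h - 1) * base_entry h) * (?S j m (h - 1) + 2 * ?c (h - 1) * low_block y h i j)
        + (gauge (Suc h) * base_entry (Suc h)) * (?S j m (Suc h) + 2 * ?c (Suc h) * (symmat y (Suc h) i j - (symmat y h i j - low_block y h i j)))"
    proof -
      have "low_block y (Suc h) i j + low_block y (Suc h) j i = symmat y (Suc h) i j" by (rule low_add) simp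
      moreover have "low_block y h j i = symmat y h i j - low_block y h i j" using low_add[OF h1, of y i j] by simp
      ultimately show ?thesis by presburger
    qed
    also have "\<dots> = gauge h * (?S j (Suc m) h + 2 * path_count (Suc m) h * low_block y h i j)"
      unfolding g1 g2 path_slope_Suc[OF h1] path_count_Suc[OF h1] by (simp add: algebra_simps)
    finally have e: "(?D (h - 1) j * base_entry h + gauge (h - 1) * ?c (h - 1) * (2 * base_entry h * (low_block y h i j - low_block y (h - 1) i j)))
       + (?D (Suc h) j * base_entry (Suc h) + gauge (Suc h) * ?c (Suc h) * (2 * base_entry (Suc h) * (low_block y (Suc h) j i - low_block y h j i)))
      = gauge h * (?S j (Suc m) h + 2 * path_count (Suc m) h * low_block y h i j)" .
    have v: "gauge (h - 1) * ?c (h - 1) * base_entry h + gauge (Suc h) * ?c (Suc h) * base_entry (Suc h) = gauge h * path_count (Suc m) h"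
    proof -
      have "gauge (h - 1) * ?c (h - 1) * base_entry h + gauge (Suc h) * ?c (Suc h) * base_entry (Suc h)
        = (gauge (h - 1) * base_entry h) * ?c (h - 1) + (gauge (Suc h) * base_entry (Suc h)) * ?c (Suc h)"
        by (simp add: mult_ac)
      then show ?thesis unfolding g1 g2 path_count_Suc[OF h1] by (simp add: algebra_simps)
    qed
    have "((\<lambda>t. path_weight p (Bfac p t y) (Suc m) h i j) has_real_derivative
      gauge h * (?S j (Suc m) h + 2 * path_count (Suc m) h * low_block y h i j)) (at 0)"
      using DERIV_add[OF up[OF h1, THEN conjunct1] dn] unfolding e using False by simp
    moreover have "path_weight p (Bfac p 0 y) (Suc m) h i j = gauge h * path_count (Suc m) h * (if i = j then 1 else 0)"
      using up[OF h1, THEN conjunct2] dnv False unfolding v[symmetric] by (simp add: distrib_right)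
    ultimately show ?thesis ..
  qed
qed

lemma path_slope_moment: "l \<ge> 1 \<Longrightarrow> path_slope G (2 * l) 0 = (\<Sum>r=1..l. A_entry l r * G r)"
proof -
  have p: "(2::real) powr (- 2 * real l + 2) = 4 * (1/4) ^ l"
  proof -
    have "(2::real) powr (- 2 * real l + 2) = 2 powr (- (2 * real l)) * 2 powr 2"
      using powr_add[of 2 "- (2 * real l)" 2] by simp
    also have "(2::real) powr (- (2 * real l)) = (1/4) ^ l"
      by (simp add: powr_minus powr_powr[symmetric] powr_realpow power_divide inverse_eq_divide)
    finally show ?thesis by simp
  qed
  have "path_slope G (2 * l) 0 = 2 * (1/4) ^ l * (\<Sum>r=1..l. real ((2 * l) choose (l - r)) * (G r + G r))"
    using path_slope_shift[of G 0 l] by simp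
  also have "\<dots> = (\<Sum>r=1..l. A_entry l r * G r)"
    unfolding sum_distrib_left by (intro sum.cong refl) (simp only: A_entry_def p, simp)
  finally show "path_slope G (2 * l) 0 = (\<Sum>r=1..l. A_entry l r * G r)" .
qed

lemma path_count_moment: "path_count (2 * l) 0 = s0 l"
proof -
  have "(2::real) powr (- 2 * real l) = (1/4) ^ l"
    by (simp add: powr_minus powr_powr[symmetric] powr_realpow power_divide inverse_eq_divide)
  then show ?thesis using path_count_shift[of 0 l] by (simp add: s0_def)
qed

text \<open>\<open>A_inv\<close> is described as a right inverse, so the description must be shown
  to single out one function, which is then used as a left inverse. Indices are shifted to start at
  0 for \<open>lowtri_inverse\<close>.\<close>

lemma A_inv_left:
  assumes m: "m \<in> {1..k}" and r: "r \<in> {1..k}"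
  shows "(\<Sum>l=1..k. A_inv k m l * A_entry l r) = (if m = r then 1 else 0)"
proof -
  let ?A = "\<lambda>i j. A_entry (Suc i) (Suc j)"
  have "lowtri k ?A" by (auto simp: lowtri_def A_entry_def)
  then obtain E where E1: "\<And>i j. i < k \<Longrightarrow> j < k \<Longrightarrow> (\<Sum>c<k. ?A i c * E c j) = (if i = j then 1 else 0)"
    and E2: "\<And>i j. i < k \<Longrightarrow> j < k \<Longrightarrow> (\<Sum>c<k. E i c * ?A c j) = (if i = j then 1 else 0)"
    using lowtri_inverse[of k ?A] by blast
  have sh: "(\<Sum>l=1..k. f l) = (\<Sum>c<k. f (Suc c))" for f :: "nat \<Rightarrow> real"
    by (simp add: sum.atLeast1_atMost_eq)
  define B where "B i j = (if i \<in> {1..k} \<and> j \<in> {1..k} then E (i - 1) (j - 1) else 0)" for i j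
  let ?P = "\<lambda>B. (\<forall>i j. (i \<notin> {1..k} \<or> j \<notin> {1..k}) \<longrightarrow> B i j = 0) \<and>
        (\<forall>i\<in>{1..k}. \<forall>j\<in>{1..k}. (\<Sum>l = 1..k. A_entry i l * B l j) = (if i = j then 1 else (0::real)))"
  have PB: "?P B"
  proof (intro conjI allI impI ballI)
    show "B i j = 0" if "i \<notin> {1..k} \<or> j \<notin> {1..k}" for i j using that by (auto simp: B_def)
    fix i j assume ij: "i \<in> {1..k}" "j \<in> {1..k}"
    have "(\<Sum>l = 1..k. A_entry i l * B l j) = (\<Sum>c<k. ?A (i - 1) c * E c (j - 1))"
      unfolding sh using ij by (intro sum.cong refl) (auto simp: B_def)
    then show "(\<Sum>l = 1..k. A_entry i l * B l j) = (if i = j then 1 else 0)" using E1[of "i - 1" "j - 1"] ij by auto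
  qed
  have un: "B' = B" if P: "?P B'" for B'
  proof (intro ext)
    fix i j
    show "B' i j = B i j"
    proof (cases "i \<in> {1..k} \<and> j \<in> {1..k}")
      case False then show ?thesis using P by (auto simp: B_def)
    next
      case True
      then obtain i' j' where i': "i = Suc i'" "i' < k" "j = Suc j'" "j' < k"
        by (metis Suc_le_D Suc_le_lessD atLeastAtMost_iff One_nat_def)
      have b: "(\<Sum>d<k. ?A c d * B' (Suc d) j) = (if c = j' then 1 else 0)" if "c < k" for c
      proof -
        have "(\<Sum>l = 1..k. A_entry (Suc c) l * B' l j) = (if Suc c = j then 1 else 0)"
          using P True that by auto
        then show ?thesis unfolding sh using i' by simp
      qed
      have "B' i j = (\<Sum>d<k. (if i' = d then 1 else 0) * B' (Suc d) j)" unfolding sum_delta_left[OF i'(2)] using i' by simp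
      also have "\<dots> = (\<Sum>d<k. (\<Sum>c<k. E i' c * ?A c d) * B' (Suc d) j)"
        using E2[OF i'(2)] by (intro sum.cong refl) simp
      also have "\<dots> = (\<Sum>c<k. E i' c * (\<Sum>d<k. ?A c d * B' (Suc d) j))"
        unfolding sum_distrib_left sum_distrib_right by (subst sum.swap) (simp add: mult.assoc)
      also have "\<dots> = (\<Sum>c<k. E i' c * (if c = j' then 1 else 0))" using b by (intro sum.cong refl) simp
      also have "\<dots> = E i' j'" using i'(4) by (simp add: sum_delta_right)
      finally show ?thesis using i' True by (simp add: B_def)
    qed
  qed
  have AB: "A_inv k = B" unfolding A_inv_def by (rule the_equality[where P = ?P, OF PB un])
  have "(\<Sum>l=1..k. A_inv k m l * A_entry l r) = (\<Sum>c<k. E (m - 1) c * ?A c (r - 1))"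
    unfolding sh AB using m r by (intro sum.cong refl) (auto simp: B_def)
  then show ?thesis using E2[of "m - 1" "r - 1"] m r by auto
qed

text \<open>The leading factor is \<open>1 / step_size p n\<close>, so the statistic is
  \<open>A_inv\<close> applied to difference quotients of the moments at \<open>t = 0\<close>, and
  their limits are \<open>A\<close> applied to the parameters.\<close>

lemma rescaled_limit:
  assumes x: "x \<in> coords p k"
  shows "(\<lambda>n. rescaled p k n (moment_map p (step_size p n) y) x) \<longlonglongrightarrow> y x"
proof -
  obtain m i j where xm: "x = (m, i, j)" by (cases x) auto
  have m: "m \<in> {1..k}" and ij: "i \<le> j" "i < p" "j < p" using x by (auto simp: xm coords_def)
  let ?pw = "\<lambda>l t. path_weight p (Bfac p t y) (2 * l) 0 i j"
  have d: "(?pw l has_real_derivative (\<Sum>r=1..l. A_entry l r * symmat y r i j)) (at 0)" "?pw l 0 = s0 l * (if i = j then 1 else 0)"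
    if "l \<ge> 1" for l
    using path_weight_derivative[OF ij(2,3), of y "2 * l" 0] that
    by (simp_all add: gauge_def low_block_def path_slope_moment path_count_moment)
  have lim: "(\<lambda>n. (?pw l (step_size p n) - ?pw l 0) / step_size p n) \<longlonglongrightarrow> (\<Sum>r=1..l. A_entry l r * symmat y r i j)" if "l \<ge> 1" for l
  proof -
    have "(\<lambda>h. (?pw l h - ?pw l 0) / h) \<midarrow>0\<rightarrow> (\<Sum>r=1..l. A_entry l r * symmat y r i j)"
      using d(1)[OF that] by (simp add: DERIV_def)
    moreover have "filterlim (\<lambda>n. step_size p n) (at 0) sequentially"
      using step_size_tendsto eventually_gt_at_top[of 0]
      by (auto simp: filterlim_at step_size_def elim!: eventually_mono)
    ultimately show ?thesis by (rule filterlim_compose)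
  qed
  have A0: "(\<Sum>r=1..l. A_entry l r * symmat y r i j) = (\<Sum>r=1..k. A_entry l r * symmat y r i j)" if "l \<le> k" for l
    by (rule sum.mono_neutral_left) (use that in \<open>auto simp: A_entry_def\<close>)
  have "(\<lambda>n. \<Sum>l=1..k. A_inv k m l * ((?pw l (step_size p n) - ?pw l 0) / step_size p n))
     \<longlonglongrightarrow> (\<Sum>l=1..k. A_inv k m l * (\<Sum>r=1..l. A_entry l r * symmat y r i j))"
    by (intro tendsto_sum tendsto_mult tendsto_const lim) auto
  also have "(\<Sum>l=1..k. A_inv k m l * (\<Sum>r=1..l. A_entry l r * symmat y r i j))
     = (\<Sum>l=1..k. A_inv k m l * (\<Sum>r=1..k. A_entry l r * symmat y r i j))"
    by (intro sum.cong refl arg_cong2[where f = "(*)"] A0) auto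
  also have "\<dots> = (\<Sum>r=1..k. (\<Sum>l=1..k. A_inv k m l * A_entry l r) * symmat y r i j)"
    unfolding sum_distrib_left sum_distrib_right by (subst sum.swap) (simp add: mult.assoc)
  also have "\<dots> = (\<Sum>r=1..k. if r = m then symmat y m i j else 0)"
  proof (rule sum.cong[OF refl])
    fix r assume "r \<in> {1..k}"
    then show "(\<Sum>l=1..k. A_inv k m l * A_entry l r) * symmat y r i j = (if r = m then symmat y m i j else 0)"
      using A_inv_left[OF m, of r] by auto
  qed
  also have "\<dots> = y x" using m ij by (simp add: xm symmat_def)
  finally have L: "(\<lambda>n. \<Sum>l=1..k. A_inv k m l * ((?pw l (step_size p n) - ?pw l 0) / step_size p n)) \<longlonglongrightarrow> y x" .
  have "\<forall>\<^sub>F n in sequentially. \<forall>l\<in>{1..k}. admissible p (step_size p n) y l"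
    by (intro eventually_ball_finite ballI eventually_compose_filterlim[OF good_eventually step_size_tendsto]) auto
  then have "\<forall>\<^sub>F n in sequentially. (\<Sum>l=1..k. A_inv k m l * ((?pw l (step_size p n) - ?pw l 0) / step_size p n))
      = rescaled p k n (moment_map p (step_size p n) y) x"
  proof eventually_elim
    case (elim n)
    have "rescaled p k n (moment_map p (step_size p n) y) x
       = sqrt (4 * real n * (real p + 1)) * (\<Sum>l=1..k. A_inv k m l * (?pw l (step_size p n) - ?pw l 0))"
      using x elim ij unfolding rescaled_def xm
      by (simp add: moment_map_good d(2) del: moment_map.simps)
    also have "\<dots> = (\<Sum>l=1..k. A_inv k m l * ((?pw l (step_size p n) - ?pw l 0) / step_size p n))"
      by (simp add: step_size_def sum_distrib_left mult_ac)
    finally show ?case ..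
  qed
  with L show ?thesis by (rule Lim_transform_eventually)
qed

section \<open>Marginal law and weak convergence\<close>

lemma emeasure_space_leb_sym_pos: "emeasure (leb_sym p n) (space (leb_sym p n)) \<noteq> 0"
proof -
  have "emeasure (leb_sym p n) (PiE (coords p n) (\<lambda>_. {0..1})) = (\<Prod>x\<in>coords p n. emeasure lborel {0..1::real})"
    unfolding leb_sym_def by (rule lborel_product.emeasure_PiM) (auto simp: finite_coords)
  then have "emeasure (leb_sym p n) (PiE (coords p n) (\<lambda>_. {0..1})) = 1" by simp
  moreover have "emeasure (leb_sym p n) (PiE (coords p n) (\<lambda>_. {0..1})) \<le> emeasure (leb_sym p n) (space (leb_sym p n))"
    by (rule emeasure_mono[OF _ sets.top]) (auto simp: space_leb_sym PiE_def)
  ultimately show ?thesis by auto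
qed

text \<open>With volume 0 almost no parameter would be admissible for any
  \<open>t = 1 / (m + 1)\<close>, whereas every parameter is admissible once \<open>t\<close> is
  small.\<close>

lemma emeasure_moment_space_pos: "emeasure (leb_sym p n) (moment_space p n) \<noteq> 0"
proof
  assume z: "emeasure (leb_sym p n) (moment_space p n) = 0"
  let ?t = "\<lambda>m. 1 / real (Suc m)"
  have ae: "AE y in leb_sym p n. \<not> all_admissible p n (?t m) y" for m
  proof -
    let ?F = "\<lambda>y. ennreal (\<Prod>x\<in>coords p n. jacobian_entry p (?t m) x y) * (1 * indicator {y. all_admissible p n (?t m) y} y)"
    have "(\<integral>\<^sup>+x. 1 * indicator (moment_space p n) x \<partial>leb_sym p n) = (\<integral>\<^sup>+y. ?F y \<partial>leb_sym p n)"
      by (rule nn_integral_moment_space) auto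
    then have "(\<integral>\<^sup>+y. ?F y \<partial>leb_sym p n) = 0" using z moment_space_sets by simp
    moreover have "?F \<in> borel_measurable (leb_sym p n)"
    proof -
      note [measurable] = prod_jac_measurable all_good_sets
      have "(\<lambda>y. indicator {y. all_admissible p n (?t m) y} y :: ennreal) \<in> borel_measurable (leb_sym p n)"
        by (rule borel_measurable_indicator') (use all_good_sets in auto)
      then show ?thesis by measurable
    qed
    ultimately have "AE y in leb_sym p n. ?F y = 0" by (simp add: nn_integral_0_iff_AE)
    then show ?thesis
    proof eventually_elim
      case (elim y)
      then show ?case using prod_jac_pos[of "?t m", where p = p and n = n and y = y]
        by (auto simp: indicator_def ennreal_eq_0_iff split: if_splits)
    qed
  qed
  have "AE y in leb_sym p n. \<forall>m. \<not> all_admissible p n (?t m) y" unfolding AE_all_countable using ae by blast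
  then have "AE y in leb_sym p n. False"
  proof eventually_elim
    case (elim y)
    have "?t \<longlonglongrightarrow> 0" using LIMSEQ_inverse_real_of_nat by (simp add: inverse_eq_divide)
    then have "\<forall>\<^sub>F m in sequentially. \<forall>l\<in>{1..n}. admissible p (?t m) y l"
      by (intro eventually_ball_finite ballI eventually_compose_filterlim[OF good_eventually]) auto
    then obtain m where "all_admissible p n (?t m) y" unfolding all_admissible_def eventually_sequentially by blast
    then show ?case using elim by blast
  qed
  then have "emeasure (leb_sym p n) (space (leb_sym p n)) = 0"
    using AE_iff_measurable[of "space (leb_sym p n)" "leb_sym p n" "\<lambda>_. False"] by simp
  then show False using emeasure_space_leb_sym_pos by blast
qed

lemma wt_block_cong:
  assumes m: "m \<ge> 1" and eq: "\<And>i j. i \<le> j \<Longrightarrow> j < p \<Longrightarrow> y (m, i, j) = y' (m, i, j)"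
  shows "block_factor p n t y m = block_factor p n t y' m"
proof -
  have s: "shifted t y m i j = shifted t y' m i j" if "i < p" "j < p" for i j
    using eq[of "min i j" "max i j"] that by (simp add: shifted_def symmat_def)
  have W: "Wfac t y m i j = Wfac t y' m i j" if "i < p" "j < p" for i j
    unfolding Wfac_def by (rule chol_cong[of p]) (use s that in auto)
  have c: "complement_gram p (Wfac t y m) i j = complement_gram p (Wfac t y' m) i j" if "i < p" "j < p" for i j
    using W that unfolding complement_gram_def by (intro arg_cong2[where f="(-)"] sum.cong refl) auto
  have C: "Cfac p t y m i j = Cfac p t y' m i j" if "i < p" "j < p" for i j
    using chol_cong[of p "complement_gram p (Wfac t y m)" "complement_gram p (Wfac t y' m)" i j] c that m by (simp add: Cfac_def)
  have "admissible p t y m = admissible p t y' m"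
    unfolding admissible_def using pd_cong[of p "shifted t y m" "shifted t y' m"] s
      pd_cong[of p "complement_gram p (Wfac t y m)" "complement_gram p (Wfac t y' m)"] c by blast
  moreover have "diag_prod p t y m = diag_prod p t y' m"
    unfolding diag_prod_def using W C by (intro prod.cong) auto
  ultimately show ?thesis by (simp add: block_factor_def)
qed

lemma wt_measurable: "(\<lambda>y. block_factor p n t y m) \<in> borel_measurable borel"
proof -
  have [measurable]: "(\<lambda>y. diag_prod p t y m) \<in> borel_measurable borel"
    unfolding diag_prod_def by (intro borel_measurable_prod borel_measurable_times Cfac_measurable Wfac_measurable)
  have [measurable]: "Measurable.pred borel (\<lambda>y. admissible p t y m)" by (rule good_measurable)
  show ?thesis unfolding block_factor_def by measurable
qed

lemma prod_jac_wt:
  assumes "t > 0"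
  shows "\<exists>c>0. \<forall>y. (\<Prod>x\<in>coords p n. jacobian_entry p t x y) * indicator {y. all_admissible p n t y} y = c * (\<Prod>m=1..n. block_factor p n t y m)"
proof -
  define d where "d = (\<Prod>m=1..n. ((2::real) ^ p) ^ ((p + 1) * (n - m)))"
  have d: "d > 0" unfolding d_def by (intro prod_pos) auto
  have "(\<Prod>x\<in>coords p n. jacobian_entry p t x y) * indicator {y. all_admissible p n t y} y = t ^ card (coords p n) / d * (\<Prod>m=1..n. block_factor p n t y m)" for y
  proof (cases "all_admissible p n t y")
    case True
    then have "(\<Prod>m=1..n. block_factor p n t y m) = (\<Prod>m=1..n. (2 ^ p * diag_prod p t y m) ^ ((p + 1) * (n - m)))"
      by (intro prod.cong refl) (simp add: all_admissible_def block_factor_def)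
    also have "\<dots> = d * (\<Prod>m=1..n. diag_prod p t y m ^ ((p + 1) * (n - m)))"
      by (simp only: power_mult_distrib prod.distrib d_def)
    finally show ?thesis using True d by (simp add: prod_jac_eq)
  next
    case False
    then obtain m where "m \<in> {1..n}" "\<not> admissible p t y m" by (auto simp: all_admissible_def)
    then have "(\<Prod>m=1..n. block_factor p n t y m) = 0" by (intro prod_zero) (auto simp: block_factor_def)
    then show ?thesis using False by simp
  qed
  moreover have "t ^ card (coords p n) / d > 0" using assms d by simp
  ultimately show ?thesis by blast
qed

lemma moment_map_cong:
  assumes eq: "\<And>x. x \<in> coords p k \<Longrightarrow> y x = y' x" and x: "x \<in> coords p k"
  shows "moment_map p t y x = moment_map p t y' x"
proof -
  obtain l i j where xl: "x = (l, i, j)" by (cases x) auto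
  have c: "(l, i, j) \<in> coords p k" "i < p" "j < p" using x by (auto simp: xl coordsD)
  have "Lfac p t y l i i = Lfac p t y' l i i" "Lfac p t y l j j = Lfac p t y' l j j"
    using moment_map_dep(1)[OF c(1), of y y' t] eq c by blast+
  moreover have "moment_map p t (y((l,i,j) := 0)) (l,i,j) = moment_map p t (y'((l,i,j) := 0)) (l,i,j)"
    by (rule moment_map_dep(2)[OF c(1)]) (rule eq)
  ultimately show ?thesis
    unfolding xl moment_map_affine[OF c(1), of t y] moment_map_affine[OF c(1), of t y'] using eq[OF c(1)] by simp
qed

definition rescaled_moments :: "nat \<Rightarrow> nat \<Rightarrow> nat \<Rightarrow> (nat \<times> nat \<times> nat \<Rightarrow> real) \<Rightarrow> nat \<times> nat \<times> nat \<Rightarrow> real" where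
  "rescaled_moments p k n y = rescaled p k n (moment_map p (step_size p n) y)"

lemma rescaled_cong:
  assumes "\<And>x. x \<in> coords p k \<Longrightarrow> z x = z' x"
  shows "rescaled p k n z = rescaled p k n z'"
  unfolding rescaled_def
proof (rule restrict_ext)
  fix x assume "x \<in> coords p k"
  then obtain m i j where x: "x = (m, i, j)" "(m, i, j) \<in> coords p k" by (cases x) auto
  have "(\<Sum>l = 1..k. A_inv k m l * (z (l, i, j) - s0 l * (if i = j then 1 else 0)))
      = (\<Sum>l = 1..k. A_inv k m l * (z' (l, i, j) - s0 l * (if i = j then 1 else 0)))"
    by (rule sum.cong[OF refl]) (use assms x in \<open>auto simp: coordsD\<close>)
  then show "(case x of (m, i, j) \<Rightarrow> sqrt (4 * real n * (real p + 1)) *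
       (\<Sum>l = 1..k. A_inv k m l * (z (l, i, j) - s0 l * (if i = j then 1 else 0))))
    = (case x of (m, i, j) \<Rightarrow> sqrt (4 * real n * (real p + 1)) *
       (\<Sum>l = 1..k. A_inv k m l * (z' (l, i, j) - s0 l * (if i = j then 1 else 0))))"
    by (simp only: x prod.case)
qed

lemma coords_mono: "k \<le> n \<Longrightarrow> coords p k \<subseteq> coords p n"
  by (auto simp: coords_def)

lemma rescaled_measurable:
  assumes "\<And>x. x \<in> coords p k \<Longrightarrow> (\<lambda>y. g y x) \<in> borel_measurable M"
  shows "(\<lambda>y. rescaled p k n (g y)) \<in> measurable M (leb_sym p k)"
proof -
  have "(\<lambda>y. restrict (\<lambda>x. (\<lambda>(m, i, j). sqrt (4 * real n * (real p + 1)) *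
       (\<Sum>l = 1..k. A_inv k m l * (g y (l, i, j) - s0 l * (if i = j then 1 else 0)))) x) (coords p k)) \<in> measurable M (leb_sym p k)"
  proof (rule measurable_leb_symI)
    fix x assume "x \<in> coords p k"
    then obtain m i j where x: "x = (m, i, j)" "(m, i, j) \<in> coords p k" by (cases x) auto
    have "(\<lambda>y. g y (l, i, j)) \<in> borel_measurable M" if "l \<in> {1..k}" for l
      by (rule assms) (use x that in \<open>auto simp: coordsD\<close>)
    then show "(\<lambda>y. (\<lambda>(m, i, j). sqrt (4 * real n * (real p + 1)) *
       (\<Sum>l = 1..k. A_inv k m l * (g y (l, i, j) - s0 l * (if i = j then 1 else 0)))) x) \<in> borel_measurable M"
      unfolding x prod.case
      by (intro borel_measurable_times borel_measurable_const borel_measurable_sum borel_measurable_diff)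
  qed
  then show ?thesis by (simp add: rescaled_def[abs_def])
qed

lemma resc_map_measurable: "rescaled_moments p k n \<in> measurable borel (leb_sym p k)"
  unfolding rescaled_moments_def[abs_def] by (rule rescaled_measurable) (rule moment_map_measurable)

lemma nn_integral_factor:
  fixes g h :: "(nat \<times> nat \<times> nat \<Rightarrow> real) \<Rightarrow> ennreal"
  assumes k: "k \<le> n" and gm: "g \<in> borel_measurable borel" and hm: "h \<in> borel_measurable borel"
    and g: "\<And>y y'. (\<And>x. x \<in> coords p k \<Longrightarrow> y x = y' x) \<Longrightarrow> g y = g y'"
    and h: "\<And>y y'. (\<And>x. x \<in> coords p n - coords p k \<Longrightarrow> y x = y' x) \<Longrightarrow> h y = h y'"
  shows "(\<integral>\<^sup>+y. g y * h y \<partial>leb_sym p n) = (\<integral>\<^sup>+y. g y \<partial>leb_sym p k) * (\<integral>\<^sup>+y. h y \<partial>PiM (coords p n - coords p k) (\<lambda>_. lborel))"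
proof -
  let ?I = "coords p k" and ?J = "coords p n - coords p k"
  have U: "?I \<union> ?J = coords p n" using coords_mono[OF k] by blast
  have m: "f \<in> borel_measurable (PiM I (\<lambda>_. lborel))" if "f \<in> borel_measurable borel"
    for f :: "(nat \<times> nat \<times> nat \<Rightarrow> real) \<Rightarrow> ennreal" and I
    by (rule measurable_compose[OF measurable_PiM_fun_borel that])
  have "(\<integral>\<^sup>+y. g y * h y \<partial>PiM (?I \<union> ?J) (\<lambda>_. lborel))
    = (\<integral>\<^sup>+x. (\<integral>\<^sup>+y. g (merge ?I ?J (x, y)) * h (merge ?I ?J (x, y)) \<partial>PiM ?J (\<lambda>_. lborel)) \<partial>PiM ?I (\<lambda>_. lborel))"
    by (rule lborel_product.product_nn_integral_fold) (auto simp: finite_coords intro!: borel_measurable_times_ennreal m gm hm)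
  also have "\<dots> = (\<integral>\<^sup>+x. (\<integral>\<^sup>+y. g x * h y \<partial>PiM ?J (\<lambda>_. lborel)) \<partial>PiM ?I (\<lambda>_. lborel))"
  proof (intro nn_integral_cong)
    fix x y
    have "g (merge ?I ?J (x, y)) = g x" by (rule g) (simp add: merge_def)
    moreover have "h (merge ?I ?J (x, y)) = h y" by (rule h) (auto simp: merge_def)
    ultimately show "g (merge ?I ?J (x, y)) * h (merge ?I ?J (x, y)) = g x * h y" by simp
  qed
  also have "\<dots> = (\<integral>\<^sup>+x. g x * (\<integral>\<^sup>+y. h y \<partial>PiM ?J (\<lambda>_. lborel)) \<partial>PiM ?I (\<lambda>_. lborel))"
    by (intro nn_integral_cong nn_integral_cmult m hm)
  also have "\<dots> = (\<integral>\<^sup>+x. g x \<partial>PiM ?I (\<lambda>_. lborel)) * (\<integral>\<^sup>+y. h y \<partial>PiM ?J (\<lambda>_. lborel))"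
    by (intro nn_integral_multc m gm)
  finally show ?thesis unfolding U leb_sym_def .
qed

definition block_weight :: "nat \<Rightarrow> nat \<Rightarrow> nat \<Rightarrow> (nat \<times> nat \<times> nat \<Rightarrow> real) \<Rightarrow> real" where
  "block_weight p k n y = (\<Prod>m=1..k. block_factor p n (step_size p n) y m)"

lemma step_size_pos: "n \<ge> 1 \<Longrightarrow> step_size p n > 0"
  by (simp add: step_size_def)

lemma block_weight_measurable: "block_weight p k n \<in> borel_measurable borel"
  unfolding block_weight_def[abs_def] by (intro borel_measurable_prod wt_measurable)

lemma block_weight_nonneg: "block_weight p k n y \<ge> 0"
  unfolding block_weight_def by (intro prod_nonneg) (simp add: wt_nonneg)

text \<open>The constant \<open>C\<close> does not depend on the integrand, so it cancels when normalizing.\<close>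

lemma marginal_formula:
  assumes k: "k \<le> n" and n: "n \<ge> 1"
  shows "\<exists>C. \<forall>F \<in> borel_measurable (leb_sym p k).
    (\<integral>\<^sup>+x. F (rescaled p k n x) * indicator (moment_space p n) x \<partial>leb_sym p n)
     = C * (\<integral>\<^sup>+y. F (rescaled_moments p k n y) * ennreal (block_weight p k n y) \<partial>leb_sym p k)"
proof -
  let ?t = "step_size p n"
  have t: "?t > 0" using n by (rule step_size_pos)
  obtain c where c: "c > 0" "\<And>y. (\<Prod>x\<in>coords p n. jacobian_entry p ?t x y) * indicator {y. all_admissible p n ?t y} y = c * (\<Prod>m=1..n. block_factor p n ?t y m)"
    using prod_jac_wt[OF t, of p n] by blast
  \<comment> \<open>The blocks above \<open>k\<close> do not influence \<open>F\<close>; their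
    integral becomes part of the constant.\<close>
  define h where "h y = ennreal (\<Prod>m\<in>{k<..n}. block_factor p n ?t y m)" for y
  have "(\<integral>\<^sup>+x. F (rescaled p k n x) * indicator (moment_space p n) x \<partial>leb_sym p n)
     = (ennreal c * (\<integral>\<^sup>+y. h y \<partial>PiM (coords p n - coords p k) (\<lambda>_. lborel))) * (\<integral>\<^sup>+y. F (rescaled_moments p k n y) * ennreal (block_weight p k n y) \<partial>leb_sym p k)"
    if F: "F \<in> borel_measurable (leb_sym p k)" for F
  proof -
    have gm: "(\<lambda>y. F (rescaled_moments p k n y) * ennreal (block_weight p k n y)) \<in> borel_measurable borel"
      by (intro borel_measurable_times_ennreal measurable_compose[OF resc_map_measurable F] measurable_compose[OF block_weight_measurable] measurable_ennreal)
    have hm: "h \<in> borel_measurable borel" unfolding h_def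
      by (intro measurable_compose[OF _ measurable_ennreal] borel_measurable_prod wt_measurable)
    have Fm: "(\<lambda>x. F (rescaled p k n x)) \<in> borel_measurable (leb_sym p n)"
      by (rule measurable_compose[OF _ F], rule rescaled_measurable) (use coords_mono[OF k] measurable_coord in blast)
    have "(\<integral>\<^sup>+x. F (rescaled p k n x) * indicator (moment_space p n) x \<partial>leb_sym p n)
      = (\<integral>\<^sup>+y. ennreal (\<Prod>x\<in>coords p n. jacobian_entry p ?t x y) * (F (rescaled p k n (moment_map_n p n ?t y)) * indicator {y. all_admissible p n ?t y} y) \<partial>leb_sym p n)"
      by (rule nn_integral_moment_space[OF t Fm])
    also have "\<dots> = (\<integral>\<^sup>+y. ennreal c * ((F (rescaled_moments p k n y) * ennreal (block_weight p k n y)) * h y) \<partial>leb_sym p n)"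
    proof (rule nn_integral_cong)
      fix y
      have r: "rescaled p k n (moment_map_n p n ?t y) = rescaled_moments p k n y"
        unfolding rescaled_moments_def by (rule rescaled_cong) (use coords_mono[OF k] in \<open>auto simp: moment_map_n_def simp del: moment_map.simps\<close>)
      have "{1..n} = {1..k} \<union> {k<..n}" using k by auto
      moreover have "prod (block_factor p n ?t y) ({1..k} \<union> {k<..n}) = prod (block_factor p n ?t y) {1..k} * prod (block_factor p n ?t y) {k<..n}"
        by (rule prod.union_disjoint) auto
      ultimately have "(\<Prod>m=1..n. block_factor p n ?t y m) = block_weight p k n y * (\<Prod>m\<in>{k<..n}. block_factor p n ?t y m)"
        unfolding block_weight_def by simp
      then have "ennreal ((\<Prod>x\<in>coords p n. jacobian_entry p ?t x y) * indicator {y. all_admissible p n ?t y} y)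
        = ennreal c * (ennreal (block_weight p k n y) * h y)"
        unfolding c(2) h_def using c(1) block_weight_nonneg[of p k n y]
        by (simp add: ennreal_mult prod_nonneg wt_nonneg)
      moreover have "ennreal ((\<Prod>x\<in>coords p n. jacobian_entry p ?t x y) * indicator {y. all_admissible p n ?t y} y)
        = ennreal (\<Prod>x\<in>coords p n. jacobian_entry p ?t x y) * indicator {y. all_admissible p n ?t y} y"
        by (simp add: indicator_def)
      ultimately have e: "ennreal (\<Prod>x\<in>coords p n. jacobian_entry p ?t x y) * indicator {y. all_admissible p n ?t y} y
        = ennreal c * (ennreal (block_weight p k n y) * h y)" by simp
      have "ennreal (\<Prod>x\<in>coords p n. jacobian_entry p ?t x y) * (F (rescaled_moments p k n y) * indicator {y. all_admissible p n ?t y} y)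
        = F (rescaled_moments p k n y) * (ennreal (\<Prod>x\<in>coords p n. jacobian_entry p ?t x y) * indicator {y. all_admissible p n ?t y} y)"
        by (simp only: mult_ac)
      also have "\<dots> = ennreal c * ((F (rescaled_moments p k n y) * ennreal (block_weight p k n y)) * h y)"
        unfolding e by (simp only: mult_ac)
      finally show "ennreal (\<Prod>x\<in>coords p n. jacobian_entry p ?t x y) * (F (rescaled p k n (moment_map_n p n ?t y)) * indicator {y. all_admissible p n ?t y} y)
         = ennreal c * ((F (rescaled_moments p k n y) * ennreal (block_weight p k n y)) * h y)"
        unfolding r .
    qed
    also have "\<dots> = ennreal c * (\<integral>\<^sup>+y. (F (rescaled_moments p k n y) * ennreal (block_weight p k n y)) * h y \<partial>leb_sym p n)"
      by (intro nn_integral_cmult measurable_leb_sym_borel borel_measurable_times_ennreal gm hm)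
    also have "(\<integral>\<^sup>+y. (F (rescaled_moments p k n y) * ennreal (block_weight p k n y)) * h y \<partial>leb_sym p n)
       = (\<integral>\<^sup>+y. F (rescaled_moments p k n y) * ennreal (block_weight p k n y) \<partial>leb_sym p k) * (\<integral>\<^sup>+y. h y \<partial>PiM (coords p n - coords p k) (\<lambda>_. lborel))"
    proof (rule nn_integral_factor[OF k gm hm])
      fix y y' :: "nat \<times> nat \<times> nat \<Rightarrow> real" assume e: "\<And>x. x \<in> coords p k \<Longrightarrow> y x = y' x"
      have "rescaled_moments p k n y = rescaled_moments p k n y'"
        unfolding rescaled_moments_def by (rule rescaled_cong, rule moment_map_cong) (use e in auto)
      moreover have "block_weight p k n y = block_weight p k n y'"
        unfolding block_weight_def by (intro prod.cong refl wt_block_cong e) (auto simp: coordsD)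
      ultimately show "F (rescaled_moments p k n y) * ennreal (block_weight p k n y) = F (rescaled_moments p k n y') * ennreal (block_weight p k n y')"
        by simp
    next
      fix y y' :: "nat \<times> nat \<times> nat \<Rightarrow> real" assume e: "\<And>x. x \<in> coords p n - coords p k \<Longrightarrow> y x = y' x"
      have "(\<Prod>m\<in>{k<..n}. block_factor p n ?t y m) = (\<Prod>m\<in>{k<..n}. block_factor p n ?t y' m)"
        by (intro prod.cong refl wt_block_cong e) (auto simp: coordsD)
      then show "h y = h y'" by (simp add: h_def)
    qed
    finally show ?thesis by (simp only: mult_ac)
  qed
  then show ?thesis by blast
qed

section \<open>Gaussian integrals and the GOE constant\<close>

definition gauss :: "real \<Rightarrow> nat \<Rightarrow> nat \<Rightarrow> (nat \<times> nat \<times> nat \<Rightarrow> real) \<Rightarrow> real" where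
  "gauss a p k y = (\<Prod>m=1..k. exp (- a * trace_sq p y m))"

definition multiplicity2 :: "nat \<times> nat \<times> nat \<Rightarrow> real" where
  "multiplicity2 = (\<lambda>(l, i, j). if i = j then 1 else 2)"

lemma sum_square_symmetric:
  fixes f :: "nat \<Rightarrow> nat \<Rightarrow> real"
  assumes "\<And>i j. f i j = f j i"
  shows "(\<Sum>i<p. \<Sum>j<p. f i j) = (\<Sum>j<p. \<Sum>i\<le>j. (if i = j then 1 else 2) * f i j)"
proof (induction p)
  case (Suc p)
  have "(\<Sum>i\<le>p. (if i = p then 1 else 2) * f i p) = (\<Sum>i<p. 2 * f i p) + f p p"
    by (simp add: lessThan_Suc_atMost[symmetric])
  moreover have "(\<Sum>j<p. f p j) = (\<Sum>i<p. f i p)" using assms by (intro sum.cong) auto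
  ultimately show ?case using Suc by (simp add: sum.distrib sum_distrib_left[symmetric])
qed simp

lemma gauss_prod: "gauss a p k y = (\<Prod>x\<in>coords p k. exp (- (a * multiplicity2 x) * (y x)\<^sup>2))"
proof -
  have "exp (- a * trace_sq p y m) = (\<Prod>j<p. \<Prod>i\<le>j. exp (- (a * multiplicity2 (m, i, j)) * (y (m, i, j))\<^sup>2))" for m
  proof -
    have "trace_sq p y m = (\<Sum>j<p. \<Sum>i\<le>j. (if i = j then 1 else 2) * (symmat y m i j)\<^sup>2)"
      unfolding trace_sq_def by (rule sum_square_symmetric) (simp add: symmat_sym)
    also have "\<dots> = (\<Sum>j<p. \<Sum>i\<le>j. multiplicity2 (m, i, j) * (y (m, i, j))\<^sup>2)"
      by (intro sum.cong refl) (simp add: multiplicity2_def symmat_def min_def max_def)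
    finally show ?thesis by (simp add: exp_sum[symmetric] sum_distrib_left sum_negf mult_ac)
  qed
  then show ?thesis unfolding gauss_def prod_coords by simp
qed

lemma nn_integral_exp_square:
  assumes a: "a > 0"
  shows "(\<integral>\<^sup>+x. ennreal (exp (- a * x\<^sup>2)) \<partial>lborel) = ennreal (sqrt (pi / a))"
proof -
  let ?s = "sqrt (1 / (2 * a))"
  have s: "?s > 0" "?s\<^sup>2 = 1 / (2 * a)" using a by simp_all
  have "exp (- a * x\<^sup>2) = sqrt (pi / a) * normal_density 0 ?s x" for x
    using a s by (simp add: normal_density_def real_sqrt_divide)
  moreover have "(\<integral>\<^sup>+x. ennreal (normal_density 0 ?s x) \<partial>lborel) = 1"
    using integrable_normal_density[OF s(1)] integral_normal_density[OF s(1)]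
    by (subst nn_integral_eq_integral) auto
  ultimately show ?thesis
    using a by (simp add: ennreal_mult' nn_integral_cmult)
qed

lemma nn_integral_gauss:
  assumes a: "a > 0"
  shows "(\<integral>\<^sup>+y. ennreal (gauss a p k y) \<partial>leb_sym p k) = ennreal (\<Prod>x\<in>coords p k. sqrt (pi / (a * multiplicity2 x)))"
proof -
  have m: "multiplicity2 x > 0" for x by (auto simp: multiplicity2_def split: prod.splits)
  have "(\<integral>\<^sup>+y. ennreal (gauss a p k y) \<partial>leb_sym p k)
     = (\<integral>\<^sup>+y. (\<Prod>x\<in>coords p k. ennreal (exp (- (a * multiplicity2 x) * (y x)\<^sup>2))) \<partial>leb_sym p k)"
    by (simp add: gauss_prod prod_ennreal)
  also have "\<dots> = (\<Prod>x\<in>coords p k. \<integral>\<^sup>+z. ennreal (exp (- (a * multiplicity2 x) * z\<^sup>2)) \<partial>lborel)"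
    unfolding leb_sym_def by (rule lborel_product.product_nn_integral_prod) (auto simp: finite_coords)
  also have "\<dots> = (\<Prod>x\<in>coords p k. ennreal (sqrt (pi / (a * multiplicity2 x))))"
    using a m by (intro prod.cong refl nn_integral_exp_square) auto
  also have "\<dots> = ennreal (\<Prod>x\<in>coords p k. sqrt (pi / (a * multiplicity2 x)))"
    using a m by (intro prod_ennreal) (simp add: less_imp_le)
  finally show ?thesis .
qed

lemma gauss_measurable: "gauss a p k \<in> borel_measurable (leb_sym p k)"
  unfolding gauss_prod[abs_def]
  by (intro borel_measurable_prod borel_measurable_exp borel_measurable_times borel_measurable_const
      borel_measurable_power measurable_compose[OF _ borel_measurable_exp] measurable_coord)

lemma gauss_pos: "gauss a p k y > 0"
  unfolding gauss_def by (intro prod_pos) auto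

lemma integrable_gauss:
  assumes "a > 0"
  shows "integrable (leb_sym p k) (gauss a p k)"
  using gauss_pos[of a p k] nn_integral_gauss[OF assms, of p k] gauss_measurable
  by (intro integrableI_nonneg) (auto simp: less_imp_le)

text \<open>Column \<open>j\<close> contributes \<open>sqrt (2 * pi)\<close> for its diagonal entry
  and \<open>sqrt pi\<close> for each of the \<open>j\<close> entries above it.\<close>

lemma goe_constant:
  "(2 * pi) powr (- real p / 2) * pi powr (- real p * (real p - 1) / 4) * (\<Prod>j<p. sqrt (2 * pi) * sqrt pi ^ j) = 1"
proof -
  have "(\<Prod>j<p. sqrt (2 * pi) * sqrt pi ^ j) = (2 * pi) powr (real p / 2) * pi powr (real p * (real p - 1) / 4)"
  proof (induction p)
    case (Suc p)
    have a: "sqrt (2 * pi) = (2 * pi) powr (1/2)" by (simp add: powr_half_sqrt)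
    have b: "sqrt pi ^ p = pi powr (real p / 2)"
      by (simp add: powr_half_sqrt[symmetric] powr_realpow[symmetric] powr_powr)
    have "(\<Prod>j<Suc p. sqrt (2 * pi) * sqrt pi ^ j)
      = ((2 * pi) powr (real p / 2) * (2 * pi) powr (1/2)) * (pi powr (real p * (real p - 1) / 4) * pi powr (real p / 2))"
      unfolding prod.lessThan_Suc Suc unfolding a b by simp
    also have "\<dots> = (2 * pi) powr (real (Suc p) / 2) * pi powr (real (Suc p) * (real (Suc p) - 1) / 4)"
      unfolding powr_add[symmetric] by (intro arg_cong2[where f="(*)"] arg_cong2[where f="(powr)"]) (auto simp: field_simps)
    finally show ?case .
  qed simp
  moreover have "(2 * pi) powr (- real p / 2) = inverse ((2 * pi) powr (real p / 2))"
    using powr_minus[of "2 * pi" "real p / 2"] by simp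
  moreover have "pi powr (- real p * (real p - 1) / 4) = inverse (pi powr (real p * (real p - 1) / 4))"
    using powr_minus[of pi "real p * (real p - 1) / 4"] by (simp only: mult_minus_left minus_divide_left)
  ultimately show ?thesis by (simp only:) (simp add: field_simps)
qed

definition goe_const :: "nat \<Rightarrow> real" where
  "goe_const p = (2 * pi) powr (- real p / 2) * pi powr (- real p * (real p - 1) / 4)"

lemma goe_density_prod: "(\<Prod>l\<in>{1..k}. goe_density p (symmat x l)) = goe_const p ^ k * gauss (1/2) p k x"
proof -
  have "(\<Sum>i<p. \<Sum>j<p. symmat x l i j * symmat x l j i) = trace_sq p x l" for l
    unfolding trace_sq_def by (intro sum.cong refl) (simp add: symmat_sym power2_eq_square)
  then show ?thesis
    by (simp add: goe_density_def gauss_def goe_const_def prod.distrib)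
qed

lemma integral_gauss_half: "goe_const p ^ k * (\<integral>y. gauss (1/2) p k y \<partial>leb_sym p k) = 1"
proof -
  have m: "multiplicity2 x > 0" for x by (auto simp: multiplicity2_def split: prod.splits)
  have "(\<integral>y. gauss (1/2) p k y \<partial>leb_sym p k) = (\<Prod>x\<in>coords p k. sqrt (pi / (1/2 * multiplicity2 x)))"
  proof -
    have "(\<integral>y. gauss (1/2) p k y \<partial>leb_sym p k) = enn2real (\<integral>\<^sup>+y. ennreal (gauss (1/2) p k y) \<partial>leb_sym p k)"
      using gauss_pos[of "1/2" p k] gauss_measurable[of "1/2" p k]
      by (intro integral_eq_nn_integral) (auto simp: less_imp_le)
    also have "\<dots> = (\<Prod>x\<in>coords p k. sqrt (pi / (1/2 * multiplicity2 x)))"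
    proof -
      have "(0::real) < 1/2" by simp
      note nn_integral_gauss[OF this, of p k]
      moreover have "0 \<le> (\<Prod>x\<in>coords p k. sqrt (pi / (1/2 * multiplicity2 x)))"
        using m by (intro prod_nonneg) (simp add: less_imp_le)
      ultimately show ?thesis by (simp only: enn2real_ennreal)
    qed
    finally show ?thesis .
  qed
  also have "\<dots> = (\<Prod>l=1..k. \<Prod>j<p. \<Prod>i\<le>j. sqrt (pi / (1/2 * (if i = j then 1 else 2))))"
    by (simp add: prod_coords multiplicity2_def)
  also have "\<dots> = (\<Prod>l=1..k. \<Prod>j<p. sqrt (2 * pi) * sqrt pi ^ j)"
  proof (intro prod.cong refl)
    fix j :: nat
    have "(\<Prod>i\<le>j. sqrt (pi / (1/2 * (if i = j then 1 else 2)))) = (\<Prod>i<j. sqrt (pi / (1/2 * (if i = j then 1 else 2)))) * sqrt (pi * 2)"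
      unfolding lessThan_Suc_atMost[symmetric] prod.lessThan_Suc by simp
    also have "(\<Prod>i<j. sqrt (pi / (1/2 * (if i = j then 1 else 2)))) = (\<Prod>i<j. sqrt pi)"
      by (intro prod.cong refl) simp
    finally show "(\<Prod>i\<le>j. sqrt (pi / (1/2 * (if i = j then 1 else 2)))) = sqrt (2 * pi) * sqrt pi ^ j"
      by (simp add: mult_ac)
  qed
  also have "\<dots> = (\<Prod>j<p. sqrt (2 * pi) * sqrt pi ^ j) ^ k" by simp
  finally have "goe_const p ^ k * (\<integral>y. gauss (1/2) p k y \<partial>leb_sym p k) = (goe_const p * (\<Prod>j<p. sqrt (2 * pi) * sqrt pi ^ j)) ^ k"
    by (simp only: power_mult_distrib)
  then show ?thesis unfolding goe_const_def goe_constant by simp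
qed

section \<open>Dominated convergence\<close>

lemma block_weight_bound:
  assumes "n \<ge> 2 * k"
  shows "block_weight p k n y \<le> gauss (1/4) p k y"
  unfolding block_weight_def gauss_def
  using assms wt_bound[of _ n p y] by (intro prod_mono) (auto simp: wt_nonneg)

lemma block_weight_tendsto: "(\<lambda>n. block_weight p k n y) \<longlonglongrightarrow> gauss (1/2) p k y"
  unfolding block_weight_def gauss_def
  using wt_tendsto[of _ p y] by (intro tendsto_prod) auto

lemma continuous_measurable_leb_sym:
  fixes f :: "(nat \<times> nat \<times> nat \<Rightarrow> real) \<Rightarrow> real"
  assumes "continuous_on (space (leb_sym p k)) f"
  shows "f \<in> borel_measurable (leb_sym p k)"
proof -
  have "(\<lambda>x. x) \<in> measurable (leb_sym p k) (restrict_space borel (space (leb_sym p k)))"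
    using measurable_PiM_fun_borel[of "coords p k"]
    by (intro measurable_restrict_space2) (auto simp: leb_sym_def)
  from measurable_compose[OF this borel_measurable_continuous_on_restrict[OF assms]] show ?thesis .
qed

lemma tendsto_coordwise:
  fixes f :: "'a \<Rightarrow> 'b \<Rightarrow> real"
  assumes "\<And>x. ((\<lambda>n. f n x) \<longlongrightarrow> l x) F"
  shows "(f \<longlongrightarrow> l) F"
  using limitin_componentwise[of "\<lambda>_. euclidean" UNIV f l F] assms
  by (simp add: euclidean_product_topology)

lemma weighted_integral_limit:
  fixes f :: "(nat \<times> nat \<times> nat \<Rightarrow> real) \<Rightarrow> real"
  assumes f: "continuous_on (space (leb_sym p k)) f" and b: "\<And>x. x \<in> space (leb_sym p k) \<Longrightarrow> \<bar>f x\<bar> \<le> b"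
  shows "(\<lambda>n. \<integral>y. f (rescaled_moments p k n y) * block_weight p k n y \<partial>leb_sym p k) \<longlonglongrightarrow> (\<integral>y. f y * gauss (1/2) p k y \<partial>leb_sym p k)"
    and "n \<ge> 2 * k \<Longrightarrow> integrable (leb_sym p k) (\<lambda>y. f (rescaled_moments p k n y) * block_weight p k n y)"
proof -
  let ?M = "leb_sym p k"
  have fm: "f \<in> borel_measurable ?M" by (rule continuous_measurable_leb_sym[OF f])
  have rm: "(\<lambda>y. f (rescaled_moments p k n y) * block_weight p k n y) \<in> borel_measurable ?M" for n
    by (intro measurable_leb_sym_borel borel_measurable_times measurable_compose[OF resc_map_measurable fm] block_weight_measurable)
  have rs: "rescaled_moments p k n y \<in> space ?M" for n y by (simp add: rescaled_moments_def rescaled_def space_leb_sym)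
  have bd: "norm (f (rescaled_moments p k n y) * block_weight p k n y) \<le> b * gauss (1/4) p k y" if "n \<ge> 2 * k" for n y
    using mult_mono[OF b[OF rs, of n y] block_weight_bound[OF that, of p y]] block_weight_nonneg[of p k n y] order_trans[OF abs_ge_zero b[OF rs, of n y]]
    by (simp add: abs_mult)
  have ib: "integrable ?M (\<lambda>y. b * gauss (1/4) p k y)" by (intro integrable_mult_right integrable_gauss) simp
  show i: "integrable ?M (\<lambda>y. f (rescaled_moments p k n y) * block_weight p k n y)" if "n \<ge> 2 * k" for n
    by (rule Bochner_Integration.integrable_bound[OF ib rm]) (use bd[OF that] in \<open>auto intro!: AE_I2 order_trans[OF _ abs_ge_self]\<close>)
  have lim: "(\<lambda>n. f (rescaled_moments p k n y) * block_weight p k n y) \<longlonglongrightarrow> f y * gauss (1/2) p k y" if y: "y \<in> space ?M" for y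
  proof (intro tendsto_mult block_weight_tendsto)
    have "(\<lambda>n. rescaled_moments p k n y) \<longlonglongrightarrow> y"
    proof (rule tendsto_coordwise)
      fix x show "(\<lambda>n. rescaled_moments p k n y x) \<longlonglongrightarrow> y x"
      proof (cases "x \<in> coords p k")
        case True then show ?thesis unfolding rescaled_moments_def by (rule rescaled_limit)
      next
        \<comment> \<open>Outside the coordinates both sides are the constant
          \<open>undefined\<close>, so convergence holds in the whole product topology.\<close>
        case False
        then have "y x = undefined" using y unfolding space_leb_sym by (intro extensional_arb)
        then show ?thesis using False by (simp add: rescaled_moments_def rescaled_def)
      qed
    qed
    then show "(\<lambda>n. f (rescaled_moments p k n y)) \<longlonglongrightarrow> f y"
      by (rule continuous_on_tendsto_compose[OF f]) (use y rs in auto)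
  qed
  \<comment> \<open>The Gaussian bound is available from \<open>n = 2 * k\<close> on, hence the
    shift.\<close>
  have "(\<lambda>n. \<integral>y. f (rescaled_moments p k (n + 2 * k) y) * block_weight p k (n + 2 * k) y \<partial>?M) \<longlonglongrightarrow> (\<integral>y. f y * gauss (1/2) p k y \<partial>?M)"
  proof (rule integral_dominated_convergence[OF _ _ ib])
    show "(\<lambda>y. f y * gauss (1/2) p k y) \<in> borel_measurable ?M" using fm gauss_measurable by measurable
    show "AE y in ?M. (\<lambda>n. f (rescaled_moments p k (n + 2 * k) y) * block_weight p k (n + 2 * k) y) \<longlonglongrightarrow> f y * gauss (1/2) p k y"
      by (intro AE_I2 LIMSEQ_ignore_initial_segment lim)
  qed (use rm bd in auto)
  then show "(\<lambda>n. \<integral>y. f (rescaled_moments p k n y) * block_weight p k n y \<partial>?M) \<longlonglongrightarrow> (\<integral>y. f y * gauss (1/2) p k y \<partial>?M)"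
    by (rule LIMSEQ_offset)
qed

text \<open>The constant of \<open>marginal_formula\<close> cancels between the integrals of
  \<open>f\<close> and of 1. It is neither 0 nor infinite because the moment space has positive
  finite volume.\<close>

lemma expectation_formula:
  fixes f :: "(nat \<times> nat \<times> nat \<Rightarrow> real) \<Rightarrow> real"
  assumes k: "k \<ge> 1" "n \<ge> 2 * k" and f: "continuous_on (space (leb_sym p k)) f"
    and b: "\<And>x. x \<in> space (leb_sym p k) \<Longrightarrow> 0 \<le> f x \<and> f x \<le> b"
  shows "(\<integral>x. f x \<partial>distr (uniform_moments p n) (leb_sym p k) (rescaled p k n))
    = (\<integral>y. f (rescaled_moments p k n y) * block_weight p k n y \<partial>leb_sym p k) / (\<integral>y. block_weight p k n y \<partial>leb_sym p k)"
    and "(\<integral>y. block_weight p k n y \<partial>leb_sym p k) > 0"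
proof -
  let ?M = "leb_sym p k" and ?V = "emeasure (leb_sym p n) (moment_space p n)"
  have kn: "k \<le> n" "n \<ge> 1" using k by auto
  obtain C where C: "\<And>F. F \<in> borel_measurable ?M \<Longrightarrow>
    (\<integral>\<^sup>+x. F (rescaled p k n x) * indicator (moment_space p n) x \<partial>leb_sym p n)
     = C * (\<integral>\<^sup>+y. F (rescaled_moments p k n y) * ennreal (block_weight p k n y) \<partial>?M)"
    using marginal_formula[OF kn, of p] by blast
  have fm: "f \<in> borel_measurable ?M" by (rule continuous_measurable_leb_sym[OF f])
  have rs: "rescaled_moments p k n y \<in> space ?M" for y by (simp add: rescaled_moments_def rescaled_def space_leb_sym)
  let ?J = "\<integral>y. f (rescaled_moments p k n y) * block_weight p k n y \<partial>?M" and ?J1 = "\<integral>y. block_weight p k n y \<partial>?M"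
  have i1: "integrable ?M (\<lambda>y. 1 * block_weight p k n y)"
    using weighted_integral_limit(2)[of p k "\<lambda>_. 1" 1 n] k by auto
  have ifn: "integrable ?M (\<lambda>y. f (rescaled_moments p k n y) * block_weight p k n y)"
    by (rule weighted_integral_limit(2)[OF f, of b]) (use b k in auto)
  have J: "(\<integral>\<^sup>+y. ennreal (f (rescaled_moments p k n y)) * ennreal (block_weight p k n y) \<partial>?M) = ennreal ?J"
    using nn_integral_eq_integral[OF ifn] b[OF rs] block_weight_nonneg[of p k n]
    by (simp add: ennreal_mult[symmetric])
  have J1: "(\<integral>\<^sup>+y. 1 * ennreal (block_weight p k n y) \<partial>?M) = ennreal ?J1"
    using nn_integral_eq_integral[OF i1] block_weight_nonneg[of p k n] by simp
  have V: "?V = C * ennreal ?J1"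
    using C[of "\<lambda>_. 1"] moment_space_sets[of p n] unfolding J1 by simp
  have V0: "?V \<noteq> 0" by (rule emeasure_moment_space_pos)
  have Vt: "?V \<noteq> \<infinity>" using emeasure_moment_space_finite[of p n] by auto
  have "ennreal ?J1 \<noteq> 0" using V V0 by auto
  then show J1pos: "?J1 > 0" by (simp add: ennreal_eq_0_iff not_le)
  have Ct: "C \<noteq> \<infinity>" using V Vt J1pos by (auto simp: ennreal_mult_eq_top_iff ennreal_eq_0_iff top_ennreal_def[symmetric])
  have C0: "C \<noteq> 0" using V V0 by auto
  obtain c where c: "C = ennreal c" "c > 0" using Ct C0 by (cases C) (auto simp: ennreal_eq_0_iff not_le)
  have J0: "?J \<ge> 0" using b[OF rs] block_weight_nonneg by (intro Bochner_Integration.integral_nonneg) auto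
  have rm0: "rescaled p k n \<in> measurable (leb_sym p n) ?M"
    using rescaled_measurable[of p k "\<lambda>y. y" "leb_sym p n" n] measurable_coord coords_mono[OF kn(1), of p] by blast
  moreover have "measurable (uniform_moments p n) ?M = measurable (leb_sym p n) ?M"
    by (rule measurable_cong_sets) (simp_all add: uniform_moments_def)
  ultimately have rm: "rescaled p k n \<in> measurable (uniform_moments p n) ?M" by simp
  have Fm: "(\<lambda>x. ennreal (f (rescaled p k n x))) \<in> borel_measurable (leb_sym p n)"
    by (rule measurable_compose[OF measurable_compose[OF rm0 fm] measurable_ennreal])
  have "(\<integral>\<^sup>+x. ennreal (f x) \<partial>distr (uniform_moments p n) ?M (rescaled p k n)) = (\<integral>\<^sup>+x. ennreal (f (rescaled p k n x)) \<partial>uniform_moments p n)"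
    by (rule nn_integral_distr[OF rm]) (use fm in measurable)
  also have "\<dots> = (\<integral>\<^sup>+x. ennreal (f (rescaled p k n x)) * indicator (moment_space p n) x \<partial>leb_sym p n) / ?V"
    unfolding uniform_moments_def by (rule nn_integral_uniform_measure[OF Fm moment_space_sets])
  also have "\<dots> = C * ennreal ?J / (C * ennreal ?J1)"
    using C[of "\<lambda>x. ennreal (f x)"] fm unfolding J V by simp
  also have "\<dots> = ennreal (?J / ?J1)"
    unfolding c using c J0 J1pos by (simp add: ennreal_mult[symmetric] divide_ennreal)
  finally have nn: "(\<integral>\<^sup>+x. ennreal (f x) \<partial>distr (uniform_moments p n) ?M (rescaled p k n)) = ennreal (?J / ?J1)" .
  have "(\<integral>x. f x \<partial>distr (uniform_moments p n) ?M (rescaled p k n)) = enn2real (ennreal (?J / ?J1))"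
    unfolding nn[symmetric] by (rule integral_eq_nn_integral) (use fm b in \<open>auto intro!: AE_I2\<close>)
  then show "(\<integral>x. f x \<partial>distr (uniform_moments p n) ?M (rescaled p k n)) = ?J / ?J1"
    using J0 J1pos by simp
qed

lemma integral_iid_goe:
  fixes f :: "(nat \<times> nat \<times> nat \<Rightarrow> real) \<Rightarrow> real"
  assumes "f \<in> borel_measurable (leb_sym p k)"
  shows "(\<integral>x. f x \<partial>iid_goe p k) = goe_const p ^ k * (\<integral>y. f y * gauss (1/2) p k y \<partial>leb_sym p k)"
proof -
  have c: "goe_const p ^ k \<ge> 0" by (simp add: goe_const_def)
  have "(\<integral>x. f x \<partial>iid_goe p k) = (\<integral>y. (goe_const p ^ k * gauss (1/2) p k y) *\<^sub>R f y \<partial>leb_sym p k)"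
    unfolding iid_goe_def goe_density_prod using c gauss_pos[of "1/2" p k] gauss_measurable[of "1/2" p k]
    by (intro integral_density assms AE_I2) (auto simp: less_imp_le)
  also have "\<dots> = (\<integral>y. goe_const p ^ k * (f y * gauss (1/2) p k y) \<partial>leb_sym p k)"
    by (simp add: mult_ac)
  finally show ?thesis by simp
qed

theorem theorem2p2:
  fixes p k :: nat
  assumes "p \<ge> 1" and "k \<ge> 1"
  shows "weak_conv_coords p k
           (\<lambda>n. distr (uniform_moments p n) (leb_sym p k) (rescaled p k n))
           (iid_goe p k)"
  unfolding weak_conv_coords_def
proof (intro allI impI)
  fix f :: "(nat \<times> nat \<times> nat \<Rightarrow> real) \<Rightarrow> real"
  assume f: "continuous_on (space (leb_sym p k)) f" and bd: "bounded (f ` space (leb_sym p k))"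
  let ?M = "leb_sym p k" and ?\<nu> = "\<lambda>n. distr (uniform_moments p n) (leb_sym p k) (rescaled p k n)"
  obtain b where b: "\<And>x. x \<in> space ?M \<Longrightarrow> \<bar>f x\<bar> \<le> b" using bd by (auto simp: bounded_iff)
  \<comment> \<open>First for nonnegative integrands, as \<open>expectation_formula\<close>
    requires; a general \<open>f\<close> is reduced to \<open>f + b\<close> below.\<close>
  have lim: "(\<lambda>n. \<integral>x. g x \<partial>?\<nu> n) \<longlonglongrightarrow> (\<integral>x. g x \<partial>iid_goe p k)"
    if g: "continuous_on (space ?M) g" "\<And>x. x \<in> space ?M \<Longrightarrow> 0 \<le> g x \<and> g x \<le> c"
    for g :: "(nat \<times> nat \<times> nat \<Rightarrow> real) \<Rightarrow> real" and c
  proof -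
    let ?I = "\<integral>y. gauss (1/2) p k y \<partial>?M"
    have I: "goe_const p ^ k * ?I = 1" by (rule integral_gauss_half)
    have gb: "\<bar>g x\<bar> \<le> c" if "x \<in> space ?M" for x using g(2)[OF that] by simp
    have "(\<lambda>n. \<integral>y. 1 * block_weight p k n y \<partial>?M) \<longlonglongrightarrow> (\<integral>y. 1 * gauss (1/2) p k y \<partial>?M)"
      by (rule weighted_integral_limit(1)[of p k "\<lambda>_. 1" 1]) auto
    then have "(\<lambda>n. (\<integral>y. g (rescaled_moments p k n y) * block_weight p k n y \<partial>?M) / (\<integral>y. block_weight p k n y \<partial>?M))
       \<longlonglongrightarrow> (\<integral>y. g y * gauss (1/2) p k y \<partial>?M) / ?I"
      using I by (intro tendsto_divide weighted_integral_limit(1)[OF g(1) gb]) auto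
    moreover have "(\<integral>y. g y * gauss (1/2) p k y \<partial>?M) / ?I = (\<integral>x. g x \<partial>iid_goe p k)"
    proof -
      have "?I \<noteq> 0" using I by auto
      then have "goe_const p ^ k = 1 / ?I" using I by (simp add: field_simps)
      then show ?thesis using integral_iid_goe[OF continuous_measurable_leb_sym[OF g(1)]] by simp
    qed
    moreover have "\<forall>\<^sub>F n in sequentially. (\<integral>y. g (rescaled_moments p k n y) * block_weight p k n y \<partial>?M) / (\<integral>y. block_weight p k n y \<partial>?M)
       = (\<integral>x. g x \<partial>?\<nu> n)"
      using eventually_ge_at_top[of "2 * k"]
    proof eventually_elim
      case (elim n)
      show ?case by (rule expectation_formula(1)[OF assms(2) elim g, symmetric])
    qed
    ultimately show ?thesis by (auto intro: Lim_transform_eventually)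
  qed
  have fm: "f \<in> borel_measurable ?M" by (rule continuous_measurable_leb_sym[OF f])
  have int: "integrable N f \<and> integrable N (\<lambda>_. b)"
    if N: "sets N = sets ?M" "(\<integral>x. 1 \<partial>N) = (1::real)" for N :: "(nat \<times> nat \<times> nat \<Rightarrow> real) measure"
  proof -
    have "emeasure N (space N) \<noteq> \<infinity>" using N(2) by (auto simp: measure_def)
    then interpret finite_measure N by (rule finite_measureI)
    have "integrable N f"
      by (rule integrable_const_bound[where B = b])
        (use b fm sets_eq_imp_space_eq[OF N(1)] measurable_cong_sets[OF N(1) refl] in \<open>auto intro!: AE_I2\<close>)
    then show ?thesis by simp
  qed
  \<comment> \<open>Undoing the shift by \<open>b\<close> requires total mass 1; for the laws of the
    statistic this is available from \<open>n = 2 * k\<close> on.\<close>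
  have split: "(\<integral>x. f x \<partial>N) = (\<integral>x. f x + b \<partial>N) - b"
    if N: "sets N = sets ?M" "(\<integral>x. 1 \<partial>N) = (1::real)" for N :: "(nat \<times> nat \<times> nat \<Rightarrow> real) measure"
    using int[OF N] N(2) by simp
  have one: "(\<integral>x. 1 \<partial>?\<nu> n) = (1::real)" if "n \<ge> 2 * k" for n
    using expectation_formula[OF assms(2) that, of p "\<lambda>_. 1" 1] by simp
  have one': "(\<integral>x. 1 \<partial>iid_goe p k) = (1::real)"
    using integral_iid_goe[of "\<lambda>_. 1" p k] integral_gauss_half[of p k] by simp
  have "(\<lambda>n. (\<integral>x. f x + b \<partial>?\<nu> n) - b) \<longlonglongrightarrow> (\<integral>x. f x + b \<partial>iid_goe p k) - b"
  proof (intro tendsto_diff tendsto_const lim)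
    show "continuous_on (space ?M) (\<lambda>x. f x + b)" using f by (intro continuous_intros)
    show "0 \<le> f x + b \<and> f x + b \<le> 2 * b" if "x \<in> space ?M" for x using b[OF that] by linarith
  qed
  moreover have "(\<integral>x. f x + b \<partial>iid_goe p k) - b = (\<integral>x. f x \<partial>iid_goe p k)"
    by (rule split[symmetric, OF _ one']) (simp add: iid_goe_def)
  moreover have "\<forall>\<^sub>F n in sequentially. (\<integral>x. f x + b \<partial>?\<nu> n) - b = (\<integral>x. f x \<partial>?\<nu> n)"
    using eventually_ge_at_top[of "2 * k"]
  proof eventually_elim
    case (elim n)
    show ?case by (rule split[symmetric, OF _ one[OF elim]]) simp
  qed
  ultimately show "(\<lambda>n. \<integral>x. f x \<partial>?\<nu> n) \<longlonglongrightarrow> (\<integral>x. f x \<partial>iid_goe p k)"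
    by (auto intro: Lim_transform_eventually)
qed

end
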